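(* Let $k$ be an uncountable field of characteristic two and let $N\ge 1$ be an integer. Then a very general hypersurface $X\subset \mathbb P^{N+1}_k$ of degree $d\geq \log_2 N+3$ is stably irrational.
   Context: A variety $X$ over a field $k$ is stably rational if $X\times \mathbb P^r_k$ is birational over $k$ to a projective space for some $r\ge 0$; it is stably irrational if it is not stably rational. A property holds for a very general point of a scheme if it holds at all closed points inside some countable intersection of open dense subsets; "very general hypersurface of degree $d$" refers to a very general point of the projective space parametrizing degree-$d$ hypersurfaces in $\mathbb P^{N+1}_k$ (the hypersurface corresponding to a closed point being defined over the residue field of that point). *)

theory Defs
  imports "HOL-Analysis.Analysis" "HOL-Algebra.QuotRing" "HOL-Library.Multiset"
begin

text \<open>
  Varieties are treated as closed subschemes of products of projective spaces over a field, each
  with its underlying Zariski space of (multi)homogeneous prime ideals and its structure sheaf.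
  Fields are \<open>HOL-Algebra\<close> structures and not types, since a hypersurface corresponding to a
  closed point lives over the residue field of that point.
\<close>

section \<open>Multivariate polynomials\<close>

text \<open>
  A monomial in variables from \<open>V\<close> is a multiset over \<open>V\<close>; a polynomial is a finitely supported
  coefficient function on monomials.
\<close>

definition mpoly_ring :: "'a ring \<Rightarrow> 'v set \<Rightarrow> ('v multiset \<Rightarrow> 'a) ring" where
  "mpoly_ring R V =
    \<lparr> carrier = {f. (\<forall>m. f m \<in> carrier R) \<and> finite {m. f m \<noteq> \<zero>\<^bsub>R\<^esub>} \<and>
                    (\<forall>m. f m \<noteq> \<zero>\<^bsub>R\<^esub> \<longrightarrow> set_mset m \<subseteq> V)},
      mult = (\<lambda>f g m. \<Oplus>\<^bsub>R\<^esub>a\<in>{a. a \<subseteq># m}. f a \<otimes>\<^bsub>R\<^esub> g (m - a)),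
      one = (\<lambda>m. if m = {#} then \<one>\<^bsub>R\<^esub> else \<zero>\<^bsub>R\<^esub>),
      zero = (\<lambda>m. \<zero>\<^bsub>R\<^esub>),
      add = (\<lambda>f g m. f m \<oplus>\<^bsub>R\<^esub> g m) \<rparr>"

definition mp_const :: "'a ring \<Rightarrow> 'a \<Rightarrow> 'v multiset \<Rightarrow> 'a" where
  "mp_const R c = (\<lambda>m. if m = {#} then c else \<zero>\<^bsub>R\<^esub>)"

definition mp_var :: "'a ring \<Rightarrow> 'v \<Rightarrow> 'v multiset \<Rightarrow> 'a" where
  "mp_var R v = (\<lambda>m. if m = {#v#} then \<one>\<^bsub>R\<^esub> else \<zero>\<^bsub>R\<^esub>)"

text \<open>A polynomial in variables \<open>v\<close>, regarded as a polynomial in the variables \<open>Inl v\<close>.\<close>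

definition mp_Inl :: "'a ring \<Rightarrow> ('v multiset \<Rightarrow> 'a) \<Rightarrow> ('v + 'w) multiset \<Rightarrow> 'a" where
  "mp_Inl R f = (\<lambda>m. if \<forall>x\<in>#m. isl x then f (image_mset projl m) else \<zero>\<^bsub>R\<^esub>)"


section \<open>Multigraded Proj\<close>

text \<open>
  A function \<open>b\<close> on the variables partitions them into blocks, each block being the homogeneous
  coordinates of one factor of a product of projective spaces.  The multidegree of a monomial \<open>m\<close>
  is the multiset \<open>image_mset b m\<close>, which records the degree of \<open>m\<close> in each block.
\<close>

definition mhomog :: "'a ring \<Rightarrow> 'v set \<Rightarrow> ('v \<Rightarrow> 'b) \<Rightarrow> 'b multiset \<Rightarrow> ('v multiset \<Rightarrow> 'a) set" where
  "mhomog R V b e =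
    {f \<in> carrier (mpoly_ring R V). \<forall>m. f m \<noteq> \<zero>\<^bsub>R\<^esub> \<longrightarrow> image_mset b m = e}"

definition mcomponent :: "'a ring \<Rightarrow> ('v \<Rightarrow> 'b) \<Rightarrow> 'b multiset \<Rightarrow> ('v multiset \<Rightarrow> 'a) \<Rightarrow> 'v multiset \<Rightarrow> 'a"
  where "mcomponent R b e f = (\<lambda>m. if image_mset b m = e then f m else \<zero>\<^bsub>R\<^esub>)"

text \<open>
  The closed subscheme cut out by a multihomogeneous ideal \<open>I\<close>: its points are the multihomogeneous
  primes containing \<open>I\<close> and, for every block, not containing all variables of that block.
\<close>

definition mproj_points ::
  "'a ring \<Rightarrow> 'v set \<Rightarrow> ('v \<Rightarrow> 'b) \<Rightarrow> ('v multiset \<Rightarrow> 'a) set \<Rightarrow> ('v multiset \<Rightarrow> 'a) set set" where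
  "mproj_points R V b I =
    {P. primeideal P (mpoly_ring R V) \<and> (\<forall>f\<in>P. \<forall>e. mcomponent R b e f \<in> P) \<and> I \<subseteq> P \<and>
        (\<forall>\<beta>\<in>b ` V. \<exists>v\<in>V. b v = \<beta> \<and> mp_var R v \<notin> P)}"

text \<open>The Zariski topology, generated by its base of principal open sets.\<close>

definition mproj_top ::
  "'a ring \<Rightarrow> 'v set \<Rightarrow> ('v \<Rightarrow> 'b) \<Rightarrow> ('v multiset \<Rightarrow> 'a) set \<Rightarrow> ('v multiset \<Rightarrow> 'a) set topology" where
  "mproj_top R V b I =
    topology_generated_by {{P \<in> mproj_points R V b I. f \<notin> P} | f e. f \<in> mhomog R V b e}"

type_synonym ('v, 'a) fraction = "(('v multiset \<Rightarrow> 'a) \<times> ('v multiset \<Rightarrow> 'a)) set"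

text \<open>
  The local ring at \<open>P\<close> consists of the fractions of multidegree zero over the quotient by \<open>I\<close>;
  \<open>mfrac R V b I P f g\<close> is the class of \<open>f / g\<close>.
\<close>

definition mfrac_pairs :: "'a ring \<Rightarrow> 'v set \<Rightarrow> ('v \<Rightarrow> 'b) \<Rightarrow> ('v multiset \<Rightarrow> 'a) set \<Rightarrow> ('v, 'a) fraction" where
  "mfrac_pairs R V b P = {(f, g). \<exists>e. f \<in> mhomog R V b e \<and> g \<in> mhomog R V b e \<and> g \<notin> P}"

definition mfrac ::
  "'a ring \<Rightarrow> 'v set \<Rightarrow> ('v \<Rightarrow> 'b) \<Rightarrow> ('v multiset \<Rightarrow> 'a) set \<Rightarrow> ('v multiset \<Rightarrow> 'a) set \<Rightarrow>
   ('v multiset \<Rightarrow> 'a) \<Rightarrow> ('v multiset \<Rightarrow> 'a) \<Rightarrow> ('v, 'a) fraction" where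
  "mfrac R V b I P f g =
    (let S = mpoly_ring R V in
     {(f', g') \<in> mfrac_pairs R V b P.
        \<exists>h \<in> carrier S - P. h \<otimes>\<^bsub>S\<^esub> ((f \<otimes>\<^bsub>S\<^esub> g') \<ominus>\<^bsub>S\<^esub> (f' \<otimes>\<^bsub>S\<^esub> g)) \<in> I})"

definition mproj_local_ring ::
  "'a ring \<Rightarrow> 'v set \<Rightarrow> ('v \<Rightarrow> 'b) \<Rightarrow> ('v multiset \<Rightarrow> 'a) set \<Rightarrow> ('v multiset \<Rightarrow> 'a) set \<Rightarrow>
   ('v, 'a) fraction ring" where
  "mproj_local_ring R V b I P =
    (let S = mpoly_ring R V; cls = mfrac R V b I P in
     \<lparr> carrier = {cls f g | f g. (f, g) \<in> mfrac_pairs R V b P},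
       mult = (\<lambda>A B. \<Union>(f, g)\<in>A. \<Union>(f', g')\<in>B. cls (f \<otimes>\<^bsub>S\<^esub> f') (g \<otimes>\<^bsub>S\<^esub> g')),
       one = cls \<one>\<^bsub>S\<^esub> \<one>\<^bsub>S\<^esub>,
       zero = cls \<zero>\<^bsub>S\<^esub> \<one>\<^bsub>S\<^esub>,
       add = (\<lambda>A B. \<Union>(f, g)\<in>A. \<Union>(f', g')\<in>B.
                cls ((f \<otimes>\<^bsub>S\<^esub> g') \<oplus>\<^bsub>S\<^esub> (f' \<otimes>\<^bsub>S\<^esub> g)) (g \<otimes>\<^bsub>S\<^esub> g')) \<rparr>)"

definition mproj_max_ideal ::
  "'a ring \<Rightarrow> 'v set \<Rightarrow> ('v \<Rightarrow> 'b) \<Rightarrow> ('v multiset \<Rightarrow> 'a) set \<Rightarrow> ('v multiset \<Rightarrow> 'a) set \<Rightarrow>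
   ('v, 'a) fraction set" where
  "mproj_max_ideal R V b I P =
    {mfrac R V b I P f g | f g. (f, g) \<in> mfrac_pairs R V b P \<and> f \<in> P}"

definition mproj_residue_field ::
  "'a ring \<Rightarrow> 'v set \<Rightarrow> ('v \<Rightarrow> 'b) \<Rightarrow> ('v multiset \<Rightarrow> 'a) set \<Rightarrow> ('v multiset \<Rightarrow> 'a) set \<Rightarrow>
   ('v, 'a) fraction set ring" where
  "mproj_residue_field R V b I P = mproj_local_ring R V b I P Quot mproj_max_ideal R V b I P"


section \<open>Ringed spaces over a field and birational equivalence\<close>

text \<open>
  Sections over an open set \<open>U\<close> are functions on \<open>U\<close> with values in the stalks, and restriction of
  sections is restriction of functions.  \<open>scalar X U c\<close> is the constant \<open>c\<close> of the base field,
  regarded as a section over \<open>U\<close>.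
\<close>

record ('p, 's, 'a) kspace =
  space_top :: "'p topology"
  sections :: "'p set \<Rightarrow> ('p \<Rightarrow> 's) ring"
  scalar :: "'p set \<Rightarrow> 'a \<Rightarrow> 'p \<Rightarrow> 's"

definition mproj_sections ::
  "'a ring \<Rightarrow> 'v set \<Rightarrow> ('v \<Rightarrow> 'b) \<Rightarrow> ('v multiset \<Rightarrow> 'a) set \<Rightarrow> ('v multiset \<Rightarrow> 'a) set set \<Rightarrow>
   (('v multiset \<Rightarrow> 'a) set \<Rightarrow> ('v, 'a) fraction) ring" where
  "mproj_sections R V b I U =
    (let \<O> = mproj_local_ring R V b I in
     \<lparr> carrier = {s \<in> (\<Pi>\<^sub>E P\<in>U. carrier (\<O> P)).
          \<forall>P\<in>U. \<exists>W f g e. openin (mproj_top R V b I) W \<and> P \<in> W \<and> W \<subseteq> U \<and>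
             f \<in> mhomog R V b e \<and> g \<in> mhomog R V b e \<and>
             (\<forall>Q\<in>W. g \<notin> Q \<and> s Q = mfrac R V b I Q f g)},
       mult = (\<lambda>s t. \<lambda>P\<in>U. s P \<otimes>\<^bsub>\<O> P\<^esub> t P),
       one = (\<lambda>P\<in>U. \<one>\<^bsub>\<O> P\<^esub>),
       zero = (\<lambda>P\<in>U. \<zero>\<^bsub>\<O> P\<^esub>),
       add = (\<lambda>s t. \<lambda>P\<in>U. s P \<oplus>\<^bsub>\<O> P\<^esub> t P) \<rparr>)"

definition mproj ::
  "'a ring \<Rightarrow> 'v set \<Rightarrow> ('v \<Rightarrow> 'b) \<Rightarrow> ('v multiset \<Rightarrow> 'a) set \<Rightarrow>
   (('v multiset \<Rightarrow> 'a) set, ('v, 'a) fraction, 'a) kspace" where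
  "mproj R V b I =
    \<lparr> space_top = mproj_top R V b I,
      sections = mproj_sections R V b I,
      scalar = (\<lambda>U c. \<lambda>P\<in>U. mfrac R V b I P (mp_const R c) \<one>\<^bsub>mpoly_ring R V\<^esub>) \<rparr>"

definition dense_open :: "'p topology \<Rightarrow> 'p set \<Rightarrow> bool" where
  "dense_open T U \<longleftrightarrow> openin T U \<and> T closure_of U = topspace T"

text \<open>
  \<open>K\<close>-isomorphism between the open subspaces \<open>U\<close> of \<open>X\<close> and \<open>W\<close> of \<open>Y\<close>: a homeomorphism \<open>\<phi>\<close>
  together with an isomorphism \<open>\<theta>\<close> from the sheaf of \<open>K\<close>-algebras on \<open>W\<close> to the direct image
  under \<open>\<phi>\<close> of the one on \<open>U\<close>.  Isomorphisms of ringed spaces are automatically local.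
\<close>

definition open_iso_over ::
  "'a ring \<Rightarrow> ('p, 's, 'a) kspace \<Rightarrow> 'p set \<Rightarrow> ('q, 't, 'a) kspace \<Rightarrow> 'q set \<Rightarrow> bool" where
  "open_iso_over K X U Y W \<longleftrightarrow>
    (\<exists>\<phi> \<theta>.
      homeomorphic_map (subtopology (space_top X) U) (subtopology (space_top Y) W) \<phi> \<and>
      (\<forall>A. openin (space_top Y) A \<and> A \<subseteq> W \<longrightarrow>
         \<theta> A \<in> ring_iso (sections Y A) (sections X {x\<in>U. \<phi> x \<in> A}) \<and>
         (\<forall>c\<in>carrier K. \<theta> A (scalar Y A c) = scalar X {x\<in>U. \<phi> x \<in> A} c) \<and>
         (\<forall>B s. openin (space_top Y) B \<and> B \<subseteq> A \<and> s \<in> carrier (sections Y A) \<longrightarrow>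
            \<theta> B (restrict s B) = restrict (\<theta> A s) {x\<in>U. \<phi> x \<in> B})))"

definition birational_over :: "'a ring \<Rightarrow> ('p, 's, 'a) kspace \<Rightarrow> ('q, 't, 'a) kspace \<Rightarrow> bool" where
  "birational_over K X Y \<longleftrightarrow>
    (\<exists>U W. dense_open (space_top X) U \<and> dense_open (space_top Y) W \<and> open_iso_over K X U Y W)"


section \<open>Projective schemes and stable rationality\<close>

abbreviation proj_scheme ::
  "'a ring \<Rightarrow> 'v set \<Rightarrow> ('v multiset \<Rightarrow> 'a) set \<Rightarrow>
   (('v multiset \<Rightarrow> 'a) set, ('v, 'a) fraction, 'a) kspace" where
  "proj_scheme K V I \<equiv> mproj K V (\<lambda>_. ()) I"

definition proj_space ::
  "'a ring \<Rightarrow> 'v set \<Rightarrow> (('v multiset \<Rightarrow> 'a) set, ('v, 'a) fraction, 'a) kspace" where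
  "proj_space K V = proj_scheme K V {\<zero>\<^bsub>mpoly_ring K V\<^esub>}"

text \<open>
  The product over \<open>K\<close> of \<open>proj_scheme K V I\<close> and the projective space with coordinates \<open>W\<close>, as a
  closed subscheme of the product of two projective spaces.
\<close>

definition proj_scheme_times ::
  "'a ring \<Rightarrow> 'v set \<Rightarrow> ('v multiset \<Rightarrow> 'a) set \<Rightarrow> 'w set \<Rightarrow>
   ((('v + 'w) multiset \<Rightarrow> 'a) set, ('v + 'w, 'a) fraction, 'a) kspace" where
  "proj_scheme_times K V I W =
    mproj K (Sum_Type.Plus V W) isl (Idl\<^bsub>mpoly_ring K (Sum_Type.Plus V W)\<^esub> (mp_Inl K ` I))"

definition stably_rational :: "'a ring \<Rightarrow> 'v set \<Rightarrow> ('v multiset \<Rightarrow> 'a) set \<Rightarrow> bool" where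
  "stably_rational K V I \<longleftrightarrow>
    (\<exists>(r :: nat) (n :: nat). birational_over K (proj_scheme_times K V I {..r}) (proj_space K {..n}))"

abbreviation stably_irrational :: "'a ring \<Rightarrow> 'v set \<Rightarrow> ('v multiset \<Rightarrow> 'a) set \<Rightarrow> bool" where
  "stably_irrational K V I \<equiv> \<not> stably_rational K V I"


section \<open>Very general hypersurfaces\<close>

definition very_general :: "'p topology \<Rightarrow> ('p \<Rightarrow> bool) \<Rightarrow> bool" where
  "very_general T Q \<longleftrightarrow>
    (\<exists>\<U>. countable \<U> \<and> (\<forall>U\<in>\<U>. dense_open T U) \<and>
         (\<forall>x\<in>topspace T. closedin T {x} \<and> x \<in> \<Inter>\<U> \<longrightarrow> Q x))"

text \<open>
  Hypersurfaces of degree \<open>d\<close> in the projective space of dimension \<open>n\<close> are parametrized by a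
  projective space with one homogeneous coordinate for every monomial of degree \<open>d\<close>.
\<close>

definition monomials :: "nat \<Rightarrow> nat \<Rightarrow> nat multiset set" where
  "monomials n d = {m. set_mset m \<subseteq> {..n} \<and> size m = d}"

abbreviation hypersurface_space ::
  "'a ring \<Rightarrow> nat \<Rightarrow> nat \<Rightarrow>
   ((nat multiset multiset \<Rightarrow> 'a) set, (nat multiset, 'a) fraction, 'a) kspace" where
  "hypersurface_space k n d \<equiv> proj_space k (monomials n d)"

abbreviation hyp_local_ring ::
  "'a ring \<Rightarrow> nat \<Rightarrow> nat \<Rightarrow> (nat multiset multiset \<Rightarrow> 'a) set \<Rightarrow> (nat multiset, 'a) fraction ring" where
  "hyp_local_ring k n d \<equiv>
    mproj_local_ring k (monomials n d) (\<lambda>_. ()) {\<zero>\<^bsub>mpoly_ring k (monomials n d)\<^esub>}"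

abbreviation hyp_max_ideal ::
  "'a ring \<Rightarrow> nat \<Rightarrow> nat \<Rightarrow> (nat multiset multiset \<Rightarrow> 'a) set \<Rightarrow> (nat multiset, 'a) fraction set" where
  "hyp_max_ideal k n d \<equiv>
    mproj_max_ideal k (monomials n d) (\<lambda>_. ()) {\<zero>\<^bsub>mpoly_ring k (monomials n d)\<^esub>}"

abbreviation hyp_residue_field ::
  "'a ring \<Rightarrow> nat \<Rightarrow> nat \<Rightarrow> (nat multiset multiset \<Rightarrow> 'a) set \<Rightarrow> (nat multiset, 'a) fraction set ring" where
  "hyp_residue_field k n d \<equiv>
    mproj_residue_field k (monomials n d) (\<lambda>_. ()) {\<zero>\<^bsub>mpoly_ring k (monomials n d)\<^esub>}"

text \<open>
  The equation at the point \<open>x\<close>, normalized so that \<open>m0\<close> has coefficient one: the coefficient of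
  \<open>m\<close> is the value at \<open>x\<close> of the quotient of the homogeneous coordinates \<open>m\<close> and \<open>m0\<close>.
\<close>

definition hyp_equation ::
  "'a ring \<Rightarrow> nat \<Rightarrow> nat \<Rightarrow> (nat multiset multiset \<Rightarrow> 'a) set \<Rightarrow> nat multiset \<Rightarrow>
   nat multiset \<Rightarrow> (nat multiset, 'a) fraction set" where
  "hyp_equation k n d x m0 = (\<lambda>m.
     if m \<in> monomials n d
     then hyp_max_ideal k n d x +>\<^bsub>hyp_local_ring k n d x\<^esub>
            mfrac k (monomials n d) (\<lambda>_. ()) {\<zero>\<^bsub>mpoly_ring k (monomials n d)\<^esub>} x
              (mp_var k m) (mp_var k m0)
     else \<zero>\<^bsub>hyp_residue_field k n d x\<^esub>)"

text \<open>
  The ideal of the hypersurface.  Its generators, one for every coordinate \<open>m0\<close> that does not vanish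
  at \<open>x\<close>, are nonzero scalar multiples of each other, so the ideal is principal.
\<close>

definition hyp_ideal ::
  "'a ring \<Rightarrow> nat \<Rightarrow> nat \<Rightarrow> (nat multiset multiset \<Rightarrow> 'a) set \<Rightarrow>
   (nat multiset \<Rightarrow> (nat multiset, 'a) fraction set) set" where
  "hyp_ideal k n d x =
    Idl\<^bsub>mpoly_ring (hyp_residue_field k n d x) {..n}\<^esub>
      {hyp_equation k n d x m0 | m0. m0 \<in> monomials n d \<and> mp_var k m0 \<notin> x}"

end

theory Submission
 imports Defs "Jordan_Normal_Form.Determinant"
  "HOL-Computational_Algebra.Computational_Algebra"
  "HOL-Computational_Algebra.Formal_Laurent_Series"
  "HOL-Library.Poly_Mapping"
  "HOL-Computational_Algebra.Fraction_Field"
  "HOL-Computational_Algebra.Field_as_Ring"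
  "HOL-Algebra.Algebraic_Closure_Type"
  "HOL-Library.Multiset_Order"
  "HOL-Library.Z2"
begin

text \<open>
  The invariant is the coefficient of a logarithmic differential form. Over a field of characteristic
  two with \<open>D\<^sub>0\<close> the identity and derivations \<open>D\<^sub>1, \<dots>, D\<^sub>n\<close>, put
  \<open>J(x) = det (D\<^sub>i x\<^sub>j) / (x\<^sub>0 \<cdots> x\<^sub>n)\<close>. Let \<open>F\<^sub>0\<close> be the special form
  \<open>z x\<^sub>0\<^bsup>d-1-n\<^esup> x\<^sub>1 \<cdots> x\<^sub>n + \<Sum>\<^sub>c x\<^bsup>T(c)\<^esup> c\<^bsup>d-|T(c)|\<^esup>\<close> with all \<open>d - |T(c)|\<close> even; distinct sets \<open>T(c)\<close> for the
  \<open>N + 2\<close> coordinates exist as soon as \<open>N + 2 \<le> 2\<^sup>n\<close> with \<open>n \<le> d - 2\<close>, whence the logarithmic bound.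
  A polynomial curve on \<open>F\<^sub>0 = 0\<close> makes a sum of square multiples of the \<open>x\<^sup>T\<close> divisible by the primes where
  \<open>x\<^sub>0 \<cdots> x\<^sub>n\<close> vanishes; this linear relation between the logarithmic derivatives cancels the poles of \<open>J\<close>, so
  that \<open>J\<close> has the same value at both ends of the curve.

  At a very general point the coefficients of the hypersurface are algebraically independent over the prime
  field (it suffices that no form with coefficients 0 and 1 vanishes), so finitely many elements of
  the residue field embed into Laurent series over an algebraic closure \<open>\<Omega>\<close> of the prime field in such a way that the
  equation reduces to \<open>F\<^sub>0\<close>. Stable rationality parametrizes the hypersurface by forms \<open>g(f(x))\<close>. Joining
  the parameter of a lift of a generic point of \<open>F\<^sub>0 = 0\<close> to a point with coordinates in \<open>\<Omega>\<close> by a line,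
  and passing to the leading coefficients along an edge of the Newton polygon, gives a chain of curves on \<open>F\<^sub>0 = 0\<close>
  from the generic point, where \<open>J \<noteq> 0\<close>, to a point killed by all derivations, where \<open>J = 0\<close>.
\<close>

hide_const (open) up_ring.monom up_ring.coeff module.smult Divisibility.prime Polynomials.degree Polynomials.lead_coeff
no_notation var ("X\<index>")

section \<open>Determinants of derivations at a prime\<close>

text \<open>In characteristic two derivations see exponents only modulo two. With every d - |T(c)|
  even, each coordinate term is x^T times a square, and squares are constants. The remaining term z
  x_0^(d-1-n) x_1 ... x_n is linear in z, which makes J nonzero at the generic point; its factor x_0
  ... x_n keeps it out of the relations at the primes where J could have a pole. Leading
  coefficients require a discrete valuation, whereas the residue field is first embedded into an
  algebraic closure of a Laurent series field. Only finitely many elements matter, so they lie in a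
  finite extension; its value group is again infinite cyclic, and expansion in a uniformizer leads
  back to Laurent series over \<Omega>. Two series variables are stacked: in the inner one Hensel's
  lemma writes down a generic point of F_0 = 0, in the outer one the hypersurface degenerates to
  F_0. At the far end of the line the parameters are independent variables, so that the form g_i
  used there cannot vanish, and one derivation kills them all, which is enough for J = 0.\<close>

definition derivation :: "('a :: comm_ring_1 => 'a) => bool" where
 "derivation D \<longleftrightarrow> (\<forall>a b. D (a + b) = D a + D b) & (\<forall>a b. D (a * b) = D a * b + a * D b)"

lemma derivation_add: "derivation D ==> D (a + b) = D a + D b"
 and derivation_mult: "derivation D ==> D (a * b) = D a * b + a * D b"
 by (auto simp: derivation_def)

lemma derivation_0 [simp]: "derivation D ==> D 0 = 0"
 using derivation_add[of D 0 0] by simp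

lemma derivation_1 [simp]: "derivation D ==> D 1 = 0"
 using derivation_mult[of D 1 1] by simp

lemma derivation_sum: "derivation D ==> D (\<Sum>i\<in>A. f i) = (\<Sum>i\<in>A. D (f i))"
 by (induction A rule: infinite_finite_induct) (auto simp: derivation_add)

lemma derivation_power: "derivation D ==> D (a ^ k) = of_nat k * a ^ (k - 1) * D a"
proof (induction k)
 case (Suc k)
 thus ?case by (cases k) (auto simp: derivation_mult algebra_simps)
qed auto

lemma derivation_prod:
 assumes "derivation D" "finite A"
 shows "D (\<Prod>i\<in>A. f i) = (\<Sum>i\<in>A. (\<Prod>k\<in>A - {i}. f k) * D (f i))"
 using assms(2)
proof (induction A rule: finite_induct)
 case (insert x A)
 have "(\<Sum>i\<in>A. (\<Prod>k\<in>insert x A - {i}. f k) * D (f i)) = (\<Sum>i\<in>A. f x * ((\<Prod>k\<in>A - {i}. f k) * D (f i)))"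
 proof (rule sum.cong[OF refl])
  fix i assume "i \<in> A"
  hence "insert x A - {i} = insert x (A - {i})" using insert by auto
  thus "(\<Prod>k\<in>insert x A - {i}. f k) * D (f i) = f x * ((\<Prod>k\<in>A - {i}. f k) * D (f i))"
  using insert by (simp add: mult.assoc)
 qed
 moreover have "insert x A - {x} = A" using insert by auto
 ultimately show ?case using insert assms(1)
  by (simp add: derivation_mult sum_distrib_left algebra_simps)
qed (use assms in auto)

text \<open>The adjugate turns \<open>M y\<close>, all of whose entries are divisible by
  \<open>p\<close>, into \<open>det M\<close> times \<open>y\<close>; entry \<open>k\<close>, where
  \<open>y\<close> is prime to \<open>p\<close>, decides.\<close>

lemma dvd_det_of_kernel:
 fixes M :: "nat => nat => 'a :: comm_ring_1"
 assumes "prime_elem p" "k < m" "~ p dvd y k"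
  and "!!i. i < m ==> p dvd (\<Sum>j<m. M i j * y j)"
 shows "p dvd det (mat m m (%(i,j). M i j))"
proof -
 define A where "A = mat m m (%(i,j). M i j)"
 define B where "B = adj_mat A"
 have A: "A \<in> carrier_mat m m" by (simp add: A_def)
 note adj = adj_mat[OF A, folded B_def]
 have "det A * y k = (\<Sum>j<m. (B * A) $$ (k,j) * y j)"
  unfolding adj(3) using assms(2) by (simp add: if_distrib[of "%x. _ * x"] if_distrib[of "%x. x * _"] cong: if_cong)
 also have "\<dots> = (\<Sum>j<m. (\<Sum>i<m. B $$ (k,i) * M i j) * y j)"
  using adj(1) A assms(2) by (intro sum.cong) (auto simp: scalar_prod_def A_def atLeast0LessThan)
 also have "\<dots> = (\<Sum>j<m. \<Sum>i<m. B $$ (k,i) * (M i j * y j))"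
  by (simp add: sum_distrib_right mult.assoc)
 also have "\<dots> = (\<Sum>i<m. \<Sum>j<m. B $$ (k,i) * (M i j * y j))"
  by (rule sum.swap)
 also have "\<dots> = (\<Sum>i<m. B $$ (k,i) * (\<Sum>j<m. M i j * y j))"
  by (simp add: sum_distrib_left)
 finally have "p dvd det A * y k"
  by (auto intro!: dvd_sum dvd_mult assms(4))
 with assms(1,3) show ?thesis unfolding A_def by (simp add: prime_elem_dvd_mult_iff)
qed

abbreviation (input) "sqmat n \<equiv> mat (Suc n) (Suc n)"

lemma det_scale_rows:
 fixes M :: "nat => nat => 'a :: comm_ring_1"
 shows "det (mat m m (%(i,j). s i * M i j)) = (\<Prod>j<m. s j) * det (mat m m (%(i,j). M i j))"
proof -
 have "mat m m (%(i,j). s i * M i j) = mat_diag m s * mat m m (%(i,j). M i j)"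
  by (subst mat_diag_mult_left[of _ m m]) (auto intro: eq_matI)
 moreover have "det (mat_diag m s) = (\<Prod>j<m. s j)"
  by (subst det_lower_triangular[of m]) (auto simp: prod_list_diag_prod mat_diag_def lessThan_atLeast0 intro!: prod.cong)
 ultimately show ?thesis by (simp add: det_mult[of _ m])
qed

lemma det_scale_columns:
 fixes M :: "nat => nat => 'a :: comm_ring_1"
 shows "det (mat m m (%(i,j). s j * M i j)) = (\<Prod>j<m. s j) * det (mat m m (%(i,j). M i j))"
proof -
 have T: "det (mat m m (%(i,j). A i j)) = det (mat m m (%(i,j). A j i))" for A :: "nat => nat => 'a"
  by (subst det_transpose[of _ m, symmetric]) (auto intro!: arg_cong[where f = det] eq_matI)
 show ?thesis using det_scale_rows[of m s "%i j. M j i"] T[of "%i j. s j * M i j"] T[of M] by simp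
qed

text \<open>Since \<open>w r = 0\<close>, row \<open>r\<close> of the elimination matrix
  \<open>U\<close> is a unit vector and the complementary minor is an identity matrix.\<close>

lemma det_combine_row:
 fixes M :: "nat => nat => 'a :: comm_ring_1"
 assumes "r < m" "w r = 0"
 shows "det (mat m m (%(i,j). M i j + w i * M r j)) = det (mat m m (%(i,j). M i j))"
proof -
 define U where "U = mat m m (%(i,j). (if i = j then 1 else 0) + (if j = r then w i else 0))"
 have U: "U \<in> carrier_mat m m" by (simp add: U_def)
 have UM: "mat m m (%(i,j). M i j + w i * M r j) = U * mat m m (%(i,j). M i j)"
  using assms(1) by (intro eq_matI)
  (auto simp: U_def scalar_prod_def distrib_right sum.distrib if_distrib[of "%x. x * _"] cong: if_cong)
 have "det U = (\<Sum>j<m. U $$ (r, j) * cofactor U r j)"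
  by (rule laplace_expansion_row[OF U assms(1)])
 also have "\<dots> = (\<Sum>j<m. if j = r then cofactor U r j else 0)"
  using assms by (intro sum.cong) (auto simp: U_def)
 also have "mat_delete U r r = 1\<^sub>m (m - 1)"
  using assms by (intro eq_matI) (auto simp: U_def mat_delete_def)
 hence "(\<Sum>j<m. if j = r then cofactor U r j else 0) = 1"
  using assms(1) by (simp add: cofactor_def)
 finally show ?thesis unfolding UM by (simp add: det_mult[OF U])
qed

text \<open>The extra factor \<open>p\<close> on both sides removes the exponent
  \<open>k - 1\<close>, so that \<open>k = 0\<close> needs no separate formula.\<close>

lemma derivation_prime_power_mult:
 assumes "derivation D"
 shows "p * D (p ^ k * b) = p ^ k * (p * D b + of_nat k * D p * b)"
proof -
 have "D (p ^ k * b) = of_nat k * p ^ (k - 1) * D p * b + p ^ k * D b"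
  by (simp only: derivation_mult[OF assms] derivation_power[OF assms])
 thus ?thesis by (cases k) (simp_all add: algebra_simps)
qed

lemma double_eq_0_char2: "(2 :: 'a :: comm_ring_1) = 0 ==> a + a = (0 :: 'a)"
 by (metis mult_2 mult_zero_left)

lemma of_nat_char2:
 assumes "(2 :: 'a :: comm_ring_1) = 0"
 shows "of_nat k = (if even k then 0 else 1 :: 'a)"
proof (cases "even k")
 case True
 then obtain i where "k = 2 * i" by blast
 thus ?thesis using assms by simp
next
 case False
 then obtain i where "k = 2 * i + 1" by (rule oddE)
 thus ?thesis using assms by simp
qed

lemma prime_elem_not_dvd_prod:
 "prime_elem p ==> (!!i. i \<in> A ==> ~ p dvd f i) ==> ~ p dvd (\<Prod>i\<in>A. f i)"
 by (induction A rule: infinite_finite_induct) (auto simp: prime_elem_dvd_mult_iff prime_elem_not_unit)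

lemma prime_elem_power_dvd_cancel:
 assumes p: "prime_elem (p :: 'a :: idom)" "~ p dvd b" and "p ^ k dvd a * b"
 shows "p ^ k dvd a"
 using assms(3)
proof (induction k)
 case (Suc k)
 hence "p ^ k dvd a * b" by (meson power_le_dvd le_SucI order_refl)
 then obtain c where c: "a = p ^ k * c" using Suc.IH by blast
 have p0: "p ^ k ~= 0" using p by auto
 obtain e where "p ^ k * c * b = p ^ Suc k * e" using Suc.prems c by blast
 hence "p ^ k * (c * b) = p ^ k * (p * e)" by (simp add: mult_ac)
 hence "c * b = p * e" using p0 by (metis mult_left_cancel)
 hence "p dvd c" using p by (metis dvd_triv_left prime_elem_dvd_mult_iff)
 thus ?case using c by (auto simp: mult_ac)
qed auto

text \<open>Meant for the property that a sum over the set is divisible by a prime: no proper part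
  of the minimal relation is a relation, which is what makes the kernel vector below
  nontrivial.\<close>

lemma minimal_zero_sum:
 assumes fin: "finite A" and "A ~= {}" and "P A"
 obtains B where "B \<subseteq> A" "B ~= {}" "P B" "!!C. C \<subset> B ==> C ~= {} ==> ~ P C"
proof -
 have "\<exists>B. (B \<subseteq> A & B ~= {} & P B) & (\<forall>C. (C \<subseteq> A & C ~= {} & P C) --> card B \<le> card C)"
  by (rule ex_has_least_nat[of _ A]) (use assms in auto)
 then obtain B where B: "B \<subseteq> A" "B ~= {}" "P B"
  and min: "!!C. C \<subseteq> A ==> C ~= {} ==> P C ==> card B \<le> card C" by blast
 have "~ P C" if "C \<subset> B" "C ~= {}" for C
  using min[of C] that B psubset_card_mono[of B C] finite_subset[OF B(1) fin] by force
 thus ?thesis using that B by blast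
qed

text \<open>
  The kernel vector behind the vanishing of residues: a relation \<open>\<Sum>\<^sub>T q\<^sub>T\<^sup>2 b\<^sup>T \<equiv> 0\<close> modulo \<open>p\<close>
  gives the logarithmic relation with coefficients \<open>\<lambda>\<^sub>j = \<Sum>\<^bsub>T\<ni>j\<^esub> q\<^sub>T\<^sup>2 b\<^sup>T\<close>, which is nontrivial when
  the relation is minimal and the sets \<open>T\<close> are distinct.
\<close>

lemma residue_kernel:
 fixes b :: "nat => 'a :: idom" and q :: "nat set => 'a"
 assumes char2: "(2 :: 'a) = 0"
  and p: "prime_elem p"
  and fin: "finite TT" "TT ~= {}" and sub: "!!T. T \<in> TT ==> T \<subseteq> {..n}"
  and unit: "!!T. T \<in> TT ==> ~ p dvd (q T)\<^sup>2 * (\<Prod>j\<in>T. b j)"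
  and rel: "p dvd (\<Sum>T\<in>TT. (q T)\<^sup>2 * (\<Prod>j\<in>T. b j))"
 obtains y w k TT1 where "k \<le> n" "~ p dvd y k" "TT1 \<subseteq> TT"
  and "(\<Sum>T\<in>TT1. (q T)\<^sup>2 * (\<Prod>j\<in>T. b j)) = p * w"
  and "!!s. (\<Sum>j\<le>n. s j * b j * y j) = (\<Sum>T\<in>TT1. (\<Sum>j\<in>T. s j) * ((q T)\<^sup>2 * (\<Prod>j\<in>T. b j)))"
  and "!!D. derivation D ==> (\<Sum>j\<le>n. D (b j) * y j) = D (p * w)"
proof -
 define c where "c = (%T. (q T)\<^sup>2 * (\<Prod>j\<in>T. b j))"
 have finT: "finite T" if "T \<in> TT" for T using sub[OF that] finite_subset by blast
 obtain TT1 where T1: "TT1 \<subseteq> TT" "TT1 ~= {}" "p dvd sum c TT1"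
  and min: "!!C. C \<subset> TT1 ==> C ~= {} ==> ~ p dvd sum c C"
  by (rule minimal_zero_sum[OF fin, of "%A. p dvd sum c A"]) (use rel in "auto simp: c_def")
 have finT1: "finite TT1" using T1 fin finite_subset by blast
 obtain T where T: "T \<in> TT1" using T1 by auto
 have "~ p dvd c T" using unit[of T] T T1(1) unfolding c_def by blast
 \<comment> \<open>A single term is prime to \<open>p\<close>, so the minimal relation involves two
   different sets, and some index \<open>k\<close> lies in exactly one of them.\<close>
 hence "TT1 ~= {T}" using T1(3) by auto
 then obtain T' where T': "T' \<in> TT1" "T' ~= T" using T by auto
 then obtain k where k: "(k \<in> T) ~= (k \<in> T')" by auto
 hence kn: "k \<le> n" using sub T T' T1 by blast
 \<comment> \<open>This is \<lambda>_j / b_j with the division carried out inside the products. The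
   sets containing the separating index \<open>k\<close> form a proper nonempty part of the
   relation, hence \<open>y k\<close> is prime to \<open>p\<close>.\<close>
 define y where "y = (%j. \<Sum>T | T \<in> TT1 & j \<in> T. (q T)\<^sup>2 * (\<Prod>i\<in>T - {j}. b i))"
 have by': "b j * y j = sum c {T \<in> TT1. j \<in> T}" for j
  unfolding y_def sum_distrib_left
 proof (rule sum.cong[OF refl])
  fix T assume "T \<in> {T \<in> TT1. j \<in> T}"
  hence "finite T" "j \<in> T" using finT T1 by auto
  thus "b j * ((q T)\<^sup>2 * (\<Prod>i\<in>T - {j}. b i)) = c T"
  unfolding c_def by (subst (2) prod.remove[of _ j]) (auto simp: mult_ac)
 qed
 have "{T \<in> TT1. k \<in> T} \<subset> TT1" "{T \<in> TT1. k \<in> T} ~= {}"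
  using k T T' by auto
 hence "~ p dvd b k * y k" unfolding by' by (rule min)
 hence yk: "~ p dvd y k" by auto
 obtain w where w: "sum c TT1 = p * w" using T1 by auto
 have swap: "(\<Sum>j\<le>n. sum (f j) {T \<in> TT1. j \<in> T}) = (\<Sum>T\<in>TT1. \<Sum>j\<in>T. f j T)" for f :: "nat => nat set => 'a"
 proof -
  have "(\<Sum>j\<le>n. sum (f j) {T \<in> TT1. j \<in> T}) = (\<Sum>T\<in>TT1. \<Sum>j | j \<in> {..n} & j \<in> T. f j T)"
  using finT1 by (intro sum.swap_restrict) auto
  also have "\<dots> = (\<Sum>T\<in>TT1. \<Sum>j\<in>T. f j T)"
  using sub T1 by (intro sum.cong) auto
  finally show ?thesis .
 qed
 have rel1: "(\<Sum>j\<le>n. s j * b j * y j) = (\<Sum>T\<in>TT1. (\<Sum>j\<in>T. s j) * c T)" for s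
  using swap[of "%j T. s j * c T"] by (simp add: mult.assoc by' sum_distrib_left sum_distrib_right)
 have rel2: "(\<Sum>j\<le>n. D (b j) * y j) = D (p * w)" if D: "derivation D" for D
 proof -
  have "(\<Sum>j\<le>n. D (b j) * y j) = (\<Sum>T\<in>TT1. \<Sum>j\<in>T. D (b j) * ((q T)\<^sup>2 * (\<Prod>i\<in>T - {j}. b i)))"
  unfolding swap[symmetric] y_def by (simp add: sum_distrib_left)
  also have "\<dots> = (\<Sum>T\<in>TT1. D (c T))"
  proof (rule sum.cong[OF refl])
  fix T assume "T \<in> TT1"
  have "D ((q T)\<^sup>2) = 0" using D char2 by (simp add: derivation_power)
  thus "(\<Sum>j\<in>T. D (b j) * ((q T)\<^sup>2 * (\<Prod>i\<in>T - {j}. b i))) = D (c T)"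
  using D finT `T \<in> TT1` T1 unfolding c_def
  by (simp add: derivation_mult derivation_prod sum_distrib_left mult_ac subset_iff)
  qed
  also have "\<dots> = D (p * w)" using D w by (simp add: derivation_sum flip: w)
  finally show ?thesis .
 qed
 show ?thesis by (rule that[of k y TT1 w, OF kn yk T1(1)]) (use w rel1 rel2 in "simp_all add: c_def")
qed

text \<open>Taking \<open>p ^ xi j\<close> out of column \<open>j\<close> leaves
  \<open>D i (b j) + xi j * (D i p / p) * b j\<close>, a simple pole along \<open>p\<close>. The
  vector of \<open>residue_kernel\<close> annihilates \<open>b\<close> and \<open>xi * b\<close>
  modulo \<open>p\<close>, by the two parity conditions, and controls the derivatives of
  \<open>b\<close>; the determinant thus regains the factor that the pole costs. If \<open>p\<close>
  divides all its derivatives there is no pole, and the same factor is the gain in the second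
  conclusion.\<close>

lemma det_derivations_at_prime:
 fixes x b :: "nat => 'a :: idom" and q :: "nat set => 'a" and xi :: "nat => nat"
  and D :: "nat => 'a => 'a" and d e :: nat
 assumes char2: "(2 :: 'a) = 0"
  and p: "prime_elem p"
  and x: "!!j. j \<le> n ==> x j = p ^ xi j * b j"
  and D0: "D 0 = (%a. a)" and D: "!!i. 1 \<le> i ==> i \<le> n ==> derivation (D i)"
  and fin: "finite TT" "TT ~= {}" and sub: "!!T. T \<in> TT ==> T \<subseteq> {..n}"
  and unit: "!!T. T \<in> TT ==> ~ p dvd (q T)\<^sup>2 * (\<Prod>j\<in>T. b j)"
  and rel: "p dvd (\<Sum>T\<in>TT. (q T)\<^sup>2 * (\<Prod>j\<in>T. b j))"
  and par1: "!!T. T \<in> TT ==> even (card T) = even d"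
  and par2: "!!T. T \<in> TT ==> even (\<Sum>j\<in>T. xi j) = even e"
 shows "p ^ (\<Sum>j\<le>n. xi j) dvd det (sqmat n (%(i,j). D i (x j)))"
  and "(!!i. 1 \<le> i ==> i \<le> n ==> p dvd D i p) ==>
  p ^ Suc (\<Sum>j\<le>n. xi j) dvd det (sqmat n (%(i,j). D i (x j)))"
proof -
 obtain y w k TT1 where k: "k \<le> n" "~ p dvd y k" and T1: "TT1 \<subseteq> TT"
  and w: "(\<Sum>T\<in>TT1. (q T)\<^sup>2 * (\<Prod>j\<in>T. b j)) = p * w"
  and s: "!!s. (\<Sum>j\<le>n. s j * b j * y j) = (\<Sum>T\<in>TT1. (\<Sum>j\<in>T. s j) * ((q T)\<^sup>2 * (\<Prod>j\<in>T. b j)))"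
  and Dw: "!!D. derivation D ==> (\<Sum>j\<le>n. D (b j) * y j) = D (p * w)"
  by (rule residue_kernel[OF char2 p fin sub unit rel]) blast+
 \<comment> \<open>In characteristic two only the common parity of the sums over the sets
   \<open>T\<close> counts, so the weighted sum is 0 or 1 times the whole relation.\<close>
 have ker_s: "p dvd (\<Sum>j\<le>n. of_nat (f j) * b j * y j)"
  if "!!T. T \<in> TT ==> even (\<Sum>j\<in>T. f j) = even e'" for f and e' :: nat
 proof -
  have "(\<Sum>j\<le>n. of_nat (f j) * b j * y j) = (\<Sum>T\<in>TT1. of_nat e' * ((q T)\<^sup>2 * (\<Prod>j\<in>T. b j)))"
  unfolding s
  proof (rule sum.cong[OF refl])
  fix T assume "T \<in> TT1"
  hence "of_nat (\<Sum>j\<in>T. f j) = (of_nat e' :: 'a)"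
  using that[of T] T1 by (auto simp: of_nat_char2[OF char2] simp del: of_nat_sum)
  thus "(\<Sum>j\<in>T. of_nat (f j)) * ((q T)\<^sup>2 * (\<Prod>j\<in>T. b j)) = of_nat e' * ((q T)\<^sup>2 * (\<Prod>j\<in>T. b j))"
  by simp
  qed
  thus ?thesis by (simp add: w flip: sum_distrib_left)
 qed
 have ker_0: "p dvd (\<Sum>j\<le>n. b j * y j)"
  using ker_s[of "%_. 1" d] par1 by simp
 have ker_xi: "p dvd (\<Sum>j\<le>n. of_nat (xi j) * b j * y j)"
  using ker_s[of xi e] par2 by simp
 let ?A = "sqmat n (%(i,j). D i (x j))"
 let ?S = "\<Sum>j\<le>n. xi j"
 have pS: "p ^ ?S = (\<Prod>j<Suc n. p ^ xi j)"
  by (simp add: power_sum lessThan_Suc_atMost)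
 have p0: "p ~= 0" using p by auto
 have reg: "p ^ Suc ?S dvd det ?A" if all: "!!i. 1 \<le> i ==> i \<le> n ==> p dvd D i p"
 proof -
  have "\<forall>i. \<exists>e. 1 \<le> i --> i \<le> n --> D i p = p * e" using all by (auto elim!: dvdE)
  then obtain g where g: "!!i. 1 \<le> i ==> i \<le> n ==> D i p = p * g i" by metis
  define M where "M = (%i j. if i = 0 then b j else D i (b j) + of_nat (xi j) * g i * b j)"
  have "D i (x j) = p ^ xi j * M i j" if "i \<le> n" "j \<le> n" for i j
  proof (cases "i = 0")
  case False
  hence "p * D i (x j) = p * (p ^ xi j * M i j)"
  using that D g derivation_prime_power_mult[of "D i" p "xi j" "b j"]
  by (simp add: x M_def algebra_simps)
  thus ?thesis using p0 by simp
  qed (use that in "auto simp: D0 x M_def")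
  hence "?A = sqmat n (%(i,j). p ^ xi j * M i j)" by (intro eq_matI) auto
  hence "det ?A = p ^ ?S * det (sqmat n (%(i,j). M i j))"
  by (simp only: det_scale_columns pS)
  moreover have "p dvd det (sqmat n (%(i,j). M i j))"
  proof (rule dvd_det_of_kernel[where y = y and k = k])
  fix i assume i: "i < Suc n"
  have "p dvd (\<Sum>j\<le>n. M i j * y j)"
  proof (cases "i = 0")
  case False
  have "(\<Sum>j\<le>n. M i j * y j) = (\<Sum>j\<le>n. D i (b j) * y j) + g i * (\<Sum>j\<le>n. of_nat (xi j) * b j * y j)"
  using False by (simp add: M_def algebra_simps sum.distrib sum_distrib_left)
  also have "(\<Sum>j\<le>n. D i (b j) * y j) = D i (p * w)" using Dw D False i by simp
  also have "\<dots> = p * (D i w + g i * w)"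
  using D[of i] False i g[of i] by (simp add: derivation_mult algebra_simps)
  finally show ?thesis using ker_xi by simp
  qed (use ker_0 in "simp add: M_def")
  thus "p dvd (\<Sum>j<Suc n. M i j * y j)" by (simp only: lessThan_Suc_atMost)
  qed (use k p in auto)
  ultimately show ?thesis by (simp add: mult_dvd_mono mult.commute)
 qed
 show "(!!i. 1 \<le> i ==> i \<le> n ==> p dvd D i p) ==> p ^ Suc ?S dvd det ?A"
  by (rule reg)
 show "p ^ ?S dvd det ?A"
 proof (cases "\<forall>i. 1 \<le> i --> i \<le> n --> p dvd D i p")
  case True
  hence "p ^ Suc ?S dvd det ?A" using reg by auto
  thus ?thesis by (rule power_le_dvd) simp
 next
  case False
  then obtain r where r: "1 \<le> r" "r \<le> n" "~ p dvd D r p" by auto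
  \<comment> \<open>The pole is confined to row \<open>r\<close>, which is multiplied by
    \<open>p\<close>. Every other derivation row is scaled by \<open>dl\<close>, a unit modulo
    \<open>p\<close>, and cleared by subtracting \<open>D i p\<close> times row
    \<open>r\<close>.\<close>
  define dl where "dl = D r p"
  define sc where "sc = (%i. if i = 0 \<or> i = r then 1 else dl)"
  define wt where "wt = (%i. if i = 0 \<or> i = r then 0 else - D i p)"
  define M where "M = (%i j. if i = 0 then b j else if i = r then p * D r (b j) + of_nat (xi j) * dl * b j
  else dl * D i (b j) - D i p * D r (b j))"
  have "p * det ?A * (\<Prod>i<Suc n. sc i) = p * det (sqmat n (%(i,j). sc i * D i (x j)))"
  by (simp only: det_scale_rows mult_ac)
  also have "\<dots> = p * det (sqmat n (%(i,j). sc i * D i (x j) + wt i * (sc r * D r (x j))))"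
  using r by (subst det_combine_row[of r "Suc n" wt "%i j. sc i * D i (x j)", symmetric])
  (auto simp: wt_def)
  also have "\<dots> = det (sqmat n (%(i,j). (if i = r then p else 1) *
  (sc i * D i (x j) + wt i * (sc r * D r (x j)))))"
  using r by (simp add: det_scale_rows del: prod.lessThan_Suc)
  also have "sqmat n (%(i,j). (if i = r then p else 1) *
  (sc i * D i (x j) + wt i * (sc r * D r (x j)))) = sqmat n (%(i,j). p ^ xi j * M i j)"
  proof (rule eq_matI, goal_cases)
  case (1 i j)
  hence ij: "i \<le> n" "j \<le> n" by auto
  note dp = derivation_prime_power_mult[of _ p "xi j" "b j"]
  have "(if i = r then p else 1) * (sc i * D i (x j) + wt i * (sc r * D r (x j))) = p ^ xi j * M i j"
  proof (cases "i = 0 \<or> i = r")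
  case True
  thus ?thesis using r ij D dp[of "D r"]
  by (auto simp: sc_def wt_def M_def D0 x dl_def algebra_simps)
  next
  case False
  have "p * (dl * D i (x j) - D i p * D r (x j)) = dl * (p * D i (x j)) - D i p * (p * D r (x j))"
  by (simp add: algebra_simps)
  also have "\<dots> = p * (p ^ xi j * M i j)"
  using False r ij D dp[of "D r"] dp[of "D i"]
  by (simp add: M_def dl_def x algebra_simps)
  finally have "dl * D i (x j) - D i p * D r (x j) = p ^ xi j * M i j" using p0 by simp
  thus ?thesis using False r by (simp add: sc_def wt_def)
  qed
  thus ?case using 1 by simp
  qed auto
  also have "det \<dots> = p ^ ?S * det (sqmat n (%(i,j). M i j))"
  by (simp only: det_scale_columns pS)
  finally have eq: "p * det ?A * (\<Prod>i<Suc n. sc i) = p ^ ?S * det (sqmat n (%(i,j). M i j))" .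
  have "p dvd det (sqmat n (%(i,j). M i j))"
  proof (rule dvd_det_of_kernel[where y = y and k = k])
  fix i assume i: "i < Suc n"
  have Dr: "(\<Sum>j\<le>n. D r (b j) * y j) = p * D r w + dl * w"
  using Dw[of "D r"] D r by (simp add: derivation_mult dl_def)
  consider "i = 0" | "i = r" | "i ~= 0" "i ~= r" by blast
  hence "p dvd (\<Sum>j\<le>n. M i j * y j)"
  proof cases
  case 1
  thus ?thesis using ker_0 by (simp add: M_def)
  next
  case 2
  have "(\<Sum>j\<le>n. M i j * y j) = p * (\<Sum>j\<le>n. D r (b j) * y j) + dl * (\<Sum>j\<le>n. of_nat (xi j) * b j * y j)"
  using 2 r by (simp add: M_def algebra_simps sum.distrib sum_distrib_left)
  thus ?thesis using ker_xi by simp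
  next
  case 3
  have "(\<Sum>j\<le>n. M i j * y j) = dl * (\<Sum>j\<le>n. D i (b j) * y j) - D i p * (\<Sum>j\<le>n. D r (b j) * y j)"
  using 3 by (simp add: M_def algebra_simps sum_subtractf sum_distrib_left)
  also have "(\<Sum>j\<le>n. D i (b j) * y j) = p * D i w + D i p * w"
  using Dw[of "D i"] D[of i] 3 i by (simp add: derivation_mult)
  finally have "(\<Sum>j\<le>n. M i j * y j) = p * (dl * D i w - D i p * D r w)"
  unfolding Dr by (simp add: algebra_simps)
  thus ?thesis by simp
  qed
  thus "p dvd (\<Sum>j<Suc n. M i j * y j)" by (simp only: lessThan_Suc_atMost)
  qed (use k p in auto)
  then obtain c where c: "det (sqmat n (%(i,j). M i j)) = p * c" by blast
  have "p * (det ?A * (\<Prod>i<Suc n. sc i)) = p * (p ^ ?S * c)" using eq c by (simp add: mult_ac)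
  hence eq': "p ^ ?S dvd det ?A * (\<Prod>i<Suc n. sc i)" using p0 by simp
  have "~ p dvd (\<Prod>i<Suc n. sc i)"
  using p r by (intro prime_elem_not_dvd_prod) (auto simp: sc_def dl_def prime_elem_not_unit)
  thus ?thesis using eq' p by (rule prime_elem_power_dvd_cancel[rotated])
 qed
qed

section \<open>The special hypersurface\<close>

lemma sum_power2_char2:
 assumes "(2 :: 'a :: comm_ring_1) = 0"
 shows "(\<Sum>i\<in>A. f i)\<^sup>2 = (\<Sum>i\<in>A. (f i :: 'a)\<^sup>2)"
proof (induction A rule: infinite_finite_induct)
 case (insert x A)
 have "(f x + sum f A)\<^sup>2 = (f x)\<^sup>2 + (sum f A)\<^sup>2 + 2 * f x * sum f A" by (rule power2_sum)
 thus ?case using insert assms by simp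
qed auto

text \<open>
  Coordinates \<open>0, \<dots>, n\<close> are the \<open>x\<^sub>j\<close> on whose logarithmic derivatives the invariant depends, \<open>n + 1\<close>
  is the coordinate occurring to an odd power in one monomial only, and the remaining coordinates
  only raise the dimension.  The other monomials are \<open>x\<^sup>T c\<^bsup>d-|T|\<^esup>\<close> with \<open>d - |T|\<close> even,
  so that modulo squares they are \<open>x\<^sup>T\<close>.
\<close>

locale shape =
 fixes N n d :: nat and T :: "nat => nat set"
 assumes n_pos: "1 \<le> n" and n_le: "n \<le> N" and n_d: "n + 2 \<le> d"
  and T_sub: "c \<le> Suc N ==> T c \<subseteq> {..n}"
  and T_par: "c \<le> Suc N ==> even (card (T c)) = even d"
  and T_card: "c \<le> Suc N ==> card (T c) + 2 \<le> d"
  and T_sep: "inj_on T {..Suc N} \<or> N = 1 & T 0 = T 1 & T 2 ~= T 0"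
  and T_special: "even d & T (Suc n) = {} & T 0 = {0,1} \<or> odd d & T (Suc n) = {0} & T 1 = {1}"
begin

definition zpart :: "(nat => 'a :: comm_ring_1) => 'a" where
 "zpart a = a (Suc n) * a 0 ^ (d - 1 - n) * (\<Prod>j=1..n. a j)"

definition form :: "(nat => 'a :: comm_ring_1) => 'a" where
 "form a = zpart a + (\<Sum>c\<le>Suc N. (\<Prod>j\<in>T c. a j) * a c ^ (d - card (T c)))"

text \<open>Squaring is additive in characteristic two, so the coordinate terms with the same set
  \<open>S\<close> add up to x^S times the square of this sum.\<close>

definition root :: "(nat => 'a :: comm_ring_1) => nat set => 'a" where
 "root a S = (\<Sum>c | c \<le> Suc N & T c = S. a c ^ ((d - card S) div 2))"

lemma finite_T: "c \<le> Suc N ==> finite (T c)"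
 using T_sub finite_subset by blast

lemma T_even: "c \<le> Suc N ==> even (d - card (T c))"
 using T_par[of c] T_card[of c] by auto

lemma form_eq_classes:
 assumes char2: "(2 :: 'a :: comm_ring_1) = 0"
 shows "form a = zpart a + (\<Sum>S\<in>T ` {..Suc N}. (\<Prod>j\<in>S. a j) * (root a S :: 'a)\<^sup>2)"
proof -
 have "(\<Sum>S\<in>T ` {..Suc N}. (\<Prod>j\<in>S. a j) * (root a S)\<^sup>2)
  = (\<Sum>S\<in>T ` {..Suc N}. \<Sum>c | c \<in> {..Suc N} & T c = S. (\<Prod>j\<in>T c. a j) * a c ^ (d - card (T c)))"
 proof (rule sum.cong[OF refl])
  fix S
  have *: "(a c ^ ((d - card S) div 2))\<^sup>2 = a c ^ (d - card (T c))" if "c \<le> Suc N" "T c = S" for c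
  using T_even[OF that(1)] that(2) by (simp flip: power_mult)
  show "(\<Prod>j\<in>S. a j) * (root a S)\<^sup>2 = (\<Sum>c | c \<in> {..Suc N} & T c = S. (\<Prod>j\<in>T c. a j) * a c ^ (d - card (T c)))"
  unfolding root_def sum_power2_char2[OF char2] sum_distrib_left by (rule sum.cong) (auto simp: *)
 qed
 also have "\<dots> = (\<Sum>c\<le>Suc N. (\<Prod>j\<in>T c. a j) * a c ^ (d - card (T c)))"
  by (rule sum.image_gen[symmetric]) auto
 finally show ?thesis by (simp add: form_def)
qed

text \<open>With \<open>T\<close> injective the root is a power of one coordinate. In the
  exceptional case coordinates 0 and 1 share a class, but \<open>n = 1\<close>, so
  \<open>bad\<close> makes \<open>p\<close> divide one of them; if the other is a unit it survives
  alone modulo \<open>p\<close>.\<close>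

lemma root_unit:
 fixes a :: "nat => 'a :: idom"
 assumes p: "prime_elem p" and c: "c \<le> Suc N" "~ p dvd a c" and bad: "\<exists>j\<le>n. p dvd a j"
 shows "~ p dvd root a (T c)"
 using T_sep
proof
 assume "inj_on T {..Suc N}"
 hence "{c'. c' \<le> Suc N & T c' = T c} = {c}" using c by (auto dest: inj_onD)
 thus ?thesis using p c by (auto simp: root_def prime_elem_dvd_power)
next
 assume N1: "N = 1 & T 0 = T 1 & T 2 ~= T 0"
 hence n: "n = 1" using n_pos n_le by auto
 define m where "m = (d - card (T c)) div 2"
 have m: "m > 0" using T_card[OF c(1)] by (auto simp: m_def)
 have pm: "p dvd a i ^ m \<longleftrightarrow> p dvd a i" for i
  using prime_elem_dvd_power[OF p, of "a i" m] m dvd_trans[OF _ dvd_power[of m "a i"]] by blast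
 have cs: "i \<le> Suc N \<longleftrightarrow> i = 0 \<or> i = 1 \<or> i = 2" for i using conjunct1[OF N1] by presburger
 hence "c = 0 \<or> c = 1 \<or> c = 2" using c by blast
 thus ?thesis
 proof (elim disjE)
  assume "c = 2"
  hence "{c'. c' \<le> Suc N & T c' = T c} = {c}" unfolding cs using N1 `c = 2` by blast
  thus ?thesis using pm c by (simp add: root_def flip: m_def)
 next
  assume "c = 0"
  hence e: "{c'. c' \<le> Suc N & T c' = T c} = {0,1}" unfolding cs using N1 by blast
  have "p dvd a 1" using bad n c `c = 0` by (auto simp: le_Suc_eq)
  hence "p dvd a 0 ^ m + a 1 ^ m \<longleftrightarrow> p dvd a 0 ^ m" using pm by (simp add: dvd_add_left_iff)
  moreover have "root a (T c) = a 0 ^ m + a 1 ^ m" unfolding root_def e m_def by simp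
  ultimately show ?thesis using pm[of 0] c(2) unfolding `c = 0` by simp
 next
  assume "c = 1"
  hence e: "{c'. c' \<le> Suc N & T c' = T c} = {0,1}" unfolding cs using N1 by blast
  have "p dvd a 0" using bad n c `c = 1` by (auto simp: le_Suc_eq)
  hence "p dvd a 0 ^ m + a 1 ^ m \<longleftrightarrow> p dvd a 1 ^ m" using pm by (simp add: dvd_add_right_iff)
  moreover have "root a (T c) = a 0 ^ m + a 1 ^ m" unfolding root_def e m_def by simp
  ultimately show ?thesis using pm[of 1] c(2) unfolding `c = 1` by simp
 qed
qed

text \<open>Since \<open>d - 1 - n \<ge> 1\<close>, the order of \<open>zpart\<close> at
  \<open>p\<close> is at least the sum of all \<open>xi j\<close>, while the class of a unit
  coordinate \<open>c\<close> has exactly the sum over \<open>T c\<close>. If \<open>p\<close>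
  divides z the former gains one more. If not, \<open>T_special\<close> supplies a smaller class:
  that of z, with set \<open>{}\<close> or \<open>{0}\<close>, or that of coordinate 1 with set
  \<open>{1}\<close> when d is odd and \<open>xi 1 = 0\<close>.\<close>

lemma class_beats_zpart:
 fixes a b :: "nat => 'a :: idom"
 assumes p: "prime_elem p"
  and a: "!!j. j \<le> n ==> a j = p ^ xi j * b j" "!!j. j \<le> n ==> ~ p dvd b j"
  and c: "c \<le> Suc N" "~ p dvd a c" and bad: "\<exists>j\<le>n. p dvd a j"
 shows "\<exists>S\<in>T ` {..Suc N}. \<exists>mu. ~ p ^ Suc mu dvd (\<Prod>j\<in>S. a j) * (root a S)\<^sup>2 & p ^ Suc mu dvd zpart a"
proof -
 have p0: "p ~= 0" using p by auto
 have xi: "p dvd a j \<longleftrightarrow> xi j > 0" if "j \<le> n" for j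
  using a[OF that] by (cases "xi j") auto
 have key: "~ p ^ Suc (\<Sum>j\<in>T c. xi j) dvd (\<Prod>j\<in>T c. a j) * (root a (T c))\<^sup>2"
  if c: "c \<le> Suc N" "~ p dvd a c" for c
 proof
  assume dvd: "p ^ Suc (\<Sum>j\<in>T c. xi j) dvd (\<Prod>j\<in>T c. a j) * (root a (T c))\<^sup>2"
  have "(\<Prod>j\<in>T c. a j) = (\<Prod>j\<in>T c. p ^ xi j * b j)"
  using T_sub[OF c(1)] a by (intro prod.cong) auto
  also have "\<dots> = p ^ (\<Sum>j\<in>T c. xi j) * (\<Prod>j\<in>T c. b j)" by (simp add: prod.distrib power_sum)
  finally have "p dvd (\<Prod>j\<in>T c. b j) * (root a (T c))\<^sup>2" using dvd p0 by (simp add: mult.assoc)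
  hence "p dvd (\<Prod>j\<in>T c. b j) \<or> p dvd root a (T c)"
  using p by (auto simp: prime_elem_dvd_mult_iff dest: prime_elem_dvd_power)
  thus False using root_unit[OF p c bad] prime_elem_not_dvd_prod[OF p, of "T c" b] T_sub[OF c(1)] a(2) by auto
 qed
 have Zdvd: "p ^ (\<Sum>j\<le>n. xi j) dvd a 0 ^ (d - 1 - n) * (\<Prod>j=1..n. a j)"
 proof -
  have "(\<Sum>j\<le>n. xi j) = xi 0 + (\<Sum>j=1..n. xi j)" by (simp add: sum.atMost_shift sum.atLeast1_atMost_eq)
  moreover have "p ^ xi 0 dvd a 0 ^ (d - 1 - n)"
  proof -
  obtain i where "d - 1 - n = Suc i" using n_d by (cases "d - 1 - n") auto
  thus ?thesis using a(1)[of 0] by simp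
  qed
  moreover have "p ^ (\<Sum>j=1..n. xi j) dvd (\<Prod>j=1..n. a j)"
  unfolding power_sum by (rule prod_dvd_prod) (auto simp: a(1))
  ultimately show ?thesis by (simp add: power_add mult_dvd_mono)
 qed
 have sub_le: "(\<Sum>j\<in>T c. xi j) \<le> (\<Sum>j\<le>n. xi j)" if "c \<le> Suc N" for c
  using T_sub[OF that] by (intro sum_mono2) auto
 obtain j0 where j0: "j0 \<le> n" "xi j0 > 0" using bad xi by auto
 have j0_le: "xi j0 \<le> (\<Sum>j\<le>n. xi j)" using j0 by (intro member_le_sum) auto
 have main: "\<exists>c\<le>Suc N. ~ p dvd a c & p ^ Suc (\<Sum>j\<in>T c. xi j) dvd zpart a"
 proof (cases "p dvd a (Suc n)")
  case True
  have "p * p ^ (\<Sum>j\<le>n. xi j) dvd zpart a"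
  unfolding zpart_def mult.assoc by (rule mult_dvd_mono[OF True Zdvd])
  moreover have "p ^ Suc (\<Sum>j\<in>T c. xi j) dvd p * p ^ (\<Sum>j\<le>n. xi j)"
  using sub_le[OF c(1)] by (simp add: le_imp_power_dvd)
  ultimately show ?thesis using c dvd_trans by blast
 next
  case False
  have Zd: "p ^ (\<Sum>j\<le>n. xi j) dvd zpart a"
  unfolding zpart_def mult.assoc by (rule dvd_mult[OF Zdvd])
  have use: "\<exists>c\<le>Suc N. ~ p dvd a c & p ^ Suc (\<Sum>j\<in>T c. xi j) dvd zpart a"
  if "c \<le> Suc N" "~ p dvd a c" "(\<Sum>j\<in>T c. xi j) < (\<Sum>j\<le>n. xi j)" for c
  proof -
  have "p ^ Suc (\<Sum>j\<in>T c. xi j) dvd p ^ (\<Sum>j\<le>n. xi j)" using that by (intro le_imp_power_dvd) auto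
  thus ?thesis using Zd that dvd_trans by blast
  qed
  from T_special show ?thesis
  proof
  assume "even d & T (Suc n) = {} & T 0 = {0, 1}"
  thus ?thesis using j0_le j0 n_le False by (intro use[of "Suc n"]) auto
  next
  assume odd: "odd d & T (Suc n) = {0} & T 1 = {1}"
  show ?thesis
  proof (cases "xi 1 = 0")
  case True
  show ?thesis
  by (rule use[of 1]) (use True odd j0_le j0 xi[of 1] n_pos n_le in auto)
  next
  case nz: False
  have "(\<Sum>j\<in>{0,1}. xi j) \<le> (\<Sum>j\<le>n. xi j)" using n_pos by (intro sum_mono2) auto
  thus ?thesis
  by (intro use[of "Suc n"]) (use nz odd n_le False in auto)
  qed
  qed
 qed
 then obtain c' where "c' \<le> Suc N" "~ p dvd a c'" "p ^ Suc (\<Sum>j\<in>T c'. xi j) dvd zpart a" by blast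
 with key[of c'] show ?thesis by blast
qed

end

section \<open>The invariant is constant along rational curves\<close>

lemma derivation_map_poly:
 assumes D: "derivation (D :: 'a :: comm_ring_1 => 'a)"
 shows "derivation (map_poly D)"
proof -
 have "map_poly D (p * q) = map_poly D p * q + p * map_poly D q" for p q
  by (rule poly_eqI)
  (simp add: coeff_map_poly D coeff_mult derivation_sum derivation_mult sum.distrib)
 moreover have "map_poly D (p + q) = map_poly D p + map_poly D q" for p q
  by (rule poly_eqI) (simp add: coeff_map_poly D derivation_add)
 ultimately show ?thesis by (simp add: derivation_def)
qed

text \<open>This is X^k p(1/X). The bound \<open>k\<close> is prescribed instead of being the
  degree, so that all coordinates of a curve are reversed alike and infinity is moved to 0.\<close>

definition rev_poly :: "nat => 'a :: comm_ring_1 poly => 'a poly" where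
 "rev_poly k p = (\<Sum>i\<le>k. monom (coeff p (k - i)) i)"

lemma coeff_rev_poly: "coeff (rev_poly k p) i = (if i \<le> k then coeff p (k - i) else 0)"
 by (simp add: rev_poly_def coeff_sum if_distrib cong: if_cong)

lemma rev_poly_add: "rev_poly k (p + q) = rev_poly k p + rev_poly k q"
 by (rule poly_eqI) (simp add: coeff_rev_poly)

lemma rev_poly_0 [simp]: "rev_poly k 0 = 0"
 by (rule poly_eqI) (simp add: coeff_rev_poly)

lemma rev_poly_sum: "rev_poly k (sum f A) = (\<Sum>i\<in>A. rev_poly k (f i))"
 by (induction A rule: infinite_finite_induct) (auto simp: rev_poly_add)

lemma rev_poly_smult: "rev_poly k (smult c p) = smult c (rev_poly k p)"
 by (rule poly_eqI) (simp add: coeff_rev_poly)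

lemma rev_poly_monom: "i \<le> k ==> rev_poly k (monom c i) = monom c (k - i)"
 by (rule poly_eqI) (auto simp: coeff_rev_poly)

lemma rev_poly_mult:
 assumes "degree p \<le> k" "degree q \<le> l"
 shows "rev_poly (k + l) (p * q) = rev_poly k p * rev_poly l q"
proof -
 have *: "rev_poly (k + l) (monom c i * monom e j) = rev_poly k (monom c i) * rev_poly l (monom e j)"
  if "i \<le> k" "j \<le> l" for c e :: 'a and i j
  using that by (simp add: mult_monom rev_poly_monom)
 have p: "p = (\<Sum>i\<le>k. monom (coeff p i) i)" and q: "q = (\<Sum>i\<le>l. monom (coeff q i) i)"
  using assms poly_as_sum_of_monoms' by metis+
 have "rev_poly (k + l) (p * q) = rev_poly (k + l) (\<Sum>i\<le>k. \<Sum>j\<le>l. monom (coeff p i) i * monom (coeff q j) j)"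
  by (subst p, subst q) (simp only: sum_product)
 also have "\<dots> = (\<Sum>i\<le>k. \<Sum>j\<le>l. rev_poly k (monom (coeff p i) i) * rev_poly l (monom (coeff q j) j))"
  by (simp add: rev_poly_sum *)
 also have "\<dots> = rev_poly k (\<Sum>i\<le>k. monom (coeff p i) i) * rev_poly l (\<Sum>i\<le>l. monom (coeff q i) i)"
  by (simp add: rev_poly_sum sum_product)
 finally show ?thesis using p q by simp
qed

lemma rev_poly_1 [simp]: "rev_poly 0 1 = 1"
 by (rule poly_eqI) (auto simp: coeff_rev_poly)

lemma rev_poly_prod:
 assumes "!!i. i \<in> A ==> degree (f i) \<le> k i"
 shows "degree (prod f A) \<le> sum k A & rev_poly (sum k A) (prod f A) = (\<Prod>i\<in>A. rev_poly (k i) (f i))"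
 using assms
proof (induction A rule: infinite_finite_induct)
 case (insert x A)
 hence IH: "degree (prod f A) \<le> sum k A" "rev_poly (sum k A) (prod f A) = (\<Prod>i\<in>A. rev_poly (k i) (f i))"
  by auto
 have "degree (f x * prod f A) \<le> k x + sum k A"
  using degree_mult_le[of "f x" "prod f A"] IH(1) insert.prems[of x] by auto
 thus ?case using insert IH by (simp add: rev_poly_mult)
qed auto

lemma rev_poly_power:
 assumes "degree p \<le> k"
 shows "degree (p ^ e) \<le> e * k & rev_poly (e * k) (p ^ e) = rev_poly k p ^ e"
 using rev_poly_prod[of "{..<e}" "%_. p" "%_. k"] assms by simp

lemma rev_poly_det:
 assumes "!!i j. i < m ==> j < m ==> degree (M i j) \<le> k"
 shows "rev_poly (m * k) (det (mat m m (%(i,j). M i j))) = det (mat m m (%(i,j). rev_poly k (M i j)))"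
  and "degree (det (mat m m (%(i,j). M i j))) \<le> m * k"
proof -
 have *: "degree (\<Prod>i=0..<m. M i (p i)) \<le> m * k &
  rev_poly (m * k) (\<Prod>i=0..<m. M i (p i)) = (\<Prod>i=0..<m. rev_poly k (M i (p i)))" if "p permutes {0..<m}" for p
 proof -
  have "p i < m" if "i < m" for i using permutes_in_image[OF `p permutes _`, of i] that by auto
  thus ?thesis using rev_poly_prod[of "{0..<m}" "%i. M i (p i)" "%_. k"] assms by simp
 qed
 have D: "det (mat m m (%(i,j). M' i j)) = (\<Sum>p | p permutes {0..<m}. smult (of_int (sign p)) (\<Prod>i=0..<m. M' i (p i)))"
  for M' :: "nat => nat => 'a poly"
 proof (subst det_def'[of _ m], simp, rule sum.cong[OF refl])
  fix p assume "p \<in> {p. p permutes {0..<m}}"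
  hence "p i < m" if "i < m" for i using permutes_in_image[of p "{0..<m}" i] that by auto
  hence "(\<Prod>i=0..<m. mat m m (%(i,j). M' i j) $$ (i, p i)) = (\<Prod>i=0..<m. M' i (p i))"
  by (intro prod.cong) auto
  moreover have "(of_int (sign p) :: 'a poly) * q = smult (of_int (sign p)) q" for q
  by (simp add: of_int_poly)
  ultimately show "signof p * (\<Prod>i=0..<m. mat m m (%(i,j). M' i j) $$ (i, p i)) =
  smult (of_int (sign p)) (\<Prod>i=0..<m. M' i (p i))" by simp
 qed
 show "rev_poly (m * k) (det (mat m m (%(i,j). M i j))) = det (mat m m (%(i,j). rev_poly k (M i j)))"
  unfolding D rev_poly_sum rev_poly_smult using * by (intro sum.cong) auto
 show "degree (det (mat m m (%(i,j). M i j))) \<le> m * k"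
  unfolding D by (intro degree_sum_le) (auto simp: * finite_permutations intro: order_trans[OF degree_smult_le])
qed

context shape
begin

lemma form_scale: "form (%c. r * a c) = r ^ d * form a"
proof -
 have "zpart (%c. r * a c) = r ^ (1 + (d - 1 - n) + n) * zpart a"
  by (simp add: zpart_def prod.distrib power_mult_distrib power_add mult_ac)
 moreover have "1 + (d - 1 - n) + n = d" using n_d by simp
 moreover have "(\<Prod>j\<in>T c. r * a j) * (r * a c) ^ (d - card (T c)) =
  r ^ d * ((\<Prod>j\<in>T c. a j) * a c ^ (d - card (T c)))" if "c \<le> Suc N" for c
 proof -
  have "d = card (T c) + (d - card (T c))" using T_card[OF that] by simp
  hence "r ^ d = r ^ card (T c) * r ^ (d - card (T c))" by (metis power_add)
  thus ?thesis by (simp add: prod.distrib power_mult_distrib mult_ac)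
 qed
 ultimately show ?thesis by (simp add: form_def distrib_left sum_distrib_left)
qed

lemma rev_poly_form:
 assumes "!!c. c \<le> Suc N ==> degree (P c) \<le> k"
 shows "rev_poly (d * k) (form P) = form (%c. rev_poly k (P c))"
proof -
 have P: "degree (P c) \<le> k" if "c \<le> Suc N" for c using assms that by auto
 have prods: "degree (\<Prod>j\<in>A. P j) \<le> card A * k &
  rev_poly (card A * k) (\<Prod>j\<in>A. P j) = (\<Prod>j\<in>A. rev_poly k (P j))" if "A \<subseteq> {..n}" for A
 proof -
  have "degree (P i) \<le> k" if "i \<in> A" for i
  using that `A \<subseteq> {..n}` n_le by (intro P) auto
  thus ?thesis using rev_poly_prod[of A P "%_. k"] by simp
 qed
 note pw = rev_poly_power[OF P]
 have mult3: "degree (p * q) \<le> k1 + k2 & rev_poly (k1 + k2) (p * q) = rev_poly k1 p * rev_poly k2 q"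
  if "degree p \<le> k1" "degree q \<le> k2" for p q :: "'a poly" and k1 k2
  using that rev_poly_mult[OF that] degree_mult_le[of p q] by auto
 have z: "rev_poly (d * k) (zpart P) = zpart (%c. rev_poly k (P c))"
 proof -
  have e: "d * k = (k + (d - 1 - n) * k) + card {1..n} * k"
  proof -
  have "d = 1 + (d - 1 - n) + n" using n_d by simp
  thus ?thesis by (metis add_mult_distrib card_atLeastAtMost diff_Suc_1 mult_1)
  qed
  show ?thesis unfolding zpart_def e
  using mult3[OF P[of "Suc n"] conjunct1[OF pw[of 0 "d - 1 - n"]]] pw[of 0] prods[of "{1..n}"] n_le
  mult3[of "P (Suc n) * P 0 ^ (d - 1 - n)" "k + (d - 1 - n) * k" "\<Prod>j=1..n. P j" "card {1..n} * k"]
  by auto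
 qed
 have c: "rev_poly (d * k) ((\<Prod>j\<in>T c. P j) * P c ^ (d - card (T c))) =
  (\<Prod>j\<in>T c. rev_poly k (P j)) * rev_poly k (P c) ^ (d - card (T c))" if "c \<le> Suc N" for c
 proof -
  have e: "d * k = card (T c) * k + (d - card (T c)) * k"
  using T_card[OF that] by (simp flip: add_mult_distrib)
  show ?thesis unfolding e
  using mult3[of "\<Prod>j\<in>T c. P j" "card (T c) * k" "P c ^ (d - card (T c))" "(d - card (T c)) * k"]
  prods[OF T_sub[OF that]] pw[OF that, of "d - card (T c)"] by simp
 qed
 show ?thesis by (simp add: form_def rev_poly_add rev_poly_sum z c)
qed

end

text \<open>The sort \<open>field_gcd\<close> provides gcds and multiplicities for polynomials over
  \<open>'e\<close>. The entry \<open>D 0\<close> is the identity, not a derivation: it is the row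
  that makes the determinant projective.\<close>

locale shape_deriv = shape +
 fixes D :: "nat => 'e :: field_gcd => 'e"
 assumes char2: "(2 :: 'e) = 0"
  and D0: "D 0 = (%a. a)" and D: "1 \<le> i ==> i \<le> n ==> derivation (D i)"
begin

text \<open>The value 0 at a vanishing coordinate is the one forced by constancy along curves: there
  the determinant vanishes to higher order than the product of the coordinates.\<close>

definition winv :: "(nat => 'e) => 'e" where
 "winv a = (if \<exists>j\<le>n. a j = 0 then 0
  else det (sqmat n (%(i,j). D i (a j))) / (\<Prod>j\<le>n. a j))"

text \<open>The Leibniz term \<open>D i r * a j\<close> is a multiple of row 0, because
  \<open>D 0\<close> is the identity.\<close>

lemma winv_scale:
 assumes "r ~= 0"
 shows "winv (%c. r * a c) = winv a"
proof (cases "\<exists>j\<le>n. a j = 0")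
 case False
 define w where "w = (%i. if i = 0 then 0 else D i r / r)"
 have "sqmat n (%(i,j). D i (r * a j)) = sqmat n (%(i,j). r * D i (a j) + w i * (r * D 0 (a j)))"
  using assms D by (intro eq_matI) (auto simp: D0 w_def derivation_mult)
 also have "det \<dots> = det (sqmat n (%(i,j). r * D i (a j)))"
  by (rule det_combine_row) (auto simp: w_def)
 also have "\<dots> = r ^ Suc n * det (sqmat n (%(i,j). D i (a j)))"
  by (simp only: det_scale_columns prod_constant card_lessThan)
 finally show ?thesis using assms by (auto simp: winv_def prod.distrib)
qed (use assms in "auto simp: winv_def")

text \<open>The curve parameter is a constant for these derivations, so the prime \<open>X\<close>
  divides its own derivatives and the stronger conclusion of \<open>det_derivations_at_prime\<close>
  holds at both ends of a curve.\<close>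

definition polyD :: "nat => 'e poly => 'e poly" where
 "polyD i = map_poly (D i)"

lemma polyD_0: "polyD 0 = (%p. p)"
 by (simp add: polyD_def D0 fun_eq_iff map_poly_idI)

lemma polyD: "1 \<le> i ==> i \<le> n ==> derivation (polyD i)"
 unfolding polyD_def by (rule derivation_map_poly[OF D])

lemma D_0 [simp]: "i \<le> n ==> D i 0 = 0"
 using D[of i] D0 by (cases "i = 0") auto

lemma coeff_polyD: "i \<le> n ==> coeff (polyD i p) k = D i (coeff p k)"
 by (simp add: polyD_def coeff_map_poly)

abbreviation wedge :: "(nat => 'e poly) => 'e poly" where
 "wedge P \<equiv> det (sqmat n (%(i,j). polyD i (P j)))"

lemma char2_poly: "(2 :: 'e poly) = 0"
 using char2 by (metis numeral_poly pCons_0_0)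

text \<open>By \<open>class_beats_zpart\<close> some class has smaller order at \<open>p\<close>
  than \<open>zpart\<close>. In the equation of the curve, the leading parts of the classes of
  minimal order must therefore cancel modulo \<open>p\<close>; this is the relation that
  \<open>det_derivations_at_prime\<close> asks for.\<close>

lemma curve_at_prime:
 assumes p: "prime_elem p" and form: "form P = 0" and nz: "!!j. j \<le> n ==> P j ~= 0"
  and c: "c \<le> Suc N" "~ p dvd P c"
 shows "p ^ multiplicity p (\<Prod>j\<le>n. P j) dvd wedge P"
  and "p dvd (\<Prod>j\<le>n. P j) ==> (!!i. 1 \<le> i ==> i \<le> n ==> p dvd polyD i p) ==>
  p ^ Suc (multiplicity p (\<Prod>j\<le>n. P j)) dvd wedge P"
proof -
 have nu: "~ is_unit p" and p0: "p ~= 0" using p by auto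
 define xi where "xi = (%j. multiplicity p (P j))"
 have "\<exists>b. P j = p ^ xi j * b & ~ p dvd b" if "j \<le> n" for j
  using multiplicity_decompose'[OF nz[OF that] nu] unfolding xi_def by (metis mult.commute)
 then obtain b where b: "!!j. j \<le> n ==> P j = p ^ xi j * b j" "!!j. j \<le> n ==> ~ p dvd b j" by metis
 have m: "multiplicity p (\<Prod>j\<le>n. P j) = (\<Sum>j\<le>n. xi j)"
  unfolding xi_def using nz p by (intro prime_elem_multiplicity_prod_distrib) auto
 show "p ^ multiplicity p (\<Prod>j\<le>n. P j) dvd wedge P"
  and "p dvd (\<Prod>j\<le>n. P j) ==> (!!i. 1 \<le> i ==> i \<le> n ==> p dvd polyD i p) ==>
  p ^ Suc (multiplicity p (\<Prod>j\<le>n. P j)) dvd wedge P"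
 proof -
  have ex: "\<exists>SS q e. finite SS & SS ~= {} & SS \<subseteq> T ` {..Suc N} & (\<forall>S\<in>SS. ~ p dvd (q S)\<^sup>2 * (\<Prod>j\<in>S. b j)) &
  p dvd (\<Sum>S\<in>SS. (q S)\<^sup>2 * (\<Prod>j\<in>S. b j)) & (\<forall>S\<in>SS. even (\<Sum>j\<in>S. xi j) = even (e::nat))"
  if bad: "\<exists>j\<le>n. p dvd P j"
  proof -
  define C where "C = (%S. (\<Prod>j\<in>S. P j) * (root P S)\<^sup>2)"
  let ?Q = "%mu. \<exists>S\<in>T ` {..Suc N}. ~ p ^ Suc mu dvd C S"
  obtain mu0 where mu0: "?Q mu0" "p ^ Suc mu0 dvd zpart P"
  using class_beats_zpart[OF p b c bad] unfolding C_def by blast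
  \<comment> \<open>\<open>mu\<close> is the minimal order of a class at \<open>p\<close>, and
    \<open>SS\<close> below collects the classes that attain it.\<close>
  define mu where "mu = (LEAST mu. ?Q mu)"
  have mu: "?Q mu" and le: "mu \<le> mu0" unfolding mu_def using mu0(1) by (rule LeastI, intro Least_le)
  have zd: "p ^ Suc mu dvd zpart P" using mu0(2) le by (meson Suc_le_mono le_imp_power_dvd dvd_trans)
  have div: "p ^ mu dvd C S" if "S \<in> T ` {..Suc N}" for S
  proof (cases mu)
  case (Suc k)
  hence "~ ?Q k" using not_less_Least[of k ?Q] unfolding mu_def by auto
  thus ?thesis using that Suc by auto
  qed auto
  define SS where "SS = {S \<in> T ` {..Suc N}. ~ p ^ Suc mu dvd C S}"
  have fin: "finite SS" "SS ~= {}" "SS \<subseteq> T ` {..Suc N}" using mu by (auto simp: SS_def)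
  define ka where "ka = (%S. multiplicity p (root P S))"
  have r0: "root P S ~= 0" if "S \<in> SS" for S using that by (auto simp: SS_def C_def)
  have "\<exists>q. root P S = p ^ ka S * q & ~ p dvd q" if "S \<in> SS" for S
  using multiplicity_decompose'[OF r0[OF that] nu] unfolding ka_def by (metis mult.commute)
  then obtain q where q: "!!S. S \<in> SS ==> root P S = p ^ ka S * q S" "!!S. S \<in> SS ==> ~ p dvd q S" by metis
  have Sn: "S \<subseteq> {..n}" if "S \<in> SS" for S using T_sub that fin(3) by blast
  have unit: "~ p dvd (q S)\<^sup>2 * (\<Prod>j\<in>S. b j)" if "S \<in> SS" for S
  using p q(2)[OF that] prime_elem_not_dvd_prod[OF p, of S b] Sn[OF that] b(2)
  by (auto simp: prime_elem_dvd_mult_iff dest: prime_elem_dvd_power)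
  have C: "C S = p ^ ((\<Sum>j\<in>S. xi j) + 2 * ka S) * ((q S)\<^sup>2 * (\<Prod>j\<in>S. b j))" if "S \<in> SS" for S
  proof -
  have "(\<Prod>j\<in>S. P j) = (\<Prod>j\<in>S. p ^ xi j * b j)" using Sn[OF that] b by (intro prod.cong) auto
  also have "\<dots> = p ^ (\<Sum>j\<in>S. xi j) * (\<Prod>j\<in>S. b j)" by (simp add: prod.distrib power_sum)
  finally show ?thesis unfolding C_def q(1)[OF that]
  by (simp add: power_mult_distrib power_add mult_ac flip: power_mult)
  qed
  have val: "(\<Sum>j\<in>S. xi j) + 2 * ka S = mu" if S: "S \<in> SS" for S
  proof (rule antisym)
  have "~ p ^ Suc mu dvd C S" using S by (auto simp: SS_def)
  thus "(\<Sum>j\<in>S. xi j) + 2 * ka S \<le> mu" unfolding C[OF S]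
  by (meson dvd_mult2 le_imp_power_dvd not_less_eq_eq)
  have "p ^ mu dvd C S" using div S by (auto simp: SS_def)
  hence "p ^ mu dvd p ^ ((\<Sum>j\<in>S. xi j) + 2 * ka S)" unfolding C[OF S]
  using prime_elem_power_dvd_cancel[OF p unit[OF S]] by blast
  thus "mu \<le> (\<Sum>j\<in>S. xi j) + 2 * ka S" using p0 nu by (metis dvd_power_iff)
  qed
  have "p ^ Suc mu dvd (\<Sum>S\<in>T ` {..Suc N}. C S)"
  using zd form unfolding form_eq_classes[OF char2_poly] C_def by (simp add: dvd_add_right_iff flip: add_eq_0_iff)
  (metis add_eq_0_iff dvd_minus_iff)
  moreover have "(\<Sum>S\<in>T ` {..Suc N}. C S) = (\<Sum>S\<in>SS. C S) + (\<Sum>S\<in>T ` {..Suc N} - SS. C S)"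
  using fin(3) by (metis add.commute finite_atMost finite_imageI sum.subset_diff)
  moreover have "p ^ Suc mu dvd (\<Sum>S\<in>T ` {..Suc N} - SS. C S)"
  by (rule dvd_sum) (auto simp: SS_def)
  ultimately have "p ^ Suc mu dvd (\<Sum>S\<in>SS. C S)" by (metis dvd_add_left_iff)
  moreover have "(\<Sum>S\<in>SS. C S) = p ^ mu * (\<Sum>S\<in>SS. (q S)\<^sup>2 * (\<Prod>j\<in>S. b j))"
  unfolding sum_distrib_left by (rule sum.cong) (auto simp: C val)
  ultimately have rel: "p dvd (\<Sum>S\<in>SS. (q S)\<^sup>2 * (\<Prod>j\<in>S. b j))" using p0 by (simp add: mult.commute[of p])
  \<comment> \<open>The squared root contributes the even number \<open>2 * ka S\<close> to the
    common order \<open>mu\<close>.\<close>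
  have par: "even (\<Sum>j\<in>S. xi j) = even mu" if "S \<in> SS" for S
  using val[OF that] by (metis even_add even_mult_iff even_numeral)
  show ?thesis using fin unit rel par by blast
  qed
  have det: "p ^ (\<Sum>j\<le>n. xi j) dvd wedge P"
  "(!!i. 1 \<le> i ==> i \<le> n ==> p dvd polyD i p) ==> p ^ Suc (\<Sum>j\<le>n. xi j) dvd wedge P"
  if bad: "\<exists>j\<le>n. p dvd P j"
  proof -
  from ex[OF bad] obtain SS q and e :: nat where S: "finite SS" "SS ~= {}" "SS \<subseteq> T ` {..Suc N}"
  "!!S. S \<in> SS ==> ~ p dvd (q S)\<^sup>2 * (\<Prod>j\<in>S. b j)" "p dvd (\<Sum>S\<in>SS. (q S)\<^sup>2 * (\<Prod>j\<in>S. b j))"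
  "!!S. S \<in> SS ==> even (\<Sum>j\<in>S. xi j) = even e" by blast
  have sub: "S \<subseteq> {..n}" "even (card S) = even d" if "S \<in> SS" for S
  using S(3) that T_sub T_par by auto
  note dd = det_derivations_at_prime[where x = P and xi = xi and b = b and D = polyD and n = n and q = q and TT = SS and e = e and d = d, OF char2_poly p b(1) polyD_0 polyD S(1,2) sub(1) S(4,5) sub(2) S(6)]
  show "p ^ (\<Sum>j\<le>n. xi j) dvd wedge P" by (rule dd(1)) auto
  show "(!!i. 1 \<le> i ==> i \<le> n ==> p dvd polyD i p) ==> p ^ Suc (\<Sum>j\<le>n. xi j) dvd wedge P"
  by (rule dd(2)) auto
  qed
  show "p ^ multiplicity p (\<Prod>j\<le>n. P j) dvd wedge P"
  proof (cases "\<exists>j\<le>n. p dvd P j")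
  case False
  hence "xi j = 0" if "j \<le> n" for j using that by (auto simp: xi_def not_dvd_imp_multiplicity_0)
  thus ?thesis by (simp add: m)
  qed (use det(1) m in auto)
  show "p ^ Suc (multiplicity p (\<Prod>j\<le>n. P j)) dvd wedge P"
  if "p dvd (\<Prod>j\<le>n. P j)" "!!i. 1 \<le> i ==> i \<le> n ==> p dvd polyD i p"
  proof -
  have "\<exists>j\<le>n. p dvd P j" using prime_elem_not_dvd_prod[OF p, of "{..n}" P] that(1) by auto
  thus ?thesis using det(2) that(2) m by simp
  qed
 qed
qed

end

lemma poly_0_det:
 fixes M :: "nat => nat => 'a :: comm_ring_1 poly"
 shows "poly (det (mat m m (%(i,j). M i j))) 0 = det (mat m m (%(i,j). poly (M i j) 0))"
proof -
 interpret comm_ring_hom "%p :: 'a poly. poly p 0" by unfold_locales auto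
 have "map_mat (%p. poly p 0) (mat m m (%(i,j). M i j)) = mat m m (%(i,j). poly (M i j) 0)"
  by (rule eq_matI) auto
 thus ?thesis by (metis hom_det)
qed

lemma prime_elem_X: "prime_elem [:0, 1 :: 'a :: field_gcd:]"
 by (simp add: prime_elem_linear_field_poly)

lemma pow_X_dvd_iff:
 "[:0, 1 :: 'a :: field:] ^ k dvd p \<longleftrightarrow> (\<forall>i<k. coeff p i = 0)"
 using monom_1_dvd_iff'[of k p] by (simp add: monom_altdef)

lemma coeff_mult_degree_bounds:
 fixes p q :: "'a :: comm_ring_1 poly"
 assumes "degree p \<le> k" "degree q \<le> l"
 shows "coeff (p * q) (k + l) = coeff p k * coeff q l"
proof -
 have "coeff (p * q) (k + l) = coeff (rev_poly (k + l) (p * q)) 0"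
  by (simp add: coeff_rev_poly)
 also have "\<dots> = coeff p k * coeff q l"
  using assms by (simp add: rev_poly_mult coeff_mult_0 coeff_rev_poly)
 finally show ?thesis .
qed

lemma (in shape) form_cong:
 assumes "!!c. c \<le> Suc N ==> a c = a' c"
 shows "form a = form a'"
proof -
 have "j \<in> T c ==> c \<le> Suc N ==> a j = a' j" for j c
  using T_sub[of c] n_le by (intro assms) auto
 thus ?thesis using assms n_le by (auto simp: form_def zpart_def intro!: arg_cong2[of _ _ _ _ "(+)"]
  arg_cong2[of _ _ _ _ "(*)"] sum.cong prod.cong)
qed

context shape_deriv
begin

lemma winv_cong:
 assumes "!!c. c \<le> n ==> a c = a' c"
 shows "winv a = winv a'"
proof -
 have "sqmat n (%(i,j). D i (a j)) = sqmat n (%(i,j). D i (a' j))"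
  by (rule eq_matI) (use assms in auto)
 thus ?thesis using assms by (auto simp: winv_def)
qed

lemma degree_polyD: "i \<le> n ==> degree (polyD i p) \<le> degree p"
 by (rule degree_le) (auto simp: coeff_polyD coeff_eq_0)

lemma wedge_rev_poly:
 assumes "!!j. j \<le> n ==> degree (P j) \<le> m"
 shows "wedge (%j. rev_poly m (P j)) = rev_poly (Suc n * m) (wedge P)"
proof -
 have comm: "polyD i (rev_poly m p) = rev_poly m (polyD i p)" if "i \<le> n" for i p
  by (rule poly_eqI) (use that in "auto simp: coeff_polyD coeff_rev_poly")
 have deg: "degree (polyD i (P j)) \<le> m" if "i \<le> n" "j \<le> n" for i j
  using assms[OF that(2)] degree_polyD[OF that(1), of "P j"] by simp
 have "rev_poly (Suc n * m) (wedge P) = det (sqmat n (%(i,j). rev_poly m (polyD i (P j))))"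
  by (rule rev_poly_det(1)) (use deg in auto)
 also have "sqmat n (%(i,j). rev_poly m (polyD i (P j))) = sqmat n (%(i,j). polyD i (rev_poly m (P j)))"
  by (rule eq_matI) (auto simp: comm)
 finally show ?thesis by simp
qed

lemma poly_0_wedge: "poly (wedge P) 0 = det (sqmat n (%(i,j). D i (poly (P j) 0)))"
proof -
 have "sqmat n (%(i,j). poly (polyD i (P j)) 0) = sqmat n (%(i,j). D i (poly (P j) 0))"
  by (rule eq_matI) (auto simp: poly_0_coeff_0 coeff_polyD)
 thus ?thesis by (simp add: poly_0_det del: mat_eq_iff)
qed

text \<open>The product \<open>X\<close> of the coordinates divides the determinant at every prime,
  and the quotient \<open>q\<close> is the invariant along the curve. The same divisibility for the
  reversed curve bounds the order at infinity, so \<open>q\<close> is constant. If a coordinate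
  vanishes at an end, the extra factor there makes \<open>q\<close> vanish too, in agreement with
  the default value of \<open>winv\<close>.\<close>

lemma curve_coprime:
 assumes form: "form P = 0"
  and coprime: "!!p. prime_elem p ==> \<exists>c\<le>Suc N. ~ p dvd P c"
  and deg: "!!c. c \<le> Suc N ==> degree (P c) \<le> m"
  and top: "c0 \<le> Suc N" "coeff (P c0) m ~= 0"
 shows "winv (%c. coeff (P c) 0) = winv (%c. coeff (P c) m)"
proof (cases "\<exists>j\<le>n. P j = 0")
 case True
 then obtain j where "j \<le> n" "P j = 0" by auto
 hence "winv (%c. coeff (P c) 0) = 0" "winv (%c. coeff (P c) m) = 0"
  unfolding winv_def by auto
 thus ?thesis by simp
next
 case False
 hence nz: "P j ~= 0" if "j \<le> n" for j using that by auto
 define X where "X = (\<Prod>j\<le>n. P j)"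
 have X0: "X ~= 0" using nz by (auto simp: X_def)
 have "X dvd wedge P"
 proof (cases "wedge P = 0")
  case wnz: False
  show ?thesis
  proof (rule multiplicity_le_imp_dvd[OF X0])
  fix p :: "'e poly" assume "prime p"
  hence p: "prime_elem p" by auto
  then obtain c where c: "c \<le> Suc N" "~ p dvd P c" using coprime by blast
  from curve_at_prime(1)[OF p form nz c] show "multiplicity p X \<le> multiplicity p (wedge P)"
  using p wnz by (intro multiplicity_geI) (auto simp: X_def)
  qed
 qed auto
 then obtain q where q: "wedge P = X * q" by blast
 let ?u = "[:0, 1 :: 'e:]"
 have Du: "?u dvd polyD i ?u" if "1 \<le> i" "i \<le> n" for i
 proof -
  have "polyD i ?u = 0" by (rule poly_eqI) (use that D[OF that] in "auto simp: coeff_polyD coeff_pCons split: nat.splits")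
  thus ?thesis by simp
 qed
 have u_dvd: "?u dvd r \<longleftrightarrow> coeff r 0 = 0" for r using pow_X_dvd_iff[of 1 r] by simp
 have X_0: "coeff X 0 = (\<Prod>j\<le>n. coeff (P j) 0)" by (simp add: X_def poly_prod flip: poly_0_coeff_0)
 have low: "winv (%c. coeff (P c) 0) = coeff q 0"
 proof (cases "\<exists>j\<le>n. coeff (P j) 0 = 0")
  case True
  hence uX: "?u dvd X" unfolding u_dvd X_0 by auto
  obtain c where c: "c \<le> Suc N" "~ ?u dvd P c" using coprime[OF prime_elem_X] by blast
  have "?u ^ Suc (multiplicity ?u X) dvd X * q"
  using curve_at_prime(2)[OF prime_elem_X form nz c _ Du] uX q by (simp add: X_def)
  moreover obtain Y where Y: "X = ?u ^ multiplicity ?u X * Y" "~ ?u dvd Y"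
  using multiplicity_decompose'[OF X0, of ?u] prime_elem_X prime_elem_not_unit by (metis mult.commute)
  ultimately have "?u * ?u ^ multiplicity ?u X dvd ?u ^ multiplicity ?u X * (Y * q)"
  by (metis mult.assoc power_Suc)
  hence "?u dvd Y * q"
  by (metis dvd_mult_cancel_left mult.commute power_not_zero prime_elem_X prime_elem_not_zeroI)
  hence "?u dvd q" using Y(2) prime_elem_X by (metis prime_elem_dvd_mult_iff)
  thus ?thesis using True by (auto simp: winv_def u_dvd)
 next
  case False
  have "poly (X * q) 0 = det (sqmat n (%(i,j). D i (coeff (P j) 0)))"
  unfolding q[symmetric] poly_0_wedge by (simp add: poly_0_coeff_0)
  hence "coeff X 0 * coeff q 0 = det (sqmat n (%(i,j). D i (coeff (P j) 0)))"
  by (simp add: poly_0_coeff_0 coeff_mult_0)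
  moreover have "coeff X 0 ~= 0" unfolding X_0 using False by auto
  ultimately show ?thesis using False unfolding winv_def X_0[symmetric] by (auto simp: field_simps)
 qed
 \<comment> \<open>The assumption on \<open>c0\<close> says that \<open>X\<close> does not divide
   all reversed coordinates, so the local statement applies to them at \<open>X\<close>.\<close>
 define P' where "P' = (%c. rev_poly m (P c))"
 have form': "form P' = 0" unfolding P'_def using rev_poly_form[OF deg, symmetric] form by simp
 have nz': "P' j ~= 0" if "j \<le> n" for j
 proof
  assume "P' j = 0"
  hence "coeff (P j) i = 0" if "i \<le> m" for i
  using that coeff_rev_poly[of m "P j" "m - i"] by (simp add: P'_def)
  moreover have "degree (P j) \<le> m" using deg that n_le by auto
  ultimately show False using nz[OF that] by (metis leading_coeff_0_iff)
 qed
 have c0': "~ ?u dvd P' c0" using top by (simp add: u_dvd P'_def coeff_rev_poly)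
 have degj: "degree (P j) \<le> m" if "j \<le> n" for j using deg that n_le by auto
 have X': "(\<Prod>j\<le>n. P' j) = rev_poly (Suc n * m) X" and degX: "degree X \<le> Suc n * m"
  using rev_poly_prod[of "{..n}" P "%_. m"] degj by (auto simp: X_def P'_def)
 have X'0: "rev_poly (Suc n * m) X ~= 0" unfolding X'[symmetric] using nz' by auto
 \<comment> \<open>The order at infinity of the product of the coordinates, seen as a homogeneous
   form of degree \<open>Suc n * m\<close>.\<close>
 let ?k = "Suc n * m - degree X"
 have W': "wedge P' = rev_poly (Suc n * m) (wedge P)"
  unfolding P'_def by (rule wedge_rev_poly) (rule degj)
 have mult: "?k \<le> multiplicity ?u (rev_poly (Suc n * m) X)"
 proof (rule multiplicity_geI)
  show "?u ^ ?k dvd rev_poly (Suc n * m) X"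
  unfolding pow_X_dvd_iff by (auto simp: coeff_rev_poly intro!: coeff_eq_0)
 qed (use X'0 prime_elem_X prime_elem_not_unit in auto)
 note at' = curve_at_prime[OF prime_elem_X form' nz' top(1) c0', unfolded X' W']
 have "?u ^ ?k dvd rev_poly (Suc n * m) (wedge P)"
  using at'(1) mult by (meson dvd_trans le_imp_power_dvd)
 moreover have degW: "degree (wedge P) \<le> Suc n * m"
  by (rule rev_poly_det(2)) (auto intro!: order_trans[OF degree_polyD degj])
 ultimately have W: "coeff (wedge P) i = 0" if "i > degree X" for i
 proof (cases "i \<le> Suc n * m")
  case True
  hence "Suc n * m - i < ?k" using that degX by linarith
  hence "coeff (rev_poly (Suc n * m) (wedge P)) (Suc n * m - i) = 0"
  using `?u ^ ?k dvd _` unfolding pow_X_dvd_iff by blast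
  thus ?thesis using True by (simp add: coeff_rev_poly)
 qed (use degW in "auto intro!: coeff_eq_0")
 have "degree q = 0"
 proof (cases "q = 0")
  case False
  have "degree (wedge P) \<le> degree X" using W by (intro degree_le) auto
  thus ?thesis using q False X0 by (simp add: degree_mult_eq)
 qed auto
 then obtain dl where dl: "q = [:dl:]" by (metis degree_eq_zeroE)
 have top_X: "coeff X (Suc n * m) = (\<Prod>j\<le>n. coeff (P j) m)"
 proof -
  have "coeff X (Suc n * m) = poly (\<Prod>j\<le>n. P' j) 0"
  unfolding X' by (simp add: coeff_rev_poly poly_0_coeff_0)
  also have "\<dots> = (\<Prod>j\<le>n. coeff (P j) m)"
  by (subst poly_prod) (simp add: P'_def coeff_rev_poly poly_0_coeff_0)
  finally show ?thesis .
 qed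
 have "winv (%c. coeff (P c) m) = dl"
 proof (cases "\<exists>j\<le>n. coeff (P j) m = 0")
  case True
  hence "coeff X (Suc n * m) = 0" unfolding top_X by auto
  moreover from this have "?u dvd rev_poly (Suc n * m) X" by (simp add: u_dvd coeff_rev_poly)
  hence "?u ^ Suc ?k dvd rev_poly (Suc n * m) (wedge P)"
  using at'(2)[OF _ _ Du] mult by (meson Suc_le_mono dvd_trans le_imp_power_dvd)
  hence "coeff (rev_poly (Suc n * m) (wedge P)) ?k = 0"
  unfolding pow_X_dvd_iff by blast
  hence "coeff (wedge P) (degree X) = 0" using degX by (simp add: coeff_rev_poly)
  hence "dl = 0" unfolding q dl using X0 by simp
  thus ?thesis using True by (auto simp: winv_def)
 next
  case False
  have "coeff (wedge P) (Suc n * m) = poly (wedge P') 0"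
  unfolding W' by (simp add: coeff_rev_poly poly_0_coeff_0)
  also have "\<dots> = det (sqmat n (%(i,j). D i (coeff (P j) m)))"
  unfolding poly_0_wedge by (simp add: P'_def coeff_rev_poly poly_0_coeff_0)
  finally have "coeff X (Suc n * m) * dl = det (sqmat n (%(i,j). D i (coeff (P j) m)))"
  unfolding q dl by (simp add: mult.commute)
  moreover have "coeff X (Suc n * m) ~= 0" unfolding top_X using False by auto
  ultimately show ?thesis using False unfolding winv_def top_X[symmetric] by (auto simp: field_simps)
 qed
 thus ?thesis using low dl by simp
qed

text \<open>Dividing by the gcd of the coordinates makes them coprime. Both end points change only
  by nonzero scalars, the lowest and the leading coefficient of the gcd, which \<open>winv\<close>
  ignores.\<close>

theorem curve:
 assumes form: "form P = 0"
  and low: "b0 \<le> Suc N" "coeff (P b0) 0 ~= 0"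
  and deg: "!!c. c \<le> Suc N ==> degree (P c) \<le> m"
  and top: "c0 \<le> Suc N" "coeff (P c0) m ~= 0"
 shows "winv (%c. coeff (P c) 0) = winv (%c. coeff (P c) m)"
proof -
 define G where "G = Gcd (P ` {..Suc N})"
 have "P b0 ~= 0" using low by auto
 hence G0: "G ~= 0" using low(1) by (auto simp: G_def Gcd_0_iff)
 define P' where "P' = (%c. P c div G)"
 have P': "P c = G * P' c" if "c \<le> Suc N" for c
 proof -
  have "G dvd P c" unfolding G_def using that by (intro Gcd_dvd) auto
  thus ?thesis by (simp add: P'_def)
 qed
 have form': "form P' = 0"
 proof -
  have "form P = form (%c. G * P' c)"
  using P' T_sub n_le by (intro form_cong) auto
  thus ?thesis using form G0 by (simp add: form_scale)
 qed
 have coprime: "\<exists>c\<le>Suc N. ~ p dvd P' c" if p: "prime_elem p" for p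
 proof (rule ccontr)
  assume "~ ?thesis"
  hence "G * p dvd P c" if "c \<le> Suc N" for c using P'[OF that] that by (auto intro: mult_dvd_mono)
  hence "G * p dvd G" unfolding G_def by (intro Gcd_greatest) auto
  hence "is_unit p" using G0 by (metis dvd_mult_cancel_left mult.right_neutral)
  thus False using p by auto
 qed
 define g where "g = degree G"
 have g_le: "g + degree (P' c) \<le> m" if "c \<le> Suc N" "P' c ~= 0" for c
  using deg[OF that(1)] P'[OF that(1)] that(2) G0 by (simp add: g_def degree_mult_eq)
 have P'c0: "P' c0 ~= 0" using top P' by auto
 hence g: "g \<le> m" using g_le[OF top(1)] by auto
 have deg': "degree (P' c) \<le> m - g" if "c \<le> Suc N" for c
  using g_le[OF that] by (cases "P' c = 0") auto
 have coeff_top: "coeff (P c) m = lead_coeff G * coeff (P' c) (m - g)" if "c \<le> Suc N" for c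
 proof -
  have "coeff (G * P' c) (g + (m - g)) = coeff G g * coeff (P' c) (m - g)"
  using deg'[OF that] by (intro coeff_mult_degree_bounds) (auto simp: g_def)
  thus ?thesis using g P'[OF that] by (simp add: g_def)
 qed
 have coeff_low: "coeff (P c) 0 = coeff G 0 * coeff (P' c) 0" if "c \<le> Suc N" for c
  using P'[OF that] by (simp add: coeff_mult_0)
 have G_0: "coeff G 0 ~= 0" using low coeff_low by auto
 have "winv (%c. coeff (P c) 0) = winv (%c. coeff G 0 * coeff (P' c) 0)"
  using coeff_low n_le by (intro winv_cong) auto
 also have "\<dots> = winv (%c. coeff (P' c) 0)" using G_0 by (rule winv_scale)
 also have "\<dots> = winv (%c. coeff (P' c) (m - g))"
  by (rule curve_coprime[OF form' coprime deg' top(1)]) (use top coeff_top in auto)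
 also have "\<dots> = winv (%c. lead_coeff G * coeff (P' c) (m - g))"
  using G0 by (intro winv_scale[symmetric]) auto
 also have "\<dots> = winv (%c. coeff (P c) m)"
  using coeff_top n_le by (intro winv_cong) auto
 finally show ?thesis .
qed

end

section \<open>Specialization of curves over a Laurent series field\<close>

text \<open>The set of monomials is a separate argument because a homomorphism may kill
  coefficients; the sum keeps its shape under \<open>hom_mev\<close>.\<close>

definition mev :: "'v multiset set => ('v multiset => 'r) => ('v => 'r :: comm_ring_1) => 'r" where
 "mev M f a = (\<Sum>m\<in>M. f m * (\<Prod>x\<in>#m. a x))"

lemma hom_mev:
 assumes "comm_ring_hom h"
 shows "h (mev M f a) = mev M (%m. h (f m)) (%x. h (a x))"
proof -
 interpret comm_ring_hom h by fact
 have "h (\<Prod>x\<in>#m. a x) = (\<Prod>x\<in>#m. h (a x))" for m by (induction m) (auto simp: hom_mult)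
 thus ?thesis by (simp add: mev_def hom_sum hom_mult)
qed

lemma mev_scale:
 assumes "!!m. m \<in> M ==> size m = d"
 shows "mev M f (%x. r * a x) = r ^ d * mev M f a"
proof -
 have "(\<Prod>x\<in>#m. r * a x) = r ^ size m * (\<Prod>x\<in>#m. a x)" for m by (induction m) (auto simp: mult_ac)
 thus ?thesis using assms by (simp add: mev_def sum_distrib_left mult_ac)
qed

lemma mev_cong:
 assumes "!!m. m \<in> M ==> f m = f' m" "!!m x. m \<in> M ==> x \<in># m ==> a x = a' x"
 shows "mev M f a = mev M f' a'"
proof -
 have "(\<Prod>x\<in>#m. a x) = (\<Prod>x\<in>#m. a' x)" if "m \<in> M" for m
  using assms(2)[OF that] by (metis (mono_tags, lifting) image_mset_cong)
 thus ?thesis using assms(1) by (simp add: mev_def)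
qed

lemma comm_ring_homI:
 assumes "h 1 = 1" "!!x y. h (x + y) = h x + h y" "!!x y. h (x * y) = h x * h y"
 shows "comm_ring_hom (h :: 'a :: comm_ring_1 => 'b :: comm_ring_1)"
proof -
 have "h 0 + h 0 = h 0" using assms(2)[of 0 0] by simp
 thus ?thesis using assms by unfold_locales auto
qed

lemma comm_ring_hom_map_poly:
 assumes "comm_ring_hom (h :: 'a :: comm_ring_1 => 'b :: comm_ring_1)"
 shows "comm_ring_hom (map_poly h)"
proof -
 interpret comm_ring_hom h by fact
 show ?thesis
  by (rule comm_ring_homI)
  (auto intro!: poly_eqI simp: coeff_map_poly hom_add hom_mult coeff_mult hom_sum)
qed

lemma comm_ring_hom_pcompose: "comm_ring_hom (%p. pcompose p q)"
 by (rule comm_ring_homI) (auto simp: pcompose_add pcompose_mult pcompose_1)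

lemma comm_ring_hom_fps_to_fls: "comm_ring_hom fps_to_fls"
 by (rule comm_ring_homI) (auto simp: fls_times_fps_to_fls)

lemma comm_ring_hom_fps_nth_0: "comm_ring_hom (%f :: 'a :: comm_ring_1 fps. fps_nth f 0)"
 by (rule comm_ring_homI) (auto simp: fps_mult_nth_0)

lemma comm_ring_hom_fls_compose_power:
 "k > 0 ==> comm_ring_hom (%f :: 'a :: idom fls. fls_compose_power f k)"
 by (rule comm_ring_homI) auto

lemma comm_ring_hom_const_poly: "comm_ring_hom (%c :: 'a :: comm_ring_1. [:c:])"
 by (rule comm_ring_homI) auto

lemma coeff_pcompose_monom': "coeff (pcompose p [:0, c:]) i = c ^ i * coeff p (i :: nat)"
 for c :: "'a :: comm_ring_1"
proof (induction p arbitrary: i)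
 case (pCons a p)
 show ?case
  by (cases i) (auto simp: pcompose_pCons pCons.IH coeff_pCons mult_ac)
qed auto

text \<open>A projective point over Laurent series has a limit: \<open>vlvl\<close> is the power of
  the variable to be divided out of the coordinates and \<open>vlead\<close> below is the limit
  point. Both are meaningful when some coordinate is nonzero.\<close>

definition vlvl :: "nat => (nat => 'e :: zero fls) => int" where
 "vlvl N v = Min (fls_subdegree ` (v ` {..Suc N} - {0}))"

definition vlead :: "nat => (nat => 'e :: zero fls) => nat => 'e" where
 "vlead N v c = fls_nth (v c) (vlvl N v)"

lemma vlvl_below:
 assumes "c \<le> Suc N" "i < vlvl N v"
 shows "fls_nth (v c) i = 0"
proof (cases "v c = 0")
 case False
 hence "vlvl N v \<le> fls_subdegree (v c)" unfolding vlvl_def using assms(1) by (intro Min_le) auto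
 thus ?thesis using assms(2) by (intro fls_eq0_below_subdegree) auto
qed auto

lemma vlvl_attained:
 assumes "c \<le> Suc N" "v c ~= 0"
 obtains c' where "c' \<le> Suc N" "v c' ~= 0" "vlvl N v = fls_subdegree (v c')" "vlead N v c' ~= 0"
proof -
 have "vlvl N v \<in> fls_subdegree ` (v ` {..Suc N} - {0})"
  unfolding vlvl_def using assms by (intro Min_in) auto
 then obtain c' where "c' \<le> Suc N" "v c' ~= 0" "vlvl N v = fls_subdegree (v c')" by auto
 thus ?thesis using that[of c'] by (simp add: vlead_def)
qed

lemma vlvl_eqI:
 assumes "!!c i. c \<le> Suc N ==> i < k ==> fls_nth (v c) i = 0" "c \<le> Suc N" "fls_nth (v c) k ~= 0"
 shows "vlvl N v = k"
proof (rule antisym)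
 show "vlvl N v \<le> k" using vlvl_below[of c N k v] assms(2,3) by force
 have "v c ~= 0" using assms(3) by auto
 then obtain c' where "c' \<le> Suc N" "vlead N v c' ~= 0" using vlvl_attained assms(2) by metis
 thus "k \<le> vlvl N v" using assms(1)[of c' "vlvl N v"] by (force simp: vlead_def)
qed

lemma vlead_scale:
 fixes v :: "nat => 'e :: idom fls"
 assumes "r ~= 0" "c0 \<le> Suc N" "v c0 ~= 0" "c \<le> Suc N"
 shows "vlead N (%c. r * v c) c = (fls_nth r (fls_subdegree r)) * vlead N v c"
proof -
 let ?s = "fls_subdegree r"
 have nth: "fls_nth (r * v c) (?s + vlvl N v) = (fls_nth r ?s) * vlead N v c" if c: "c \<le> Suc N" for c
 proof (cases "v c = 0")
  case False
  have le: "vlvl N v \<le> fls_subdegree (v c)" unfolding vlvl_def using c False by (intro Min_le) auto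
  show ?thesis
  proof (cases "vlvl N v = fls_subdegree (v c)")
  case True
  thus ?thesis unfolding vlead_def by simp
  next
  case ne: False
  hence "vlead N v c = 0" using le unfolding vlead_def by simp
  moreover have "?s + vlvl N v < fls_subdegree (r * v c)" using ne le assms(1) False by simp
  ultimately show ?thesis by simp
  qed
 qed (simp add: vlead_def)
 obtain c' where c': "c' \<le> Suc N" "v c' ~= 0" "vlead N v c' ~= 0" using vlvl_attained assms(2,3) by metis
 have "vlvl N (%c. r * v c) = ?s + vlvl N v"
 proof (rule vlvl_eqI[OF _ c'(1)])
  show "fls_nth (r * v c') (?s + vlvl N v) ~= 0" using nth[OF c'(1)] c' assms(1) by simp
  fix c i assume ci: "c \<le> Suc N" "i < ?s + vlvl N v"
  show "fls_nth (r * v c) i = 0"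
  proof (cases "v c = 0")
  case False
  have "vlvl N v \<le> fls_subdegree (v c)" unfolding vlvl_def using ci False by (intro Min_le) auto
  thus ?thesis using ci assms(1) False by (intro fls_eq0_below_subdegree) simp
  qed auto
 qed
 thus ?thesis using nth[OF assms(4)] by (simp add: vlead_def)
qed

context shape_deriv
begin

text \<open>The reduction of the equation is compared with \<open>form\<close> by values at
  polynomial points, since reductions of curves are what gets inserted.\<close>

definition specializes :: "nat multiset set => (nat multiset => 'e fps) => bool" where
 "specializes M F \<longleftrightarrow> finite M & (\<forall>m\<in>M. size m = d & set_mset m \<subseteq> {..Suc N}) &
  (\<forall>a :: nat => 'e poly. mev M (%m. [:fps_nth (F m) 0:]) a = form a)"

text \<open>Let t be the series variable. Replacing X by t^gm X and multiplying by t^-mu, where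
  \<open>mu\<close> is the value of the supporting line, makes all coefficients integral. Modulo t
  only those on the edge from \<open>l\<close> to \<open>r\<close> survive and form a curve on
  \<open>form = 0\<close>, to which \<open>curve\<close> applies.\<close>

lemma newton_edge:
 assumes F: "specializes M F"
  and h: "mev M (%m. [:fps_to_fls (F m):]) h = 0"
  and deg: "!!c. c \<le> Suc N ==> degree (h c) \<le> e"
  and l: "b0 \<le> Suc N" "coeff (h b0) l ~= 0" and r: "c0 \<le> Suc N" "coeff (h c0) r ~= 0"
  and lr: "l \<le> r" "m l + int l * gm = m r + int r * gm"
  and m: "m = (%j. vlvl N (%c. coeff (h c) j))"
  and ge: "!!c j. c \<le> Suc N ==> coeff (h c) j ~= 0 ==> m r + int r * gm \<le> m j + int j * gm"
  and gt: "!!c j. c \<le> Suc N ==> coeff (h c) j ~= 0 ==> j < l \<or> r < j ==> m r + int r * gm < m j + int j * gm"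
 shows "winv (vlead N (%c. coeff (h c) l)) = winv (vlead N (%c. coeff (h c) r))"
proof -
 define mu where "mu = m r + int r * gm"
 have M: "finite M" "!!mm. mm \<in> M ==> size mm = d" "!!mm. mm \<in> M ==> set_mset mm \<subseteq> {..Suc N}"
  and Fsp: "!!a :: nat => 'e poly. mev M (%m. [:fps_nth (F m) 0:]) a = form a"
  using F by (auto simp: specializes_def)
 have below: "fls_nth (coeff (h c) j) i = 0" if "c \<le> Suc N" "i < mu - int j * gm" for c j i
 proof (cases "coeff (h c) j = 0")
  case False
  hence "i < m j" using ge[OF that(1) False] that(2) by (simp add: mu_def)
  thus ?thesis using vlvl_below[OF that(1), of i "%c. coeff (h c) j"] by (simp add: m)
 qed auto
 define s where "s = (fls_X_intpow gm :: 'e fls)"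
 have s_pow: "s ^ j = fls_X_intpow (int j * gm)" for j by (simp add: s_def fls_X_intpow_power mult.commute)
 define h' where "h' = (%c. [:fls_X_intpow (- mu):] * pcompose (h c) [:0, s:])"
 have coeff_h': "coeff (h' c) j = fls_shift (mu - int j * gm) (coeff (h c) j)" for c j
  unfolding h'_def by (simp add: coeff_pcompose_monom' s_pow fls_X_intpow_times_conv_shift(1) fls_shifted_times_simps)
 define H where "H = (%c. \<Sum>j\<le>e. monom (fls_regpart (coeff (h' c) j)) j)"
 have coeff_H: "coeff (H c) j = fls_regpart (coeff (h' c) j)" if "c \<le> Suc N" for c j
  using deg[OF that] by (cases "j \<le> e") (auto simp: H_def coeff_sum coeff_h' coeff_eq_0 if_distrib cong: if_cong)
 have hH: "map_poly fps_to_fls (H c) = h' c" if "c \<le> Suc N" for c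
 proof (rule poly_eqI)
  fix j
  have "fps_to_fls (fls_regpart (coeff (h' c) j)) = coeff (h' c) j"
  proof (rule fls_regpart_to_fls_trivial)
  show "0 \<le> fls_subdegree (coeff (h' c) j)"
  proof (cases "coeff (h' c) j = 0")
  case False
  show ?thesis using below[OF that] False by (intro fls_subdegree_geI) (auto simp: coeff_h')
  qed auto
  qed
  thus "coeff (map_poly fps_to_fls (H c)) j = coeff (h' c) j"
  by (simp add: coeff_map_poly coeff_H[OF that])
 qed
 have "mev M (%m. [:fps_to_fls (F m):]) (%c. pcompose (h c) [:0, s:]) = pcompose (mev M (%m. [:fps_to_fls (F m):]) h) [:0, s:]"
  by (subst hom_mev[OF comm_ring_hom_pcompose]) simp
 moreover have "mev M (%m. [:fps_to_fls (F m):]) h' =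
  [:fls_X_intpow (- mu):] ^ d * mev M (%m. [:fps_to_fls (F m):]) (%c. pcompose (h c) [:0, s:])"
  unfolding h'_def by (rule mev_scale) (rule M(2))
 ultimately have "mev M (%m. [:fps_to_fls (F m):]) h' = 0" using h by simp
 also have "mev M (%m. [:fps_to_fls (F m):]) h' = mev M (%m. map_poly fps_to_fls [:F m:]) (%c. map_poly fps_to_fls (H c))"
 proof (rule mev_cong)
  fix mm x assume "mm \<in> M" "x \<in># mm"
  hence "x \<le> Suc N" using M(3) by fastforce
  thus "h' x = map_poly fps_to_fls (H x)" by (simp add: hH)
 qed (simp add: map_poly_pCons)
 also have "\<dots> = map_poly fps_to_fls (mev M (%m. [:F m:]) H)"
  by (rule hom_mev[symmetric]) (rule comm_ring_hom_map_poly[OF comm_ring_hom_fps_to_fls])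
 finally have H0: "mev M (%m. [:F m:]) H = 0"
  by (subst (asm) eq_commute, subst (asm) map_poly_eq_0_iff) auto
 define P where "P = (%c. map_poly (%f. fps_nth f 0) (H c))"
 have "form P = mev M (%m. map_poly (%f. fps_nth f 0) [:F m:]) P"
  unfolding Fsp[symmetric] by (simp add: map_poly_pCons)
 also have "\<dots> = map_poly (%f. fps_nth f 0) (mev M (%m. [:F m:]) H)"
  unfolding P_def by (rule hom_mev[symmetric]) (rule comm_ring_hom_map_poly[OF comm_ring_hom_fps_nth_0])
 finally have formP: "form P = 0" using H0 by simp
 have coeff_P: "coeff (P c) j = fls_nth (coeff (h c) j) (mu - int j * gm)" if "c \<le> Suc N" for c j
  by (simp add: P_def coeff_map_poly coeff_H[OF that] coeff_h')
 have P_out: "coeff (P c) j = 0" if "c \<le> Suc N" "j < l \<or> r < j" for c j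
 proof (cases "coeff (h c) j = 0")
  case False
  hence "mu - int j * gm < m j" using gt[OF that(1) False that(2)] by (simp add: mu_def)
  thus ?thesis using vlvl_below[OF that(1), of "mu - int j * gm" "%c. coeff (h c) j"] by (simp add: coeff_P[OF that(1)] m)
 qed (simp add: coeff_P[OF that(1)])
 \<comment> \<open>The common factor X^l is removed so that the edge starts at coefficient
   0.\<close>
 define P' where "P' = (%c. \<Sum>j\<le>r - l. monom (coeff (P c) (l + j)) j)"
 have coeff_P': "coeff (P' c) j = coeff (P c) (l + j)" if "c \<le> Suc N" for c j
  using P_out[OF that, of "l + j"] by (cases "j \<le> r - l") (auto simp: P'_def coeff_sum if_distrib cong: if_cong)
 have PP': "P c = monom 1 l * P' c" if "c \<le> Suc N" for c
  by (rule poly_eqI) (auto simp: coeff_monom_mult coeff_P'[OF that] P_out[OF that])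
 have "form P = form (%c. monom 1 l * P' c)" by (intro form_cong) (rule PP')
 hence formP': "form P' = 0" using formP by (simp add: form_scale)
 obtain b1 where b1: "b1 \<le> Suc N" "vlead N (%c. coeff (h c) l) b1 ~= 0"
  using vlvl_attained[of b0 N "%c. coeff (h c) l"] l by metis
 obtain c1 where c1: "c1 \<le> Suc N" "vlead N (%c. coeff (h c) r) c1 ~= 0"
  using vlvl_attained[of c0 N "%c. coeff (h c) r"] r by metis
 have low: "coeff (P' c) 0 = vlead N (%c. coeff (h c) l) c" if "c \<le> Suc N" for c
 proof -
  have "mu - int l * gm = m l" using lr by (simp add: mu_def)
  thus ?thesis by (simp add: coeff_P' coeff_P that vlead_def m)
 qed
 have top: "coeff (P' c) (r - l) = vlead N (%c. coeff (h c) r) c" if "c \<le> Suc N" for c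
  using lr by (simp add: coeff_P' coeff_P that vlead_def m mu_def)
 have "degree (P' c) \<le> r - l" for c
  unfolding P'_def by (intro degree_sum_le) (auto intro: order_trans[OF degree_monom_le])
 hence "winv (%c. coeff (P' c) 0) = winv (%c. coeff (P' c) (r - l))"
  using curve[OF formP' b1(1) _ _ c1(1)] b1 c1 low top by simp
 moreover have "winv (%c. coeff (P' c) 0) = winv (vlead N (%c. coeff (h c) l))"
  using low n_le by (intro winv_cong) auto
 moreover have "winv (%c. coeff (P' c) (r - l)) = winv (vlead N (%c. coeff (h c) r))"
  using top n_le by (intro winv_cong) auto
 ultimately show ?thesis by simp
qed

text \<open>A walk to the right along the lower Newton polygon. The slope \<open>gm\<close> supports
  it with \<open>r\<close> as the rightmost point of contact; turning the line about
  \<open>r\<close> until it meets a later point gives the next edge. Subdegrees divisible by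
  \<open>e!\<close> make all slopes integers, since the horizontal distances are at most
  \<open>e\<close>.\<close>

lemma newton_chain:
 assumes F: "specializes M F"
  and h: "mev M (%m. [:fps_to_fls (F m):]) h = 0"
  and deg: "!!c. c \<le> Suc N ==> degree (h c) \<le> e"
  and top: "c0 \<le> Suc N" "coeff (h c0) e ~= 0"
  and div: "!!c j. c \<le> Suc N ==> coeff (h c) j ~= 0 ==> int (fact e) dvd fls_subdegree (coeff (h c) j)"
  and m: "m = (%j. vlvl N (%c. coeff (h c) j))"
  and V: "V = {j. j \<le> e & (\<exists>c\<le>Suc N. coeff (h c) j ~= 0)}"
  and r: "r \<in> V"
  and ge: "!!j. j \<in> V ==> j < r ==> m r + int r * gm \<le> m j + int j * gm"
  and gt: "!!j. j \<in> V ==> r < j ==> m r + int r * gm < m j + int j * gm"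
 shows "winv (vlead N (%c. coeff (h c) r)) = winv (vlead N (%c. coeff (h c) e))"
 using r ge gt
proof (induction "e - r" arbitrary: r gm rule: less_induct)
 case less
 have re: "r \<le> e" using less.prems(1) by (simp add: V)
 show ?case
 proof (cases "r = e")
  case False
  have eV: "e \<in> V" using top by (auto simp: V)
  have mdiv: "int (fact e) dvd m j" if "j \<in> V" for j
  proof -
  obtain c where "c \<le> Suc N" "coeff (h c) j ~= 0" using `j \<in> V` by (auto simp: V)
  then obtain c' where "c' \<le> Suc N" "coeff (h c') j ~= 0" "m j = fls_subdegree (coeff (h c') j)"
  using vlvl_attained[of c N "%c. coeff (h c) j"] unfolding m by metis
  thus ?thesis using div by simp
  qed
  \<comment> \<open>\<open>s j\<close> is the value of \<open>gm\<close> for which the line through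
    \<open>r\<close> also passes through \<open>j\<close>; the largest one belongs to the next edge,
    and its rightmost point is \<open>r'\<close>.\<close>
  define s where "s = (%j. (m r - m j) div (int j - int r))"
  have s: "m r - m j = (int j - int r) * s j" if j: "j \<in> V" "r < j" for j
  proof -
  have "j - r dvd fact e" using j by (intro dvd_fact) (auto simp: V)
  hence "int (j - r) dvd int (fact e)" by (simp only: of_nat_dvd_iff)
  hence "int j - int r dvd m r - m j"
  using mdiv[OF j(1)] mdiv[OF less.prems(1)] j(2) by (metis dvd_diff dvd_trans int_ops(6) less_or_eq_imp_le not_less_iff_gr_or_eq of_nat_diff)
  thus ?thesis by (simp add: s_def)
  qed
  define A where "A = {j \<in> V. r < j}"
  have finA: "finite A" "e \<in> A" using eV re False by (auto simp: A_def V)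
  define gm' where "gm' = Max (s ` A)"
  define r' where "r' = Max {j \<in> A. s j = gm'}"
  have "gm' \<in> s ` A" unfolding gm'_def using finA by (intro Max_in) auto
  hence "r' \<in> {j \<in> A. s j = gm'}" unfolding r'_def using finA by (intro Max_in) auto
  hence r': "r' \<in> V" "r < r'" "s r' = gm'" by (auto simp: A_def)
  have s_le: "s j \<le> gm'" if "j \<in> A" for j unfolding gm'_def using that finA by (intro Max_ge) auto
  have s_lt: "s j < gm'" if "j \<in> A" "r' < j" for j
  proof -
  have "~ s j = gm'"
  proof
  assume "s j = gm'"
  hence "j \<le> r'" unfolding r'_def using that finA by (intro Max_ge) auto
  thus False using that by simp
  qed
  thus ?thesis using s_le[OF that(1)] by simp
  qed
  have lt: "gm' < gm"
  proof -
  have "m r + int r * gm < m r' + int r' * gm" using less.prems(3)[OF r'(1,2)] .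
  hence "(int r' - int r) * gm' < (int r' - int r) * gm" using s[OF r'(1,2)] r'(3) by (simp add: algebra_simps)
  thus ?thesis using r'(2) by (simp add: mult_less_cancel_left)
  qed
  have below: "m r + int r * gm' < m j + int j * gm'" if "j \<in> V" "j < r" for j
  proof -
  have "(int r - int j) * gm' < (int r - int j) * gm" using lt that(2) by simp
  thus ?thesis using less.prems(2)[OF that] by (simp add: algebra_simps)
  qed
  have above: "m r + int r * gm' \<le> m j + int j * gm'" if "j \<in> V" "r < j" for j
  proof -
  have "(int j - int r) * s j \<le> (int j - int r) * gm'" using s_le[of j] that by (intro mult_left_mono) (auto simp: A_def)
  thus ?thesis using s[OF that] by (simp add: algebra_simps)
  qed
  have above': "m r + int r * gm' < m j + int j * gm'" if "j \<in> V" "r' < j" for j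
  proof -
  have "(int j - int r) * s j < (int j - int r) * gm'" using s_lt[of j] that r'(2) by (intro mult_strict_left_mono) (auto simp: A_def)
  thus ?thesis using s[of j] that r'(2) by (simp add: algebra_simps)
  qed
  have eq: "m r + int r * gm' = m r' + int r' * gm'"
  using s[OF r'(1,2)] r'(3) by (simp add: algebra_simps)
  have Vin: "j \<in> V" if "c \<le> Suc N" "coeff (h c) j ~= 0" for c j
  using that le_degree[OF that(2)] deg[OF that(1)] by (auto simp: V)
  obtain b1 where b1: "b1 \<le> Suc N" "coeff (h b1) r ~= 0" using less.prems(1) by (auto simp: V)
  obtain c1 where c1: "c1 \<le> Suc N" "coeff (h c1) r' ~= 0" using r'(1) by (auto simp: V)
  have "winv (vlead N (%c. coeff (h c) r)) = winv (vlead N (%c. coeff (h c) r'))"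
  proof (rule newton_edge[OF F h deg b1 c1 _ eq m])
  fix c j assume cj: "c \<le> Suc N" "coeff (h c) j ~= 0"
  note j = Vin[OF cj]
  show "m r' + int r' * gm' \<le> m j + int j * gm'"
  using below[OF j] above[OF j] eq by (cases j r rule: linorder_cases) auto
  show "m r' + int r' * gm' < m j + int j * gm'" if "j < r \<or> r' < j"
  using that below[OF j] above'[OF j] eq by auto
  qed (use r'(2) in auto)
  also have "\<dots> = winv (vlead N (%c. coeff (h c) e))"
  proof (rule less.hyps[of r' gm'])
  show "e - r' < e - r" using r' re False by (auto simp: V)
  show "m r' + int r' * gm' \<le> m j + int j * gm'" if "j \<in> V" "j < r'" for j
  using below[OF that(1)] above[OF that(1)] eq by (cases j r rule: linorder_cases) auto
  show "m r' + int r' * gm' < m j + int j * gm'" if "j \<in> V" "r' < j" for j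
  using above'[OF that] eq by simp
  qed (use r' in auto)
  finally show ?thesis .
 qed auto
qed

text \<open>Substituting the power t^(e!) for the series variable t makes subdegrees divisible by
  \<open>e!\<close> and leaves leading coefficients unchanged, after which
  \<open>newton_chain\<close> runs from coefficient 0 to coefficient \<open>e\<close>.\<close>

theorem newton:
 assumes F: "specializes M F"
  and h: "mev M (%m. [:fps_to_fls (F m):]) h = 0"
  and deg: "!!c. c \<le> Suc N ==> degree (h c) \<le> e"
  and low: "b0 \<le> Suc N" "coeff (h b0) 0 ~= 0"
  and top: "c0 \<le> Suc N" "coeff (h c0) e ~= 0"
 shows "winv (vlead N (%c. coeff (h c) 0)) = winv (vlead N (%c. coeff (h c) e))"
proof -
 define L :: nat where "L = fact e"
 have L: "L > 0" by (simp add: L_def)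
 define ph where "ph = (%f :: 'e fls. fls_compose_power f L)"
 have hom: "comm_ring_hom ph" unfolding ph_def by (rule comm_ring_hom_fls_compose_power[OF L])
 have nth: "fls_nth (ph f) i = (if int L dvd i then fls_nth f (i div int L) else 0)" for f i
  unfolding ph_def using L by (rule fls_nth_compose_power)
 have nth_mult: "fls_nth (ph f) (int L * i) = fls_nth f i" for f i using L by (simp add: nth)
 have inj: "ph f = 0 \<longleftrightarrow> f = 0" for f
 proof
  assume "ph f = 0"
  hence "fls_nth f i = 0" for i using nth_mult[of f i] by simp
  thus "f = 0" by (intro fls_eqI) simp
 qed (simp add: ph_def)
 define F' where "F' = (%m. fps_compose (F m) (fps_X ^ L))"
 have F': "fps_to_fls (F' m) = ph (fps_to_fls (F m))" for m
  unfolding F'_def ph_def using L by (simp add: fls_compose_power_fps_to_fls)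
 have sp: "specializes M F'" using F by (simp add: specializes_def F'_def)
 define h' where "h' = (%c. map_poly ph (h c))"
 have ph0: "ph 0 = 0" by (simp add: inj)
 have coeff: "coeff (h' c) j = ph (coeff (h c) j)" for c j
  by (simp add: h'_def coeff_map_poly ph0)
 have "mev M (%m. map_poly ph [:fps_to_fls (F m):]) (%c. map_poly ph (h c)) = 0"
  by (subst hom_mev[OF comm_ring_hom_map_poly[OF hom], symmetric]) (simp add: h)
 hence h'0: "mev M (%m. [:fps_to_fls (F' m):]) h' = 0"
  by (simp add: h'_def F' map_poly_pCons ph0)
 have deg': "degree (h' c) \<le> e" if "c \<le> Suc N" for c
  using deg[OF that] by (intro degree_le) (auto simp: coeff coeff_eq_0 ph0)
 have div: "int (fact e) dvd fls_subdegree (coeff (h' c) j)" if "coeff (h' c) j ~= 0" for c j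
 proof -
  have "fls_nth (coeff (h' c) j) (fls_subdegree (coeff (h' c) j)) ~= 0" using that by simp
  thus ?thesis unfolding coeff nth L_def by (auto split: if_splits)
 qed
 define m where "m = (%j. vlvl N (%c. coeff (h' c) j))"
 define V where "V = {j. j \<le> e & (\<exists>c\<le>Suc N. coeff (h' c) j ~= 0)}"
 \<comment> \<open>Steep enough for the supporting line to touch the polygon at 0 only.\<close>
 define gm where "gm = \<bar>m 0\<bar> + (\<Sum>j\<le>e. \<bar>m j\<bar>) + 1"
 have "winv (vlead N (%c. coeff (h' c) 0)) = winv (vlead N (%c. coeff (h' c) e))"
 proof (rule newton_chain[OF sp h'0 deg' top(1) _ div m_def V_def])
  show "0 \<in> V" using low by (auto simp: V_def coeff inj)
  fix j assume j: "j \<in> V" "0 < j"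
  have "\<bar>m j\<bar> \<le> (\<Sum>j\<le>e. \<bar>m j\<bar>)" using j by (intro member_le_sum) (auto simp: V_def)
  hence "\<bar>m 0\<bar> + \<bar>m j\<bar> < gm" by (simp add: gm_def)
  moreover have "0 \<le> gm" using `\<bar>m 0\<bar> + \<bar>m j\<bar> < gm` by linarith
  hence "1 * gm \<le> int j * gm" using j by (intro mult_right_mono) auto
  ultimately show "m 0 + int 0 * gm < m j + int j * gm" by linarith
 qed (use top in "auto simp: coeff inj")
 moreover have lead: "winv (vlead N (%c. coeff (h' c) j)) = winv (vlead N (%c. coeff (h c) j))"
  if c: "c \<le> Suc N" "coeff (h c) j ~= 0" for c j
 proof -
  let ?v = "%c. coeff (h c) j"
  obtain c1 where c1: "c1 \<le> Suc N" "vlead N ?v c1 ~= 0" using vlvl_attained[of c N ?v] c by metis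
  have "vlvl N (%c. ph (?v c)) = int L * vlvl N ?v"
  proof (rule vlvl_eqI[OF _ c1(1)])
  show "fls_nth (ph (?v c1)) (int L * vlvl N ?v) ~= 0" using c1 by (simp add: nth_mult vlead_def)
  fix c i assume ci: "c \<le> Suc N" "i < int L * vlvl N ?v"
  have "i div int L < vlvl N ?v" if "int L dvd i" using that ci(2) L by auto
  thus "fls_nth (ph (?v c)) i = 0" using vlvl_below[OF ci(1), of _ ?v] by (simp add: nth)
  qed
  thus ?thesis unfolding coeff vlead_def by (simp add: nth_mult)
 qed
 ultimately show ?thesis using lead[OF low] lead[OF top] by simp
qed

end

section \<open>Laurent series over rational function fields\<close>

text \<open>The invariant will take values in Laurent series over rational functions, and
  \<open>shape_deriv\<close> asks for \<open>field_gcd\<close>; the trivial Euclidean structure of a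
  field serves.\<close>

instantiation fls :: (field)
 "{unique_euclidean_ring, normalization_euclidean_semiring, normalization_semidom_multiplicative}"
begin

definition [simp]: "normalize_fls = (normalize_field :: 'a fls => _)"
definition [simp]: "unit_factor_fls = (unit_factor_field :: 'a fls => _)"
definition [simp]: "modulo_fls = (mod_field :: 'a fls => _)"
definition [simp]: "euclidean_size_fls = (euclidean_size_field :: 'a fls => _)"
definition [simp]: "division_segment (x :: 'a fls) = 1"

instance
 by standard (simp_all add: dvd_field_iff field_split_simps split: if_splits)

end

instantiation fls :: (field) euclidean_ring_gcd
begin

definition gcd_fls :: "'a fls => 'a fls => 'a fls" where
 "gcd_fls = Euclidean_Algorithm.gcd"
definition lcm_fls :: "'a fls => 'a fls => 'a fls" where
 "lcm_fls = Euclidean_Algorithm.lcm"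
definition Gcd_fls :: "'a fls set => 'a fls" where
 "Gcd_fls = Euclidean_Algorithm.Gcd"
definition Lcm_fls :: "'a fls set => 'a fls" where
 "Lcm_fls = Euclidean_Algorithm.Lcm"

instance by standard (simp_all add: gcd_fls_def lcm_fls_def Gcd_fls_def Lcm_fls_def)

end

instance fls :: (field) field_gcd ..

section \<open>Coefficientwise maps of Laurent series and derivations of rational functions\<close>

lemma fls_times_nth_bounds:
 fixes f g :: "'a :: comm_ring_1 fls"
 assumes "!!i. i < a ==> fls_nth f i = 0" "!!i. i < b ==> fls_nth g i = 0"
 shows "fls_nth (f * g) n = (\<Sum>i=a..n - b. fls_nth f i * fls_nth g (n - i))"
proof (cases "f = 0 \<or> g = 0")
 case False
 hence "a \<le> fls_subdegree f" "b \<le> fls_subdegree g"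
  using assms by (meson fls_subdegree_geI)+
 thus ?thesis unfolding fls_times_nth(2) by (intro sum.mono_neutral_left) auto
qed auto

definition fls_map :: "('a => 'b) => 'a :: zero fls => 'b :: zero fls" where
 "fls_map h f = Abs_fls (%n. h (fls_nth f n))"

lemma fls_nth_map: "h 0 = 0 ==> fls_nth (fls_map h f) n = h (fls_nth f n)"
 unfolding fls_map_def
 by (rule nth_Abs_fls_lower_bound[of "fls_subdegree f"]) auto

lemma comm_ring_hom_fls_map:
 assumes "comm_ring_hom (h :: 'a :: comm_ring_1 => 'b :: comm_ring_1)"
 shows "comm_ring_hom (fls_map h)"
proof -
 interpret comm_ring_hom h by fact
 note nth = fls_nth_map[of h, OF hom_zero]
 have "fls_map h (f * g) = fls_map h f * fls_map h g" for f g
 proof (rule fls_eqI)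
  fix n
  have "fls_nth (fls_map h (f * g)) n = (\<Sum>i=fls_subdegree f..n - fls_subdegree g. h (fls_nth f i) * h (fls_nth g (n - i)))"
  unfolding nth by (subst fls_times_nth_bounds[of "fls_subdegree f" _ "fls_subdegree g"]) (auto simp: hom_sum hom_mult)
  also have "\<dots> = fls_nth (fls_map h f * fls_map h g) n"
  by (subst fls_times_nth_bounds[of "fls_subdegree f" _ "fls_subdegree g"]) (auto simp: nth)
  finally show "fls_nth (fls_map h (f * g)) n = fls_nth (fls_map h f * fls_map h g) n" .
 qed
 moreover have "fls_map h (f + g) = fls_map h f + fls_map h g" for f g
  by (rule fls_eqI) (simp add: nth hom_add)
 moreover have "fls_map h 1 = 1" by (rule fls_eqI) (auto simp: nth)
 ultimately show ?thesis by (intro comm_ring_homI)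
qed

lemma derivation_fls_map:
 assumes D: "derivation (D :: 'a :: comm_ring_1 => 'a)"
 shows "derivation (fls_map D)"
proof -
 note nth = fls_nth_map[of D, OF derivation_0[OF D]]
 have "fls_map D (f * g) = fls_map D f * g + f * fls_map D g" for f g
 proof (rule fls_eqI)
  fix n
  have "fls_nth (fls_map D (f * g)) n =
  (\<Sum>i=fls_subdegree f..n - fls_subdegree g. D (fls_nth f i) * fls_nth g (n - i) + fls_nth f i * D (fls_nth g (n - i)))"
  unfolding nth by (subst fls_times_nth_bounds[of "fls_subdegree f" _ "fls_subdegree g"])
  (auto simp: derivation_sum[OF D] derivation_mult[OF D])
  also have "\<dots> = fls_nth (fls_map D f * g) n + fls_nth (f * fls_map D g) n"
  by (subst (1 2) fls_times_nth_bounds[of "fls_subdegree f" _ "fls_subdegree g"]) (auto simp: nth sum.distrib D)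
  finally show "fls_nth (fls_map D (f * g)) n = fls_nth (fls_map D f * g + f * fls_map D g) n" by simp
 qed
 moreover have "fls_map D (f + g) = fls_map D f + fls_map D g" for f g
  by (rule fls_eqI) (simp add: nth derivation_add[OF D])
 ultimately show ?thesis by (simp add: derivation_def)
qed

definition dfrac :: "('a :: idom => 'a) => 'a fract => 'a fract" where
 "dfrac D q = (let (a, b) = (SOME (a, b). b ~= 0 & q = Fract a b) in Fract (D a * b - a * D b) (b * b))"

lemma dfrac_Fract:
 assumes D: "derivation D" and b: "b ~= 0"
 shows "dfrac D (Fract a b) = Fract (D a * b - a * D b) (b * b)"
proof -
 obtain a' b' where s: "(SOME (a', b'). b' ~= 0 & Fract a b = Fract a' b') = (a', b')" by fastforce
 have "case (a', b') of (a', b') => b' ~= 0 & Fract a b = Fract a' b'"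
  unfolding s[symmetric] by (rule someI[of _ "(a, b)"]) (use b in auto)
 hence b': "b' ~= 0" and eq: "a * b' = a' * b" using b by (auto simp: eq_fract)
 have deq: "D a * b' + a * D b' = D a' * b + a' * D b"
  using arg_cong[OF eq, of D] D by (simp add: derivation_mult)
 have "(D a' * b' - a' * D b') * (b * b) - (D a * b - a * D b) * (b' * b') =
  b * b' * (D a' * b + a' * D b - (D a * b' + a * D b')) + (a * b' - a' * b) * (b' * D b + b * D b')"
  by (simp add: algebra_simps)
 also have "\<dots> = 0" using eq deq by simp
 finally show ?thesis using b b' by (simp add: dfrac_def s eq_fract)
qed

lemma derivation_dfrac:
 assumes D: "derivation D"
 shows "derivation (dfrac D)"
proof -
 have "dfrac D (p + q) = dfrac D p + dfrac D q & dfrac D (p * q) = dfrac D p * q + p * dfrac D q" for p q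
 proof (cases p, cases q)
  fix a b a' b' assume "p = Fract a b" "b ~= 0" "q = Fract a' b'" "b' ~= 0"
  thus ?thesis using D
  by (auto simp: dfrac_Fract derivation_mult derivation_add eq_fract algebra_simps)
 qed
 thus ?thesis by (simp add: derivation_def)
qed

text \<open>The Euler operator t_i d/dt_i. Unlike the partial derivative it preserves monomials up
  to a scalar, so nothing has to be said about lowered exponents.\<close>

lift_definition euler :: "nat => ((nat \<Rightarrow>\<^sub>0 nat) \<Rightarrow>\<^sub>0 'a) => ((nat \<Rightarrow>\<^sub>0 nat) \<Rightarrow>\<^sub>0 'a :: comm_ring_1)" is
 "%i p m. of_nat (Poly_Mapping.lookup m i) * p m"
 by (erule rev_finite_subset) auto

lemma euler_add: "euler i (p + q) = euler i p + euler i q"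
 by transfer (auto simp: algebra_simps)

lemma euler_single: "euler i (Poly_Mapping.single m c) = Poly_Mapping.single m (of_nat (Poly_Mapping.lookup m i) * c)"
 by (rule poly_mapping_eqI) (simp add: euler.rep_eq lookup_single when_def)

lemma euler_0: "euler i 0 = 0"
 by transfer auto

lemma euler_sum: "euler i (sum f A) = (\<Sum>x\<in>A. euler i (f x))"
 by (induction A rule: infinite_finite_induct) (auto simp: euler_add euler_0)

lemma derivation_euler: "derivation (euler i :: ((nat \<Rightarrow>\<^sub>0 nat) \<Rightarrow>\<^sub>0 'a :: comm_ring_1) => _)"
proof -
 have s: "euler i (Poly_Mapping.single m c * Poly_Mapping.single m' c') =
  euler i (Poly_Mapping.single m c) * Poly_Mapping.single m' c' + Poly_Mapping.single m c * euler i (Poly_Mapping.single m' (c' :: 'a))" for m m' c c'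
  by (simp add: euler_single mult_single lookup_add algebra_simps flip: single_add)
 have "euler i (p * q) = euler i p * q + p * euler i (q :: (nat \<Rightarrow>\<^sub>0 nat) \<Rightarrow>\<^sub>0 'a)" for p q
 proof -
  let ?s = "%p m. Poly_Mapping.single m (Poly_Mapping.lookup p m) :: (nat \<Rightarrow>\<^sub>0 nat) \<Rightarrow>\<^sub>0 'a"
  have p: "(\<Sum>m\<in>Poly_Mapping.keys p. ?s p m) = p" for p
  proof (rule poly_mapping_eqI)
  fix k
  have "Poly_Mapping.lookup (\<Sum>m\<in>Poly_Mapping.keys p. ?s p m) k = (\<Sum>m\<in>Poly_Mapping.keys p. if m = k then Poly_Mapping.lookup p m else 0)"
  by (simp add: lookup_sum lookup_single when_def)
  also have "\<dots> = Poly_Mapping.lookup p k" by (auto simp: in_keys_iff)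
  finally show "Poly_Mapping.lookup (\<Sum>m\<in>Poly_Mapping.keys p. ?s p m) k = Poly_Mapping.lookup p k" .
  qed
  have "euler i ((\<Sum>m\<in>Poly_Mapping.keys p. ?s p m) * (\<Sum>m\<in>Poly_Mapping.keys q. ?s q m)) =
  euler i (\<Sum>m\<in>Poly_Mapping.keys p. ?s p m) * (\<Sum>m\<in>Poly_Mapping.keys q. ?s q m) +
  (\<Sum>m\<in>Poly_Mapping.keys p. ?s p m) * euler i (\<Sum>m\<in>Poly_Mapping.keys q. ?s q m)"
  unfolding sum_product euler_sum s by (simp add: sum.distrib)
  thus ?thesis unfolding p .
 qed
 thus ?thesis by (simp add: derivation_def euler_add)
qed

section \<open>Hensel's lemma for power series\<close>

lemma poly_taylor1:
 "\<exists>R. poly p (x + y :: 'a :: idom) = poly p x + y * poly (pderiv p) x + y ^ 2 * R"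
proof (induction p)
 case (pCons a p)
 then obtain R where R: "poly p (x + y) = poly p x + y * poly (pderiv p) x + y ^ 2 * R" by blast
 show ?case
  by (rule exI[of _ "x * R + poly (pderiv p) x + y * R"])
  (simp add: R pderiv_pCons algebra_simps power2_eq_square)
qed auto

lemma fps_X_power_dvd_iff:
 "fps_X ^ k dvd (f :: 'a :: comm_ring_1 fps) \<longleftrightarrow> (\<forall>i<k. fps_nth f i = 0)"
proof
 assume *: "\<forall>i<k. fps_nth f i = 0"
 have "f = fps_X ^ k * fps_shift k f"
  using * by (intro fps_ext) (auto simp: fps_X_power_mult_nth)
 thus "fps_X ^ k dvd f" by (metis dvd_triv_left)
qed (auto simp: fps_X_power_mult_nth elim!: dvdE)

text \<open>The derivative at the root stays a unit, so one coefficient can be corrected at a time;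
  coefficient \<open>i\<close> no longer changes after stage \<open>i\<close>, and the diagonal is
  the root.\<close>

theorem hensel_fps:
 fixes q :: "'a :: field fps poly"
 assumes "poly (map_poly (%f. fps_nth f 0) q) r0 = 0"
  and "poly (pderiv (map_poly (%f. fps_nth f 0) q)) r0 ~= 0"
 obtains r where "fps_nth r 0 = r0" "poly q r = 0"
proof -
 interpret h: comm_ring_hom "%f :: 'a fps. fps_nth f 0" by (rule comm_ring_hom_fps_nth_0)
 have ev: "fps_nth (poly p s) 0 = poly (map_poly (%f. fps_nth f 0) p) (fps_nth s 0)" for p and s :: "'a fps"
  by (induction p) (auto simp: map_poly_pCons fps_mult_nth_0)
 have pd: "map_poly (%f. fps_nth f 0) (pderiv q) = pderiv (map_poly (%f. fps_nth f 0) q)"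
  by (rule poly_eqI) (simp add: coeff_map_poly coeff_pderiv)
 have step: "\<exists>c. fps_X ^ Suc (Suc k) dvd poly q (s + fps_const c * fps_X ^ Suc k)"
  if s: "fps_nth s 0 = r0" "fps_X ^ Suc k dvd poly q s" for s k
 proof -
  obtain A where A: "poly q s = fps_X ^ Suc k * A" using s by blast
  define B where "B = poly (pderiv q) s"
  have B0: "fps_nth B 0 ~= 0" using assms(2) s unfolding B_def ev pd by simp
  define c where "c = - fps_nth A 0 / fps_nth B 0"
  define y where "y = fps_const c * fps_X ^ Suc k"
  obtain R where R: "poly q (s + y) = poly q s + y * poly (pderiv q) s + y ^ 2 * R" using poly_taylor1 by blast
  have "fps_nth (A + fps_const c * B) 0 = 0" using B0 by (simp add: c_def)
  hence "fps_X dvd A + fps_const c * B"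
  using fps_X_power_dvd_iff[of 1 "A + fps_const c * B"] by simp
  then obtain A' where A': "A + fps_const c * B = fps_X * A'" by blast
  have "poly q (s + y) = fps_X ^ Suc k * (A + fps_const c * B) + y ^ 2 * R"
  unfolding R A B_def[symmetric] by (simp add: y_def algebra_simps)
  also have "\<dots> = fps_X ^ Suc (Suc k) * (A' + fps_const c ^ 2 * fps_X ^ k * R)"
  unfolding A' y_def by (simp add: power2_eq_square algebra_simps)
  finally show ?thesis unfolding y_def by (metis dvd_triv_left)
 qed
 then obtain c where c: "!!s k. fps_nth s 0 = r0 ==> fps_X ^ Suc k dvd poly q s ==>
  fps_X ^ Suc (Suc k) dvd poly q (s + fps_const (c s k) * fps_X ^ Suc k)" by metis
 define S where "S = rec_nat (fps_const r0) (%k s. s + fps_const (c s k) * fps_X ^ Suc k)"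
 have S_Suc: "S (Suc k) = S k + fps_const (c (S k) k) * fps_X ^ Suc k" and S_0: "S 0 = fps_const r0" for k
  by (simp_all add: S_def)
 have inv: "fps_nth (S k) 0 = r0 & fps_X ^ Suc k dvd poly q (S k)" for k
 proof (induction k)
  case 0
  have "fps_nth (poly q (fps_const r0)) 0 = 0" using assms(1) by (simp add: ev)
  thus ?case using fps_X_power_dvd_iff[of 1 "poly q (fps_const r0)"] by (simp add: S_0)
 next
  case (Suc k)
  thus ?case using c[of "S k" k] by (simp add: S_Suc del: power_Suc)
 qed
 define r where "r = Abs_fps (%i. fps_nth (S i) i)"
 have stable: "fps_nth (S (i + j)) i = fps_nth (S i) i" for i j
  by (induction j) (auto simp: S_Suc fps_X_power_mult_right_nth)
 have diff: "fps_X ^ Suc k dvd r - S k" for k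
 proof -
  have "fps_nth (r - S k) i = 0" if "i < Suc k" for i
  using stable[of i "k - i"] that by (simp add: r_def)
  thus ?thesis unfolding fps_X_power_dvd_iff by blast
 qed
 have "fps_X ^ Suc k dvd poly q r" for k
 proof -
  have "r - S k dvd poly q r - poly q (S k)"
  proof (induction q)
  case (pCons a p)
  have "poly (pCons a p) r - poly (pCons a p) (S k) = r * (poly p r - poly p (S k)) + (r - S k) * poly p (S k)"
  by (simp add: algebra_simps)
  thus ?case using pCons by simp
  qed auto
  hence "fps_X ^ Suc k dvd poly q r - poly q (S k)" using diff dvd_trans by blast
  thus ?thesis using inv[of k] by (metis diff_add_cancel dvd_add)
 qed
 hence "fps_nth (poly q r) k = 0" for k
  using fps_X_power_dvd_iff[of "Suc k" "poly q r"] by blast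
 hence "poly q r = 0" by (intro fps_ext) simp
 moreover have "fps_nth r 0 = r0" using inv[of 0] by (simp add: r_def)
 ultimately show ?thesis using that by blast
qed

section \<open>A generic point of the special hypersurface\<close>

type_synonym 'o ratf = "((nat \<Rightarrow>\<^sub>0 nat) \<Rightarrow>\<^sub>0 'o) fract"

definition cst :: "'o :: field => 'o ratf" where
 "cst c = Fract (Poly_Mapping.single 0 c) 1"

definition tmon :: "(nat \<Rightarrow>\<^sub>0 nat) => ('o :: field) ratf" where
 "tmon e = Fract (Poly_Mapping.single e 1) 1"

abbreviation tvar :: "nat => ('o :: field) ratf" where
 "tvar i \<equiv> tmon (Poly_Mapping.single i 1)"

text \<open>Not a quotient by the argument: this is t_i d/dt_i on rational functions, a genuine
  derivation that fixes its own variable.\<close>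

definition dlog :: "nat => ('o :: field) ratf => 'o ratf" where
 "dlog i = dfrac (euler i)"

lemma comm_ring_hom_cst: "comm_ring_hom (cst :: 'o :: field => _)"
proof (rule comm_ring_homI)
 show "cst 1 = (1 :: 'o ratf)" by (simp add: cst_def One_fract_def)
qed (auto simp: cst_def mult_single single_add)

lemma tmon_0: "tmon 0 = 1"
 by (simp add: tmon_def One_fract_def)

lemma tmon_add: "tmon (e + e') = tmon e * tmon e'"
 by (simp add: tmon_def mult_single)

lemma tmon_nonzero [simp]: "tmon e ~= (0 :: 'o :: field ratf)"
proof -
 have "Poly_Mapping.single e (1 :: 'o) ~= 0" by (metis lookup_single_eq lookup_zero zero_neq_one)
 thus ?thesis by (simp add: tmon_def eq_fract Zero_fract_def)
qed

lemma tvar_power: "tvar i ^ k = tmon (Poly_Mapping.single i k)"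
 by (induction k) (auto simp: tmon_0 simp flip: tmon_add single_add)

lemma tmon_prod_mset: "(\<Prod>x\<in>#m. tmon (f x)) = tmon (\<Sum>x\<in>#m. f x)"
 by (induction m) (auto simp: tmon_0 tmon_add)

lemma derivation_dlog: "derivation (dlog i)"
 unfolding dlog_def by (rule derivation_dfrac[OF derivation_euler])

lemma euler_1: "euler i 1 = 0"
 using derivation_1[OF derivation_euler] .

lemma dlog_cst: "dlog i (cst c) = 0"
 by (simp add: dlog_def cst_def dfrac_Fract derivation_euler euler_single euler_1 Zero_fract_def)

lemma dlog_tvar: "dlog i (tvar j :: 'o :: field ratf) = (if i = j then tvar j else 0)"
 by (simp add: dlog_def tmon_def dfrac_Fract derivation_euler euler_single euler_1 Zero_fract_def lookup_single)

lemma tmon_independent: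
 assumes "finite A" "A ~= {}" "!!m. m \<in> A ==> r m ~= (0 :: 'o :: field)" "inj_on e A"
 shows "(\<Sum>m\<in>A. cst (r m) * tmon (e m)) ~= 0"
proof -
 have "(\<Sum>m\<in>A. cst (r m) * tmon (e m)) = (\<Sum>m\<in>A. Fract (Poly_Mapping.single (e m) (r m)) 1)"
  by (simp add: cst_def tmon_def mult_single)
 also have "\<dots> = Fract (\<Sum>m\<in>A. Poly_Mapping.single (e m) (r m)) 1"
  by (induction A rule: infinite_finite_induct) (auto simp: Zero_fract_def)
 finally have eq: "(\<Sum>m\<in>A. cst (r m) * tmon (e m)) = Fract (\<Sum>m\<in>A. Poly_Mapping.single (e m) (r m)) 1" .
 obtain m0 where m0: "m0 \<in> A" using assms by auto
 have "Poly_Mapping.lookup (\<Sum>m\<in>A. Poly_Mapping.single (e m) (r m)) (e m0) = (\<Sum>m\<in>A. if m = m0 then r m else 0)"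
  unfolding lookup_sum using assms(4) m0 by (intro sum.cong) (auto simp: lookup_single when_def dest: inj_onD)
 also have "\<dots> = r m0" using assms(1) m0 by simp
 finally have "(\<Sum>m\<in>A. Poly_Mapping.single (e m) (r m)) ~= 0" using assms(3)[OF m0] by (metis lookup_zero)
 thus ?thesis unfolding eq by (simp add: Zero_fract_def eq_fract)
qed

context shape
begin

lemma hom_form:
 assumes "comm_ring_hom h"
 shows "h (form a) = form (%c. h (a c))"
proof -
 interpret comm_ring_hom h by fact
 show ?thesis by (simp add: form_def zpart_def hom_add hom_mult hom_sum hom_prod hom_power)
qed

text \<open>The coordinates w, v, u named by \<open>T_special\<close>: for either parity of d the
  term of w is w^d and the term of u is v u^(d-1).\<close>

definition cw :: nat where "cw = (if even d then Suc n else 1)"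
definition cv :: nat where "cv = (if even d then 1 else 0)"
definition cu :: nat where "cu = (if even d then 0 else Suc n)"

lemma c_distinct [simp]: "cw ~= cv" "cu ~= cv" "cu ~= cw" "cv ~= cw" "cv ~= cu" "cw ~= cu"
 using n_pos by (auto simp: cw_def cv_def cu_def)

lemma c_le [simp]: "cw \<le> Suc N" "cv \<le> Suc N" "cu \<le> Suc N"
 using n_le n_pos by (auto simp: cw_def cv_def cu_def)

text \<open>
 With coordinates scaled by these powers of \<open>\<epsilon>\<close> the lowest term of the special form is
 \<open>\<epsilon>\<^sup>d (w\<^sup>d + v u\<^bsup>d-1\<^esup>)\<close>, so that Hensel's lemma solves the equation for \<open>v\<close>.
\<close>

definition wt :: "nat + nat => nat" where
 "wt x = (if x = Inl cu then 0 else if x = Inl cw then 1 else if x = Inl cv then d else 2 * d)"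

text \<open>A coordinate c other than u and w has weight at least d and enters its own term with
  exponent at least two, which gives at least 2 d > d. The z-term contains both w, of weight 1, and
  v, of weight d.\<close>

lemma form_weighted:
 fixes x :: "'a :: comm_ring_1"
 shows "\<exists>R. form (%c. x ^ wt (Inl c) * t c) = x ^ d * (t cw ^ d + t cv * t cu ^ (d - 1) + x * R)"
proof -
 let ?a = "%c. x ^ wt (Inl c) * t c"
 let ?m = "%c. (\<Prod>j\<in>T c. ?a j) * ?a c ^ (d - card (T c))"
 have d: "d \<ge> 3" using n_d n_pos by auto
 have w: "?m cw = x ^ d * t cw ^ d"
 proof (cases "even d")
  case True
  hence "T cw = {}" using T_special by (simp add: cw_def)
  thus ?thesis by (simp add: wt_def power_mult_distrib)
 next
  case False
  hence "T cw = {cw}" using T_special by (simp add: cw_def)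
  moreover have "(x * t cw) * (x * t cw) ^ (d - 1) = x ^ d * t cw ^ d"
  using d by (cases d) (auto simp: power_mult_distrib)
  ultimately show ?thesis by (simp add: wt_def)
 qed
 have u: "?m cu = x ^ d * (t cv * t cu ^ (d - 1))"
 proof (cases "even d")
  case True
  hence "T cu = {cu, cv}" using T_special by (simp add: cu_def cv_def)
  moreover have "t cu * t cu ^ (d - Suc (Suc 0)) = t cu ^ (d - Suc 0)"
  proof -
  have "d - Suc 0 = Suc (d - Suc (Suc 0))" using d by simp
  thus ?thesis by simp
  qed
  ultimately show ?thesis by (simp add: wt_def mult_ac)
 next
  case False
  hence "T cu = {cv}" using T_special by (simp add: cu_def cv_def)
  thus ?thesis by (simp add: wt_def mult_ac)
 qed
 have other: "x ^ Suc d dvd ?m c" if "c \<le> Suc N" "c ~= cu" "c ~= cw" for c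
 proof -
  have "d \<le> wt (Inl c)" using that by (auto simp: wt_def)
  hence "x ^ d dvd ?a c" by (intro dvd_mult2 le_imp_power_dvd)
  hence "(x ^ d) ^ 2 dvd ?a c ^ (d - card (T c))"
  using T_card[OF that(1)] by (intro dvd_power_le) auto
  moreover have "x ^ Suc d dvd x ^ (d * 2)" using d by (intro le_imp_power_dvd) auto
  hence "x ^ Suc d dvd (x ^ d) ^ 2" by (simp only: power_mult)
  ultimately show ?thesis using dvd_trans dvd_mult by blast
 qed
 have z: "x ^ Suc d dvd zpart ?a"
 proof -
  have p1: "?a 1 dvd (\<Prod>j=1..n. ?a j)" using n_pos by (intro dvd_prodI) auto
  show ?thesis
  proof (cases "even d")
  case True
  hence "x dvd ?a (Suc n)" "x ^ d dvd ?a 1" using n_pos by (auto simp: wt_def cu_def cw_def cv_def)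
  thus ?thesis unfolding zpart_def power_Suc using p1
  by (meson dvd_mult2 dvd_trans mult_dvd_mono)
  next
  case False
  hence "x ^ d dvd ?a 0" "x dvd ?a 1" using n_pos by (auto simp: wt_def cu_def cw_def cv_def)
  moreover have "?a 0 dvd ?a 0 ^ (d - 1 - n)" using n_d by (intro dvd_power) auto
  ultimately have "x ^ d * x dvd ?a 0 ^ (d - 1 - n) * (\<Prod>j=1..n. ?a j)"
  using p1 by (meson dvd_trans mult_dvd_mono)
  thus ?thesis unfolding zpart_def power_Suc by (simp add: mult.assoc mult.commute[of x])
  qed
 qed
 have "x ^ Suc d dvd zpart ?a + (\<Sum>c\<in>{..Suc N} - {cw} - {cu}. ?m c)"
  using z other by (intro dvd_add dvd_sum) auto
 then obtain R where R: "zpart ?a + (\<Sum>c\<in>{..Suc N} - {cw} - {cu}. ?m c) = x ^ Suc d * R" by blast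
 have "(\<Sum>c\<le>Suc N. ?m c) = ?m cw + (?m cu + (\<Sum>c\<in>{..Suc N} - {cw} - {cu}. ?m c))"
  by (subst sum.remove[of _ cw], simp, simp, subst sum.remove[of _ cu]) auto
 hence "form ?a = ?m cw + ?m cu + (zpart ?a + (\<Sum>c\<in>{..Suc N} - {cw} - {cu}. ?m c))"
  unfolding form_def by (simp only: ac_simps)
 also have "\<dots> = x ^ d * (t cw ^ d + t cv * t cu ^ (d - 1) + x * R)"
  unfolding R w u by (simp add: algebra_simps)
 finally show ?thesis by blast
qed

text \<open>The coordinates of the hypersurface and those of the projective factor become variables
  of one rational function field.\<close>

definition enc :: "nat + nat => nat" where
 "enc = case_sum (%c. 2 * c) (%i. 2 * i + 1)"

lemma enc_eq_iff [simp]: "enc x = enc y \<longleftrightarrow> x = y"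
 by (cases x; cases y) (auto simp: enc_def; presburger)+

abbreviation tv :: "nat + nat => ('o :: field) ratf" where
 "tv x \<equiv> tvar (enc x)"

text \<open>The equation is linear in v at lowest order, with invertible coefficient u^(d-1); the
  sign of the root disappears in characteristic two. The third conclusion says that the point is a
  simple root in v, which permits a second use of Hensel's lemma in the outer variable.\<close>

lemma special_root:
 assumes char2: "(2 :: 'o :: field) = 0"
 obtains nu :: "('o :: field) ratf fps" where
  "fps_nth nu 0 * tv (Inl cu) ^ (d - 1) = tv (Inl cw) ^ d"
  "form (%c. fps_X ^ wt (Inl c) * (if c = cv then nu else fps_const (tv (Inl c)))) = 0"
  "poly (pderiv (form (%c. if c = cv then [:0, 1:] else [:fls_X ^ wt (Inl c) * fls_const (tv (Inl c)):])))
  (fls_X ^ d * fps_to_fls nu) ~= 0"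
proof -
 interpret cs: comm_ring_hom "cst :: 'o => _" by (rule comm_ring_hom_cst)
 have "cst (2 :: 'o) = 2" by (metis cs.hom_add cs.hom_one one_add_one)
 hence c2: "(2 :: 'o ratf) = 0" using char2 by simp
 define t :: "nat => 'o ratf fps poly" where
  "t = (%c. if c = cv then [:0, 1:] else [:fps_const (tv (Inl c)):])"
 obtain R where R: "form (%c. [:fps_X:] ^ wt (Inl c) * t c) = [:fps_X:] ^ d * (t cw ^ d + t cv * t cu ^ (d - 1) + [:fps_X:] * R)"
  using form_weighted[of "[:fps_X:]" t] by blast
 define q where "q = t cw ^ d + t cv * t cu ^ (d - 1) + [:fps_X:] * R"
 interpret m0: comm_ring_hom "map_poly (%f :: 'o ratf fps. fps_nth f 0)"
  by (rule comm_ring_hom_map_poly[OF comm_ring_hom_fps_nth_0])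
 have "map_poly (%f. fps_nth f 0) (smult fps_X R) = 0"
  by (rule poly_eqI) (simp add: coeff_map_poly fps_mult_nth_0)
 hence q0: "map_poly (%f. fps_nth f 0) q = [: tv (Inl cw) ^ d, tv (Inl cu) ^ (d - 1) :]"
  by (simp add: q_def t_def m0.hom_add m0.hom_mult m0.hom_power map_poly_pCons flip: pCons_one)
  (simp add: poly_const_pow)
 let ?r0 = "- (tv (Inl cw) ^ d / tv (Inl cu) ^ (d - 1)) :: 'o ratf"
 obtain nu where nu: "fps_nth nu 0 = ?r0" "poly q nu = 0"
  by (rule hensel_fps[of q ?r0]) (auto simp: q0 pderiv_pCons)
 have "fps_nth nu 0 * tv (Inl cu) ^ (d - 1) = - (tv (Inl cw) ^ d)" by (simp add: nu)
 also have "\<dots> = tv (Inl cw) ^ d" using double_eq_0_char2[OF c2] by (metis minus_unique)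
 finally have 1: "fps_nth nu 0 * tv (Inl cu) ^ (d - 1) = tv (Inl cw) ^ d" .
 have ev: "comm_ring_hom (%p. poly p nu)" by (rule comm_ring_homI) auto
 have "form (%c. poly ([:fps_X:] ^ wt (Inl c) * t c) nu) = poly ([:fps_X:] ^ d * q) nu"
  unfolding q_def R[symmetric] by (rule hom_form[OF ev, symmetric])
 hence "form (%c. poly ([:fps_X:] ^ wt (Inl c) * t c) nu) = 0" using nu(2) by simp
 moreover have "poly ([:fps_X:] ^ wt (Inl c) * t c) nu = fps_X ^ wt (Inl c) * (if c = cv then nu else fps_const (tv (Inl c)))" for c
  by (simp add: t_def poly_power)
 ultimately have 2: "form (%c. fps_X ^ wt (Inl c) * (if c = cv then nu else fps_const (tv (Inl c)))) = 0" by simp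
 define Ph where "Ph = form (%c. if c = cv then [:0, 1:] else [:fls_X ^ wt (Inl c) * fls_const (tv (Inl c) :: 'o ratf):])"
 let ?F = "map_poly fps_to_fls :: 'o ratf fps poly => _"
 interpret F: comm_ring_hom ?F by (rule comm_ring_hom_map_poly[OF comm_ring_hom_fps_to_fls])
 interpret fl: comm_ring_hom "fps_to_fls :: 'o ratf fps => _" by (rule comm_ring_hom_fps_to_fls)
 \<comment> \<open>\<open>Ph\<close> uses the unscaled coordinate v, \<open>q\<close> the one
   divided by the power given by its weight d; the chain rule carries the nonvanishing derivative
   over.\<close>
 have "pcompose Ph [:0, fls_X ^ d:] = form (%c. ?F ([:fps_X:] ^ wt (Inl c) * t c))"
  unfolding Ph_def hom_form[OF comm_ring_hom_pcompose]
  by (intro arg_cong[of _ _ form] ext)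
  (auto simp: t_def F.hom_mult F.hom_power map_poly_pCons fps_to_fls_power fls_times_fps_to_fls poly_const_pow wt_def pcompose_pCons split: if_splits)
 also have "\<dots> = ?F ([:fps_X:] ^ d * q)"
  unfolding q_def R[symmetric] by (rule hom_form[symmetric]) (rule F.comm_ring_hom_axioms)
 also have "\<dots> = smult (fls_X ^ d) (?F q)"
  by (intro poly_eqI) (simp add: poly_const_pow coeff_map_poly fls_times_fps_to_fls fps_to_fls_power)
 finally have "pderiv (pcompose Ph [:0, fls_X ^ d:]) = smult (fls_X ^ d) (pderiv (?F q))" by (simp add: pderiv_smult)
 from arg_cong[OF this, of "%p. poly p (fps_to_fls nu)"]
 have "poly (pderiv Ph) (fls_X ^ d * fps_to_fls nu) * fls_X ^ d = fls_X ^ d * poly (pderiv (?F q)) (fps_to_fls nu)"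
  by (simp add: pderiv_pcompose poly_pcompose pderiv_pCons mult.commute)
 moreover have "poly (pderiv (?F q)) (fps_to_fls nu) = fps_to_fls (poly (pderiv q) nu)"
 proof -
  have "pderiv (?F q) = ?F (pderiv q)"
  by (rule poly_eqI) (simp add: coeff_pderiv coeff_map_poly fl.hom_mult)
  moreover have "poly (?F p) (fps_to_fls nu) = fps_to_fls (poly p nu)" for p
  by (induction p) (auto simp: map_poly_pCons fl.hom_mult)
  ultimately show ?thesis by simp
 qed
 moreover have "fps_nth (poly (pderiv q) nu) 0 ~= 0"
 proof -
  have "fps_nth (poly p nu) 0 = poly (map_poly (%f. fps_nth f 0) p) (fps_nth nu 0)" for p
  by (induction p) (auto simp: map_poly_pCons fps_mult_nth_0)
  moreover have "map_poly (%f. fps_nth f 0) (pderiv q) = pderiv (map_poly (%f. fps_nth f 0) q)"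
  by (rule poly_eqI) (simp add: coeff_map_poly coeff_pderiv)
  ultimately show ?thesis by (simp add: q0 pderiv_pCons)
 qed
 hence "fps_to_fls (poly (pderiv q) nu) ~= 0" by auto
 ultimately have 3: "poly (pderiv Ph) (fls_X ^ d * fps_to_fls nu) ~= 0" by auto
 show ?thesis using that[OF 1 2] 3 unfolding Ph_def by blast
qed

text \<open>A generic point of the product of the special hypersurface with the remaining
  coordinates: all coordinates but v are independent variables up to their weight factors.\<close>

definition pt :: "('o :: field) ratf fps => nat + nat => 'o ratf fls" where
 "pt nu x = fls_X ^ wt x * fps_to_fls (if x = Inl cv then nu else fps_const (tv x))"

text \<open>The bound on the exponent of w describes remainders modulo the equation. To lowest order
  v is w^d / u^(d-1), so a monomial acquires w-exponent
  \<open>count m (Inl cw) + d * count m (Inl cv)\<close>; division by d recovers both counts, hence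
  distinct monomials of the lowest weight stay distinct.\<close>

lemma pt_generic:
 fixes r :: "(nat + nat) multiset => 'o :: field"
 assumes nu: "fps_nth nu 0 * tv (Inl cu) ^ (d - 1) = tv (Inl cw) ^ d"
  and A: "finite A" "A ~= {}" "!!m. m \<in> A ==> r m ~= 0" "!!m. m \<in> A ==> count m (Inl cw) < d"
 shows "(\<Sum>m\<in>A. fls_const (cst (r m)) * (\<Prod>x\<in>#m. pt nu x)) ~= 0"
proof -
 define w where "w = (%m. \<Sum>x\<in>#m. wt x)"
 define tt where "tt = (%x. if x = Inl cv then nu else fps_const (tv x))"
 define t0 where "t0 = (%x. if x = Inl cv then fps_nth nu 0 else tv x)"
 have prod: "(\<Prod>x\<in>#m. pt nu x) = fls_X ^ w m * fps_to_fls (\<Prod>x\<in>#m. tt x)" for m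
  by (induction m) (auto simp: w_def tt_def pt_def power_add fls_times_fps_to_fls mult_ac)
 have tt0: "fps_nth (\<Prod>x\<in>#m. tt x) 0 = (\<Prod>x\<in>#m. t0 x)" for m
  by (induction m) (auto simp: tt_def t0_def fps_mult_nth_0)
 define mu where "mu = Min (w ` A)"
 have le: "mu \<le> w m" if "m \<in> A" for m unfolding mu_def using A that by (intro Min_le) auto
 define A0 where "A0 = {m \<in> A. w m = mu}"
 have "mu \<in> w ` A" unfolding mu_def using A by (intro Min_in) auto
 hence A0: "finite A0" "A0 ~= {}" "A0 \<subseteq> A" using A by (auto simp: A0_def)
 have coeff: "fls_nth (fls_const (cst (r m)) * (\<Prod>x\<in>#m. pt nu x)) (int mu) =
  (if w m = mu then cst (r m) * (\<Prod>x\<in>#m. t0 x) else 0)" if "m \<in> A" for m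
 proof -
  have "fls_nth (fls_X ^ w m * fps_to_fls G) (int mu) = (if w m = mu then fps_nth G 0 else 0)" for G :: "'o ratf fps"
  using le[OF that] by (simp add: fls_X_power_times_conv_shift(1))
  thus ?thesis unfolding prod by (simp add: tt0)
 qed
 \<comment> \<open>The power u^((d-1) K) clears the denominators of all monomials at once.\<close>
 define K where "K = Max ((%m. count m (Inl cv)) ` A)"
 have K: "count m (Inl cv) \<le> K" if "m \<in> A" for m unfolding K_def using A that by (intro Max_ge) auto
 define e where "e = (%m. (\<Sum>x\<in>#filter_mset (%x. x ~= Inl cv) m. Poly_Mapping.single (enc x) 1) +
  (Poly_Mapping.single (enc (Inl cw)) (d * count m (Inl cv)) +
  Poly_Mapping.single (enc (Inl cu)) ((d - 1) * (K - count m (Inl cv)))) :: nat \<Rightarrow>\<^sub>0 nat)"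
 have e: "(\<Prod>x\<in>#m. t0 x) * tv (Inl cu) ^ ((d - 1) * K) = tmon (e m)" if "m \<in> A" for m
 proof -
  let ?k = "count m (Inl cv)"
  have "m = filter_mset (%x. x ~= Inl cv) m + replicate_mset ?k (Inl cv)"
  by (rule multiset_eqI) auto
  hence "(\<Prod>x\<in>#m. t0 x) = (\<Prod>x\<in>#filter_mset (%x. x ~= Inl cv) m. t0 x) * fps_nth nu 0 ^ ?k"
  by (metis (no_types, lifting) image_mset_union prod_mset.union image_replicate_mset prod_mset_replicate_mset t0_def)
  also have "(\<Prod>x\<in>#filter_mset (%x. x ~= Inl cv) m. t0 x) = (\<Prod>x\<in>#filter_mset (%x. x ~= Inl cv) m. tv x)"
  by (intro arg_cong[of _ _ prod_mset] image_mset_cong) (auto simp: t0_def)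
  finally have 1: "(\<Prod>x\<in>#m. t0 x) = tmon (\<Sum>x\<in>#filter_mset (%x. x ~= Inl cv) m. Poly_Mapping.single (enc x) 1) * fps_nth nu 0 ^ ?k"
  by (simp add: tmon_prod_mset)
  have "(d - 1) * K = (d - 1) * ?k + (d - 1) * (K - ?k)"
  using K[OF that] by (simp flip: add_mult_distrib2)
  hence "tv (Inl cu) ^ ((d - 1) * K) = ((tv (Inl cu) ^ (d - 1)) ^ ?k * tv (Inl cu) ^ ((d - 1) * (K - ?k)) :: 'o ratf)"
  by (simp only: power_add power_mult)
  hence "fps_nth nu 0 ^ ?k * tv (Inl cu) ^ ((d - 1) * K) = (tv (Inl cw) ^ d) ^ ?k * tv (Inl cu) ^ ((d - 1) * (K - ?k))"
  unfolding nu[symmetric] by (simp add: power_mult_distrib mult_ac)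
  also have "\<dots> = tmon (Poly_Mapping.single (enc (Inl cw)) (d * ?k) + Poly_Mapping.single (enc (Inl cu)) ((d - 1) * (K - ?k)))"
  by (simp only: power_mult[symmetric]) (simp only: tvar_power tmon_add)
  finally show ?thesis unfolding 1 e_def tmon_add by (simp add: mult_ac)
 qed
 have look: "Poly_Mapping.lookup (\<Sum>x\<in>#m. Poly_Mapping.single (enc x) (1::nat)) (enc y) = count m y" for m :: "(nat + nat) multiset" and y
  by (induction m) (auto simp: lookup_add lookup_single when_def)
 have lk: "Poly_Mapping.lookup (e m) (enc y) = (if y = Inl cv then 0 else count m y) +
  ((if y = Inl cw then d * count m (Inl cv) else 0) + (if y = Inl cu then (d - 1) * (K - count m (Inl cv)) else 0))" for m y
  unfolding e_def by (simp add: lookup_add look[unfolded One_nat_def] lookup_single when_def)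
 have inj: "inj_on e A0"
 proof (rule inj_onI)
  fix m m' assume mm: "m \<in> A0" "m' \<in> A0" "e m = e m'"
  hence A': "m \<in> A" "m' \<in> A" using A0(3) by auto
  have eq: "Poly_Mapping.lookup (e m) (enc y) = Poly_Mapping.lookup (e m') (enc y)" for y using mm(3) by simp
  have "count m (Inl cw) + d * count m (Inl cv) = count m' (Inl cw) + d * count m' (Inl cv)"
  using eq[of "Inl cw"] unfolding lk by simp
  moreover have "(count m (Inl cw) + d * count m (Inl cv)) div d = count m (Inl cv)" if "m \<in> A" for m
  using A(4)[OF that] by simp
  ultimately have v: "count m (Inl cv) = count m' (Inl cv)" using A' by metis
  show "m = m'"
  proof (rule multiset_eqI)
  fix y show "count m y = count m' y" using v eq[of y, unfolded lk v] by (cases "y = Inl cv") auto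
  qed
 qed
 have "fls_nth (\<Sum>m\<in>A. fls_const (cst (r m)) * (\<Prod>x\<in>#m. pt nu x)) (int mu) = (\<Sum>m\<in>A0. cst (r m) * (\<Prod>x\<in>#m. t0 x))"
 proof -
  have "fls_nth (\<Sum>m\<in>A. fls_const (cst (r m)) * (\<Prod>x\<in>#m. pt nu x)) (int mu) =
  (\<Sum>m\<in>A. if w m = mu then cst (r m) * (\<Prod>x\<in>#m. t0 x) else 0)"
  unfolding fls_nth_sum by (intro sum.cong refl coeff)
  thus ?thesis using A(1) by (simp add: A0_def sum.inter_filter)
 qed
 also have "\<dots> * tv (Inl cu) ^ ((d - 1) * K) = (\<Sum>m\<in>A0. cst (r m) * tmon (e m))"
  unfolding sum_distrib_right mult.assoc using e A0(3) by (intro sum.cong) auto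
 also have "\<dots> ~= 0" using A0 A(3) inj by (intro tmon_independent) auto
 finally show ?thesis by auto
qed

text \<open>Derivation 1 is along z, the coordinate \<open>Suc n\<close>; for
  \<open>i \<ge> 2\<close> it is along coordinate \<open>i\<close>. Of the coordinates 0 and 1 one
  is v, which is detected by z, and the other is left to row 0.\<close>

definition dlogs :: "nat => ('o :: field) ratf fls => 'o ratf fls" where
 "dlogs i = (if i = 0 then (%a. a) else fls_map (dlog (enc (Inl (if i = 1 then Suc n else i)))))"

lemma char2_ratf:
 assumes "(2 :: 'o :: field) = 0"
 shows "(2 :: ('o :: field) ratf) = 0"
proof -
 interpret cs: comm_ring_hom "cst :: 'o => _" by (rule comm_ring_hom_cst)
 have "cst (2 :: 'o) = 2" by (metis cs.hom_add cs.hom_one one_add_one)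
 thus ?thesis using assms by simp
qed

lemma shape_deriv_dlogs:
 assumes "(2 :: 'o :: field) = 0"
 shows "shape_deriv N n d T (dlogs :: nat => ('o :: field) ratf fls => _)"
proof unfold_locales
 have "(2 :: 'o ratf fls) = fls_const 2" by simp
 thus "(2 :: 'o ratf fls) = 0" using char2_ratf[OF assms] by simp
qed (auto simp: dlogs_def intro!: derivation_fls_map derivation_dlog)

lemma fls_map_X_power_times:
 assumes "derivation D"
 shows "fls_map D (fls_X ^ k * fls_const c) = fls_X ^ k * fls_const (D c)"
 by (rule fls_eqI) (auto simp: fls_nth_map assms fls_X_power_times_conv_shift(1))

lemma dlogs_pt:
 assumes "1 \<le> i" "i \<le> n" "x ~= Inl cv"
 shows "dlogs i (pt nu x) = (if x = Inl (if i = 1 then Suc n else i) then pt nu x else (0 :: ('o :: field) ratf fls))"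
proof -
 have "pt nu x = fls_X ^ wt x * fls_const (tv x)" using assms by (simp add: pt_def)
 thus ?thesis using assms by (auto simp: dlogs_def fls_map_X_power_times derivation_dlog dlog_tvar[unfolded One_nat_def])
qed

text \<open>If the z-derivation killed v, it would kill every term of the form except the one linear
  in z, which it fixes; the equation would force that nonzero term to vanish. So row 1 detects
  column v, rows \<open>i \<ge> 2\<close> detect their own columns, row 0 the last one, and the
  kernel is zero.\<close>

lemma winv_pt:
 fixes nu :: "('o :: field) ratf fps"
 assumes char2: "(2 :: 'o) = 0" and nu0: "fps_nth nu 0 ~= 0" and form0: "form (%c. pt nu (Inl c)) = 0"
 shows "shape_deriv.winv n dlogs (%c. pt nu (Inl c)) ~= 0"
proof -
 interpret S: shape_deriv N n d T "dlogs :: nat => 'o ratf fls => _" by (rule shape_deriv_dlogs[OF char2])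
 let ?p = "%c. pt nu (Inl c)"
 have p0: "?p c ~= 0" for c
 proof -
  have "nu ~= 0" using nu0 by auto
  thus ?thesis by (auto simp: pt_def)
 qed
 have vn: "cv \<le> 1" "cv \<le> n" using n_pos by (auto simp: cv_def)
 have D1: "derivation (dlogs 1 :: 'o ratf fls => _)" using S.D[of 1] n_pos by simp
 have D1p: "dlogs 1 (?p c) = (if c = Suc n then ?p c else 0)" if "c ~= cv" for c
  using dlogs_pt[of 1 "Inl c" nu] n_pos that by auto
 have D1v: "dlogs 1 (?p cv) ~= 0"
 proof
  assume v0: "dlogs 1 (?p cv) = 0"
  have D1x: "dlogs 1 (?p c) = 0" if "c ~= Suc n" for c
  using D1p[of c] v0 that by (cases "c = cv") auto
  have D1prod: "dlogs 1 (\<Prod>j\<in>A. ?p j) = 0" if "A \<subseteq> {..n}" for A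
  using that D1x finite_subset[OF that] by (subst derivation_prod[OF D1]) (auto intro!: sum.neutral)
  have D1pow: "dlogs 1 (?p c ^ k) = 0" if "even k" for c k
  unfolding derivation_power[OF D1] using that by (simp add: of_nat_char2[OF S.char2])
  have "dlogs 1 ((\<Prod>j\<in>T c. ?p j) * ?p c ^ (d - card (T c))) = 0" if "c \<le> Suc N" for c
  unfolding derivation_mult[OF D1] using D1prod[OF T_sub[OF that]] D1pow[OF T_even[OF that]] by simp
  hence "dlogs 1 (form ?p) = dlogs 1 (zpart ?p)"
  unfolding form_def derivation_add[OF D1] derivation_sum[OF D1] by simp
  also have "\<dots> = zpart ?p"
  proof -
  have "dlogs 1 (?p 0) = 0" using D1x by simp
  hence "dlogs 1 (?p 0 ^ (d - 1 - n)) = 0" unfolding derivation_power[OF D1] by simp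
  moreover have "dlogs 1 (\<Prod>j=1..n. ?p j) = 0" by (rule D1prod) auto
  moreover have "dlogs 1 (?p (Suc n)) = ?p (Suc n)" using D1p[of "Suc n"] vn n_pos by auto
  ultimately show ?thesis unfolding zpart_def derivation_mult[OF D1] by simp
  qed
  finally have "zpart ?p = 0" using form0 D1 by simp
  thus False using p0 by (simp add: zpart_def)
 qed
 have "det (sqmat n (%(i,j). dlogs i (?p j))) ~= 0"
 proof
  assume "det (sqmat n (%(i,j). dlogs i (?p j))) = 0"
  then obtain y where y: "y \<in> carrier_vec (Suc n)" "y ~= 0\<^sub>v (Suc n)"
  "sqmat n (%(i,j). dlogs i (?p j)) *\<^sub>v y = 0\<^sub>v (Suc n)"
  using det_0_iff_vec_prod_zero_field[of "sqmat n (%(i,j). dlogs i (?p j))" "Suc n"] by auto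
  have row: "(\<Sum>j\<le>n. dlogs i (?p j) * (y $ j)) = 0" if "i \<le> n" for i
  proof -
  have "(sqmat n (%(i,j). dlogs i (?p j)) *\<^sub>v y) $ i = 0" using y(3) that by simp
  thus ?thesis using that y(1) by (simp add: scalar_prod_def atLeast0LessThan lessThan_Suc_atMost del: sum.atMost_Suc sum.lessThan_Suc)
  qed
  have "(\<Sum>j\<le>n. dlogs 1 (?p j) * (y $ j)) = (\<Sum>j\<le>n. if j = cv then dlogs 1 (?p cv) * (y $ cv) else 0)"
  using D1p by (intro sum.cong) auto
  hence yv: "y $ cv = 0" using row[OF n_pos] D1v vn by simp
  have yi: "y $ i = 0" if i: "2 \<le> i" "i \<le> n" for i
  proof -
  have "(\<Sum>j\<le>n. dlogs i (?p j) * (y $ j)) = (\<Sum>j\<le>n. if j = i then ?p i * (y $ i) else 0)"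
  proof (intro sum.cong refl)
  fix j
  show "dlogs i (?p j) * (y $ j) = (if j = i then ?p i * (y $ i) else 0)"
  using yv dlogs_pt[of i "Inl j" nu] i vn by (cases "j = cv") auto
  qed
  thus ?thesis using row[OF i(2)] p0 i by simp
  qed
  have "(\<Sum>j\<le>n. dlogs 0 (?p j) * (y $ j)) = (\<Sum>j\<le>n. if j = 1 - cv then ?p (1 - cv) * (y $ (1 - cv)) else 0)"
  proof (intro sum.cong refl)
  fix j assume "j \<in> {..n}"
  hence "j = cv \<or> j = 1 - cv \<or> 2 \<le> j & j \<le> n" using vn by auto
  thus "dlogs 0 (?p j) * (y $ j) = (if j = 1 - cv then ?p (1 - cv) * (y $ (1 - cv)) else 0)"
  using yv yi vn by (auto simp: S.D0)
  qed
  moreover have "Suc 0 - cv \<le> n" using n_pos by simp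
  ultimately have y1: "y $ (1 - cv) = 0" using row[of 0] p0 by simp
  have "y $ j = 0" if "j \<le> n" for j
  proof -
  have "j = cv \<or> j = 1 - cv \<or> 2 \<le> j & j \<le> n" using vn that by auto
  thus ?thesis using yv yi y1 by auto
  qed
  hence "y = 0\<^sub>v (Suc n)" using y(1) by (intro eq_vecI) auto
  thus False using y(2) by simp
 qed
 thus ?thesis using p0 by (simp add: S.winv_def)
qed

end

section \<open>The obstruction\<close>

lemma finite_multisets_bounded: "finite A ==> finite {m. set_mset m \<subseteq> A & size m = k}"
proof -
 assume "finite A"
 have "{m. set_mset m \<subseteq> A & size m = k} \<subseteq> mset ` {xs. set xs \<subseteq> A & length xs = k}"
 proof
  fix m assume m: "m \<in> {m. set_mset m \<subseteq> A & size m = k}"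
  obtain xs where "mset xs = m" using ex_mset by blast
  thus "m \<in> mset ` {xs. set xs \<subseteq> A & length xs = k}" using m by (intro image_eqI[of _ _ xs]) auto
 qed
 thus ?thesis using finite_lists_length_eq[OF `finite A`] finite_surj by blast
qed

definition pev :: "('c :: zero => 'r) => ('v multiset => 'c) => ('v => 'r :: comm_ring_1) => 'r" where
 "pev io p a = mev {m. p m ~= 0} (%m. io (p m)) a"

text \<open>Monomials on the line q + X p: the lowest coefficient belongs to q, the top one to
  p.\<close>

lemma prod_mset_linear:
 fixes q p :: "'v => 'a :: comm_ring_1"
 shows "degree (\<Prod>x\<in>#m. [:q x, p x:]) \<le> size m &
  coeff (\<Prod>x\<in>#m. [:q x, p x:]) 0 = (\<Prod>x\<in>#m. q x) &
  coeff (\<Prod>x\<in>#m. [:q x, p x:]) (size m) = (\<Prod>x\<in>#m. p x)"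
proof (induction m)
 case (add x m)
 let ?P = "\<Prod>x\<in>#m. [:q x, p x:]"
 have d1: "degree [:q x, p x:] \<le> 1" by simp
 have "coeff ([:q x, p x:] * ?P) (1 + size m) = coeff [:q x, p x:] 1 * coeff ?P (size m)"
  using d1 add.IH by (intro coeff_mult_degree_bounds) auto
 moreover have "degree ([:q x, p x:] * ?P) \<le> 1 + size m"
  using degree_mult_le[of "[:q x, p x:]" ?P] d1 add.IH by linarith
 ultimately show ?case using add.IH by (simp add: coeff_mult_0)
qed auto

context shape
begin

definition zmono :: "nat multiset" where
 "zmono = {#Suc n#} + replicate_mset (d - 1 - n) 0 + mset_set {1..n}"

definition cmono :: "nat => nat multiset" where
 "cmono c = mset_set (T c) + replicate_mset (d - card (T c)) c"

definition form_coeff :: "nat multiset => 'o :: comm_ring_1" where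
 "form_coeff m = of_bool (m = zmono) + (\<Sum>c\<le>Suc N. of_bool (m = cmono c))"

definition mons :: "nat multiset set" where
 "mons = {m. set_mset m \<subseteq> {..Suc N} & size m = d}"

lemma finite_mons: "finite mons"
 unfolding mons_def by (rule finite_multisets_bounded) auto

lemma zmono_mons: "zmono \<in> mons"
 using n_d n_le by (auto simp: zmono_def mons_def)

lemma cmono_mons: "c \<le> Suc N ==> cmono c \<in> mons"
 using finite_T[of c] T_sub[of c] T_card[of c] n_le by (auto simp: cmono_def mons_def)

text \<open>z occurs exactly once on the left and an even number of times on the right.\<close>

lemma zmono_neq_cmono:
 assumes "c \<le> Suc N"
 shows "zmono ~= cmono c"
proof
 assume "zmono = cmono c"
 hence "count zmono (Suc n) = count (cmono c) (Suc n)" by simp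
 moreover have "Suc n \<notin> T c" using T_sub[OF assms] by auto
 ultimately have "1 = (if c = Suc n then d - card (T c) else 0)"
  by (simp add: zmono_def cmono_def finite_T[OF assms])
 thus False using T_even[OF assms] by (metis odd_one zero_neq_one)
qed

text \<open>The equation at a point is normalized at \<open>zmono\<close>, so its coefficient there
  is 1 and has to specialize to 1.\<close>

lemma form_coeff_zmono: "form_coeff zmono = 1"
 using zmono_neq_cmono by (simp add: form_coeff_def)

lemma form_eq_mev:
 assumes "comm_ring_hom h"
 shows "mev mons (%m. h (form_coeff m)) a = form a"
proof -
 interpret comm_ring_hom h by fact
 have ob: "h (of_bool b) = of_bool b" for b by (cases b) auto
 have single: "(\<Sum>m\<in>mons. of_bool (m = m0) * (\<Prod>x\<in>#m. a x)) = (\<Prod>x\<in>#m0. a x)" if "m0 \<in> mons" for m0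
  using finite_mons that by (simp add: of_bool_def if_distrib[of "%x. x * _"] cong: if_cong)
 have hf: "h (form_coeff m) = of_bool (m = zmono) + (\<Sum>c\<le>Suc N. of_bool (m = cmono c))" for m
  by (simp only: form_coeff_def hom_add hom_sum ob)
 have "mev mons (%m. h (form_coeff m)) a = (\<Sum>m\<in>mons. of_bool (m = zmono) * (\<Prod>x\<in>#m. a x)) +
  (\<Sum>m\<in>mons. \<Sum>c\<le>Suc N. of_bool (m = cmono c) * (\<Prod>x\<in>#m. a x))"
  by (simp only: mev_def hf distrib_right sum.distrib sum_distrib_right)
 also have "(\<Sum>m\<in>mons. \<Sum>c\<le>Suc N. of_bool (m = cmono c) * (\<Prod>x\<in>#m. a x)) =
  (\<Sum>c\<le>Suc N. \<Sum>m\<in>mons. of_bool (m = cmono c) * (\<Prod>x\<in>#m. a x))" by (rule sum.swap)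
 also have "\<dots> = (\<Sum>c\<le>Suc N. \<Prod>x\<in>#cmono c. a x)"
  by (intro sum.cong refl single cmono_mons) auto
 also have "\<dots> = (\<Sum>c\<le>Suc N. (\<Prod>j\<in>T c. a j) * a c ^ (d - card (T c)))"
  by (intro sum.cong) (auto simp: cmono_def prod_unfold_prod_mset)
 also have "(\<Sum>m\<in>mons. of_bool (m = zmono) * (\<Prod>x\<in>#m. a x)) = zpart a"
  unfolding single[OF zmono_mons] by (simp add: zmono_def zpart_def prod_unfold_prod_mset mult_ac)
 finally show ?thesis by (simp add: form_def)
qed

definition emb :: "'o :: field => 'o ratf fls" where
 "emb c = fls_const (cst c)"

text \<open>The outer variable is kept while the constants move into the field over which the
  generic point of the special form lives.\<close>

definition lift :: "('o :: field) fls => 'o ratf fls fls" where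
 "lift = fls_map emb"

lemma comm_ring_hom_fls_const: "comm_ring_hom (fls_const :: 'a :: comm_ring_1 => _)"
 by (rule comm_ring_homI) (auto simp: fls_plus_const)

lemma comm_ring_hom_emb: "comm_ring_hom (emb :: 'o :: field => _)"
proof -
 interpret a: comm_ring_hom "cst :: 'o => _" by (rule comm_ring_hom_cst)
 interpret b: comm_ring_hom "fls_const :: 'o ratf => _" by (rule comm_ring_hom_fls_const)
 show ?thesis unfolding emb_def
  by (rule comm_ring_homI) (simp_all only: a.hom_add a.hom_mult a.hom_one b.hom_add b.hom_mult b.hom_one)
qed

lemma emb_0 [simp]: "emb 0 = 0"
proof -
 interpret comm_ring_hom "emb :: 'a => _" by (rule comm_ring_hom_emb)
 show ?thesis by simp
qed

lemma comm_ring_hom_lift: "comm_ring_hom (lift :: ('o :: field) fls => _)"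
 unfolding lift_def by (rule comm_ring_hom_fls_map[OF comm_ring_hom_emb])

lemma nth_lift: "fls_nth (lift f) i = emb (fls_nth f i)"
 unfolding lift_def by (rule fls_nth_map) simp

lemma fls_nth_lift_times:
 assumes "!!i. i < mu ==> fls_nth f i = 0"
 shows "fls_nth (lift f * fps_to_fls G) mu = emb (fls_nth f mu) * fps_nth G 0"
 by (subst fls_times_nth_bounds[of mu _ 0]) (auto simp: nth_lift assms)

text \<open>The lowest coefficient in the outer variable is a polynomial with constant coefficients
  at the reduced point, and \<open>gen\<close> says that it does not vanish.\<close>

lemma pev_lift_nonzero:
 fixes p :: "'v multiset => ('o :: field) fls"
 assumes fin: "finite {m. p m ~= 0}" and nz: "\<exists>m. p m ~= 0"
  and gen: "!!A r. finite A ==> A ~= {} ==> A \<subseteq> {m. p m ~= 0} ==> (!!m. m \<in> A ==> r m ~= 0) ==>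
  (\<Sum>m\<in>A. emb (r m) * (\<Prod>x\<in>#m. fps_nth (et x) 0)) ~= 0"
 shows "pev lift p (%x. fps_to_fls (et x)) ~= 0"
proof -
 let ?S = "{m. p m ~= 0}"
 define mu where "mu = Min ((%m. fls_subdegree (p m)) ` ?S)"
 have le: "mu \<le> fls_subdegree (p m)" if "p m ~= 0" for m unfolding mu_def using fin that by (intro Min_le) auto
 have "mu \<in> (%m. fls_subdegree (p m)) ` ?S" unfolding mu_def using fin nz by (intro Min_in) auto
 then obtain m0 where m0: "p m0 ~= 0" "mu = fls_subdegree (p m0)" by auto
 define A where "A = {m \<in> ?S. fls_nth (p m) mu ~= 0}"
 have A: "finite A" "m0 \<in> A" "A \<subseteq> ?S" using fin m0 by (auto simp: A_def)
 have prod: "(\<Prod>x\<in>#m. fps_to_fls (et x)) = fps_to_fls (\<Prod>x\<in>#m. et x)" for m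
  by (induction m) (auto simp: fls_times_fps_to_fls)
 have prod0: "fps_nth (\<Prod>x\<in>#m. et x) 0 = (\<Prod>x\<in>#m. fps_nth (et x) 0)" for m
  by (induction m) (auto simp: fps_mult_nth_0)
 have "fls_nth (pev lift p (%x. fps_to_fls (et x))) mu = (\<Sum>m\<in>?S. emb (fls_nth (p m) mu) * (\<Prod>x\<in>#m. fps_nth (et x) 0))"
  unfolding pev_def mev_def fls_nth_sum prod
 proof (intro sum.cong refl)
  fix m assume "m \<in> ?S"
  hence "fls_nth (p m) i = 0" if "i < mu" for i using le[of m] that by (intro fls_eq0_below_subdegree) auto
  thus "fls_nth (lift (p m) * fps_to_fls (\<Prod>x\<in>#m. et x)) mu = emb (fls_nth (p m) mu) * (\<Prod>x\<in>#m. fps_nth (et x) 0)"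
  by (simp only: fls_nth_lift_times prod0)
 qed
 also have "\<dots> = (\<Sum>m\<in>A. emb (fls_nth (p m) mu) * (\<Prod>x\<in>#m. fps_nth (et x) 0))"
  using fin by (intro sum.mono_neutral_right) (auto simp: A_def)
 also have "\<dots> ~= 0" using A by (intro gen) (auto simp: A_def)
 finally show ?thesis by auto
qed

text \<open>\<open>Fg\<close> says that \<open>g\<close> maps into the hypersurface,
  \<open>rel\<close> that g(f(a)) is proportional to a on it. \<open>RG\<close> and
  \<open>RH\<close> are remainders of low w-degree, so that \<open>pt_generic\<close> makes them
  nonzero at the lift of the generic point. \<open>newton\<close> then identifies the invariant of
  that point with the invariant of the limit of g at independent constants of the first
  derivation.\<close>

theorem obstruction:
 fixes F :: "nat multiset => ('o :: field) fls" and F' :: "nat multiset => 'o fps"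
  and g :: "nat => nat multiset => 'o fls" and f :: "nat => (nat + nat) multiset => 'o fls"
  and RG RH :: "(nat + nat) multiset => 'o fls"
 defines "val \<equiv> (%p (a :: nat + nat => 'o ratf fls fls). pev lift p a)"
 defines "G \<equiv> (%i a. pev lift (g i) (%j. val (f j) a))"
 assumes char2: "(2 :: 'o) = 0"
  and F: "!!m. m \<in> mons ==> F m = fps_to_fls (F' m)" "!!m. m \<in> mons ==> fps_nth (F' m) 0 = form_coeff m"
  and g: "!!i. i \<le> Suc N ==> finite {m. g i m ~= 0}" "!!i m. i \<le> Suc N ==> g i m ~= 0 ==> size m = e"
  and Fg: "!!a. mev mons (%m. [:lift (F m):]) (%i. pev (%c. [:lift c:]) (g i) a) = 0"
  and R: "finite {m. RG m ~= 0}" "\<exists>m. RG m ~= 0" "!!m. RG m ~= 0 ==> count m (Inl cw) < d"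
  "finite {m. RH m ~= 0}" "\<exists>m. RH m ~= 0" "!!m. RH m ~= 0 ==> count m (Inl cw) < d"
  and rel: "!!a i j. mev mons (%m. lift (F m)) (%c. a (Inl c)) = 0 ==> i \<le> Suc N ==> j \<le> Suc N ==>
  val RH a * (a (Inl j) * G i a - a (Inl i) * G j a) = 0"
  and i0: "i0 \<le> Suc N" "!!a. mev mons (%m. lift (F m)) (%c. a (Inl c)) = 0 ==> G i0 a = val RG a"
 shows False
proof -
 interpret em: comm_ring_hom "emb :: 'o => _" by (rule comm_ring_hom_emb)
 interpret S: shape_deriv N n d T "dlogs :: nat => 'o ratf fls => _" by (rule shape_deriv_dlogs[OF char2])
 obtain nu :: "'o ratf fps" where nu: "fps_nth nu 0 * tv (Inl cu) ^ (d - 1) = tv (Inl cw) ^ d"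
  and nu2: "form (%c. fps_X ^ wt (Inl c) * (if c = cv then nu else fps_const (tv (Inl c)))) = 0"
  and nu3: "poly (pderiv (form (%c. if c = cv then [:0, 1:] else [:fls_X ^ wt (Inl c) * fls_const (tv (Inl c)):])))
  (fls_X ^ d * fps_to_fls nu) ~= 0"
  by (rule special_root[OF char2])
 have nu0: "fps_nth nu 0 ~= 0" using nu tmon_nonzero by (metis mult_zero_left power_eq_0_iff)
 have form_pt: "form (%c. pt nu (Inl c)) = 0"
 proof -
  have "fps_to_fls (form (%c. fps_X ^ wt (Inl c) * (if c = cv then nu else fps_const (tv (Inl c))))) = form (%c. pt nu (Inl c))"
  unfolding hom_form[OF comm_ring_hom_fps_to_fls] pt_def
  by (simp add: fls_times_fps_to_fls fps_to_fls_power if_distrib cong: if_cong)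
  thus ?thesis using nu2 by simp
 qed
 define FE where "FE = (%m. Abs_fps (%i. emb (fps_nth (F' m) i)))"
 have FE: "lift (F m) = fps_to_fls (FE m)" if "m \<in> mons" for m
  using F(1)[OF that] by (intro fls_eqI) (auto simp: nth_lift FE_def)
 have spec: "mev mons (%m. [:fps_nth (FE m) 0:]) a = form a" for a :: "nat => 'o ratf fls poly"
 proof -
  interpret cp: comm_ring_hom "%c :: 'o ratf fls. [:c:]" by (rule comm_ring_hom_const_poly)
  have "comm_ring_hom (%c. [:emb (c :: 'o):])"
  by (rule comm_ring_homI) (auto simp: em.hom_add em.hom_mult)
  from form_eq_mev[OF this] show ?thesis
  using F(2) by (simp add: FE_def cong: mev_cong)
 qed
 have specializes: "S.specializes mons FE"
  unfolding S.specializes_def using finite_mons spec by (auto simp: mons_def)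
 \<comment> \<open>The equation as a polynomial in v, all other coordinates held at the reduced
   point; only v has to be corrected in the outer variable.\<close>
 define Q where "Q = mev mons (%m. [:FE m:]) (%c. if c = cv then [:0, 1:] else [:fps_const (pt nu (Inl c)):])"
 let ?m0 = "map_poly (%h :: 'o ratf fls fps. fps_nth h 0)"
 have "?m0 Q = mev mons (%m. ?m0 [:FE m:]) (%c. ?m0 (if c = cv then [:0, 1:] else [:fps_const (pt nu (Inl c)):]))"
  unfolding Q_def by (rule hom_mev[OF comm_ring_hom_map_poly[OF comm_ring_hom_fps_nth_0]])
 also have "\<dots> = mev mons (%m. [:fps_nth (FE m) 0:]) (%c. if c = cv then [:0, 1:] else [:pt nu (Inl c):])"
  by (intro mev_cong) (auto simp: map_poly_pCons)
 also have "\<dots> = form (%c. if c = cv then [:0, 1:] else [:pt nu (Inl c):])" by (rule spec)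
 finally have Q0: "?m0 Q = form (%c. if c = cv then [:0, 1:] else [:pt nu (Inl c):])" .
 have "poly (form (%c. if c = cv then [:0, 1:] else [:pt nu (Inl c):])) x =
  form (%c. if c = cv then x else pt nu (Inl c))" for x
 proof -
  have "comm_ring_hom (%p. poly p x)" by (rule comm_ring_homI) auto
  from hom_form[OF this] show ?thesis by (simp add: if_distrib[of "%p. poly p x"] cong: if_cong)
 qed
 moreover have "(%c. if c = cv then pt nu (Inl cv) else pt nu (Inl c)) = (%c. pt nu (Inl c))" by auto
 ultimately have "poly (?m0 Q) (pt nu (Inl cv)) = form (%c. pt nu (Inl c))"
  unfolding Q0 by simp
 hence r1: "poly (?m0 Q) (pt nu (Inl cv)) = 0" using form_pt by simp
 have "pt nu (Inl c) = fls_X ^ wt (Inl c) * fls_const (tv (Inl c))" if "c ~= cv" for c using that by (simp add: pt_def)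
 hence "(%c. if c = cv then [:0, 1:] else [:pt nu (Inl c):]) = (%c. if c = cv then [:0, 1:] else [:fls_X ^ wt (Inl c) * fls_const (tv (Inl c)):])"
  by auto
 moreover have "pt nu (Inl cv) = fls_X ^ d * fps_to_fls nu" by (simp add: pt_def wt_def)
 ultimately have r2: "poly (pderiv (?m0 Q)) (pt nu (Inl cv)) ~= 0" unfolding Q0 using nu3 by simp
 obtain V where V: "fps_nth V 0 = pt nu (Inl cv)" "poly Q V = 0"
  using hensel_fps[OF r1 r2] by blast
 define et where "et = (%x. if x = Inl cv then V else fps_const (pt nu x))"
 have eta0: "fps_nth (et x) 0 = pt nu x" for x using V by (auto simp: et_def)
 define a where "a = (%x. fps_to_fls (et x))"
 have Fa: "mev mons (%m. lift (F m)) (%c. a (Inl c)) = 0"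
 proof -
  have "comm_ring_hom (%p. poly p V)" by (rule comm_ring_homI) auto
  from hom_mev[OF this, of mons "%m. [:FE m:]"] V(2)
  have "mev mons FE (%c. poly (if c = cv then [:0, 1:] else [:fps_const (pt nu (Inl c)):]) V) = 0"
  unfolding Q_def by simp
  also have "(%c. poly (if c = cv then [:0, 1:] else [:fps_const (pt nu (Inl c)):]) V) = (%c. et (Inl c))"
  by (auto simp: et_def)
  finally have "fps_to_fls (mev mons FE (%c. et (Inl c))) = 0" by simp
  hence "mev mons (%m. fps_to_fls (FE m)) (%c. a (Inl c)) = 0"
  unfolding hom_mev[OF comm_ring_hom_fps_to_fls] a_def .
  thus ?thesis using FE mev_cong[of mons "%m. lift (F m)" "%m. fps_to_fls (FE m)"] by metis
 qed
 have gen: "val R a ~= 0" if "finite {m. R m ~= 0}" "\<exists>m. R m ~= 0" "!!m. R m ~= 0 ==> count m (Inl cw) < d" for R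
  unfolding val_def a_def
 proof (rule pev_lift_nonzero[OF that(1,2)])
  fix A and r :: "(nat + nat) multiset => 'o"
  assume "finite A" "A ~= {}" "A \<subseteq> {m. R m ~= 0}" "!!m. m \<in> A ==> r m ~= 0"
  thus "(\<Sum>m\<in>A. emb (r m) * (\<Prod>x\<in>#m. fps_nth (et x) 0)) ~= 0"
  unfolding eta0 emb_def using that(3) by (intro pt_generic[OF nu]) auto
 qed
 have RHa: "val RH a ~= 0" and RGa: "val RG a ~= 0" using gen R by auto
 have Gi0: "G i0 a ~= 0" using i0(2)[OF Fa] RGa by simp
 have cross: "a (Inl j) * G i a = a (Inl i) * G j a" if "i \<le> Suc N" "j \<le> Suc N" for i j
  using rel[OF Fa that] RHa by simp
 define p where "p = (%j. val (f j) a)"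
 \<comment> \<open>The far end of the line: these variables are independent over the constants, so
   \<open>g i0\<close> does not vanish there, and the derivation along z kills them.\<close>
 define q where "q = (%j. fps_to_fls (fps_const (fls_const (tv (Inr j) :: 'o ratf))))"
 \<comment> \<open>The image under g of the line from q, at parameter 0, to p = f(a), at infinity;
   the forms have degree \<open>e\<close>, so the end at infinity is coefficient
   \<open>e\<close>.\<close>
 define h where "h = (%c. pev (%c. [:lift c:]) (g c) (%j. [:q j, p j:]))"
 have deg_h: "degree (h c) \<le> e"
  and h_low: "coeff (h c) 0 = pev lift (g c) q"
  and h_top: "coeff (h c) e = G c a" if c: "c \<le> Suc N" for c
 proof -
  note pl = prod_mset_linear[of q p]
  have "degree ([:lift (g c m):] * (\<Prod>x\<in>#m. [:q x, p x:])) \<le> e" if "g c m ~= 0" for m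
  using pl[of m] g(2)[OF c that] by (auto intro: order_trans[OF degree_smult_le])
  thus "degree (h c) \<le> e"
  unfolding h_def pev_def mev_def using g(1)[OF c] by (intro degree_sum_le) auto
  show "coeff (h c) 0 = pev lift (g c) q"
  unfolding h_def pev_def mev_def coeff_sum using pl by (intro sum.cong) auto
  show "coeff (h c) e = G c a"
  unfolding h_def pev_def mev_def coeff_sum G_def p_def[symmetric] using pl g(2)[OF c] by (intro sum.cong) auto
 qed
 have tvI: "(\<Sum>m\<in>A. emb (r m) * (\<Prod>x\<in>#m. fls_const (tv (Inr x)))) ~= 0"
  if A: "finite A" "A ~= {}" "!!m. m \<in> A ==> r m ~= 0" for A and r :: "nat multiset => 'o"
 proof -
  let ?e = "%m. \<Sum>x\<in>#m. Poly_Mapping.single (enc (Inr x)) (1 :: nat)"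
  interpret fc: comm_ring_hom "fls_const :: 'o ratf => _" by (rule comm_ring_hom_fls_const)
  have pr: "(\<Prod>x\<in>#m. fls_const (tv (Inr x) :: 'o ratf)) = fls_const (tmon (?e m))" for m
  proof -
  have "(\<Prod>x\<in>#m. fls_const (tv (Inr x) :: 'o ratf)) = fls_const (\<Prod>x\<in>#m. tv (Inr x))"
  by (induction m) (simp_all only: image_mset_empty image_mset_add_mset prod_mset_empty prod_mset.add_mset fc.hom_one fc.hom_mult)
  thus ?thesis by (simp only: tmon_prod_mset)
  qed
  have look: "Poly_Mapping.lookup (?e m) (enc (Inr y)) = count m y" for m :: "nat multiset" and y
  by (induction m) (auto simp: lookup_add lookup_single when_def)
  have "inj ?e" by (rule injI, rule multiset_eqI) (metis look)
  hence "(\<Sum>m\<in>A. cst (r m) * tmon (?e m)) ~= 0" using A by (intro tmon_independent) (auto intro: inj_on_subset)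
  hence "fls_const (\<Sum>m\<in>A. cst (r m) * tmon (?e m)) ~= 0" by (rule fls_const_nonzero)
  thus ?thesis unfolding pr emb_def by (simp only: fc.hom_sum fc.hom_mult not_False_eq_True)
 qed
 have low: "coeff (h i0) 0 ~= 0"
 proof -
  have "\<exists>m. g i0 m ~= 0"
  proof (rule ccontr)
  assume "~ ?thesis"
  hence "{m. g i0 m ~= 0} = {}" by auto
  thus False using Gi0 by (simp add: G_def pev_def mev_def)
  qed
  hence "pev lift (g i0) q ~= 0" unfolding q_def
  using tvI by (intro pev_lift_nonzero g(1)[OF i0(1)]) auto
  thus ?thesis using h_low[OF i0(1)] by simp
 qed
 have top: "coeff (h i0) e ~= 0" using h_top[OF i0(1)] Gi0 by simp
 have "mev mons (%m. [:fps_to_fls (FE m):]) h = 0"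
  using Fg[of "%j. [:q j, p j:]"] FE mev_cong[of mons "%m. [:lift (F m):]" "%m. [:fps_to_fls (FE m):]" h h] unfolding h_def by metis
 from S.newton[OF specializes this deg_h i0(1) low i0(1) top]
 have main: "S.winv (vlead N (%c. coeff (h c) 0)) = S.winv (vlead N (%c. coeff (h c) e))" .
 have "S.winv (vlead N (%c. coeff (h c) 0)) = 0"
 proof -
  let ?v = "vlead N (%c. coeff (h c) 0)"
  have kill: "dlogs 1 (fls_nth (pev lift (g c) q) k) = 0" for c k
  proof -
  have D1: "derivation (dlogs 1 :: 'o ratf fls => _)" using S.D[of 1] n_pos by simp
  have pr: "(\<Prod>x\<in>#m. q x) = fps_to_fls (fps_const (fls_const (\<Prod>x\<in>#m. tv (Inr x) :: 'o ratf)))" for m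
  proof -
  interpret fc: comm_ring_hom "fls_const :: 'o ratf => _" by (rule comm_ring_hom_fls_const)
  have "comm_ring_hom (%c :: 'o ratf. fps_to_fls (fps_const (fls_const c)))"
  by (rule comm_ring_homI)
  (simp_all only: fc.hom_one fc.hom_add fc.hom_mult fps_const_add[symmetric] fps_const_mult[symmetric]
  fps_to_fls_plus fls_times_fps_to_fls fps_const_1_eq_1 fps_one_to_fls)
  then interpret hq: comm_ring_hom "%c :: 'o ratf. fps_to_fls (fps_const (fls_const c))" .
  show ?thesis unfolding q_def
  by (induction m) (simp_all only: image_mset_empty image_mset_add_mset prod_mset_empty prod_mset.add_mset hq.hom_one hq.hom_mult)
  qed
  have dm: "dlog i (\<Prod>x\<in>#m. tv (Inr x) :: 'o ratf) = 0" if "!!x. i ~= enc (Inr x)" for i m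
  using that by (induction m) (auto simp: derivation_mult[OF derivation_dlog] dlog_tvar derivation_1[OF derivation_dlog] dlog_tvar[unfolded One_nat_def] derivation_0[OF derivation_dlog])
  have "dlogs 1 (fls_nth (lift y * (\<Prod>x\<in>#m. q x)) k) = 0" for y m
  proof -
  have "fls_nth (lift y * (\<Prod>x\<in>#m. q x)) k = fls_const (cst (fls_nth y k) * (\<Prod>x\<in>#m. tv (Inr x)))"
  unfolding pr by (simp add: nth_lift emb_def)
  moreover have "dlog (enc (Inl (Suc n))) (cst (fls_nth y k) * (\<Prod>x\<in>#m. tv (Inr x)) :: 'o ratf) = 0"
  using dm[of "enc (Inl (Suc n))" m] by (simp add: derivation_mult[OF derivation_dlog] dlog_cst)
  moreover have "fls_map (dlog i) (fls_const c) = fls_const (dlog i c)" for i and c :: "'o ratf"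
  using fls_map_X_power_times[OF derivation_dlog, of i 0 c] by simp
  ultimately show ?thesis by (simp add: dlogs_def)
  qed
  thus ?thesis unfolding pev_def mev_def fls_nth_sum derivation_sum[OF D1] by simp
  qed
  have "dlogs 1 (?v c) = 0" if "c \<le> Suc N" for c using kill h_low[OF that] by (simp add: vlead_def)
  hence row: "dlogs 1 (?v c) = 0" if "c \<le> n" for c using that n_le by auto
  \<comment> \<open>Row 1 is zero.\<close>
  have "det (sqmat n (%(i,j). dlogs i (?v j))) = 0"
  proof -
  have "sqmat n (%(i,j). dlogs i (?v j)) = sqmat n (%(i,j). (if i = 1 then 0 else 1) * dlogs i (?v j))"
  using row by (intro eq_matI) auto
  also have "det \<dots> = 0" using n_pos by (simp only: det_scale_rows) auto
  finally show ?thesis .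
  qed
  thus ?thesis by (simp add: S.winv_def)
 qed
 moreover have "S.winv (vlead N (%c. coeff (h c) e)) ~= 0"
 proof -
  define r where "r = G cu a / a (Inl cu)"
  have "pt nu (Inl cu) ~= 0" by (simp add: pt_def)
  hence au: "a (Inl cu) ~= 0" unfolding a_def using eta0[of "Inl cu"] by auto
  have Gr: "G c a = r * a (Inl c)" if "c \<le> Suc N" for c
  using cross[of c cu] that au by (simp add: r_def field_simps)
  have r0: "r ~= 0" using Gr[OF i0(1)] Gi0 by auto
  have lvl: "vlvl N (%c. a (Inl c)) = 0"
  by (rule vlvl_eqI[of _ _ _ cu]) (use eta0 `pt nu (Inl cu) ~= 0` in "auto simp: a_def")
  have lead: "vlead N (%c. a (Inl c)) c = pt nu (Inl c)" for c
  unfolding vlead_def lvl by (simp add: a_def eta0)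
  have vl: "vlvl N (%c. coeff (h c) e) = vlvl N (%c. r * a (Inl c))"
  proof -
  have "(%c. coeff (h c) e) ` {..Suc N} = (%c. r * a (Inl c)) ` {..Suc N}"
  by (intro image_cong) (auto simp: h_top Gr)
  thus ?thesis by (simp only: vlvl_def)
  qed
  have "S.winv (vlead N (%c. coeff (h c) e)) = S.winv (%c. fls_nth r (fls_subdegree r) * pt nu (Inl c))"
  proof (rule S.winv_cong)
  fix c assume "c \<le> n"
  hence c: "c \<le> Suc N" using n_le by simp
  have "vlead N (%c. coeff (h c) e) c = vlead N (%c. r * a (Inl c)) c"
  unfolding vlead_def vl using c by (simp add: h_top Gr)
  also have "\<dots> = fls_nth r (fls_subdegree r) * vlead N (%c. a (Inl c)) c"
  by (rule vlead_scale[of _ cu]) (use r0 au c in auto)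
  finally show "vlead N (%c. coeff (h c) e) c = fls_nth r (fls_subdegree r) * pt nu (Inl c)" by (simp add: lead)
  qed
  also have "\<dots> = S.winv (%c. pt nu (Inl c))" using r0 by (intro S.winv_scale) auto
  finally show ?thesis using winv_pt[OF char2 nu0 form_pt] by simp
 qed
 ultimately show False using main by simp
qed

end

section \<open>Places\<close>

text \<open>Ring homomorphisms on subrings are represented by their graphs.\<close>

definition hom_graph :: "('w :: field \<times> 'o :: field) set => bool" where
 "hom_graph G \<longleftrightarrow> (1, 1) \<in> G & (\<forall>y. (0, y) \<in> G --> y = 0) &
  (\<forall>a b c d. (a, b) \<in> G --> (c, d) \<in> G --> (a - c, b - d) \<in> G & (a * c, b * d) \<in> G)"

lemma hom_graphD:
 assumes "hom_graph G"
 shows "(1, 1) \<in> G" "(0, y) \<in> G ==> y = 0"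
  "(a, b) \<in> G ==> (c, d) \<in> G ==> (a - c, b - d) \<in> G"
  "(a, b) \<in> G ==> (c, d) \<in> G ==> (a * c, b * d) \<in> G"
 using assms by (auto simp: hom_graph_def)

lemma hom_graph_more:
 assumes G: "hom_graph G"
 shows "(0, 0) \<in> G" "(a, b) \<in> G ==> (- a, - b) \<in> G" "(a, b) \<in> G ==> (c, d) \<in> G ==> (a + c, b + d) \<in> G"
  "(a, b) \<in> G ==> (a, b') \<in> G ==> b = b'" "(a, b) \<in> G ==> (a ^ k, b ^ k) \<in> G"
proof -
 show z: "(0, 0) \<in> G" using hom_graphD(3)[OF G hom_graphD(1)[OF G] hom_graphD(1)[OF G]] by simp
 show m: "(- a, - b) \<in> G" if "(a, b) \<in> G" for a b using hom_graphD(3)[OF G z that] by simp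
 show "(a + c, b + d) \<in> G" if "(a, b) \<in> G" "(c, d) \<in> G" using hom_graphD(3)[OF G that(1) m[OF that(2)]] by simp
 show "b = b'" if "(a, b) \<in> G" "(a, b') \<in> G"
  using hom_graphD(2)[OF G, of "b - b'"] hom_graphD(3)[OF G that] by simp
 show "(a ^ k, b ^ k) \<in> G" if "(a, b) \<in> G"
  by (induction k) (auto simp: hom_graphD(1)[OF G] hom_graphD(4)[OF G that])
qed

lemma hom_graph_sum:
 assumes G: "hom_graph G" and "!!i. i \<in> A ==> (f i, g i) \<in> G"
 shows "(\<Sum>i\<in>A. f i, \<Sum>i\<in>A. g i) \<in> G"
 using assms(2) by (induction A rule: infinite_finite_induct) (auto simp: hom_graph_more[OF G])

definition graph_polys :: "('w :: field \<times> 'o :: field) set => ('w poly \<times> 'o poly) set" where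
 "graph_polys G = {(P, q). \<forall>i. (coeff P i, coeff q i) \<in> G}"

lemma graph_polys_closed:
 assumes G: "hom_graph G" and P: "(P, p) \<in> graph_polys G" and Q: "(Q, q) \<in> graph_polys G"
 shows "(P - Q, p - q) \<in> graph_polys G" "(P * Q, p * q) \<in> graph_polys G"
 using P Q by (auto simp: graph_polys_def coeff_mult intro!: hom_graphD[OF G] hom_graph_sum[OF G])

lemma graph_polys_monom:
 assumes G: "hom_graph G" and "(a, b) \<in> G"
 shows "(monom a k, monom b k) \<in> graph_polys G"
 using assms by (auto simp: graph_polys_def hom_graph_more)

text \<open>The assignment P(x) to q(r) is single valued precisely because every relation satisfied
  by x reduces to one satisfied by r.\<close>

lemma hom_graph_adjoin:
 assumes G: "hom_graph (G :: ('w :: field \<times> 'o :: field) set)"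
  and r: "!!P q. (P, q) \<in> graph_polys G ==> poly P x = 0 ==> poly q r = 0"
 shows "\<exists>G'. hom_graph G' & G \<subseteq> G' & (x, r) \<in> G'"
proof -
 define G' where "G' = {(poly P x, poly q r) | P q. (P, q) \<in> graph_polys G}"
 have inG': "(poly P x, poly q r) \<in> G'" if "(P, q) \<in> graph_polys G" for P q
  using that by (auto simp: G'_def)
 have sub: "(a, b) \<in> G'" if "(a, b) \<in> G" for a b
  using inG'[OF graph_polys_monom[OF G that, of 0]] by (simp add: poly_monom)
 have "(x, r) \<in> G'"
  using inG'[OF graph_polys_monom[OF G hom_graphD(1)[OF G], of 1]] by (simp add: poly_monom)
 moreover have "hom_graph G'"
  unfolding hom_graph_def
 proof (intro conjI allI impI)
  show "(1, 1) \<in> G'" by (rule sub[OF hom_graphD(1)[OF G]])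
  show "y = 0" if "(0, y) \<in> G'" for y using that r by (auto simp: G'_def)
  fix a b c d assume "(a, b) \<in> G'" "(c, d) \<in> G'"
  then obtain P q P' q' where *: "(P, q) \<in> graph_polys G" "(P', q') \<in> graph_polys G"
  "a = poly P x" "b = poly q r" "c = poly P' x" "d = poly q' r" by (auto simp: G'_def)
  show "(a - c, b - d) \<in> G'" using inG'[OF graph_polys_closed(1)[OF G *(1,2)]] * by simp
  show "(a * c, b * d) \<in> G'" using inG'[OF graph_polys_closed(2)[OF G *(1,2)]] * by simp
 qed
 ultimately show ?thesis using sub by auto
qed

text \<open>A nonzero reduced relation \<open>q0\<close> of least degree divides all others up to
  its leading coefficient. It is not constant by \<open>no\<close>, so a root of it exists and is a
  common root.\<close>

lemma common_root:
 assumes G: "hom_graph (G :: ('w :: field \<times> 'o :: alg_closed_field) set)"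
  and no: "!!P q y. (P, q) \<in> graph_polys G ==> poly P x = 0 ==> q = [:y:] ==> y = 0"
 shows "\<exists>r. \<forall>P q. (P, q) \<in> graph_polys G --> poly P x = 0 --> poly q r = 0"
proof -
 define J where "J = {q. q ~= 0 & (\<exists>P. (P, q) \<in> graph_polys G & poly P x = 0)}"
 show ?thesis
 proof (cases "J = {}")
  case True
  hence "poly q 0 = 0" if "(P, q) \<in> graph_polys G" "poly P x = 0" for P q
  using that unfolding J_def by (cases "q = 0") auto
  thus ?thesis by blast
 next
  case False
  then obtain q0 where q0: "q0 \<in> J" and min: "!!q. q \<in> J ==> degree q0 \<le> degree q"
  using ex_has_least_nat[of "%q. q \<in> J" _ degree] by blast
  then obtain P0 where P0: "(P0, q0) \<in> graph_polys G" "poly P0 x = 0" by (auto simp: J_def)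
  have "degree q0 > 0"
  proof (rule ccontr)
  assume "~ ?thesis"
  then obtain y where "q0 = [:y:]" by (metis degree_eq_zeroE gr0I)
  thus False using no[OF P0] q0 by (auto simp: J_def)
  qed
  then obtain r where r: "poly q0 r = 0" using alg_closed_imp_poly_has_root by blast
  have "poly q r = 0" if "(P, q) \<in> graph_polys G" "poly P x = 0" for P q
  using that
  proof (induction "degree q" arbitrary: P q rule: less_induct)
  case less
  show ?case
  proof (cases "q = 0")
  case False
  hence "q \<in> J" using less.prems by (auto simp: J_def)
  hence le: "degree q0 \<le> degree q" by (rule min)
  let ?k = "degree q - degree q0"
  \<comment> \<open>Cross multiplication by leading coefficients instead of division, so that
    \<open>q1\<close> again has a lift \<open>P1\<close> with coefficients in the domain of the
    graph.\<close>
  define q1 where "q1 = monom (lead_coeff q0) 0 * q - monom (lead_coeff q) ?k * q0"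
  define P1 where "P1 = monom (coeff P0 (degree q0)) 0 * P - monom (coeff P (degree q)) ?k * P0"
  have c0: "(coeff P0 (degree q0), lead_coeff q0) \<in> G" and c1: "(coeff P (degree q), lead_coeff q) \<in> G"
  using P0 less.prems by (auto simp: graph_polys_def)
  have "(P1, q1) \<in> graph_polys G" unfolding P1_def q1_def
  by (intro graph_polys_closed[OF G] graph_polys_monom[OF G] c0 c1 P0 less.prems)
  moreover have "poly P1 x = 0" using P0 less.prems by (simp add: P1_def)
  ultimately have P1: "(P1, q1) \<in> graph_polys G" "poly P1 x = 0" by auto
  have q00: "q0 ~= 0" using q0 by (auto simp: J_def)
  have "poly q1 r = 0"
  proof (cases "q1 = 0")
  case q1: False
  have "coeff q1 i = 0" if "i \<ge> degree q" for i
  proof (cases "i = degree q")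
  case True
  thus ?thesis using le by (simp add: q1_def coeff_monom_mult)
  next
  case False
  hence "i > degree q" using that by simp
  thus ?thesis using le by (auto simp: q1_def coeff_monom_mult coeff_eq_0)
  qed
  hence "degree q1 < degree q"
  using q1 by (meson leading_coeff_0_iff not_le)
  thus ?thesis using less.hyps P1 by blast
  qed auto
  hence "lead_coeff q0 * poly q r = 0" using r by (simp add: q1_def poly_monom)
  thus ?thesis using q00 by simp
  qed auto
  qed
  thus ?thesis by blast
 qed
qed

text \<open>Chevalley's extension theorem: a maximal graph, given by Zorn's lemma, has a valuation
  ring as its domain. An algebraically closed target leaves no residue field extension to account
  for.\<close>

theorem place_extension:
 assumes G0: "hom_graph (G0 :: ('w :: field \<times> 'o :: alg_closed_field) set)"
 obtains G where "hom_graph G" "G0 \<subseteq> G"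
  "!!x. x \<notin> fst ` G ==> x ~= 0 & (inverse x, 0) \<in> G"
  "!!x y. (x, y) \<in> G ==> y ~= 0 ==> (inverse x, inverse y) \<in> G"
proof -
 define AA where "AA = {G. hom_graph G & G0 \<subseteq> G}"
 have "\<exists>M\<in>AA. \<forall>H\<in>AA. M \<subseteq> H --> H = M"
 proof (rule subset_Zorn_nonempty)
  show "AA ~= {}" using G0 by (auto simp: AA_def)
  fix CC assume C: "CC ~= {}" "subset.chain AA CC"
  hence CA: "H \<in> CC ==> hom_graph H & G0 \<subseteq> H" for H by (auto simp: subset.chain_def AA_def)
  have two: "\<exists>H\<in>CC. u \<in> H & v \<in> H" if uv: "u \<in> \<Union>CC" "v \<in> \<Union>CC" for u v
  proof -
  obtain A B where AB: "A \<in> CC" "u \<in> A" "B \<in> CC" "v \<in> B" using uv by auto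
  hence "A \<subseteq> B \<or> B \<subseteq> A" using C(2) unfolding subset.chain_def by blast
  thus ?thesis using AB by blast
  qed
  have "hom_graph (\<Union>CC)"
  unfolding hom_graph_def
  proof (intro conjI allI impI)
  show "(1, 1) \<in> \<Union>CC" using C(1) CA hom_graphD(1) by blast
  show "y = 0" if "(0, y) \<in> \<Union>CC" for y using that CA hom_graphD(2) by blast
  fix a b c d assume "(a, b) \<in> \<Union>CC" "(c, d) \<in> \<Union>CC"
  then obtain H where H: "H \<in> CC" "(a, b) \<in> H" "(c, d) \<in> H" using two by blast
  thus "(a - c, b - d) \<in> \<Union>CC" "(a * c, b * d) \<in> \<Union>CC"
  using CA hom_graphD(3,4) by blast+
  qed
  thus "\<Union>CC \<in> AA" using C(1) CA by (auto simp: AA_def)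
 qed
 then obtain G where G: "hom_graph G" "G0 \<subseteq> G" and max: "!!H. hom_graph H ==> G \<subseteq> H ==> H = G"
  unfolding AA_def by auto
 have inv: "(inverse x, inverse y) \<in> G" if xy: "(x, y) \<in> G" "y ~= 0" for x y
 proof -
  \<comment> \<open>Localization at the kernel extends the graph, so by maximality the domain is
    already local.\<close>
  define G' where "G' = {(a / b, c / e) | a b c e. (a, c) \<in> G & (b, e) \<in> G & e ~= 0}"
  have inG': "(a / b, c / e) \<in> G'" if "(a, c) \<in> G" "(b, e) \<in> G" "e ~= 0" for a b c e
  using that by (auto simp: G'_def)
  have b0: "b ~= 0" if "(b, e) \<in> G" "e ~= 0" for b e using that hom_graphD(2)[OF G(1)] by auto
  have "hom_graph G'"
  unfolding hom_graph_def
  proof (intro conjI allI impI)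
  show "(1, 1) \<in> G'" using inG'[OF hom_graphD(1)[OF G(1)] hom_graphD(1)[OF G(1)]] by simp
  show "y = 0" if "(0, y) \<in> G'" for y
  proof -
  obtain a b c e where *: "0 = a / b" "y = c / e" "(a, c) \<in> G" "(b, e) \<in> G" "e ~= 0"
  using `(0, y) \<in> G'` by (auto simp: G'_def)
  hence "a = 0" using b0 by auto
  thus ?thesis using * hom_graphD(2)[OF G(1)] by auto
  qed
  fix u v u' v' assume "(u, v) \<in> G'" "(u', v') \<in> G'"
  then obtain a b c e a' b' c' e' where *: "u = a / b" "v = c / e" "(a, c) \<in> G" "(b, e) \<in> G" "e ~= 0"
  "u' = a' / b'" "v' = c' / e'" "(a', c') \<in> G" "(b', e') \<in> G" "e' ~= 0" by (auto simp: G'_def)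
  have nz: "b ~= 0" "b' ~= 0" using b0 * by auto
  have 1: "(a * b' - a' * b, c * e' - c' * e) \<in> G" "(b * b', e * e') \<in> G" "(a * a', c * c') \<in> G"
  using * by (auto intro!: hom_graphD(3,4)[OF G(1)])
  have "u - u' = (a * b' - a' * b) / (b * b')" "v - v' = (c * e' - c' * e) / (e * e')"
  "u * u' = (a * a') / (b * b')" "v * v' = (c * c') / (e * e')"
  using * nz by (auto simp: field_simps)
  thus "(u - u', v - v') \<in> G'" "(u * u', v * v') \<in> G'"
  using inG'[OF 1(1,2)] inG'[OF 1(3,2)] * by simp_all
  qed
  moreover have "G \<subseteq> G'"
  proof (rule subsetI)
  fix z assume "z \<in> G"
  thus "z \<in> G'" using inG'[of "fst z" "snd z", OF _ hom_graphD(1)[OF G(1)]] by simp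
  qed
  ultimately have "G' = G" by (rule max)
  moreover have "(1 / x, 1 / y) \<in> G'" by (rule inG'[OF hom_graphD(1)[OF G(1)] xy])
  ultimately show ?thesis by (simp add: inverse_eq_divide)
 qed
 \<comment> \<open>The extension of the maximal ideal to the ring generated by \<open>x\<close> is
   the unit ideal. The constant term is absent since it can be absorbed into a unit.\<close>
 define rel where "rel = (%x k. \<exists>a. (\<forall>i. (a i, 0) \<in> G) & (1 :: 'w) = (\<Sum>i=1..k. a i * x ^ i))"
 have ex_rel: "\<exists>k. rel x k" if x: "x \<notin> fst ` G" for x
 proof (rule ccontr)
  assume norel: "~ ?thesis"
  have "\<exists>r. \<forall>P q. (P, q) \<in> graph_polys G --> poly P x = 0 --> poly q r = 0"
  proof (rule common_root[OF G(1)])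
  fix P q y assume P: "(P, q) \<in> graph_polys G" "poly P x = 0" "q = [:y:]"
  show "y = 0"
  proof (rule ccontr)
  assume y: "y ~= 0"
  have Pq: "(coeff P i, coeff q i) \<in> G" for i using P by (auto simp: graph_polys_def)
  have P0: "(coeff P 0, y) \<in> G" using Pq[of 0] P(3) by simp
  have Pi: "(coeff P i, 0) \<in> G" if "i > 0" for i
  using Pq[of i] P(3) that by (cases i) auto
  note iP = inv[OF P0 y]
  have "coeff P 0 ~= 0" using P0 y hom_graphD(2)[OF G(1)] by auto
  define a where "a = (%i. if i = 0 then 0 else - (inverse (coeff P 0) * coeff P i))"
  have "(a i, 0) \<in> G" for i
  using hom_graph_more(2)[OF G(1) hom_graphD(4)[OF G(1) iP Pi[of i]]] hom_graph_more(1)[OF G(1)] by (auto simp: a_def)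
  moreover have "1 = (\<Sum>i=1..Polynomial.degree P. a i * x ^ i)"
  proof -
  have "0 = coeff P 0 + (\<Sum>i=1..Polynomial.degree P. coeff P i * x ^ i)"
  using P(2) unfolding poly_altdef by (simp add: sum.atMost_shift sum.atLeast1_atMost_eq)
  hence "1 = - (inverse (coeff P 0) * (\<Sum>i=1..Polynomial.degree P. coeff P i * x ^ i))"
  using `coeff P 0 ~= 0` by (simp add: field_simps eq_neg_iff_add_eq_0)
  also have "\<dots> = (\<Sum>i=1..Polynomial.degree P. a i * x ^ i)"
  unfolding sum_distrib_left sum_negf[symmetric] by (intro sum.cong) (auto simp: a_def)
  finally show ?thesis .
  qed
  ultimately show False using norel unfolding rel_def by blast
  qed
  qed
  then obtain r where r: "!!P q. (P, q) \<in> graph_polys G ==> poly P x = 0 ==> poly q r = 0" by blast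
  have "\<exists>G'. hom_graph G' & G \<subseteq> G' & (x, r) \<in> G'"
  by (rule hom_graph_adjoin[OF G(1)]) (rule r)
  then obtain G' where "hom_graph G'" "G \<subseteq> G'" "(x, r) \<in> G'" by blast
  thus False using max x by force
 qed
 \<comment> \<open>The relation for \<open>inverse x\<close>, multiplied by the top term of the
   relation for \<open>x\<close>, rewrites that term in lower powers. Thus minimal relations for
   both cannot coexist.\<close>
 have reduce: "\<exists>k'<k. rel x k'" if k: "rel x k" "rel (inverse x) l" "l \<le> k" and x: "x ~= 0" for x k l
 proof -
  obtain a where a: "!!i. (a i, 0) \<in> G" "1 = (\<Sum>i=1..k. a i * x ^ i)" using k(1) by (auto simp: rel_def)
  obtain b where b: "!!i. (b i, 0) \<in> G" "1 = (\<Sum>i=1..l. b i * inverse x ^ i)" using k(2) by (auto simp: rel_def)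
  have k0: "k > 0" using a(2) by (cases k) auto
  define c where "c = (%j. if j < k then a k * (if k - j \<le> l then b (k - j) else 0) else 0)"
  have cG: "(c j, 0) \<in> G" for j
  using hom_graphD(4)[OF G(1) a(1) b(1)] hom_graph_more(1)[OF G(1)] by (auto simp: c_def)
  have top: "a k * x ^ k = (\<Sum>j<k. c j * x ^ j)"
  proof -
  have "a k * x ^ k = (\<Sum>i=1..l. a k * b i * x ^ (k - i))"
  proof -
  have "a k * x ^ k = a k * x ^ k * (\<Sum>i=1..l. b i * inverse x ^ i)" using b(2) by simp
  also have "\<dots> = (\<Sum>i=1..l. a k * b i * x ^ (k - i))"
  unfolding sum_distrib_left
  proof (intro sum.cong refl)
  fix i assume "i \<in> {1..l}"
  hence "x ^ k = x ^ (k - i) * x ^ i" using k(3) by (simp flip: power_add)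
  thus "a k * x ^ k * (b i * inverse x ^ i) = a k * b i * x ^ (k - i)"
  using x by (simp add: power_inverse field_simps)
  qed
  finally show ?thesis .
  qed
  also have "\<dots> = (\<Sum>j\<in>{k - l..<k}. a k * b (k - j) * x ^ j)"
  by (rule sum.reindex_bij_witness[of _ "%j. k - j" "%i. k - i"]) (use k(3) k0 in auto)
  also have "\<dots> = (\<Sum>j<k. c j * x ^ j)"
  by (rule sum.mono_neutral_cong_left) (auto simp: c_def)
  finally show ?thesis .
  qed
  have "(\<Sum>i=1..k. a i * x ^ i) = (\<Sum>i=1..k-1. a i * x ^ i) + a k * x ^ k"
  using k0 by (cases k) auto
  also have "a k * x ^ k = c 0 + (\<Sum>i=1..k-1. c i * x ^ i)"
  unfolding top using k0 by (cases k) (auto simp: lessThan_Suc_atMost sum.atMost_shift sum.atLeast1_atMost_eq simp del: sum.lessThan_Suc)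
  finally have eq: "1 - c 0 = (\<Sum>i=1..k-1. (a i + c i) * x ^ i)"
  using a(2) by (simp add: algebra_simps sum.distrib)
  have "(1 - c 0, 1 - 0) \<in> G" by (rule hom_graphD(3)[OF G(1) hom_graphD(1)[OF G(1)] cG])
  hence u: "(1 - c 0, 1) \<in> G" by simp
  note iu = inv[OF u]
  have "1 - c 0 ~= 0" using u hom_graphD(2)[OF G(1)] by fastforce
  hence "1 = inverse (1 - c 0) * (\<Sum>i=1..k-1. (a i + c i) * x ^ i)" using eq by (metis left_inverse)
  hence "1 = (\<Sum>i=1..k-1. (inverse (1 - c 0) * (a i + c i)) * x ^ i)" by (simp add: sum_distrib_left mult.assoc)
  moreover have "(inverse (1 - c 0) * (a i + c i), 0) \<in> G" for i
  using hom_graphD(4)[OF G(1) iu hom_graph_more(3)[OF G(1) a(1) cG]] by simp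
  ultimately have "rel x (k - 1)" unfolding rel_def by (intro exI[of _ "%i. inverse (1 - c 0) * (a i + c i)"]) simp
  thus ?thesis using k0 by (intro exI[of _ "k - 1"]) auto
 qed
 have val: "x ~= 0 & (inverse x, 0) \<in> G" if x: "x \<notin> fst ` G" for x
 proof -
  have x0: "x ~= 0" using x hom_graph_more(1)[OF G(1)] by force
  have "inverse x \<in> fst ` G"
  proof (rule ccontr)
  assume ix: "inverse x \<notin> fst ` G"
  define k where "k = (LEAST k. rel x k)"
  define l where "l = (LEAST l. rel (inverse x) l)"
  have kl: "rel x k" "rel (inverse x) l" unfolding k_def l_def
  using ex_rel[OF x] ex_rel[OF ix] by (auto intro: LeastI_ex)
  show False
  proof (cases "l \<le> k")
  case True
  from reduce[OF kl this x0] show False unfolding k_def using not_less_Least by blast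
  next
  case False
  have "\<exists>k'<l. rel (inverse x) k'" by (rule reduce[of _ _ k]) (use kl False x0 in auto)
  thus False unfolding l_def using not_less_Least by blast
  qed
  qed
  then obtain y where y: "(inverse x, y) \<in> G" by auto
  have "y = 0"
  proof (rule ccontr)
  assume "y ~= 0"
  from inv[OF y this] have "x \<in> fst ` G" by force
  thus False using x by simp
  qed
  thus ?thesis using y x0 by simp
 qed
 show ?thesis using that[OF G val inv] .
qed

section \<open>Discrete places\<close>

lemma comm_ring_hom_eq_0_iff:
 assumes "comm_ring_hom (h :: 'a :: field => 'b :: field)"
 shows "h x = 0 \<longleftrightarrow> x = 0"
proof -
 interpret comm_ring_hom h by fact
 show ?thesis
 proof
  assume hx: "h x = 0"
  show "x = 0"
  proof (rule ccontr)
  assume "x ~= 0"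
  hence "h x * h (inverse x) = 1" by (simp flip: hom_mult)
  thus False using hx by simp
  qed
 qed simp
qed

lemma comm_ring_hom_inverse:
 assumes "comm_ring_hom (h :: 'a :: field => 'b :: field)"
 shows "h (inverse x) = inverse (h x)"
proof (cases "x = 0")
 case False
 interpret comm_ring_hom h by fact
 have "h x * h (inverse x) = 1" using False by (simp flip: hom_mult)
 thus ?thesis by (metis inverse_unique)
next
 case True
 interpret comm_ring_hom h by fact
 show ?thesis using True by simp
qed

section \<open>Subfields of finite degree\<close>

definition is_subfield :: "'w :: field set => bool" where
 "is_subfield L \<longleftrightarrow> 1 \<in> L & (\<forall>x\<in>L. \<forall>y\<in>L. x - y \<in> L & x * y \<in> L) & (\<forall>x\<in>L. inverse x \<in> L)"

lemma is_subfieldD: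
 assumes "is_subfield L"
 shows "1 \<in> L" "0 \<in> L" "x \<in> L ==> y \<in> L ==> x - y \<in> L" "x \<in> L ==> y \<in> L ==> x * y \<in> L"
  "x \<in> L ==> inverse x \<in> L" "x \<in> L ==> y \<in> L ==> x + y \<in> L" "x \<in> L ==> - x \<in> L" "x \<in> L ==> x ^ n \<in> L"
  "x \<in> L ==> y \<in> L ==> x / y \<in> L" "x \<in> L ==> x powi j \<in> L"
proof -
 show m: "x - y \<in> L" "x * y \<in> L" if "x \<in> L" "y \<in> L" for x y
  using assms that by (auto simp: is_subfield_def)
 show one: "1 \<in> L" using assms by (auto simp: is_subfield_def)
 show z: "0 \<in> L" using m(1)[OF one one] by simp
 show n: "- x \<in> L" if "x \<in> L" for x using m(1)[OF z that] by simp
 show "x + y \<in> L" if "x \<in> L" "y \<in> L" using m(1)[OF that(1) n[OF that(2)]] by simp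
 show iv: "inverse x \<in> L" if "x \<in> L" for x using assms that by (auto simp: is_subfield_def)
 show p: "x ^ n \<in> L" if "x \<in> L" for x n using that by (induction n) (auto intro: one m)
 show "x / y \<in> L" if "x \<in> L" "y \<in> L" using m(2)[OF that(1) iv[OF that(2)]] by (simp add: divide_inverse)
 show "x powi j \<in> L" if "x \<in> L" using that by (auto simp: power_int_def intro: p iv)
qed

lemma is_subfield_sum: "is_subfield L ==> (!!i. i \<in> A ==> f i \<in> L) ==> sum f A \<in> L"
 by (induction A rule: infinite_finite_induct) (auto simp: is_subfieldD)

text \<open>The point is the bound \<open>D\<close>, uniform over \<open>L\<close>: the span of
  finitely many products is closed under multiplication, and \<open>D\<close> is the size of the
  spanning set.\<close>

lemma finite_extension:
 fixes e :: "'f :: field => 'w :: field"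
 assumes e: "comm_ring_hom e" and alg: "!!x. \<exists>p. p ~= 0 & poly (map_poly e p) x = 0" and fin: "finite Th"
 obtains L D where "range e \<subseteq> L" "Th \<subseteq> L" "is_subfield L"
  "!!x. x \<in> L ==> \<exists>c. (\<exists>i\<le>D. c i ~= 0) & (\<Sum>i\<le>D::nat. e (c i) * x ^ i) = 0"
proof -
 interpret e: comm_ring_hom e by fact
 note e0 = comm_ring_hom_eq_0_iff[OF e]
 interpret V: vector_space "%c x. e c * x"
  by unfold_locales (simp_all add: algebra_simps e.hom_add e.hom_mult)
 have span_mult: "x * y \<in> V.span C" if "x \<in> V.span B" "!!b. b \<in> B ==> b * y \<in> V.span C" for x y B C
  using that(1)
 proof (induction rule: V.span_induct_alt)
  case (step c x z)
  have "e c * (x * y) + z * y \<in> V.span C"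
  using step that(2) by (intro V.span_add V.span_scale) auto
  thus ?case by (simp add: algebra_simps)
 qed (simp add: V.span_zero)
 have e_span: "e c \<in> V.span B" if "1 \<in> V.span B" for c B
  using V.span_scale[OF that, of c] by simp
 have "\<exists>B. finite B & 1 \<in> V.span B & Th \<subseteq> V.span B & (\<forall>x\<in>V.span B. \<forall>y\<in>V.span B. x * y \<in> V.span B)"
  using fin
 proof induction
  case empty
  have "x * y \<in> V.span {1}" if "x \<in> V.span {1}" "y \<in> V.span {1}" for x y
  using span_mult[OF that(1), of y] that(2) by auto
  thus ?case by (intro exI[of _ "{1}"]) (auto intro: V.span_base)
 next
  case (insert th Th)
  then obtain B where B: "finite B" "1 \<in> V.span B" "Th \<subseteq> V.span B"
  "!!x y. x \<in> V.span B ==> y \<in> V.span B ==> x * y \<in> V.span B" by blast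
  obtain p where p: "p ~= 0" "poly (map_poly e p) th = 0" using alg by blast
  define m where "m = degree p"
  define a where "a = coeff p m"
  have a0: "a ~= 0" using p by (simp add: a_def m_def)
  have deg: "degree (map_poly e p) = m"
  unfolding m_def by (rule degree_map_poly) (use p e0 in auto)
  have "0 = (\<Sum>i\<le>m. e (coeff p i) * th ^ i)"
  using p(2) unfolding poly_altdef deg by (simp add: coeff_map_poly)
  also have "\<dots> = (\<Sum>i<m. e (coeff p i) * th ^ i) + e a * th ^ m"
  by (simp add: lessThan_Suc_atMost[symmetric] a_def)
  finally have "e a * th ^ m = - (\<Sum>i<m. e (coeff p i) * th ^ i)" by (simp add: eq_neg_iff_add_eq_0 add.commute)
  hence "inverse (e a) * (e a * th ^ m) = - (\<Sum>i<m. inverse (e a) * (e (coeff p i) * th ^ i))"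
  by (simp add: sum_distrib_left)
  moreover have "inverse (e a) * (e a * th ^ m) = th ^ m" using a0 e0[of a] by (simp flip: mult.assoc)
  ultimately have top: "th ^ m = (\<Sum>i<m. e (- inverse a * coeff p i) * th ^ i)"
  using a0 e0[of a] by (simp add: comm_ring_hom_inverse[OF e] e.hom_mult e.hom_uminus sum_negf mult.assoc)
  have m0: "m > 0"
  proof (rule ccontr)
  assume "~ m > 0"
  thus False using top by simp
  qed
  \<comment> \<open>The equation of degree \<open>m\<close> for \<open>th\<close> rewrites
    \<open>th ^ m\<close>, so these products still span a ring.\<close>
  define B' where "B' = (%(b, i). b * th ^ i) ` (B \<times> {..<m})"
  let ?L = "V.span B'"
  have inB': "b * th ^ i \<in> ?L" if "b \<in> B" "i < m" for b i
  using that by (auto simp: B'_def intro!: V.span_base)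
  have BL: "V.span B \<subseteq> ?L"
  using inB'[of _ 0] m0 by (intro V.span_minimal) (auto simp: V.subspace_span)
  have 2: "x * l \<in> ?L" if "x \<in> ?L" "l \<in> V.span B" for x l
  proof (rule span_mult[OF that(1)])
  fix z assume "z \<in> B'"
  then obtain b i where z: "z = b * th ^ i" "b \<in> B" "i < m" by (auto simp: B'_def)
  have "(b * l) * th ^ i \<in> ?L"
  by (rule span_mult[of _ B]) (use z inB' B(4)[OF V.span_base that(2)] in auto)
  thus "z * l \<in> ?L" by (simp add: z ac_simps)
  qed
  have 1: "x * th \<in> ?L" if "x \<in> ?L" for x
  proof (rule span_mult[OF that])
  fix z assume "z \<in> B'"
  then obtain b i where z: "z = b * th ^ i" "b \<in> B" "i < m" by (auto simp: B'_def)
  show "z * th \<in> ?L"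
  proof (cases "Suc i < m")
  case True
  thus ?thesis using inB'[OF z(2) True] z by (simp add: ac_simps)
  next
  case False
  hence "m = Suc i" using z by simp
  hence "z * th = b * th ^ m" using z by (simp add: ac_simps)
  also have "\<dots> = (\<Sum>i<m. e (- inverse a * coeff p i) * (b * th ^ i))"
  by (subst top) (simp add: sum_distrib_left ac_simps)
  also have "\<dots> \<in> ?L" by (intro V.span_sum V.span_scale inB') (use z in auto)
  finally show ?thesis .
  qed
  qed
  have 3: "x * th ^ i \<in> ?L" if "x \<in> ?L" for x i
  using that by (induction i arbitrary: x) (auto simp: mult.assoc[symmetric] 1)
  have 4: "x * y \<in> ?L" if "x \<in> ?L" "y \<in> ?L" for x y
  proof -
  have "y * x \<in> ?L"
  proof (rule span_mult[OF that(2)])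
  fix z assume "z \<in> B'"
  then obtain b i where z: "z = b * th ^ i" "b \<in> B" "i < m" by (auto simp: B'_def)
  have "x * b * th ^ i \<in> ?L" using 3[OF 2[OF that(1)]] z by (auto intro: V.span_base)
  thus "z * x \<in> ?L" by (simp add: z ac_simps)
  qed
  thus ?thesis by (simp add: mult.commute)
  qed
  have "th \<in> ?L" using 1[of 1] BL B(2) by auto
  moreover have "finite B'" using B by (simp add: B'_def)
  ultimately show ?case using BL B(2,3) 4 by (intro exI[of _ B']) auto
 qed
 then obtain B where B: "finite B" "1 \<in> V.span B" "Th \<subseteq> V.span B"
  "!!x y. x \<in> V.span B ==> y \<in> V.span B ==> x * y \<in> V.span B" by blast
 let ?L = "V.span B"
 have powL: "x ^ i \<in> ?L" if "x \<in> ?L" for x i using that by (induction i) (auto intro: B)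
 have polyL: "poly (map_poly e p) x \<in> ?L" if "x \<in> ?L" for p x
  unfolding poly_altdef using that
  by (auto simp: coeff_map_poly intro!: V.span_sum V.span_scale powL)
 have invL: "inverse x \<in> ?L" if x: "x \<in> ?L" for x
 proof (cases "x = 0")
  case True
  thus ?thesis by (simp add: V.span_zero)
 next
  case False
  define J where "J = (%p. p ~= 0 & poly (map_poly e p) x = 0)"
  obtain p where p: "J p" and min: "!!q. J q ==> degree p \<le> degree q"
  using alg[of x] ex_has_least_nat[of J _ degree] unfolding J_def by blast
  obtain a q where pq: "p = pCons a q" by (cases p) auto
  have eq: "e a + x * poly (map_poly e q) x = 0" using p by (simp add: J_def pq map_poly_pCons)
  have "q ~= 0"
  proof
  assume "q = 0"
  thus False using p eq e0 by (auto simp: J_def pq)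
  qed
  have "a ~= 0"
  proof
  assume "a = 0"
  hence "J q" using eq False `q ~= 0` by (auto simp: J_def)
  from min[OF this] show False using `q ~= 0` by (simp add: pq)
  qed
  have xq: "x * poly (map_poly e q) x = - e a" using eq by (simp add: eq_neg_iff_add_eq_0 add.commute)
  have "x * (poly (map_poly e q) x * e (- inverse a)) = x * poly (map_poly e q) x * - inverse (e a)"
  by (simp add: comm_ring_hom_inverse[OF e] e.hom_uminus)
  also have "\<dots> = 1" unfolding xq using `a ~= 0` e0[of a] by simp
  finally have "x * (poly (map_poly e q) x * e (- inverse a)) = 1" .
  hence "inverse x = poly (map_poly e q) x * e (- inverse a)" by (rule inverse_unique)
  thus ?thesis using B(4) polyL[OF x] e_span[OF B(2)] by simp
 qed
 have rel: "\<exists>c. (\<exists>i\<le>card B. c i ~= 0) & (\<Sum>i\<le>card B. e (c i) * x ^ i) = 0" if x: "x \<in> ?L" for x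
 proof (cases "inj_on (%i. x ^ i) {..card B}")
  case True
  let ?S = "(%i. x ^ i) ` {..card B}"
  \<comment> \<open>There are \<open>card B + 1\<close> distinct powers in a space spanned by
    \<open>card B\<close> elements. Coinciding powers give a relation directly in the other
    case.\<close>
  have "V.dependent ?S"
  proof (rule ccontr)
  assume "V.independent ?S"
  hence "card ?S \<le> card B"
  using V.independent_span_bound[OF B(1), of ?S] powL[OF x] by auto
  thus False using True by (simp add: card_image)
  qed
  then obtain u v where u: "v \<in> ?S" "u v ~= 0" "(\<Sum>v\<in>?S. e (u v) * v) = 0"
  unfolding V.dependent_finite[OF finite_imageI[OF finite_atMost]] by blast
  have "(\<Sum>i\<le>card B. e (u (x ^ i)) * x ^ i) = 0"
  using u(3) by (simp add: sum.reindex[OF True])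
  thus ?thesis using u by (intro exI[of _ "%i. u (x ^ i)"]) auto
 next
  case False
  then obtain i j where ij: "i \<le> card B" "j \<le> card B" "i ~= j" "x ^ i = x ^ j" by (auto simp: inj_on_def)
  let ?c = "%l. if l = i then 1 else if l = j then - 1 else 0 :: 'f"
  have "(\<Sum>l\<le>card B. e (?c l) * x ^ l) = (\<Sum>l\<in>{i, j}. e (?c l) * x ^ l)"
  by (rule sum.mono_neutral_right) (use ij in auto)
  also have "\<dots> = 0" using ij by (simp add: e.hom_uminus)
  finally show ?thesis using ij by (intro exI[of _ ?c]) auto
 qed
 show ?thesis
 proof (rule that[of ?L "card B"])
  show "is_subfield ?L" unfolding is_subfield_def using B(2,4) invL by (auto intro: V.span_diff)
 qed (use B(3) e_span[OF B(2)] rel in auto)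
qed

text \<open>\<open>G\<close> is a place that extends the reduction of power series at 0, and
  \<open>L\<close> is a subfield whose elements have degree at most \<open>D\<close> over the
  Laurent series. The aim is that the place is discrete on \<open>L\<close>.\<close>

locale place_field =
 fixes e :: "'o :: field fls => 'w :: field" and G :: "('w \<times> 'o) set" and L :: "'w set" and D :: nat
 assumes e_hom: "comm_ring_hom e"
  and G_hom: "hom_graph G"
  and G_e: "(e (fps_to_fls f), fps_nth f 0) \<in> G"
  and G_val: "x \<notin> fst ` G ==> x ~= 0 & (inverse x, 0) \<in> G"
  and G_inv: "(x, y) \<in> G ==> y ~= 0 ==> (inverse x, inverse y) \<in> G"
  and L_range: "range e \<subseteq> L"
  and L_field: "is_subfield L"
  and L_rel: "x \<in> L ==> \<exists>c. (\<exists>i\<le>D. c i ~= 0) & (\<Sum>i\<le>D. e (c i) * x ^ i) = 0"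
begin

interpretation e: comm_ring_hom e by (rule e_hom)

lemmas e0 = comm_ring_hom_eq_0_iff[OF e_hom]
lemmas GD = hom_graphD[OF G_hom] hom_graph_more[OF G_hom]
lemmas LD = is_subfieldD[OF L_field]

definition "max_id = {x. (x, 0) \<in> G}"
definition "units = {x. \<exists>y. y ~= 0 & (x, y) \<in> G}"
definition "vring = fst ` G"
definition "res x = (THE y. (x, y) \<in> G)"
definition "tt = e fls_X"

lemma unitsI: "(x, y) \<in> G ==> y ~= 0 ==> x \<in> units"
 by (auto simp: units_def)

lemma unitsE:
 assumes "x \<in> units"
 obtains y where "(x, y) \<in> G" "y ~= 0"
 using assms by (auto simp: units_def)

lemma vringI: "(x, y) \<in> G ==> x \<in> vring"
 unfolding vring_def by (metis fst_conv image_eqI)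

lemma vring_cases: "x \<in> vring \<longleftrightarrow> x \<in> max_id \<or> x \<in> units"
 by (auto simp: max_id_def intro: unitsI vringI elim: unitsE) (auto simp: vring_def intro: unitsI)

lemma res_eq: "(x, y) \<in> G ==> res x = y"
 unfolding res_def by (rule the_equality) (auto intro: GD(8))

lemma res_graph: "x \<in> vring ==> (x, res x) \<in> G"
 by (auto simp: vring_def res_eq)

lemma max_units: "x \<in> max_id ==> x \<notin> units"
 by (auto simp: max_id_def units_def dest: GD(8))

lemma units_0: "x \<in> units ==> x ~= 0"
 using max_units[of 0] GD(5) by (auto simp: max_id_def)

lemma units_1: "1 \<in> units" by (rule unitsI[OF GD(1)]) simp

lemma units_mult: "x \<in> units ==> y \<in> units ==> x * y \<in> units"
 by (metis unitsE unitsI GD(4) mult_eq_0_iff)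

lemma units_inverse: "x \<in> units ==> inverse x \<in> units"
 by (elim unitsE, rule unitsI[OF G_inv]) auto

lemma units_power: "x \<in> units ==> x ^ n \<in> units"
 by (induction n) (auto simp: units_1 units_mult)

lemma max_mult: "x \<in> max_id ==> y \<in> vring ==> x * y \<in> max_id"
 by (auto simp: max_id_def dest!: res_graph GD(4)[of x 0 y])

lemma max_power: "x \<in> max_id ==> n > 0 ==> x ^ n \<in> max_id"
proof (induction n)
 case (Suc n)
 have "x ^ n \<in> vring" using Suc units_1 by (cases "n = 0") (auto simp: vring_cases)
 thus ?case using max_mult[OF Suc.prems(1)] by simp
qed simp

lemma trichotomy:
 assumes "x ~= 0"
 shows "x \<in> units \<or> x \<in> max_id \<or> inverse x \<in> max_id"
 using G_val[of x] vring_cases[of x] by (auto simp: vring_def max_id_def)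

lemma tt_max: "tt \<in> max_id"
 using G_e[of fps_X] by (simp add: tt_def max_id_def)

lemma tt_0: "tt ~= 0" by (simp add: tt_def e0)

lemma tt_L: "tt \<in> L" using L_range by (auto simp: tt_def)

lemma tt_powi_unit: "tt powi j \<in> units ==> j = 0"
proof (rule ccontr)
 assume u: "tt powi j \<in> units" and j: "j ~= 0"
 have *: "tt powi (int n) \<notin> units" if "n > 0" for n
  using max_units[OF max_power[OF tt_max that]] by simp
 show False
 proof (cases "j > 0")
  case True
  thus ?thesis using *[of "nat j"] u by simp
 next
  case False
  thus ?thesis using *[of "nat (- j)"] units_inverse[OF u] j by (simp flip: power_int_minus)
 qed
qed

section \<open>Values of the place on the finite extension\<close>

lemma e_value:
 assumes "c ~= 0"
 shows "\<exists>j u. u \<in> units & e c = u * tt powi j"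
proof -
 define j where "j = fls_subdegree c"
 define f where "f = fls_regpart (fls_shift j c)"
 have f: "fps_to_fls f = fls_shift j c" unfolding f_def
  by (rule fls_regpart_to_fls_trivial) (use assms in "simp add: j_def fls_shift_subdegree")
 have "fps_nth f 0 = fls_nth c j" by (simp add: f_def)
 hence "fps_nth f 0 ~= 0" using assms by (simp add: j_def)
 hence u: "e (fps_to_fls f) \<in> units" using G_e[of f] by (auto simp: units_def)
 have "c = fps_to_fls f * fls_X_intpow j" by (simp add: f fls_shifted_times_simps)
 hence "e c = e (fps_to_fls f) * e (fls_X_intpow j)" by (metis e.hom_mult)
 moreover have "e (fls_X_intpow j) = tt powi j"
 proof (cases "j \<ge> 0")
  case True
  hence "fls_X_intpow j = (fls_X :: 'o fls) ^ nat j" by (simp add: fls_X_power_conv_shift_1)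
  thus ?thesis using True by (simp add: tt_def power_int_def e.hom_power)
 next
  case False
  hence "fls_X_intpow (- j) = (fls_X :: 'o fls) ^ nat (- j)" by (simp add: fls_X_power_conv_shift_1)
  hence "tt ^ nat (- j) * e (fls_X_intpow j) = e (fls_X_intpow (- j) * fls_X_intpow j)"
  by (simp add: tt_def e.hom_power e.hom_mult)
  also have "\<dots> = 1" by (subst fls_X_intpow_times_fls_X_intpow) simp
  finally have "inverse (tt ^ nat (- j)) = e (fls_X_intpow j)" by (rule inverse_unique)
  thus ?thesis using False by (simp add: power_int_def power_inverse)
 qed
 ultimately show ?thesis using u by (intro exI[of _ j] exI[of _ "e (fps_to_fls f)"]) simp
qed

text \<open>Otherwise one term would dominate all others strictly, and dividing by it would present
  0 as 1 plus elements of the maximal ideal.\<close>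

lemma equal_terms:
 fixes T :: "'i => 'w"
 assumes "finite I" "I ~= {}" "(\<Sum>i\<in>I. T i) = 0" "!!i. i \<in> I ==> T i ~= 0"
 shows "\<exists>i\<in>I. \<exists>j\<in>I. i ~= j & T i / T j \<in> units"
proof (rule ccontr)
 assume not: "~ ?thesis"
 have "\<exists>i\<in>J. \<forall>j\<in>J. j ~= i --> T j / T i \<in> max_id" if "finite J" "J ~= {}" "J \<subseteq> I" for J
  using that
 proof (induction rule: finite_ne_induct)
  case (insert k J)
  then obtain i where i: "i \<in> J" "!!j. j \<in> J ==> j ~= i ==> T j / T i \<in> max_id" by auto
  have nz: "T k ~= 0" "T i ~= 0" and ki: "k ~= i" using insert.prems insert.hyps assms(4) i by auto
  have "T k / T i \<notin> units" using not ki i insert.prems by blast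
  then consider "T k / T i \<in> max_id" | "inverse (T k / T i) \<in> max_id"
  using trichotomy[of "T k / T i"] nz by auto
  thus ?case
  proof cases
  case 1
  thus ?thesis using i by (intro bexI[of _ i]) auto
  next
  case 2
  have "T j / T k \<in> max_id" if "j \<in> J" for j
  proof (cases "j = i")
  case True
  thus ?thesis using 2 by (simp add: field_simps)
  next
  case False
  have "(T j / T i) * (inverse (T k / T i)) \<in> max_id"
  using i(2)[OF that False] 2 by (intro max_mult) (auto simp: vring_cases)
  thus ?thesis using nz by (simp add: field_simps)
  qed
  thus ?thesis by (intro bexI[of _ k]) auto
  qed
 qed auto
 from this[OF assms(1,2)] obtain i where i: "i \<in> I" "!!j. j \<in> I ==> j ~= i ==> T j / T i \<in> max_id" by auto
 have "(\<Sum>j\<in>I - {i}. T j / T i, \<Sum>j\<in>I - {i}. 0) \<in> G"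
  by (rule hom_graph_sum[OF G_hom]) (use i in "auto simp: max_id_def")
 from GD(7)[OF GD(1) this] have "(1 + (\<Sum>j\<in>I - {i}. T j / T i), 1) \<in> G" by simp
 moreover have "1 + (\<Sum>j\<in>I - {i}. T j / T i) = (\<Sum>j\<in>I. T j) / T i"
  using i(1) assms(1,4) by (simp add: sum.remove[of I i] add_divide_distrib sum_divide_distrib)
 ultimately have "(0, 1 :: 'o) \<in> G" using assms(3) by simp
 thus False using GD(2)[of 1] by simp
qed

text \<open>The exponent \<open>k \<le> D\<close> found in \<open>ex_value\<close> depends on the
  element, but it always divides \<open>D!\<close>, so one exponent serves all of
  \<open>L\<close>.\<close>

definition "E = (fact D :: nat)"

lemma E_pos: "E > 0" by (simp add: E_def)

text \<open>In the algebraic relation for x two terms have equal value by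
  \<open>equal_terms\<close>; their quotient is x^k, with k the difference of the exponents, times a
  Laurent series, whose value is a power of t.\<close>

lemma ex_value:
 assumes x: "x \<in> L" "x ~= 0"
 shows "\<exists>j. x ^ E * tt powi (- j) \<in> units"
proof -
 obtain c where c: "\<exists>i\<le>D. c i ~= 0" "(\<Sum>i\<le>D. e (c i) * x ^ i) = 0" using L_rel[OF x(1)] by blast
 define I where "I = {i. i \<le> D & c i ~= 0}"
 have "(\<Sum>i\<in>I. e (c i) * x ^ i) = (\<Sum>i\<le>D. e (c i) * x ^ i)"
  by (rule sum.mono_neutral_left) (auto simp: I_def)
 hence "\<exists>i\<in>I. \<exists>j\<in>I. i ~= j & e (c i) * x ^ i / (e (c j) * x ^ j) \<in> units"
  using c x by (intro equal_terms) (auto simp: I_def e0)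
 then obtain i j where ij: "i \<in> I" "j \<in> I" "i ~= j" "e (c i) * x ^ i / (e (c j) * x ^ j) \<in> units" by blast
 have "\<exists>i j. i \<in> I & j \<in> I & j < i & e (c i) * x ^ i / (e (c j) * x ^ j) \<in> units"
 proof (cases "j < i")
  case False
  hence "i < j" using ij by simp
  moreover have "e (c j) * x ^ j / (e (c i) * x ^ i) \<in> units"
  using units_inverse[OF ij(4)] by (simp add: inverse_divide)
  ultimately show ?thesis using ij by blast
 qed (use ij in blast)
 then obtain i j where ij: "i \<in> I" "j \<in> I" "j < i" "e (c i) * x ^ i / (e (c j) * x ^ j) \<in> units" by blast
 obtain p u where u: "u \<in> units" "e (c i) = u * tt powi p" using e_value[of "c i"] ij by (auto simp: I_def)
 obtain q v where v: "v \<in> units" "e (c j) = v * tt powi q" using e_value[of "c j"] ij by (auto simp: I_def)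
 define k where "k = i - j"
 have k: "k > 0" "k \<le> D" and "i = k + j" using ij by (auto simp: k_def I_def)
 hence xi: "x ^ i = x ^ k * x ^ j" by (simp add: power_add)
 note nz = units_0[OF u(1)] units_0[OF v(1)] tt_0 x(2)
 have "e (c i) * x ^ i / (e (c j) * x ^ j) * (v * inverse u) = x ^ k * tt powi (- (q - p))"
  using nz unfolding u(2) v(2) xi by (simp add: power_int_diff power_int_minus field_simps)
 moreover have "e (c i) * x ^ i / (e (c j) * x ^ j) * (v * inverse u) \<in> units"
  by (intro units_mult units_inverse ij u v)
 ultimately have xk: "x ^ k * tt powi (- (q - p)) \<in> units" by simp
 obtain l where l: "E = k * l" using k dvd_fact[of k D] unfolding E_def by (auto simp: dvd_def)
 have "(x ^ k * tt powi (- (q - p))) ^ l = x ^ E * tt powi (- ((q - p) * int l))"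
  unfolding l power_mult_distrib power_mult by (simp only: power_int_mult power_int_of_nat mult_minus_left[symmetric])
 thus ?thesis using units_power[OF xk, of l] by auto
qed

text \<open>The valuation of \<open>L\<close> scaled so that t has value \<open>E\<close>;
  integrality of all values is what makes it discrete.\<close>

definition "value_of x = (THE j. x ^ E * tt powi (- j) \<in> units)"

lemma value_unique:
 assumes "x ^ E * tt powi (- i) \<in> units" "x ^ E * tt powi (- j) \<in> units"
 shows "i = j"
proof -
 have x0: "x ^ E ~= 0" using units_0[OF assms(1)] by auto
 have "x ^ E * tt powi (- i) * inverse (x ^ E * tt powi (- j)) \<in> units"
  by (intro units_mult units_inverse assms)
 also have "x ^ E * tt powi (- i) * inverse (x ^ E * tt powi (- j)) = tt powi (j - i)"
  using x0 tt_0 by (simp add: power_int_diff power_int_minus field_simps)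
 finally show ?thesis using tt_powi_unit by fastforce
qed

lemma value_eq: "x ^ E * tt powi (- j) \<in> units ==> value_of x = j"
 unfolding value_of_def by (rule the_equality) (auto dest: value_unique)

lemma value_prop:
 assumes "x \<in> L" "x ~= 0"
 shows "x ^ E * tt powi (- value_of x) \<in> units"
 using ex_value[OF assms] value_eq by auto

lemma value_mult:
 assumes "x \<in> L" "x ~= 0" "y \<in> L" "y ~= 0"
 shows "value_of (x * y) = value_of x + value_of y"
proof (rule value_eq)
 have "(x * y) ^ E * tt powi (- (value_of x + value_of y)) =
  (x ^ E * tt powi (- value_of x)) * (y ^ E * tt powi (- value_of y))"
  using tt_0 by (simp add: power_mult_distrib power_int_add[of tt "- value_of x" "- value_of y", simplified] power_int_diff power_int_minus field_simps)
 thus "(x * y) ^ E * tt powi (- (value_of x + value_of y)) \<in> units"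
  using units_mult[OF value_prop value_prop] assms by simp
qed

lemma value_1: "value_of 1 = 0" by (rule value_eq) (simp add: units_1)

lemma value_inverse: "x \<in> L ==> x ~= 0 ==> value_of (inverse x) = - value_of x"
 using value_mult[of x "inverse x"] LD(5)[of x] value_1 by simp

lemma value_powi: "x \<in> L ==> x ~= 0 ==> value_of (x powi j) = j * value_of x"
proof -
 assume x: "x \<in> L" "x ~= 0"
 have n: "value_of (x ^ n) = int n * value_of x" for n
  by (induction n) (use x in "auto simp: value_1 value_mult LD algebra_simps")
 show ?thesis
  by (auto simp: power_int_def n value_inverse x LD simp flip: power_inverse)
  (use n value_inverse x LD in "auto simp: power_inverse")
qed

lemma value_units: "x \<in> units ==> value_of x = 0"
 by (rule value_eq) (simp add: units_power)

lemma value_max: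
 assumes "x \<in> L" "x ~= 0" "x \<in> max_id"
 shows "value_of x > 0"
proof (rule ccontr)
 assume "~ ?thesis"
 then obtain n where n: "- value_of x = int n" using nonneg_int_cases[of "- value_of x"] by fastforce
 have "tt ^ n \<in> vring" using max_power[OF tt_max, of n] units_1 by (cases "n = 0") (auto simp: vring_cases)
 hence "x ^ E * tt ^ n \<in> max_id" by (intro max_mult max_power assms E_pos)
 hence "x ^ E * tt powi (- value_of x) \<in> max_id" by (simp add: n)
 thus False using value_prop[OF assms(1,2)] max_units by blast
qed

lemma value_iff:
 assumes x: "x \<in> L" "x ~= 0"
 shows "x \<in> units \<longleftrightarrow> value_of x = 0" "x \<in> max_id \<longleftrightarrow> value_of x > 0" "x \<in> vring \<longleftrightarrow> value_of x \<ge> 0"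
proof -
 have "inverse x \<in> max_id ==> value_of x < 0"
  using value_max[of "inverse x"] value_inverse[OF x] LD(5)[OF x(1)] x by auto
 thus "x \<in> units \<longleftrightarrow> value_of x = 0" "x \<in> max_id \<longleftrightarrow> value_of x > 0" "x \<in> vring \<longleftrightarrow> value_of x \<ge> 0"
  using trichotomy[OF x(2)] value_units[of x] value_max[OF x] by (auto simp: vring_cases)
qed

lemma ex_uniformizer: "\<exists>pj\<in>L. pj ~= 0 & pj \<in> max_id & (\<forall>x\<in>L \<inter> max_id. x / pj \<in> vring)"
proof -
 obtain pj where pj: "pj \<in> L & pj ~= 0 & pj \<in> max_id"
  and min: "!!x. x \<in> L & x ~= 0 & x \<in> max_id ==> nat (value_of pj) \<le> nat (value_of x)"
  using ex_has_least_nat[of "%x. x \<in> L & x ~= 0 & x \<in> max_id" tt "%x. nat (value_of x)"] tt_L tt_0 tt_max by blast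
 have "x / pj \<in> vring" if "x \<in> L" "x \<in> max_id" for x
 proof (cases "x = 0")
  case True
  thus ?thesis using vringI[OF GD(5)] by simp
 next
  case False
  have "value_of (x * inverse pj) = value_of x - value_of pj"
  using pj that False by (subst value_mult) (auto simp: LD value_inverse)
  moreover have "value_of pj \<le> value_of x" using min[of x] value_max[of x] that False by auto
  ultimately have "x * inverse pj \<in> vring"
  using pj that False by (subst value_iff(3)) (auto simp: LD)
  thus ?thesis by (simp add: divide_inverse)
 qed
 thus ?thesis using pj by blast
qed

definition "unif = (SOME pj. pj \<in> L & pj ~= 0 & pj \<in> max_id & (\<forall>x\<in>L \<inter> max_id. x / pj \<in> vring))"

lemma unif: "unif \<in> L" "unif ~= 0" "unif \<in> max_id" "x \<in> L ==> x \<in> max_id ==> x / unif \<in> vring"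
 using someI_ex[of "%pj. pj \<in> L & pj ~= 0 & pj \<in> max_id & (\<forall>x\<in>L \<inter> max_id. x / pj \<in> vring)"] ex_uniformizer
 unfolding unif_def by blast+

section \<open>Expansion in powers of a uniformizer\<close>

definition "RL = L \<inter> vring"

lemma RL_closed:
 "1 \<in> RL" "0 \<in> RL" "x \<in> RL ==> y \<in> RL ==> x + y \<in> RL" "x \<in> RL ==> y \<in> RL ==> x - y \<in> RL"
 "x \<in> RL ==> y \<in> RL ==> x * y \<in> RL" "e (fps_to_fls f) \<in> RL" "unif \<in> RL"
 using LD vringI[OF GD(1)] vringI[OF GD(5)] vringI[OF GD(7)[OF res_graph res_graph]]
  vringI[OF GD(3)[OF res_graph res_graph]] vringI[OF GD(4)[OF res_graph res_graph]] vringI[OF G_e[of f]] L_range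
  unif(1,3)
 by (auto simp: RL_def vring_cases[of unif])

lemma RL_power: "x \<in> RL ==> x ^ n \<in> RL" by (induction n) (auto intro: RL_closed)

lemma res_simps:
 "x \<in> RL ==> y \<in> RL ==> res (x + y) = res x + res y" "x \<in> RL ==> y \<in> RL ==> res (x * y) = res x * res y"
 "res (e (fps_to_fls f)) = fps_nth f 0" "res 1 = 1" "res 0 = 0" "res unif = 0"
 using GD(7)[OF res_graph res_graph] GD(4)[OF res_graph res_graph] G_e GD(1,5) unif(3)
 by (auto simp: RL_def max_id_def intro!: res_eq)

text \<open>The constants form a field of representatives for the residues inside \<open>L\<close>,
  which yields digits compatible with addition and multiplication.\<close>

definition "coef c = e (fls_const c)"

lemma coef_simps: "coef c \<in> RL" "res (coef c) = c" "coef 0 = 0" "coef (a + b) = coef a + coef b" "coef (a * b) = coef a * coef b"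
 using RL_closed(6)[of "fps_const c"] res_simps(3)[of "fps_const c"]
 by (simp_all add: coef_def e.hom_add[symmetric] e.hom_mult[symmetric] flip: fls_plus_const)

definition "shift x = (x - coef (res x)) / unif"

lemma shift_eq: "x = coef (res x) + unif * shift x"
 using unif(2) by (simp add: shift_def)

lemma shift_eqI: "x = coef (res x) + unif * y ==> shift x = y"
 unfolding shift_def using unif(2) by (metis add_diff_cancel_left' nonzero_mult_div_cancel_left)

lemma shift_RL:
 assumes "x \<in> RL"
 shows "shift x \<in> RL"
proof -
 have "(x - coef (res x), res x - res x) \<in> G"
  using GD(3)[OF res_graph res_graph, of x "coef (res x)"] assms coef_simps(1,2)[of "res x"] by (auto simp: RL_def)
 hence "x - coef (res x) \<in> max_id" by (simp add: max_id_def)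
 moreover have "x - coef (res x) \<in> L" using assms coef_simps(1) by (auto simp: RL_def intro: LD)
 ultimately show ?thesis using unif(4) unif(1) LD(9) by (simp add: RL_def shift_def)
qed

text \<open>Digit \<open>n\<close> of the expansion: the residue after removing \<open>n\<close>
  digits and dividing by the uniformizer each time.\<close>

fun ser_nth :: "nat => 'w => 'o" where
 "ser_nth 0 x = res x"
| "ser_nth (Suc n) x = ser_nth n (shift x)"

definition "ser x = Abs_fps (%n. ser_nth n x)"

lemma shift_add:
 assumes "x \<in> RL" "y \<in> RL"
 shows "shift (x + y) = shift x + shift y"
proof (rule shift_eqI)
 have "x + y = (coef (res x) + unif * shift x) + (coef (res y) + unif * shift y)"
  by (intro arg_cong2[where f = "(+)"] shift_eq)
 also have "\<dots> = coef (res (x + y)) + unif * (shift x + shift y)"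
  unfolding res_simps(1)[OF assms] coef_simps by (simp only: distrib_left add.assoc add.left_commute)
 finally show "x + y = coef (res (x + y)) + unif * (shift x + shift y)" .
qed

text \<open>The product rule is left asymmetric on purpose: it is the recursion satisfied by the
  tail of a product of power series.\<close>

lemma shift_mult:
 assumes "x \<in> RL" "y \<in> RL"
 shows "shift (x * y) = shift x * y + coef (res x) * shift y"
proof (rule shift_eqI)
 have "x * y = (coef (res x) + unif * shift x) * y"
  using shift_eq[of x] by simp
 also have "\<dots> = coef (res x) * (coef (res y) + unif * shift y) + unif * shift x * y"
  using shift_eq[of y] by (simp add: algebra_simps)
 also have "\<dots> = coef (res (x * y)) + unif * (shift x * y + coef (res x) * shift y)"
  by (simp add: res_simps(2)[OF assms] coef_simps algebra_simps)
 finally show "x * y = coef (res (x * y)) + unif * (shift x * y + coef (res x) * shift y)" .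
qed

lemma shift_coef: "shift (coef c) = 0" by (rule shift_eqI) (simp add: coef_simps)

lemma ser_add: "x \<in> RL ==> y \<in> RL ==> ser (x + y) = ser x + ser y"
proof -
 have "x \<in> RL ==> y \<in> RL ==> ser_nth n (x + y) = ser_nth n x + ser_nth n y" for n
  by (induction n arbitrary: x y) (auto simp: res_simps shift_add shift_RL)
 thus "x \<in> RL ==> y \<in> RL ==> ?thesis" by (simp add: ser_def fps_eq_iff)
qed

lemma ser_0: "ser 0 = 0"
proof -
 have "ser_nth n 0 = 0" for n using shift_coef[of 0] by (induction n) (auto simp: res_simps coef_simps)
 thus ?thesis by (simp add: ser_def fps_eq_iff)
qed

lemma ser_coef: "ser (coef c) = fps_const c"
proof -
 have "fps_nth (ser 0) n = 0" for n by (simp add: ser_0)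
 hence "ser_nth n (coef c) = (if n = 0 then c else 0)" for n
  by (cases n) (auto simp: coef_simps shift_coef ser_def)
 thus ?thesis by (simp add: ser_def fps_eq_iff)
qed

lemma ser_step: "ser x = fps_const (res x) + fps_X * ser (shift x)"
proof (rule fps_ext)
 fix n show "fps_nth (ser x) n = fps_nth (fps_const (res x) + fps_X * ser (shift x)) n"
  by (cases n) (auto simp: ser_def)
qed

lemma ser_mult: "x \<in> RL ==> y \<in> RL ==> ser (x * y) = ser x * ser y"
proof -
 have "fps_nth (ser (x * y)) n = fps_nth (ser x * ser y) n" if "x \<in> RL" "y \<in> RL" for x y n
  using that
 proof (induction n arbitrary: x y)
  case 0
  thus ?case by (simp add: ser_def res_simps)
 next
  case (Suc n)
  note s = shift_RL[OF Suc.prems(1)] shift_RL[OF Suc.prems(2)]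
  have "fps_nth (ser (x * y)) (Suc n) = fps_nth (ser (shift (x * y))) n" by (simp add: ser_def)
  also have "\<dots> = fps_nth (ser (shift x * y)) n + fps_nth (ser (coef (res x) * shift y)) n"
  by (simp add: shift_mult Suc.prems ser_add RL_closed s coef_simps)
  also have "\<dots> = fps_nth (ser (shift x) * ser y) n + fps_nth (ser (coef (res x)) * ser (shift y)) n"
  by (simp only: Suc.IH s Suc.prems coef_simps)
  also have "\<dots> = fps_nth (ser (shift x) * ser y) n + res x * fps_nth (ser y) (Suc n)"
  by (simp add: ser_coef) (simp add: ser_def)
  also have "\<dots> = fps_nth ((fps_const (res x) + fps_X * ser (shift x)) * ser y) (Suc n)"
  by (simp add: distrib_right mult.assoc)
  finally show ?case by (simp only: ser_step[of x, symmetric])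
 qed
 thus "x \<in> RL ==> y \<in> RL ==> ?thesis" by (auto intro: fps_ext)
qed

lemma ser_1: "ser 1 = 1"
 using ser_coef[of 1] by (simp add: coef_def)

lemma ser_unif: "ser unif = fps_X"
proof -
 have "shift unif = 1" by (rule shift_eqI) (simp add: res_simps coef_simps)
 thus ?thesis using ser_step[of unif] by (simp add: res_simps ser_1)
qed

lemma ser_unif_power: "ser (unif ^ n) = fps_X ^ n"
 by (induction n) (simp_all add: ser_1 ser_mult RL_closed RL_power ser_unif)

lemma ex_pole:
 assumes "x \<in> L"
 shows "\<exists>n. x * unif ^ n \<in> RL"
proof (cases "x = 0")
 case False
 have vu: "value_of unif > 0" using value_max unif by blast
 have "value_of (x * unif ^ n) = value_of x + int n * value_of unif" for n
  using value_mult[OF assms False LD(8)[OF unif(1)], of n] value_powi[OF unif(1,2), of "int n"] unif(2) by simp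
 moreover have "0 \<le> value_of x + int (nat (- value_of x)) * value_of unif"
 proof (cases "value_of x \<ge> 0")
  case False
  hence "(- value_of x) * 1 \<le> (- value_of x) * value_of unif" using vu by (intro mult_left_mono) auto
  thus ?thesis using False by simp
 qed (use vu in simp)
 ultimately have "x * unif ^ nat (- value_of x) \<in> vring"
  using assms False unif by (subst value_iff(3)) (auto simp: LD)
 thus ?thesis using assms unif(1) by (auto simp: RL_def LD)
qed (simp add: RL_closed)

text \<open>Some power of the uniformizer clears the pole of \<open>x\<close>; by
  \<open>expand_eq\<close> the result does not depend on the choice.\<close>

definition "expand x = (let n = (SOME n. x * unif ^ n \<in> RL) in fps_to_fls (ser (x * unif ^ n)) / fls_X ^ n)"

lemma expand_eq:
 assumes "x * unif ^ n \<in> RL"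
 shows "expand x = fps_to_fls (ser (x * unif ^ n)) / fls_X ^ n"
proof -
 define m where "m = (SOME n. x * unif ^ n \<in> RL)"
 have m: "x * unif ^ m \<in> RL" unfolding m_def by (rule someI[of "%n. x * unif ^ n \<in> RL", OF assms])
 have "ser (x * unif ^ m * unif ^ n) = ser (x * unif ^ n * unif ^ m)" by (simp add: ac_simps)
 hence "ser (x * unif ^ m) * fps_X ^ n = ser (x * unif ^ n) * fps_X ^ m"
  by (simp only: ser_mult[OF m] ser_mult[OF assms] RL_power RL_closed ser_unif_power)
 hence "fps_to_fls (ser (x * unif ^ m) * fps_X ^ n) = fps_to_fls (ser (x * unif ^ n) * fps_X ^ m)" by simp
 hence "fps_to_fls (ser (x * unif ^ m)) * fls_X ^ n = fps_to_fls (ser (x * unif ^ n)) * fls_X ^ m"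
  by (simp only: fls_times_fps_to_fls fps_to_fls_power fps_X_to_fls)
 moreover have "(fls_X :: 'o fls) ^ k ~= 0" for k by simp
 ultimately show ?thesis unfolding expand_def m_def[symmetric] Let_def by (simp only: frac_eq_eq not_False_eq_True simp_thms)
qed

lemma expand_RL: "x \<in> RL ==> expand x = fps_to_fls (ser x)"
 using expand_eq[of x 0] by simp

lemma expand_hom:
 assumes "x \<in> L" "y \<in> L"
 shows "expand (x + y) = expand x + expand y" "expand (x * y) = expand x * expand y"
proof -
 obtain m n where m: "x * unif ^ m \<in> RL" and n: "y * unif ^ n \<in> RL" using ex_pole assms by blast
 have m': "x * unif ^ (m + n) \<in> RL" and n': "y * unif ^ (m + n) \<in> RL"
  using RL_closed(5)[OF m RL_power[OF RL_closed(7), of n]] RL_closed(5)[OF n RL_power[OF RL_closed(7), of m]]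
  by (simp_all add: power_add ac_simps)
 have a: "(x + y) * unif ^ (m + n) = x * unif ^ (m + n) + y * unif ^ (m + n)" by (simp add: algebra_simps)
 have "(x + y) * unif ^ (m + n) \<in> RL" unfolding a by (rule RL_closed(3)[OF m' n'])
 from expand_eq[OF this] show "expand (x + y) = expand x + expand y"
  unfolding expand_eq[OF m'] expand_eq[OF n'] a by (simp add: ser_add m' n' add_divide_distrib)
 have a: "(x * y) * unif ^ (m + n) = x * unif ^ m * (y * unif ^ n)" by (simp add: power_add ac_simps)
 have "(x * y) * unif ^ (m + n) \<in> RL" unfolding a by (rule RL_closed(5)[OF m n])
 from expand_eq[OF this] have "expand (x * y) = fps_to_fls (ser (x * unif ^ m) * ser (y * unif ^ n)) / fls_X ^ (m + n)"
  unfolding a ser_mult[OF m n] .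
 thus "expand (x * y) = expand x * expand y"
  unfolding expand_eq[OF m] expand_eq[OF n] fls_times_fps_to_fls power_add
  by (simp only: times_divide_times_eq)
qed

lemma expand_e: "expand (e (fps_to_fls f)) = fps_to_fls (ser (e (fps_to_fls f)))"
 "fps_nth (ser (e (fps_to_fls f))) 0 = fps_nth f 0" "expand 1 = 1"
 using expand_RL[OF RL_closed(6)] expand_RL[OF RL_closed(1)]
 by (auto simp: ser_def[of "e (fps_to_fls f)"] res_simps ser_1)

end

text \<open>Trades a finite extension for Laurent series over the same constants. The embedded
  Laurent series field is not fixed by \<open>rh\<close>, since t acquires the ramification index as
  its order, but power series stay power series with the same constant term.\<close>

theorem discretize:
 fixes e :: "'o :: alg_closed_field fls => 'w :: field"
 assumes e: "comm_ring_hom e" and alg: "!!x. \<exists>p. p ~= 0 & poly (map_poly e p) x = 0" and fin: "finite Th"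
 obtains L rh where "Th \<subseteq> L" "is_subfield L" "range e \<subseteq> L" "rh 1 = 1"
  "!!x y. x \<in> L ==> y \<in> L ==> rh (x + y) = rh x + rh y" "!!x y. x \<in> L ==> y \<in> L ==> rh (x * y) = rh x * rh y"
  "!!f. \<exists>h. rh (e (fps_to_fls f)) = fps_to_fls (h :: 'o fps) & fps_nth h 0 = fps_nth f 0"
proof -
 interpret e: comm_ring_hom e by fact
 obtain L D where L: "range e \<subseteq> L" "Th \<subseteq> L" "is_subfield L"
  "!!x. x \<in> L ==> \<exists>c. (\<exists>i\<le>D. c i ~= 0) & (\<Sum>i\<le>D::nat. e (c i) * x ^ i) = 0"
  using finite_extension[OF e alg fin] by blast
 define G0 where "G0 = {(e (fps_to_fls f), fps_nth f 0) | f. True}"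
 have inG0: "(e (fps_to_fls f), fps_nth f 0) \<in> G0" for f by (auto simp: G0_def)
 have "hom_graph G0"
  unfolding hom_graph_def
 proof (intro conjI allI impI)
  show "(1, 1) \<in> G0" using inG0[of 1] by simp
  show "y = 0" if "(0, y) \<in> G0" for y
  using that by (auto simp: G0_def comm_ring_hom_eq_0_iff[OF e])
  fix a b c d assume "(a, b) \<in> G0" "(c, d) \<in> G0"
  then obtain f g where fg: "a = e (fps_to_fls f)" "b = fps_nth f 0" "c = e (fps_to_fls g)" "d = fps_nth g 0"
  by (auto simp: G0_def)
  show "(a - c, b - d) \<in> G0" using inG0[of "f - g"] by (simp add: fg e.hom_minus)
  show "(a * c, b * d) \<in> G0" using inG0[of "f * g"] by (simp add: fg e.hom_mult fls_times_fps_to_fls fps_mult_nth_0)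
 qed
 from place_extension[OF this] obtain G where G: "hom_graph G" "G0 \<subseteq> G"
  "!!x. x \<notin> fst ` G ==> x ~= 0 & (inverse x, 0) \<in> G"
  "!!x y. (x, y) \<in> G ==> y ~= 0 ==> (inverse x, inverse y) \<in> G" by blast
 interpret P: place_field e G L D
  by unfold_locales (use L G inG0 e in auto)
 show ?thesis
  by (rule that[of L P.expand]) (use L P.expand_hom P.expand_e in auto)
qed

section \<open>Embedding finitely generated fields\<close>

text \<open>Graph of an embedding of a subring of a carrier-based field into a field type; the
  equivalence for zero encodes both single-valuedness and injectivity.\<close>

definition inj_graph :: "('k, 'm) ring_scheme => ('k \<times> 'w :: field) set => bool" where
 "inj_graph K GG \<longleftrightarrow> (\<one>\<^bsub>K\<^esub>, 1) \<in> GG & (\<forall>x w. (x, w) \<in> GG --> x \<in> carrier K & (x = \<zero>\<^bsub>K\<^esub> \<longleftrightarrow> w = 0)) &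
  (\<forall>x w y v. (x, w) \<in> GG --> (y, v) \<in> GG --> (x \<ominus>\<^bsub>K\<^esub> y, w - v) \<in> GG & (x \<otimes>\<^bsub>K\<^esub> y, w * v) \<in> GG)"

lemma inj_graphD:
 assumes "inj_graph K GG"
 shows "(\<one>\<^bsub>K\<^esub>, 1) \<in> GG" "(x, w) \<in> GG ==> x \<in> carrier K" "(x, w) \<in> GG ==> x = \<zero>\<^bsub>K\<^esub> \<longleftrightarrow> w = 0"
  "(x, w) \<in> GG ==> (y, v) \<in> GG ==> (x \<ominus>\<^bsub>K\<^esub> y, w - v) \<in> GG"
  "(x, w) \<in> GG ==> (y, v) \<in> GG ==> (x \<otimes>\<^bsub>K\<^esub> y, w * v) \<in> GG"
proof -
 show "(\<one>\<^bsub>K\<^esub>, 1) \<in> GG" using assms unfolding inj_graph_def by blast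
 show "(x, w) \<in> GG ==> x \<in> carrier K" using assms unfolding inj_graph_def by blast
 show "(x, w) \<in> GG ==> x = \<zero>\<^bsub>K\<^esub> \<longleftrightarrow> w = 0" using assms unfolding inj_graph_def by blast
 show "(x, w) \<in> GG ==> (y, v) \<in> GG ==> (x \<ominus>\<^bsub>K\<^esub> y, w - v) \<in> GG" using assms unfolding inj_graph_def by blast
 show "(x, w) \<in> GG ==> (y, v) \<in> GG ==> (x \<otimes>\<^bsub>K\<^esub> y, w * v) \<in> GG" using assms unfolding inj_graph_def by blast
qed

context field
begin

lemma inj_graph_more:
 assumes G: "inj_graph R GG"
 shows "(\<zero>, 0) \<in> GG" "(x, w) \<in> GG ==> (\<ominus> x, - w) \<in> GG" "(x, w) \<in> GG ==> (y, v) \<in> GG ==> (x \<oplus> y, w + v) \<in> GG"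
  "(x, w) \<in> GG ==> (y, w) \<in> GG ==> x = y" "(x, w) \<in> GG ==> (x, v) \<in> GG ==> w = v"
proof -
 note D = inj_graphD[OF G]
 show z: "(\<zero>, 0) \<in> GG" using D(4)[OF D(1) D(1)] by (simp add: a_minus_def r_neg)
 show m: "(\<ominus> x, - w) \<in> GG" if "(x, w) \<in> GG" for x w
  using D(4)[OF z that] D(2)[OF that] by (simp add: a_minus_def)
 show "(x \<oplus> y, w + v) \<in> GG" if "(x, w) \<in> GG" "(y, v) \<in> GG"
  using D(4)[OF that(1) m[OF that(2)]] D(2)[OF that(1)] D(2)[OF that(2)] by (simp add: a_minus_def minus_minus)
 show "x = y" if "(x, w) \<in> GG" "(y, w) \<in> GG"
 proof -
  have "x \<ominus> y = \<zero>" using D(3)[OF D(4)[OF that]] by simp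
  thus ?thesis using D(2)[OF that(1)] D(2)[OF that(2)] by (simp add: r_right_minus_eq)
 qed
 show "w = v" if "(x, w) \<in> GG" "(x, v) \<in> GG"
  using D(3)[OF D(4)[OF that]] D(2)[OF that(1)] by (simp add: r_right_minus_eq)
qed

lemma inv_closed_mult:
 assumes "y \<in> carrier R" "y ~= \<zero>"
 shows "m_inv R y \<in> carrier R" "y \<otimes> m_inv R y = \<one>" "m_inv R y ~= \<zero>"
proof -
 have y: "y \<in> Units R" using assms by (simp add: field_Units)
 show "m_inv R y \<in> carrier R" "y \<otimes> m_inv R y = \<one>" using y by auto
 thus "m_inv R y ~= \<zero>" using assms by auto
qed

text \<open>Passing to quotients makes the domain a field, so that polynomial division over it is
  available when the next element is adjoined.\<close>

lemma inj_graph_fractions: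
 assumes G: "inj_graph R (GG :: ('a \<times> 'w :: field) set)" and c: "countable GG"
 obtains GG' where "inj_graph R GG'" "GG \<subseteq> GG'" "countable GG'" "!!x w. (x, w) \<in> GG' ==> w ~= 0 ==> (m_inv R x, inverse w) \<in> GG'"
proof -
 note D = inj_graphD[OF G] inj_graph_more[OF G]
 define f :: "('a \<times> 'w) \<times> ('a \<times> 'w) => 'a \<times> 'w" where "f = (%((x, w), (y, v)). (x \<otimes> m_inv R y, w / v))"
 define GG' where "GG' = f ` (GG \<times> (GG - {(\<zero>, 0)}))"
 have I: "(x \<otimes> m_inv R y, w / v) \<in> GG'" if "(x, w) \<in> GG" "(y, v) \<in> GG" "v ~= 0" for x y w v
  unfolding GG'_def using that by (intro image_eqI[of _ _ "((x, w), (y, v))"]) (auto simp: f_def)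
 have E: "\<exists>x w y v. p = x \<otimes> m_inv R y & q = w / v & (x, w) \<in> GG & (y, v) \<in> GG & v ~= 0 & y ~= \<zero> &
  x \<in> carrier R & y \<in> carrier R" if pq: "(p, q) \<in> GG'" for p q
 proof -
  obtain z where z: "z \<in> GG \<times> (GG - {(\<zero>, 0)})" "(p, q) = f z" using pq unfolding GG'_def by blast
  obtain x w y v where "z = ((x, w), (y, v))" by (cases z) auto
  hence *: "p = x \<otimes> m_inv R y" "q = w / v" "(x, w) \<in> GG" "(y, v) \<in> GG" "y = \<zero> --> v ~= 0" using z by (auto simp: f_def)
  hence "v ~= 0" "y ~= \<zero>" using D(3)[OF *(4)] by auto
  thus ?thesis using * D(2)[OF *(3)] D(2)[OF *(4)]
  by (intro exI[of _ x] exI[of _ w] exI[of _ y] exI[of _ v]) simp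
 qed
 have "inj_graph R GG'"
  unfolding inj_graph_def
 proof (intro conjI allI impI)
  show "(\<one>, 1) \<in> GG'" using I[OF D(1) D(1)] by simp
  show "x \<in> carrier R" if xw: "(x, w) \<in> GG'" for x w
  using E[OF xw] inv_closed_mult by auto
  show "x = \<zero> \<longleftrightarrow> w = 0" if xw: "(x, w) \<in> GG'" for x w
  proof -
  from E[OF xw] obtain a b c d where *: "x = a \<otimes> m_inv R c" "w = b / d" "(a, b) \<in> GG" "(c, d) \<in> GG" "d ~= 0" "c ~= \<zero>"
  "a \<in> carrier R" "c \<in> carrier R" by blast
  have "x = \<zero> \<longleftrightarrow> a = \<zero>" using inv_closed_mult[OF *(8,6)] * integral by auto
  thus ?thesis using D(3)[OF *(3)] * by auto
  qed
  fix x w y v assume xw: "(x, w) \<in> GG'" and yv: "(y, v) \<in> GG'"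
  from E[OF xw] obtain a b c d where *: "x = a \<otimes> m_inv R c" "w = b / d" "(a, b) \<in> GG" "(c, d) \<in> GG" "d ~= 0" "c ~= \<zero>"
  "a \<in> carrier R" "c \<in> carrier R" by blast
  from E[OF yv] obtain a' b' c' d' where **: "y = a' \<otimes> m_inv R c'" "v = b' / d'" "(a', b') \<in> GG" "(c', d') \<in> GG" "d' ~= 0" "c' ~= \<zero>"
  "a' \<in> carrier R" "c' \<in> carrier R" by blast
  note i = inv_closed_mult[OF *(8,6)] and i' = inv_closed_mult[OF **(8,6)]
  have ci: "m_inv R (c \<otimes> c') = m_inv R c \<otimes> m_inv R c'"
  proof (rule comm_inv_char)
  have "c \<otimes> c' \<otimes> (m_inv R c \<otimes> m_inv R c') = (c \<otimes> m_inv R c) \<otimes> (c' \<otimes> m_inv R c')"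
  using i(1) i'(1) *(7,8) **(7,8) by (simp add: m_ac a_minus_def l_distr r_distr l_minus r_minus)
  thus "c \<otimes> c' \<otimes> (m_inv R c \<otimes> m_inv R c') = \<one>" unfolding i(2) i'(2) by simp
  qed (use i i' * ** in auto)
  note cd = D(5)[OF *(4) **(4)]
  have J: "(p \<otimes> m_inv R (c \<otimes> c'), q / (d * d')) \<in> GG'" if "(p, q) \<in> GG" for p q
  by (rule I[OF that cd]) (use * ** in simp)
  have "(a \<otimes> a', b * b') \<in> GG" by (rule D(5)[OF *(3) **(3)])
  moreover have "a \<otimes> a' \<otimes> m_inv R (c \<otimes> c') = x \<otimes> y" unfolding ci *(1) **(1) using i(1) i'(1) *(7,8) **(7,8) by (simp add: m_ac a_minus_def l_distr r_distr l_minus r_minus)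
  ultimately show "(x \<otimes> y, w * v) \<in> GG'" using J[of "a \<otimes> a'" "b * b'"] * ** by simp
  have "(a \<otimes> c' \<ominus> a' \<otimes> c, b * d' - b' * d) \<in> GG" by (rule D(4)[OF D(5)[OF *(3) **(4)] D(5)[OF **(3) *(4)]])
  moreover have "(a \<otimes> c' \<ominus> a' \<otimes> c) \<otimes> m_inv R (c \<otimes> c') = x \<ominus> y"
  proof -
  have "(a \<otimes> c' \<ominus> a' \<otimes> c) \<otimes> (m_inv R c \<otimes> m_inv R c') =
  a \<otimes> m_inv R c \<otimes> (c' \<otimes> m_inv R c') \<ominus> a' \<otimes> m_inv R c' \<otimes> (c \<otimes> m_inv R c)"
  using i(1) i'(1) *(7,8) **(7,8) by (simp add: m_ac a_minus_def l_distr r_distr l_minus r_minus)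
  thus ?thesis unfolding ci i(2) i'(2) using i(1) i'(1) * ** by simp
  qed
  moreover have "(b * d' - b' * d) / (d * d') = w - v" using * ** by (simp add: field_simps)
  ultimately show "(x \<ominus> y, w - v) \<in> GG'" using J[of "a \<otimes> c' \<ominus> a' \<otimes> c" "b * d' - b' * d"] * ** by simp
 qed
 moreover have "GG \<subseteq> GG'"
 proof (rule subrelI)
  fix x w assume "(x, w) \<in> GG"
  thus "(x, w) \<in> GG'" using I[OF _ D(1), of x w] D(2)[of x w] by simp
 qed
 moreover have "countable GG'" unfolding GG'_def using c by (intro countable_image countable_SIGMA) auto
 moreover have "(m_inv R x, inverse w) \<in> GG'" if xw: "(x, w) \<in> GG'" and w: "w ~= 0" for x w
 proof -
  from E[OF xw] obtain a b c d where *: "x = a \<otimes> m_inv R c" "w = b / d" "(a, b) \<in> GG" "(c, d) \<in> GG" "d ~= 0" "c ~= \<zero>"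
  "a \<in> carrier R" "c \<in> carrier R" by blast
  have b: "b ~= 0" using w * by auto
  hence a: "a ~= \<zero>" using D(3)[OF *(3)] by auto
  note i = inv_closed_mult[OF *(8,6)] and j = inv_closed_mult[OF *(7) a]
  have "m_inv R x = c \<otimes> m_inv R a"
  proof (rule comm_inv_char)
  have "x \<otimes> (c \<otimes> m_inv R a) = (a \<otimes> m_inv R a) \<otimes> (c \<otimes> m_inv R c)"
  unfolding *(1) using i(1) j(1) *(7,8) by (simp add: m_ac)
  thus "x \<otimes> (c \<otimes> m_inv R a) = \<one>" unfolding i(2) j(2) by simp
  qed (use i j * in auto)
  thus ?thesis using I[OF *(4,3) b] * by simp
 qed
 ultimately show ?thesis by (rule that)
qed

end

locale graph_field = field R for R :: "('a, 'm) ring_scheme" (structure) +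
 fixes GG :: "('a \<times> 'w :: field) set"
 assumes graph: "inj_graph R GG"
  and graph_inverse: "(x, w) \<in> GG ==> w ~= 0 ==> (m_inv R x, inverse w) \<in> GG"
begin

lemmas gD = inj_graphD[OF graph] inj_graph_more[OF graph]

definition "B = snd ` GG"
definition "j w = (THE x. (x, w) \<in> GG)"
text \<open>Polynomials are taken over the image \<open>B\<close> inside the field type and are
  evaluated in the carrier-based field after their coefficients are carried back by
  \<open>j\<close>.\<close>

definition "BP = {p. \<forall>i. poly.coeff p i \<in> B}"
definition "evK c p = fold_coeffs (%b acc. j b \<oplus> c \<otimes> acc) p \<zero>"

lemma B_I: "(x, w) \<in> GG ==> w \<in> B"
 unfolding B_def by (metis image_eqI snd_conv)

lemma j_eq: "(x, w) \<in> GG ==> j w = x"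
 unfolding j_def by (rule the_equality) (auto intro: gD(9))

lemma j_graph: "w \<in> B ==> (j w, w) \<in> GG"
 by (auto simp: B_def j_eq)

lemma B_subfield: "is_subfield B"
 unfolding is_subfield_def
proof (intro conjI ballI)
 show "1 \<in> B" by (rule B_I[OF gD(1)])
 show "x - y \<in> B" "x * y \<in> B" if "x \<in> B" "y \<in> B" for x y
  using B_I[OF gD(4)[OF j_graph j_graph]] B_I[OF gD(5)[OF j_graph j_graph]] that by auto
 show "inverse x \<in> B" if "x \<in> B" for x
  using B_I[OF graph_inverse[OF j_graph[OF that]]] that by (cases "x = 0") auto
qed

lemmas BD = is_subfieldD[OF B_subfield]

lemma j_simps:
 "x \<in> B ==> j x \<in> carrier R" "x \<in> B ==> j x = \<zero> \<longleftrightarrow> x = 0" "j 1 = \<one>" "j 0 = \<zero>"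
 "x \<in> B ==> y \<in> B ==> j (x + y) = j x \<oplus> j y" "x \<in> B ==> y \<in> B ==> j (x * y) = j x \<otimes> j y"
 "x \<in> B ==> j (- x) = \<ominus> j x"
 using gD(2)[OF j_graph] gD(3)[OF j_graph] j_eq[OF gD(1)] j_eq[OF gD(6)] j_eq[OF gD(8)[OF j_graph j_graph]]
  j_eq[OF gD(5)[OF j_graph j_graph]] j_eq[OF gD(7)[OF j_graph]] by auto

lemma BP_pCons: "pCons b p \<in> BP \<longleftrightarrow> b \<in> B & p \<in> BP"
proof -
 have "(\<forall>i. poly.coeff (pCons b p) i \<in> B) \<longleftrightarrow> (\<forall>i. i = 0 --> b \<in> B) & (\<forall>i. poly.coeff p i \<in> B)"
  by (auto simp: coeff_pCons split: nat.splits)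
 thus ?thesis by (auto simp: BP_def)
qed

lemma BP_closed:
 "0 \<in> BP" "p \<in> BP ==> q \<in> BP ==> p + q \<in> BP" "p \<in> BP ==> q \<in> BP ==> p - q \<in> BP"
 "p \<in> BP ==> q \<in> BP ==> p * q \<in> BP" "b \<in> B ==> Polynomial.monom b k \<in> BP"
 by (auto simp: BP_def coeff_mult BD intro!: BD is_subfield_sum[OF B_subfield])

lemma evK_pCons:
 assumes "c \<in> carrier R"
 shows "evK c (pCons b p) = j b \<oplus> c \<otimes> evK c p"
 using assms
proof (cases "p = 0 & b = 0")
 case False
 have "coeffs (pCons b p) = b # coeffs p" using False by (auto simp: cCons_def)
 thus ?thesis by (simp add: evK_def fold_coeffs_def)
qed (simp add: evK_def j_simps)

lemma evK_0: "evK c 0 = \<zero>" by (simp add: evK_def)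

context
 fixes c assumes c: "c \<in> carrier R"
begin

lemma evK_closed: "p \<in> BP ==> evK c p \<in> carrier R"
 by (induction p) (auto simp: evK_0 evK_pCons[OF c] BP_pCons c j_simps)

lemma evK_add: "p \<in> BP ==> q \<in> BP ==> evK c (p + q) = evK c p \<oplus> evK c q"
proof (induction p q rule: poly_induct2)
 case (pCons a p b q)
 hence *: "j a \<in> carrier R" "j b \<in> carrier R" "evK c p \<in> carrier R" "evK c q \<in> carrier R"
  by (auto simp: BP_pCons j_simps evK_closed)
 show ?case using pCons * by (simp add: evK_pCons[OF c] BP_pCons j_simps r_distr c a_ac)
qed (simp add: evK_0)

lemma evK_smult: "b \<in> B ==> p \<in> BP ==> evK c (Polynomial.smult b p) = j b \<otimes> evK c p"
proof (induction p)
 case (pCons a p)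
 hence *: "j a \<in> carrier R" "j b \<in> carrier R" "evK c p \<in> carrier R"
  by (auto simp: BP_pCons j_simps evK_closed)
 show ?case using pCons * by (simp add: evK_pCons[OF c] BP_pCons j_simps r_distr c m_ac)
qed (simp add: evK_0 j_simps)

lemma BP_smult: "b \<in> B ==> p \<in> BP ==> Polynomial.smult b p \<in> BP"
 by (auto simp: BP_def BD)

lemma evK_mult: "p \<in> BP ==> q \<in> BP ==> evK c (p * q) = evK c p \<otimes> evK c q"
proof (induction p)
 case (pCons a p)
 hence *: "j a \<in> carrier R" "evK c p \<in> carrier R" "evK c q \<in> carrier R" "a \<in> B" "p \<in> BP"
  by (auto simp: BP_pCons j_simps evK_closed)
 have "evK c (pCons a p * q) = evK c (Polynomial.smult a q) \<oplus> evK c (pCons 0 (p * q))"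
  using * pCons.prems by (simp add: evK_add BP_smult BP_pCons BP_closed BD)
 also have "\<dots> = j a \<otimes> evK c q \<oplus> c \<otimes> (evK c p \<otimes> evK c q)"
  using * pCons by (simp add: evK_smult evK_pCons[OF c] j_simps c)
 finally show ?case using * by (simp add: evK_pCons[OF c] l_distr r_distr c m_ac)
qed (simp add: evK_0 evK_closed)

lemma evK_const: "b \<in> B ==> evK c [:b:] = j b"
 by (simp add: evK_pCons[OF c] evK_0 c j_simps)

lemma evK_diff: "p \<in> BP ==> q \<in> BP ==> evK c (p - q) = evK c p \<ominus> evK c q"
proof -
 assume pq: "p \<in> BP" "q \<in> BP"
 have "evK c p = evK c (p - q) \<oplus> evK c q" using evK_add[OF BP_closed(3)[OF pq] pq(2)] by simp
 thus ?thesis using evK_closed pq BP_closed(3)[OF pq] by (simp add: a_minus_def a_assoc r_neg)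
qed

end

lemma BP_division:
 assumes "f \<in> BP" "g \<in> BP" "g ~= 0"
 shows "\<exists>q r. q \<in> BP & r \<in> BP & f = q * g + r & (r = 0 \<or> Polynomial.degree r < Polynomial.degree g)"
 using assms(1)
proof (induction "Polynomial.degree f" arbitrary: f rule: less_induct)
 case less
 show ?case
 proof (cases "f = 0 \<or> Polynomial.degree f < Polynomial.degree g")
  case True
  thus ?thesis using less.prems BP_closed(1) by (intro exI[of _ 0] exI[of _ f]) auto
 next
  case False
  define m where "m = Polynomial.monom (poly.coeff f (Polynomial.degree f) / poly.coeff g (Polynomial.degree g)) (Polynomial.degree f - Polynomial.degree g)"
  have m: "m \<in> BP" unfolding m_def using less.prems assms(2) by (intro BP_closed BD) (auto simp: BP_def)
  define f1 where "f1 = f - m * g"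
  have f1: "f1 \<in> BP" unfolding f1_def by (intro BP_closed m less.prems assms)
  have z: "poly.coeff f1 i = 0" if "i \<ge> Polynomial.degree f" for i
  proof (cases "i = Polynomial.degree f")
  case True
  thus ?thesis using False assms(3) by (simp add: f1_def m_def coeff_monom_mult)
  next
  case False
  hence "i > Polynomial.degree f" using that by simp
  thus ?thesis using `~ (f = 0 \<or> _)` by (auto simp: f1_def m_def coeff_monom_mult coeff_eq_0)
  qed
  have "\<exists>q r. q \<in> BP & r \<in> BP & f1 = q * g + r & (r = 0 \<or> Polynomial.degree r < Polynomial.degree g)"
  proof (cases "f1 = 0")
  case True
  thus ?thesis using BP_closed(1) by (intro exI[of _ 0]) simp
  next
  case False
  hence "Polynomial.degree f1 < Polynomial.degree f" using z by (meson leading_coeff_0_iff not_le)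
  thus ?thesis using less.hyps f1 by blast
  qed
  then obtain q r where "q \<in> BP" "r \<in> BP" "f1 = q * g + r" "r = 0 \<or> Polynomial.degree r < Polynomial.degree g" by blast
  thus ?thesis using m by (intro exI[of _ "q + m"] exI[of _ r]) (auto simp: f1_def algebra_simps intro: BP_closed)
 qed
qed

lemma countable_BP:
 assumes "countable GG"
 shows "countable BP"
proof -
 have "countable B" unfolding B_def using assms by simp
 moreover have "BP \<subseteq> Poly ` lists B"
 proof
  fix p assume "p \<in> BP"
  hence "coeffs p \<in> lists B" by (auto simp: BP_def coeffs_def)
  thus "p \<in> Poly ` lists B" by (intro image_eqI[of _ _ "coeffs p"]) auto
 qed
 ultimately show ?thesis using countable_lists by (meson countable_image countable_subset)
qed

lemma adjoin_graph:
 assumes c: "c \<in> carrier R" and w: "!!p. p \<in> BP ==> evK c p = \<zero> \<longleftrightarrow> poly p w = 0" and "countable GG"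
 shows "\<exists>GG'. inj_graph R GG' & GG \<subseteq> GG' & countable GG' & (c, w) \<in> GG'"
proof -
 define GG' where "GG' = (%p. (evK c p, poly p w)) ` BP"
 have I: "(evK c p, poly p w) \<in> GG'" if "p \<in> BP" for p using that by (auto simp: GG'_def)
 have one: "[:1:] \<in> BP" and X: "[:0, 1:] \<in> BP" by (auto simp: BP_pCons BP_closed BD)
 have "inj_graph R GG'"
  unfolding inj_graph_def
 proof (intro conjI allI impI)
  show "(\<one>, 1) \<in> GG'" using I[OF one] by (simp only: evK_const[OF c BD(1)] j_simps poly_pCons poly_0) simp
  show "x \<in> carrier R" "x = \<zero> \<longleftrightarrow> v = 0" if "(x, v) \<in> GG'" for x v
  using that w evK_closed[OF c] by (auto simp: GG'_def)
  fix x u y v assume "(x, u) \<in> GG'" "(y, v) \<in> GG'"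
  then obtain p q where pq: "p \<in> BP" "q \<in> BP" "x = evK c p" "u = poly p w" "y = evK c q" "v = poly q w"
  by (auto simp: GG'_def)
  show "(x \<ominus> y, u - v) \<in> GG'" using I[OF BP_closed(3)[OF pq(1,2)]] by (simp add: pq evK_diff[OF c])
  show "(x \<otimes> y, u * v) \<in> GG'" using I[OF BP_closed(4)[OF pq(1,2)]] by (simp add: pq evK_mult[OF c])
 qed
 moreover have "GG \<subseteq> GG'"
 proof (rule subrelI)
  fix x v assume xv: "(x, v) \<in> GG"
  have "[:v:] \<in> BP" using B_I[OF xv] by (simp add: BP_pCons BP_closed)
  from I[OF this] show "(x, v) \<in> GG'" by (simp add: evK_const[OF c B_I[OF xv]] j_eq[OF xv])
 qed
 moreover have "(c, w) \<in> GG'" using I[OF X] c by (simp add: evK_pCons[OF c] evK_0 j_simps)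
 moreover have "countable GG'" using countable_BP[OF assms(3)] unfolding GG'_def by simp
 ultimately show ?thesis by blast
qed

end

text \<open>For transcendental \<open>c\<close> only countably many algebraic elements have to be
  avoided in an uncountable field. For algebraic \<open>c\<close> a root of its minimal polynomial
  serves, and it exists because the target is algebraically closed.\<close>

lemma (in graph_field) ex_matching_element:
 assumes c: "c \<in> carrier R" and "countable GG" and unc: "uncountable (UNIV :: 'w set)"
  and closed: "!!p :: 'w poly. Polynomial.degree p > 0 ==> \<exists>x. poly p x = 0"
 shows "\<exists>w. \<forall>p\<in>BP. evK c p = \<zero> \<longleftrightarrow> poly p w = 0"
proof (cases "\<exists>p\<in>BP. p ~= 0 & evK c p = \<zero>")
 case False
 have "countable (\<Union>p\<in>BP - {0}. {x. poly p x = 0})"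
  using countable_BP[OF assms(2)] by (intro countable_UN) (auto intro: countable_finite poly_roots_finite)
 then obtain w where w: "w \<notin> (\<Union>p\<in>BP - {0}. {x. poly p x = 0})" using unc by (metis UNIV_eq_I)
 have "evK c p = \<zero> \<longleftrightarrow> poly p w = 0" if "p \<in> BP" for p
  using False w that by (cases "p = 0") (auto simp: evK_0)
 thus ?thesis by blast
next
 case True
 then obtain P where P: "P \<in> BP" "P ~= 0" "evK c P = \<zero>"
  and Pmin: "!!q. q \<in> BP & q ~= 0 & evK c q = \<zero> ==> Polynomial.degree P \<le> Polynomial.degree q"
  using ex_has_least_nat[of "%p. p \<in> BP & p ~= 0 & evK c p = \<zero>" _ Polynomial.degree] by blast
 have "Polynomial.degree P > 0"
 proof (rule ccontr)
  assume "~ ?thesis"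
  then obtain b where b: "P = [:b:]" by (metis degree_eq_zeroE gr0I)
  thus False using P by (simp add: BP_pCons evK_const[OF c] j_simps)
 qed
 then obtain w where w: "poly P w = 0" using closed by blast
 have 1: "poly q w = 0" if q: "q \<in> BP" "evK c q = \<zero>" for q
 proof -
  obtain s r where sr: "s \<in> BP" "r \<in> BP" "q = s * P + r" "r = 0 \<or> Polynomial.degree r < Polynomial.degree P"
  using BP_division[OF q(1) P(1,2)] by blast
  have "evK c q = evK c s \<otimes> evK c P \<oplus> evK c r"
  using sr P by (simp add: evK_add[OF c] evK_mult[OF c] BP_closed)
  hence "evK c r = \<zero>" using q(2) P(3) evK_closed[OF c] sr by simp
  hence "r = 0" using Pmin[of r] sr by (cases "r = 0") auto
  thus ?thesis using sr w by simp
 qed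
 \<comment> \<open>\<open>S\<close> is a minimal polynomial of \<open>w\<close>. It divides
   \<open>P\<close>, and the cofactor has smaller degree than \<open>P\<close>, so it does not
   vanish at \<open>c\<close>; therefore \<open>S\<close> does.\<close>
 obtain S where S: "S \<in> BP" "S ~= 0" "poly S w = 0"
  and Smin: "!!q. q \<in> BP & q ~= 0 & poly q w = 0 ==> Polynomial.degree S \<le> Polynomial.degree q"
  using ex_has_least_nat[of "%p. p \<in> BP & p ~= 0 & poly p w = 0" P Polynomial.degree] P w by blast
 have div: "\<exists>s\<in>BP. q = s * S" if q: "q \<in> BP" "poly q w = 0" for q
 proof -
  obtain s r where sr: "s \<in> BP" "r \<in> BP" "q = s * S + r" "r = 0 \<or> Polynomial.degree r < Polynomial.degree S"
  using BP_division[OF q(1) S(1,2)] by blast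
  hence "poly r w = 0" using q S by simp
  hence "r = 0" using Smin[of r] sr by (cases "r = 0") auto
  thus ?thesis using sr by auto
 qed
 have degS: "Polynomial.degree S > 0"
 proof (rule ccontr)
  assume "~ ?thesis"
  then obtain b where "S = [:b:]" by (metis degree_eq_zeroE gr0I)
  thus False using S by simp
 qed
 obtain u where u: "u \<in> BP" "P = u * S" using div[OF P(1) w] by blast
 have u0: "u ~= 0" using u P by auto
 have "evK c u \<otimes> evK c S = \<zero>" using P(3) u S by (simp add: evK_mult[OF c])
 moreover have "evK c u ~= \<zero>"
 proof
  assume "evK c u = \<zero>"
  hence "Polynomial.degree P \<le> Polynomial.degree u" using Pmin[of u] u u0 by blast
  thus False using degS u0 S(2) by (simp add: u(2) degree_mult_eq)
 qed
 ultimately have S0: "evK c S = \<zero>" using integral evK_closed[OF c] u S by blast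
 have "evK c q = \<zero>" if q: "q \<in> BP" "poly q w = 0" for q
  using div[OF q] S0 evK_closed[OF c] by (auto simp: evK_mult[OF c] S)
 thus ?thesis using 1 by blast
qed

text \<open>Countability is carried through the induction, since each transcendental element needs
  it to find its image.\<close>

theorem (in field) extend_inj_graph:
 assumes "inj_graph R (GG :: ('a \<times> 'w :: field) set)" "countable GG" and unc: "uncountable (UNIV :: 'w set)"
  and closed: "!!p :: 'w poly. Polynomial.degree p > 0 ==> \<exists>x. poly p x = 0"
  and "finite S" "S \<subseteq> carrier R"
 shows "\<exists>GG'. inj_graph R GG' & GG \<subseteq> GG' & S \<subseteq> fst ` GG'"
proof -
 have "\<exists>GG'. inj_graph R GG' & countable GG' & GG \<subseteq> GG' & S \<subseteq> fst ` GG'"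
  using assms(5,6)
 proof induction
  case (insert c S)
  then obtain GG1 where 1: "inj_graph R GG1" "countable GG1" "GG \<subseteq> GG1" "S \<subseteq> fst ` GG1" by auto
  from inj_graph_fractions[OF 1(1,2)] obtain GG2 where
  2: "inj_graph R GG2" "GG1 \<subseteq> GG2" "countable GG2" "!!x w. (x, w) \<in> GG2 ==> w ~= 0 ==> (m_inv R x, inverse w) \<in> GG2" by blast
  interpret graph_field R GG2 by unfold_locales (use 2 in auto)
  have c: "c \<in> carrier R" using insert by simp
  have "\<exists>w. \<forall>p\<in>BP. evK c p = \<zero> \<longleftrightarrow> poly p w = 0"
  by (rule ex_matching_element[OF c 2(3) unc closed])
  then obtain w where w: "!!p. p \<in> BP ==> evK c p = \<zero> \<longleftrightarrow> poly p w = 0" by blast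
  have "\<exists>GG'. inj_graph R GG' & GG2 \<subseteq> GG' & countable GG' & (c, w) \<in> GG'"
  by (rule adjoin_graph[OF c w 2(3)])
  then obtain GG3 where 3: "inj_graph R GG3" "GG2 \<subseteq> GG3" "countable GG3" "(c, w) \<in> GG3" by blast
  have "c \<in> fst ` GG3" using 3(4) by (metis fst_conv image_eqI)
  moreover have "fst ` GG1 \<subseteq> fst ` GG3" using 2(2) 3(2) by (intro image_mono) blast
  ultimately show ?case using 1(3,4) 2(2) 3(1,2,3) by (intro exI[of _ GG3]) blast
 qed (use assms in auto)
 thus ?thesis by blast
qed

abbreviation (input) "form_set M e A \<equiv> finite A & A ~= {} & (\<forall>mu\<in>A. set_mset mu \<subseteq> M & size mu = e)"

section \<open>Values that are generic over the prime field\<close>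

lemma countable_forms:
 assumes "finite V"
 shows "countable {A. finite A & A \<subseteq> {mu. set_mset mu \<subseteq> V}}"
proof (rule countable_Collect_finite_subset)
 have "{mu. set_mset mu \<subseteq> V} \<subseteq> mset ` lists V"
 proof
  fix mu assume mu: "mu \<in> {mu. set_mset mu \<subseteq> V}"
  obtain xs where "mset xs = mu" using ex_mset by blast
  thus "mu \<in> mset ` lists V" using mu by (intro image_eqI[of _ _ xs]) auto
 qed
 moreover have "countable (lists V)" using assms by (intro countable_lists countable_finite)
 ultimately show "countable {mu. set_mset mu \<subseteq> V}" by (meson countable_image countable_subset)
qed

text \<open>A polynomial with coefficients 0 and 1 is the same as a finite set \<open>A\<close> of
  monomials, so there are countably many. The values are chosen one variable at a time, avoiding the
  roots of countably many nonzero polynomials in that variable.\<close>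

lemma ex_generic_values:
 fixes U :: "'v => 'w :: field set"
 assumes "finite M" "!!m. m \<in> M ==> uncountable (U m)"
 shows "\<exists>u. (\<forall>m\<in>M. u m \<in> U m) &
  (\<forall>A. finite A & A ~= {} & (\<forall>mu\<in>A. set_mset mu \<subseteq> M) --> (\<Sum>mu\<in>A. \<Prod>x\<in>#mu. u x) ~= 0)"
 using assms
proof induction
 case empty
 have "(\<Sum>mu\<in>A. \<Prod>x\<in>#mu. u x) ~= (0 :: 'w)" if "finite A" "A ~= {}" "\<forall>mu\<in>A. set_mset mu \<subseteq> {}" for A and u :: "'v => 'w"
 proof -
  have "A = {{#}}" using that by auto
  thus ?thesis by simp
 qed
 thus ?case by auto
next
 case (insert k M)
 then obtain u where u: "!!m. m \<in> M ==> u m \<in> U m"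
  "!!A. finite A & A ~= {} & (\<forall>mu\<in>A. set_mset mu \<subseteq> M) ==> (\<Sum>mu\<in>A. \<Prod>x\<in>#mu. u x) ~= 0" by auto
 define AA where "AA = {A. finite A & A ~= {} & (\<forall>mu\<in>A. set_mset mu \<subseteq> insert k M)}"
 define rest where "rest = (%mu. filter_mset (%x. x ~= k) mu)"
 define q where "q = (%A. \<Sum>mu\<in>A. Polynomial.monom (\<Prod>x\<in>#rest mu. u x) (count mu k))"
 have rest: "rest mu + replicate_mset (count mu k) k = mu" for mu
  by (rule multiset_eqI) (auto simp: rest_def)
 have q0: "q A ~= 0" if A: "A \<in> AA" for A
 proof -
  obtain mu0 where mu0: "mu0 \<in> A" using A by (auto simp: AA_def)
  define A0 where "A0 = {mu \<in> A. count mu k = count mu0 k}"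
  have inj: "inj_on rest A0" by (rule inj_onI) (metis (mono_tags, lifting) A0_def mem_Collect_eq rest)
  have "poly.coeff (q A) (count mu0 k) = (\<Sum>mu\<in>A0. \<Prod>x\<in>#rest mu. u x)"
  unfolding q_def coeff_sum A0_def using A by (auto simp: AA_def sum.inter_filter intro!: sum.cong)
  also have "\<dots> = (\<Sum>nu\<in>rest ` A0. \<Prod>x\<in>#nu. u x)" by (simp add: sum.reindex[OF inj])
  also have "\<dots> ~= 0"
  by (rule u(2)) (use A mu0 in "auto simp: A0_def AA_def rest_def")
  finally show ?thesis by auto
 qed
 have "countable AA"
 proof -
  from countable_forms[OF finite.insertI[OF insert.hyps(1)], of k] show ?thesis
  unfolding AA_def by (rule countable_subset[rotated]) auto
 qed
 hence "countable (\<Union>A\<in>AA. {x. poly (q A) x = 0})"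
  by (rule countable_UN) (intro countable_finite poly_roots_finite q0)
 moreover have "uncountable (U k)" using insert by auto
 ultimately have "uncountable (U k - (\<Union>A\<in>AA. {x. poly (q A) x = 0}))" by (intro uncountable_minus_countable)
 hence "U k - (\<Union>A\<in>AA. {x. poly (q A) x = 0}) ~= {}" by (metis countable_empty)
 then obtain z where z: "z \<in> U k" "!!A. A \<in> AA ==> poly (q A) z ~= 0" by auto
 have eq: "(\<Prod>x\<in>#mu. (u(k := z)) x) = (\<Prod>x\<in>#rest mu. u x) * z ^ count mu k" for mu
 proof -
  have "(\<Prod>x\<in>#mu. (u(k := z)) x) = (\<Prod>x\<in>#rest mu + replicate_mset (count mu k) k. (u(k := z)) x)" by (simp only: rest)
  also have "\<dots> = (\<Prod>x\<in>#rest mu. (u(k := z)) x) * z ^ count mu k" by (simp add: image_replicate_mset)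
  also have "image_mset (u(k := z)) (rest mu) = image_mset u (rest mu)" by (rule image_mset_cong) (auto simp: rest_def)
  finally show ?thesis .
 qed
 show ?case
 proof (intro exI[of _ "u(k := z)"] conjI ballI allI impI)
  show "(u(k := z)) m \<in> U m" if "m \<in> insert k M" for m using that u(1) z(1) insert.hyps by auto
  fix A assume A: "finite A & A ~= {} & (\<forall>mu\<in>A. set_mset mu \<subseteq> insert k M)"
  have "(\<Sum>mu\<in>A. \<Prod>x\<in>#mu. (u(k := z)) x) = poly (q A) z"
  by (simp only: eq q_def poly_sum poly_monom)
  thus "(\<Sum>mu\<in>A. \<Prod>x\<in>#mu. (u(k := z)) x) ~= 0" using z(2)[of A] A by (simp add: AA_def)
 qed
qed

text \<open>Dehomogenization: deleting \<open>m0\<close> from monomials of one fixed degree is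
  injective, so forms remain nonzero when the value at \<open>m0\<close> is set to 1.\<close>

lemma ex_generic_homogeneous_values:
 fixes U :: "'v => 'w :: field set"
 assumes "finite M" "!!m. m \<in> M ==> m ~= m0 ==> uncountable (U m)"
 shows "\<exists>u. u m0 = 1 & (\<forall>m\<in>M - {m0}. u m \<in> U m) &
  (\<forall>A e. form_set M e A --> (\<Sum>mu\<in>A. \<Prod>x\<in>#mu. u x) ~= 0)"
proof -
 have "\<exists>u. (\<forall>m\<in>M - {m0}. u m \<in> U m) &
  (\<forall>A. finite A & A ~= {} & (\<forall>mu\<in>A. set_mset mu \<subseteq> M - {m0}) --> (\<Sum>mu\<in>A. \<Prod>x\<in>#mu. u x) ~= 0)"
  by (rule ex_generic_values) (use assms in auto)
 then obtain u where u: "!!m. m \<in> M - {m0} ==> u m \<in> U m"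
  "!!A. finite A & A ~= {} & (\<forall>mu\<in>A. set_mset mu \<subseteq> M - {m0}) ==> (\<Sum>mu\<in>A. \<Prod>x\<in>#mu. u x) ~= 0" by blast
 define rest where "rest = (%mu. filter_mset (%x. x ~= m0) mu)"
 have rest: "rest mu + replicate_mset (count mu m0) m0 = mu" for mu
  by (rule multiset_eqI) (auto simp: rest_def)
 have eq: "(\<Prod>x\<in>#mu. (u(m0 := 1)) x) = (\<Prod>x\<in>#rest mu. u x)" for mu
 proof -
  have "(\<Prod>x\<in>#mu. (u(m0 := 1)) x) = (\<Prod>x\<in>#rest mu + replicate_mset (count mu m0) m0. (u(m0 := 1)) x)" by (simp only: rest)
  also have "\<dots> = (\<Prod>x\<in>#rest mu. (u(m0 := 1)) x)" by (simp add: image_replicate_mset)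
  also have "image_mset (u(m0 := 1)) (rest mu) = image_mset u (rest mu)" by (rule image_mset_cong) (auto simp: rest_def)
  finally show ?thesis .
 qed
 show ?thesis
 proof (intro exI[of _ "u(m0 := 1)"] conjI ballI allI impI)
  fix A e assume A: "form_set M e A"
  have inj: "inj_on rest A"
  proof (rule inj_onI)
  fix mu nu assume *: "mu \<in> A" "nu \<in> A" "rest mu = rest nu"
  have "size (rest mu) + count mu m0 = e" "size (rest nu) + count nu m0 = e"
  using A * arg_cong[OF rest[of mu], of size] arg_cong[OF rest[of nu], of size] by simp_all
  hence "count mu m0 = count nu m0" using * by simp
  hence "rest mu + replicate_mset (count mu m0) m0 = rest nu + replicate_mset (count nu m0) m0"
  using *(3) by (simp only:)
  thus "mu = nu" unfolding rest .
  qed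
  have "(\<Sum>nu\<in>rest ` A. \<Prod>x\<in>#nu. u x) ~= 0"
  by (rule u(2)) (use A in "auto simp: rest_def")
  hence "(\<Sum>mu\<in>A. \<Prod>x\<in>#rest mu. u x) ~= 0" by (simp add: sum.reindex[OF inj])
  thus "(\<Sum>mu\<in>A. \<Prod>x\<in>#mu. (u(m0 := 1)) x) ~= 0" unfolding eq .
 qed (use u in auto)
qed

text \<open>Sets of naturals are encoded in the coefficients 0 and 1 after the constant term, so
  Cantor's theorem applies even to a countable coefficient field.\<close>

lemma uncountable_series:
 fixes e :: "'o :: field fls => 'w :: field"
 assumes "comm_ring_hom e"
 shows "uncountable {e (fps_to_fls f) | f. fps_nth f 0 = c}"
proof
 let ?U = "{e (fps_to_fls f) | f. fps_nth f 0 = c}"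
 assume cU: "countable ?U"
 interpret comm_ring_hom e by fact
 define s where "s = (%S. Abs_fps (%n. if n = 0 then c else if n \<in> S then 1 else 0) :: 'o fps)"
 have "inj_on (%S. e (fps_to_fls (s (Suc ` S)))) UNIV"
 proof (rule inj_onI)
  fix S T :: "nat set" assume "e (fps_to_fls (s (Suc ` S))) = e (fps_to_fls (s (Suc ` T)))"
  hence "e (fps_to_fls (s (Suc ` S)) - fps_to_fls (s (Suc ` T))) = 0" by (simp add: hom_minus)
  hence "s (Suc ` S) = s (Suc ` T)" by (simp add: comm_ring_hom_eq_0_iff[OF assms])
  hence "fps_nth (s (Suc ` S)) (Suc n) = fps_nth (s (Suc ` T)) (Suc n)" for n by simp
  hence "(if n \<in> S then 1 else 0 :: 'o) = (if n \<in> T then 1 else 0)" for n by (simp add: s_def inj_image_mem_iff)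
  hence "n \<in> S \<longleftrightarrow> n \<in> T" for n by (metis zero_neq_one)
  thus "S = T" by auto
 qed
 moreover have "(%S. e (fps_to_fls (s (Suc ` S)))) ` UNIV \<subseteq> ?U" by (auto simp: s_def)
 ultimately have "countable (UNIV :: nat set set)"
  using cU countable_image_inj_on countable_subset by blast
 hence "\<exists>f :: nat => nat set. range f = UNIV" by (metis UNIV_not_empty range_from_nat_into)
 thus False using Cantors_theorem[of "UNIV :: nat set"] by simp
qed

section \<open>Multivariate polynomial rings\<close>

lemma finite_submultisets: "finite {a. a \<subseteq># m}"
proof (rule finite_subset)
 show "{a. a \<subseteq># m} \<subseteq> (\<Union>k\<le>size m. {a. set_mset a \<subseteq> set_mset m & size a = k})"
  by (auto dest: set_mset_mono size_mset_mono)
qed (auto intro: finite_multisets_bounded)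

context abelian_monoid
begin

lemma finsum_Sigma:
 assumes "finite A" "!!x. x \<in> A ==> finite (B x)" "!!x y. x \<in> A ==> y \<in> B x ==> f x y \<in> carrier G"
 shows "(\<Oplus>x\<in>A. \<Oplus>y\<in>B x. f x y) = (\<Oplus>z\<in>Sigma A B. f (fst z) (snd z))"
 using assms
proof (induction A rule: finite_induct)
 case (insert x A)
 have "(\<Oplus>z\<in>Sigma (insert x A) B. f (fst z) (snd z)) = (\<Oplus>z\<in>Pair x ` B x \<union> Sigma A B. f (fst z) (snd z))"
  by (rule arg_cong[where f = "finsum G _"]) auto
 also have "\<dots> = (\<Oplus>z\<in>Pair x ` B x. f (fst z) (snd z)) \<oplus> (\<Oplus>z\<in>Sigma A B. f (fst z) (snd z))"
  using insert by (intro finsum_Un_disjoint) auto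
 also have "(\<Oplus>z\<in>Pair x ` B x. f (fst z) (snd z)) = (\<Oplus>y\<in>B x. f x y)"
  using insert by (subst finsum_reindex) (auto simp: inj_on_def)
 finally show ?case using insert by (subst finsum_insert) (auto intro!: finsum_closed)
qed simp

lemma finsum_single:
 assumes "finite A" "i \<in> A" "f i \<in> carrier G" "!!x. x \<in> A ==> x ~= i ==> f x = \<zero>"
 shows "finsum G f A = f i"
proof -
 have "finsum G f A = finsum G f {i}"
 proof (rule add.finprod_mono_neutral_cong_right)
  show "f \<in> A \<rightarrow> carrier G" using assms(3,4) by (metis Pi_I zero_closed)
 qed (use assms in auto)
 thus ?thesis using assms(3) by simp
qed

lemma finsum_nonzero:
 "finsum G f A ~= \<zero> ==> \<exists>x\<in>A. f x ~= \<zero>"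
 by (metis add.finprod_one_eqI)

end

locale mpoly = cring K for K :: "'a ring" (structure)
begin

abbreviation "PR \<equiv> mpoly_ring K"
abbreviation (input) PR_mult ("_ \<otimes>[_] _" [70,0,71] 70) where "p \<otimes>[V] q \<equiv> p \<otimes>\<^bsub>PR V\<^esub> q"
abbreviation (input) PR_add ("_ \<oplus>[_] _" [65,0,66] 65) where "p \<oplus>[V] q \<equiv> p \<oplus>\<^bsub>PR V\<^esub> q"
abbreviation (input) PR_minus ("_ \<ominus>[_] _" [65,0,66] 65) where "p \<ominus>[V] q \<equiv> p \<ominus>\<^bsub>PR V\<^esub> q"
abbreviation (input) PR_uminus ("\<ominus>[_] _" [0,81] 80) where "\<ominus>[V] p \<equiv> \<ominus>\<^bsub>PR V\<^esub> p"
abbreviation (input) PR_zero ("\<zero>[_]") where "\<zero>[V] \<equiv> \<zero>\<^bsub>PR V\<^esub>"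
abbreviation (input) PR_one ("\<one>[_]") where "\<one>[V] \<equiv> \<one>\<^bsub>PR V\<^esub>"

lemma carrier_iff: "f \<in> carrier (PR V) \<longleftrightarrow>
  (\<forall>m. f m \<in> carrier K) & finite {m. f m ~= \<zero>} & (\<forall>m. f m ~= \<zero> --> set_mset m \<subseteq> V)"
 by (simp add: mpoly_ring_def)

lemma PR_simps:
 "\<one>[V] = (%m. if m = {#} then \<one> else \<zero>)" "\<zero>[V] = (%m. \<zero>)"
 "f \<oplus>[V] g = (%m. f m \<oplus> g m)" "f \<otimes>[V] g = (%m. \<Oplus>a\<in>{a. a \<subseteq># m}. f a \<otimes> g (m - a))"
 by (simp_all add: mpoly_ring_def)

lemma carrierD: "f \<in> carrier (PR V) ==> f m \<in> carrier K"
 "f \<in> carrier (PR V) ==> finite {m. f m ~= \<zero>}" "f \<in> carrier (PR V) ==> f m ~= \<zero> ==> set_mset m \<subseteq> V"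
 by (auto simp: carrier_iff)

lemma mult_nonzero:
 assumes "f \<in> carrier (PR V)" "g \<in> carrier (PR V)" "(f \<otimes>[V] g) m ~= \<zero>"
 shows "\<exists>a b. m = a + b & f a ~= \<zero> & g b ~= \<zero>"
proof -
 obtain a where a: "a \<subseteq># m" "f a \<otimes> g (m - a) ~= \<zero>"
  using finsum_nonzero assms(3) by (fastforce simp: PR_simps)
 hence "f a ~= \<zero>" "g (m - a) ~= \<zero>" using carrierD(1)[OF assms(1), of a] carrierD(1)[OF assms(2), of "m - a"] by auto
 thus ?thesis using a(1) by (intro exI[of _ a] exI[of _ "m - a"]) simp
qed

lemma mult_coeff_closed:
 assumes "!!m. f m \<in> carrier K" "!!m. g m \<in> carrier K"
 shows "(f \<otimes>[V] g) m \<in> carrier K"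
 unfolding PR_simps using assms by (intro finsum_closed) auto

lemma mult_closed:
 assumes f: "f \<in> carrier (PR V)" and g: "g \<in> carrier (PR V)"
 shows "f \<otimes>[V] g \<in> carrier (PR V)"
 unfolding carrier_iff
proof (intro conjI allI impI)
 show "(f \<otimes>[V] g) m \<in> carrier K" for m by (rule mult_coeff_closed) (use f g carrierD(1) in blast)+
 have "{m. (f \<otimes>[V] g) m ~= \<zero>} \<subseteq> (%(a, b). a + b) ` ({m. f m ~= \<zero>} \<times> {m. g m ~= \<zero>})"
  using mult_nonzero[OF f g] by fastforce
 thus "finite {m. (f \<otimes>[V] g) m ~= \<zero>}"
  by (rule finite_subset) (intro finite_imageI finite_cartesian_product carrierD(2)[OF f] carrierD(2)[OF g])
 show "set_mset m \<subseteq> V" if m: "(f \<otimes>[V] g) m ~= \<zero>" for m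
  using mult_nonzero[OF f g m] carrierD(3)[OF f] carrierD(3)[OF g] by (metis Un_least set_mset_union)
qed

lemma add_closed:
 assumes f: "f \<in> carrier (PR V)" and g: "g \<in> carrier (PR V)"
 shows "f \<oplus>[V] g \<in> carrier (PR V)"
proof -
 have "{m. f m \<oplus> g m ~= \<zero>} \<subseteq> {m. f m ~= \<zero>} \<union> {m. g m ~= \<zero>}"
  using carrierD(1)[OF f] carrierD(1)[OF g] by auto
 hence "finite {m. f m \<oplus> g m ~= \<zero>}" by (rule finite_subset) (use carrierD(2)[OF f] carrierD(2)[OF g] in simp)
 moreover have "set_mset m \<subseteq> V" if "f m \<oplus> g m ~= \<zero>" for m
 proof -
  have "f m ~= \<zero> \<or> g m ~= \<zero>" using that by auto
  thus ?thesis using carrierD(3)[OF f] carrierD(3)[OF g] by blast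
 qed
 ultimately show ?thesis unfolding carrier_iff PR_simps using carrierD(1)[OF f] carrierD(1)[OF g] by simp
qed

lemma mult_comm:
 fixes f g :: "'v multiset => 'a"
 assumes f: "!!m. f m \<in> carrier K" and g: "!!m. g m \<in> carrier K"
 shows "f \<otimes>[V] g = g \<otimes>[V] f"
proof
 fix m :: "'v multiset"
 let ?h = "%a. m - a"
 have im: "?h ` {a. a \<subseteq># m} = {a. a \<subseteq># m}"
 proof -
  have "a \<in> ?h ` {a. a \<subseteq># m}" if "a \<subseteq># m" for a
  using that by (intro image_eqI[of _ _ "m - a"]) (auto simp: subset_mset.diff_diff_right)
  thus ?thesis by auto
 qed
 have inj: "inj_on ?h {a. a \<subseteq># m}"
  by (rule inj_onI) (metis mem_Collect_eq subset_mset.diff_diff_right subset_mset.add_diff_inverse add_diff_cancel_left')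
 have "(\<Oplus>a\<in>{a. a \<subseteq># m}. g a \<otimes> f (m - a)) = (\<Oplus>a\<in>?h ` {a. a \<subseteq># m}. g a \<otimes> f (m - a))" by (simp only: im)
 also have "\<dots> = (\<Oplus>a\<in>{a. a \<subseteq># m}. g (m - a) \<otimes> f (m - (m - a)))"
  by (rule finsum_reindex) (use f g inj in auto)
 also have "\<dots> = (\<Oplus>a\<in>{a. a \<subseteq># m}. f a \<otimes> g (m - a))"
  by (rule finsum_cong') (use f g in "auto simp: m_comm subset_mset.diff_diff_right")
 finally show "(f \<otimes>[V] g) m = (g \<otimes>[V] f) m" by (simp add: PR_simps)
qed

lemma mult_assoc:
 fixes f g h :: "'v multiset => 'a"
 assumes f: "!!m. f m \<in> carrier K" and g: "!!m. g m \<in> carrier K" and h: "!!m. h m \<in> carrier K"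
 shows "f \<otimes>[V] g \<otimes>[V] h = f \<otimes>[V] (g \<otimes>[V] h)"
proof
 fix m :: "'v multiset"
 let ?L = "Sigma {x. x \<subseteq># m} (%x. {a. a \<subseteq># x})" and ?R = "Sigma {a. a \<subseteq># m} (%a. {b. b \<subseteq># m - a})"
 \<comment> \<open>Both bracketings sum over decompositions of \<open>m\<close> into three parts;
   this map passes from outer sum first to first part first.\<close>
 let ?ph = "%(x, a). (a, x - a)"
 have im: "?ph ` ?L = ?R"
 proof (intro equalityI subsetI)
  fix z assume "z \<in> ?ph ` ?L"
  then obtain x a where z: "z = (a, x - a)" "x \<subseteq># m" "a \<subseteq># x" by auto
  have "a \<subseteq># m" using z by (metis subset_mset.order_trans)
  moreover have "x - a \<subseteq># m - a" using z(2) by (auto simp: subseteq_mset_def intro: diff_le_mono)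
  ultimately show "z \<in> ?R" by (simp add: z)
 next
  fix z assume "z \<in> ?R"
  then obtain a b where z: "z = (a, b)" "a \<subseteq># m" "b \<subseteq># m - a" by auto
  have "a + b \<subseteq># m" using z(2,3) by (auto simp: subseteq_mset_def le_diff_conv2 add.commute)
  thus "z \<in> ?ph ` ?L" by (intro image_eqI[of _ _ "(a + b, a)"]) (auto simp: z)
 qed
 have inj: "inj_on ?ph ?L" by (rule inj_onI) (auto, metis subset_mset.add_diff_inverse)
 have "((f \<otimes>[V] g) \<otimes>[V] h) m = (\<Oplus>x\<in>{x. x \<subseteq># m}. \<Oplus>a\<in>{a. a \<subseteq># x}. f a \<otimes> g (x - a) \<otimes> h (m - x))"
  unfolding PR_simps using f g h by (intro finsum_cong' finsum_ldistr) (auto intro!: finsum_closed finite_submultisets)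
 also have "\<dots> = (\<Oplus>z\<in>?L. f (snd z) \<otimes> g (fst z - snd z) \<otimes> h (m - fst z))"
  using f g h by (subst finsum_Sigma) (auto intro: finite_submultisets)
 also have "\<dots> = (\<Oplus>z\<in>?L. f (fst (?ph z)) \<otimes> (g (snd (?ph z)) \<otimes> h (m - fst (?ph z) - snd (?ph z))))"
 proof (rule finsum_cong')
  fix z assume "z \<in> ?L"
  then obtain x a where z: "z = (x, a)" "x \<subseteq># m" "a \<subseteq># x" by auto
  have "m - a - (x - a) = m - x" using z(3) by (simp add: diff_diff_add_mset)
  thus "f (snd z) \<otimes> g (fst z - snd z) \<otimes> h (m - fst z) = f (fst (?ph z)) \<otimes> (g (snd (?ph z)) \<otimes> h (m - fst (?ph z) - snd (?ph z)))"
  using f g h by (simp add: z m_assoc)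
 qed (use f g h in auto)
 also have "\<dots> = (\<Oplus>z\<in>?ph ` ?L. f (fst z) \<otimes> (g (snd z) \<otimes> h (m - fst z - snd z)))"
  by (rule finsum_reindex[symmetric]) (use f g h inj in auto)
 also have "\<dots> = (\<Oplus>z\<in>?R. f (fst z) \<otimes> (g (snd z) \<otimes> h (m - fst z - snd z)))" by (simp only: im)
 also have "\<dots> = (\<Oplus>a\<in>{a. a \<subseteq># m}. \<Oplus>b\<in>{b. b \<subseteq># m - a}. f a \<otimes> (g b \<otimes> h (m - a - b)))"
  using f g h by (subst finsum_Sigma) (auto intro: finite_submultisets)
 also have "\<dots> = (f \<otimes>[V] (g \<otimes>[V] h)) m"
  unfolding PR_simps using f g h by (intro finsum_cong' finsum_rdistr[symmetric]) (auto intro!: finsum_closed finite_submultisets)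
 finally show "((f \<otimes>[V] g) \<otimes>[V] h) m = (f \<otimes>[V] (g \<otimes>[V] h)) m" .
qed

lemma PR_cring: "cring (PR V)"
proof (rule cringI)
 show "abelian_group (PR V)"
 proof (rule abelian_groupI)
  fix f assume f: "f \<in> carrier (PR V)"
  have "(%m. \<ominus> f m) \<in> carrier (PR V)"
  proof -
  have "\<ominus> f m ~= \<zero> \<longleftrightarrow> f m ~= \<zero>" for m using carrierD(1)[OF f, of m] by (metis minus_minus minus_zero)
  thus ?thesis using f by (simp add: carrier_iff)
  qed
  moreover have "(%m. \<ominus> f m) \<oplus>[V] f = \<zero>[V]" using carrierD(1)[OF f] by (auto simp: PR_simps l_neg)
  ultimately show "\<exists>g\<in>carrier (PR V). g \<oplus>[V] f = \<zero>[V]" by blast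
 qed (auto simp: add_closed, auto simp: PR_simps carrier_iff a_ac)
 show "comm_monoid (PR V)"
 proof (rule comm_monoidI)
  show "f \<otimes>[V] g \<in> carrier (PR V)" if "f \<in> carrier (PR V)" "g \<in> carrier (PR V)" for f g
  by (rule mult_closed[OF that])
  show "f \<otimes>[V] g = g \<otimes>[V] f" if "f \<in> carrier (PR V)" "g \<in> carrier (PR V)" for f g
  by (rule mult_comm) (use that carrierD(1) in blast)+
  show "f \<otimes>[V] g \<otimes>[V] h = f \<otimes>[V] (g \<otimes>[V] h)"
  if "f \<in> carrier (PR V)" "g \<in> carrier (PR V)" "h \<in> carrier (PR V)" for f g h
  by (rule mult_assoc) (use that carrierD(1) in blast)+
  show "\<one>[V] \<otimes>[V] f = f" if f: "f \<in> carrier (PR V)" for f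
  proof
  fix m
  have "(\<one>[V] \<otimes>[V] f) m = (\<Oplus>a\<in>{a. a \<subseteq># m}. (if a = {#} then \<one> else \<zero>) \<otimes> f (m - a))" by (simp add: PR_simps)
  also have "\<dots> = (if {#} = ({#} :: 'b multiset) then \<one> else \<zero>) \<otimes> f (m - {#})"
  by (rule finsum_single) (use carrierD(1)[OF f] finite_submultisets in auto)
  finally show "(\<one>[V] \<otimes>[V] f) m = f m" using carrierD(1)[OF f] by simp
  qed
  show "\<one>[V] \<in> carrier (PR V)"
  by (simp add: carrier_iff PR_simps finite_subset[of _ "{{#}}"] subset_iff)
 qed
 show "(f \<oplus>[V] g) \<otimes>[V] h = f \<otimes>[V] h \<oplus>[V] g \<otimes>[V] h"
  if f: "f \<in> carrier (PR V)" and g: "g \<in> carrier (PR V)" and h: "h \<in> carrier (PR V)" for f g h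
  unfolding PR_simps fun_eq_iff using carrierD(1)[OF f] carrierD(1)[OF g] carrierD(1)[OF h]
  by (simp add: l_distr finsum_addf)
qed

sublocale PR: cring "PR V" for V by (rule PR_cring)

lemma a_inv_coeff: "f \<in> carrier (PR V) ==> (\<ominus>[V] f) m = \<ominus> f m"
proof -
 assume f: "f \<in> carrier (PR V)"
 have "(\<ominus>[V] f) m \<oplus> f m = \<zero>" using PR.l_neg[OF f] by (simp add: PR_simps fun_eq_iff)
 thus ?thesis using carrierD(1)[OF f] carrierD(1)[OF PR.a_inv_closed[OF f]] by (metis minus_equality)
qed

lemma minus_coeff: "f \<in> carrier (PR V) ==> g \<in> carrier (PR V) ==> (f \<ominus>[V] g) m = f m \<ominus> g m"
 by (simp add: a_minus_def a_inv_coeff PR_simps(3))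

definition mono :: "'a => 'v multiset => 'v multiset => 'a" where
 "mono c m = (%m'. if m' = m then c else \<zero>)"

lemma mono_closed: "c \<in> carrier K ==> set_mset m \<subseteq> V ==> mono c m \<in> carrier (PR V)"
 by (auto simp: carrier_iff mono_def intro: finite_subset[of _ "{m}"])

lemma mono_mult_coeff:
 assumes "c \<in> carrier K" "!!m. f m \<in> carrier K"
 shows "(mono c a \<otimes>[V] f) m = (if a \<subseteq># m then c \<otimes> f (m - a) else \<zero>)"
proof (cases "a \<subseteq># m")
 case True
 have "(\<Oplus>x\<in>{x. x \<subseteq># m}. mono c a x \<otimes> f (m - x)) = mono c a a \<otimes> f (m - a)"
  by (rule finsum_single) (use True assms finite_submultisets in "auto simp: mono_def")
 thus ?thesis using True by (simp add: PR_simps mono_def)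
next
 case False
 have "(\<Oplus>x\<in>{x. x \<subseteq># m}. mono c a x \<otimes> f (m - x)) = \<zero>"
  by (rule add.finprod_one_eqI) (use False assms in "auto simp: mono_def")
 thus ?thesis using False by (simp add: PR_simps)
qed

lemma mono_mult_mono:
 assumes "c \<in> carrier K" "d \<in> carrier K"
 shows "mono c a \<otimes>[V] mono d b = mono (c \<otimes> d) (a + b)"
proof
 fix m
 have d: "mono d b x \<in> carrier K" for x using assms by (simp add: mono_def)
 show "(mono c a \<otimes>[V] mono d b) m = mono (c \<otimes> d) (a + b) m"
  unfolding mono_mult_coeff[OF assms(1) d] using assms by (auto simp: mono_def)
qed

lemma mp_const_mono: "mp_const K c = mono c {#}" and mp_var_mono: "mp_var K v = mono \<one> {#v#}"
 and one_mono: "\<one>[V] = mono \<one> {#}"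
 by (simp_all add: mp_const_def mp_var_def mono_def PR_simps)

text \<open>Terms are split off one by one, and the rest keeps the coefficients of \<open>f\<close>;
  conditions on the support or on the coefficients of \<open>f\<close> therefore persist in the
  induction.\<close>

lemma poly_induct [consumes 1, case_names zero add]:
 assumes "f \<in> carrier (PR V)" "Q \<zero>[V]"
  and "!!c m g. c \<in> carrier K ==> c ~= \<zero> ==> f m = c ==> set_mset m \<subseteq> V ==> g \<in> carrier (PR V) ==>
  (!!m'. g m' ~= \<zero> ==> f m' = g m') ==> Q g ==> Q (mono c m \<oplus>[V] g)"
 shows "Q f"
proof -
 define r where "r = (%A m. if m \<in> A then f m else \<zero>)"
 have rc: "r A \<in> carrier (PR V)" for A
  unfolding carrier_iff
 proof (intro conjI allI impI)
  show "finite {m. r A m ~= \<zero>}" by (rule finite_subset[OF _ carrierD(2)[OF assms(1)]]) (auto simp: r_def)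
 qed (use carrierD(1,3)[OF assms(1)] in "auto simp: r_def split: if_splits")
 have "Q (r A)" if "finite A" "A \<subseteq> {m. f m ~= \<zero>}" for A
  using that
 proof (induction A rule: finite_induct)
  case empty
  have "r {} = \<zero>[V]" by (auto simp: r_def PR_simps)
  thus ?case using assms(2) by simp
 next
  case (insert m A)
  have "r (insert m A) = mono (f m) m \<oplus>[V] r A"
  using insert.hyps carrierD(1)[OF assms(1)] by (auto simp: r_def PR_simps mono_def)
  moreover have "Q (mono (f m) m \<oplus>[V] r A)"
  by (rule assms(3)) (use insert rc carrierD[OF assms(1)] in "auto simp: r_def split: if_splits")
  ultimately show ?case by simp
 qed
 from this[OF carrierD(2)[OF assms(1)]] have "Q (r {m. f m ~= \<zero>})" by simp
 moreover have "r {m. f m ~= \<zero>} = f" by (auto simp: r_def)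
 ultimately show ?thesis by simp
qed

lemma homog_iff: "f \<in> mhomog K V b e \<longleftrightarrow> f \<in> carrier (PR V) & (\<forall>m. f m ~= \<zero> --> image_mset b m = e)"
 by (auto simp: mhomog_def)

lemma homogD: "f \<in> mhomog K V b e ==> f \<in> carrier (PR V)"
 by (simp add: homog_iff)

lemma homog_mult:
 assumes "f \<in> mhomog K V b e" "g \<in> mhomog K V b e'"
 shows "f \<otimes>[V] g \<in> mhomog K V b (e + e')"
 using assms mult_nonzero[of f V g] by (fastforce simp: homog_iff)

lemma homog_add:
 assumes "f \<in> mhomog K V b e" "g \<in> mhomog K V b e"
 shows "f \<oplus>[V] g \<in> mhomog K V b e"
proof -
 have "f m ~= \<zero> \<or> g m ~= \<zero>" if "(f \<oplus>[V] g) m ~= \<zero>" for m using that by (auto simp: PR_simps)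
 thus ?thesis using assms by (fastforce simp: homog_iff)
qed

lemma homog_minus:
 assumes "f \<in> mhomog K V b e" "g \<in> mhomog K V b e"
 shows "f \<ominus>[V] g \<in> mhomog K V b e"
proof -
 have c: "f \<in> carrier (PR V)" "g \<in> carrier (PR V)" using assms homogD by auto
 have "f m ~= \<zero> \<or> g m ~= \<zero>" if "(f \<ominus>[V] g) m ~= \<zero>" for m
  using that unfolding minus_coeff[OF c] by (auto simp: a_minus_def)
 thus ?thesis using assms c by (fastforce simp: homog_iff)
qed

lemma homog_zero: "\<zero>[V] \<in> mhomog K V b e"
 using PR.zero_closed by (auto simp: homog_iff PR_simps(2))

lemma homog_mono: "c \<in> carrier K ==> set_mset m \<subseteq> V ==> image_mset b m = e ==> mono c m \<in> mhomog K V b e"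
 using mono_closed by (auto simp: homog_iff) (auto simp: mono_def split: if_splits)

lemma homog_one: "\<one>[V] \<in> mhomog K V b {#}"
 unfolding one_mono by (rule homog_mono) auto

end

locale mpoly_field = field K for K :: "'a ring" (structure)
begin

sublocale mpoly K ..

text \<open>The multiset order is total and compatible with addition, so the product of the highest
  terms cannot cancel.\<close>

lemma PR_domain: "domain (PR (V :: 'v :: linorder set))"
proof (rule domain.intro[OF PR_cring], unfold_locales)
 show "\<one>[V] ~= \<zero>[V]" by (simp add: PR_simps fun_eq_iff)
 fix f g assume eq: "f \<otimes>[V] g = \<zero>[V]" and f: "f \<in> carrier (PR V)" and g: "g \<in> carrier (PR V)"
 show "f = \<zero>[V] \<or> g = \<zero>[V]"
 proof (rule ccontr)
  assume "~ ?thesis"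
  hence ne: "{m. f m ~= \<zero>} ~= {}" "{m. g m ~= \<zero>} ~= {}" by (auto simp: PR_simps fun_eq_iff)
  define a where "a = Max {m. f m ~= \<zero>}"
  define b where "b = Max {m. g m ~= \<zero>}"
  have a: "f a ~= \<zero>" "!!m. f m ~= \<zero> ==> m \<le> a"
  using Max_in[OF carrierD(2)[OF f] ne(1)] Max_ge[OF carrierD(2)[OF f]] by (auto simp: a_def)
  have b: "g b ~= \<zero>" "!!m. g m ~= \<zero> ==> m \<le> b"
  using Max_in[OF carrierD(2)[OF g] ne(2)] Max_ge[OF carrierD(2)[OF g]] by (auto simp: b_def)
  note c = carrierD(1)[OF f] carrierD(1)[OF g]
  have "(\<Oplus>x\<in>{x. x \<subseteq># a + b}. f x \<otimes> g (a + b - x)) = f a \<otimes> g (a + b - a)"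
  proof (rule finsum_single)
  fix x assume x: "x \<in> {x. x \<subseteq># a + b}" "x ~= a"
  show "f x \<otimes> g (a + b - x) = \<zero>"
  proof (rule ccontr)
  assume "f x \<otimes> g (a + b - x) ~= \<zero>"
  hence "f x ~= \<zero>" "g (a + b - x) ~= \<zero>" using c by auto
  hence "x < a" "a + b - x \<le> b" using a(2) b(2) x by (auto intro: le_neq_trans)
  hence "x + (a + b - x) < a + b" by (rule add_less_le_mono)
  thus False using x by simp
  qed
  qed (use c finite_submultisets in auto)
  hence "(f \<otimes>[V] g) (a + b) = f a \<otimes> g b" by (simp add: PR_simps)
  thus False using eq a(1) b(1) c integral by (auto simp: PR_simps(2))
 qed
qed

end

section \<open>Evaluation\<close>

text \<open>Homomorphisms on a subring \<open>A\<close> only: the embedding into Laurent series is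
  available for finitely many elements of the field at a time.\<close>

definition partial_hom :: "'a ring => 'a set => ('a => 'r :: comm_ring_1) => bool" where
 "partial_hom K A h \<longleftrightarrow> A \<subseteq> carrier K & \<zero>\<^bsub>K\<^esub> \<in> A & \<one>\<^bsub>K\<^esub> \<in> A & h \<zero>\<^bsub>K\<^esub> = 0 & h \<one>\<^bsub>K\<^esub> = 1 &
  (\<forall>x\<in>A. \<ominus>\<^bsub>K\<^esub> x \<in> A) &
  (\<forall>x\<in>A. \<forall>y\<in>A. x \<oplus>\<^bsub>K\<^esub> y \<in> A & x \<otimes>\<^bsub>K\<^esub> y \<in> A & h (x \<oplus>\<^bsub>K\<^esub> y) = h x + h y & h (x \<otimes>\<^bsub>K\<^esub> y) = h x * h y)"

definition peval :: "'a ring => ('a => 'r :: comm_ring_1) => ('v multiset => 'a) => ('v => 'r) => 'r" where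
 "peval K h p a = mev {m. p m ~= \<zero>\<^bsub>K\<^esub>} (%m. h (p m)) a"

text \<open>Says that \<open>q\<close> is the composite of \<open>g\<close> with \<open>f\<close>,
  through values at all points; evaluation is the only use that is made of the composite.\<close>

abbreviation (input) subst_rel ::
 "'a ring => 'a set => ('a => 'r :: comm_ring_1) => ('v multiset => 'a) => ('w multiset => 'a) => ('w => 'v multiset => 'a) => bool" where
 "subst_rel K A h q g f \<equiv> (\<forall>m. q m \<in> A) & (\<forall>a. peval K h q a = peval K h g (%j. peval K h (f j) a))"

lemma partial_hom_compose:
 assumes "partial_hom K A h" "comm_ring_hom ph"
 shows "partial_hom K A (%x. ph (h x))"
proof -
 interpret comm_ring_hom ph by fact
 show ?thesis using assms(1) unfolding partial_hom_def by (auto simp: hom_add hom_mult)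
qed

locale phom = mpoly K for K :: "'a ring" (structure) +
 fixes A :: "'a set" and h :: "'a => 'r :: comm_ring_1"
 assumes phom: "partial_hom K A h"
begin

lemma A_sub: "x \<in> A ==> x \<in> carrier K" and A0: "\<zero> \<in> A" and A1: "\<one> \<in> A" and Am: "x \<in> A ==> \<ominus> x \<in> A"
 and Aadd: "x \<in> A ==> y \<in> A ==> x \<oplus> y \<in> A" and Amult: "x \<in> A ==> y \<in> A ==> x \<otimes> y \<in> A"
 and h0: "h \<zero> = 0" and h1: "h \<one> = 1"
 and hadd: "x \<in> A ==> y \<in> A ==> h (x \<oplus> y) = h x + h y" and hmult: "x \<in> A ==> y \<in> A ==> h (x \<otimes> y) = h x * h y"
 using phom unfolding partial_hom_def by auto

lemma finsum_A:
 assumes "!!i. i \<in> Z ==> f i \<in> A"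
 shows "finsum K f Z \<in> A" "h (finsum K f Z) = (\<Sum>i\<in>Z. h (f i))"
proof -
 have "finsum K f Z \<in> A & h (finsum K f Z) = (\<Sum>i\<in>Z. h (f i))"
  using assms
 proof (induction Z rule: infinite_finite_induct)
  case (insert x Z)
  hence "finsum K f (insert x Z) = f x \<oplus> finsum K f Z"
  using A_sub by (intro finsum_insert) auto
  thus ?case using insert Aadd hadd by auto
 qed (auto simp: A0 h0)
 thus "finsum K f Z \<in> A" "h (finsum K f Z) = (\<Sum>i\<in>Z. h (f i))" by auto
qed

definition "PA V = {p \<in> carrier (PR V). \<forall>m. p m \<in> A}"

lemma PA_D: "p \<in> PA V ==> p \<in> carrier (PR V)" "p \<in> PA V ==> p m \<in> A"
 by (auto simp: PA_def)

lemma PA_closed: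
 assumes "p \<in> PA V" "q \<in> PA V"
 shows "p \<oplus>[V] q \<in> PA V" "p \<otimes>[V] q \<in> PA V" "p \<ominus>[V] q \<in> PA V"
proof -
 note c = PA_D(1)[OF assms(1)] PA_D(1)[OF assms(2)] and d = PA_D(2)[OF assms(1)] PA_D(2)[OF assms(2)]
 have "(p \<oplus>[V] q) m \<in> A" for m unfolding PR_simps using d Aadd by simp
 thus "p \<oplus>[V] q \<in> PA V" using add_closed[OF c] by (simp add: PA_def)
 have "(p \<otimes>[V] q) m \<in> A" for m unfolding PR_simps using d Amult by (intro finsum_A) auto
 thus "p \<otimes>[V] q \<in> PA V" using mult_closed[OF c] by (simp add: PA_def)
 have "(p \<ominus>[V] q) m \<in> A" for m unfolding minus_coeff[OF c] unfolding a_minus_def using d Aadd Am by simp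
 thus "p \<ominus>[V] q \<in> PA V" using PR.minus_closed[OF c] by (simp add: PA_def)
qed

lemma PA_mono: "c \<in> A ==> set_mset m \<subseteq> V ==> mono c m \<in> PA V"
 unfolding PA_def using mono_closed[OF A_sub] A0 by (intro CollectI conjI allI) (auto simp: mono_def)

lemma peval_superset:
 assumes "finite T" "{m. p m ~= \<zero>} \<subseteq> T"
 shows "peval K h p a = (\<Sum>m\<in>T. h (p m) * (\<Prod>x\<in>#m. a x))"
 unfolding peval_def mev_def by (rule sum.mono_neutral_left) (use assms h0 in auto)

lemma peval_mono: "peval K h (mono c m) a = h c * (\<Prod>x\<in>#m. a x)"
 by (subst peval_superset[of "{m}"]) (auto simp: mono_def)

lemma peval_zero: "peval K h \<zero>[V] a = 0"
 by (simp add: peval_def PR_simps mev_def)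

lemma peval_one: "peval K h \<one>[V] a = 1"
 by (simp add: one_mono peval_mono h1)

lemma peval_add:
 assumes "p \<in> PA V" "q \<in> PA V"
 shows "peval K h (p \<oplus>[V] q) a = peval K h p a + peval K h q a"
proof -
 note c = PA_D(1)[OF assms(1)] PA_D(1)[OF assms(2)] and d = PA_D(2)[OF assms(1)] PA_D(2)[OF assms(2)]
 let ?T = "{m. p m ~= \<zero>} \<union> {m. q m ~= \<zero>}"
 have T: "finite ?T" using carrierD(2)[OF c(1)] carrierD(2)[OF c(2)] by simp
 have "{m. (p \<oplus>[V] q) m ~= \<zero>} \<subseteq> ?T" by (auto simp: PR_simps)
 from peval_superset[OF T this] peval_superset[OF T, of p] peval_superset[OF T, of q] show ?thesis
  using d by (simp add: PR_simps hadd distrib_right sum.distrib)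
qed

lemma peval_mult:
 assumes "p \<in> PA V" "q \<in> PA V"
 shows "peval K h (p \<otimes>[V] q) a = peval K h p a * peval K h q a"
proof -
 note c = PA_D(1)[OF assms(1)] PA_D(1)[OF assms(2)] and d = PA_D(2)[OF assms(1)] PA_D(2)[OF assms(2)]
 let ?S = "{m. p m ~= \<zero>} \<times> {m. q m ~= \<zero>}"
 let ?T = "(%z. fst z + snd z) ` ?S"
 have S: "finite ?S" using carrierD(2)[OF c(1)] carrierD(2)[OF c(2)] by simp
 have "{m. (p \<otimes>[V] q) m ~= \<zero>} \<subseteq> ?T"
 proof
  fix m assume "m \<in> {m. (p \<otimes>[V] q) m ~= \<zero>}"
  then obtain x y where "m = x + y" "p x ~= \<zero>" "q y ~= \<zero>" using mult_nonzero[OF c] by blast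
  thus "m \<in> ?T" by (intro image_eqI[of _ _ "(x, y)"]) auto
 qed
 hence "peval K h (p \<otimes>[V] q) a = (\<Sum>m\<in>?T. h ((p \<otimes>[V] q) m) * (\<Prod>x\<in>#m. a x))"
  by (rule peval_superset[OF finite_imageI[OF S]])
 also have "\<dots> = (\<Sum>m\<in>?T. \<Sum>z\<in>{z \<in> ?S. fst z + snd z = m}. h (p (fst z)) * (\<Prod>x\<in>#fst z. a x) * (h (q (snd z)) * (\<Prod>x\<in>#snd z. a x)))"
 proof (rule sum.cong[OF refl])
  fix m
  have "h ((p \<otimes>[V] q) m) = (\<Sum>x\<in>{x. x \<subseteq># m}. h (p x) * h (q (m - x)))"
  unfolding PR_simps using d by (subst finsum_A(2)) (auto simp: hmult Amult)
  also have "\<dots> = (\<Sum>x\<in>{x. x \<subseteq># m & p x ~= \<zero> & q (m - x) ~= \<zero>}. h (p x) * h (q (m - x)))"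
  by (rule sum.mono_neutral_right) (auto simp: finite_submultisets h0)
  also have "\<dots> = (\<Sum>z\<in>{z \<in> ?S. fst z + snd z = m}. h (p (fst z)) * h (q (snd z)))"
  by (rule sum.reindex_bij_witness[of _ fst "%x. (x, m - x)"]) auto
  finally show "h ((p \<otimes>[V] q) m) * (\<Prod>x\<in>#m. a x) =
  (\<Sum>z\<in>{z \<in> ?S. fst z + snd z = m}. h (p (fst z)) * (\<Prod>x\<in>#fst z. a x) * (h (q (snd z)) * (\<Prod>x\<in>#snd z. a x)))"
  by (simp only: sum_distrib_right) (auto intro!: sum.cong simp: ac_simps)
 qed
 also have "\<dots> = (\<Sum>z\<in>?S. h (p (fst z)) * (\<Prod>x\<in>#fst z. a x) * (h (q (snd z)) * (\<Prod>x\<in>#snd z. a x)))"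
  by (rule sum.group[OF S finite_imageI[OF S]]) auto
 also have "\<dots> = peval K h p a * peval K h q a"
  unfolding peval_def mev_def sum_product by (simp add: sum.cartesian_product case_prod_beta)
 finally show ?thesis .
qed

lemma peval_minus:
 assumes "p \<in> PA V" "q \<in> PA V"
 shows "peval K h (p \<ominus>[V] q) a = peval K h p a - peval K h q a"
proof -
 note c = PA_D(1)[OF assms(1)] PA_D(1)[OF assms(2)]
 have "p = (p \<ominus>[V] q) \<oplus>[V] q"
  using c by (simp add: PR.minus_eq PR.a_assoc PR.l_neg)
 hence "peval K h p a = peval K h (p \<ominus>[V] q) a + peval K h q a"
  using peval_add[OF PA_closed(3)[OF assms] assms(2)] by simp
 thus ?thesis by simp
qed

end

section \<open>Local rings\<close>

locale mlocal = mpoly K for K :: "'a ring" (structure) +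
 fixes V :: "'v set" and b :: "'v => 'b" and I P :: "('v multiset => 'a) set"
 assumes ideal_I: "ideal I (PR V)" and prime_P: "primeideal P (PR V)" and I_P: "I \<subseteq> P"
begin

abbreviation "S \<equiv> PR V"
abbreviation "OP \<equiv> mproj_local_ring K V b I P"
abbreviation "cls \<equiv> mfrac K V b I P"
abbreviation "pairs \<equiv> mfrac_pairs K V b P"

lemmas I_zero = additive_subgroup.zero_closed[OF ideal.axioms(1)[OF ideal_I]]
lemmas I_add = additive_subgroup.a_closed[OF ideal.axioms(1)[OF ideal_I]]
lemmas I_minus = additive_subgroup.a_inv_closed[OF ideal.axioms(1)[OF ideal_I]]
lemmas I_mult = ideal.I_l_closed[OF ideal_I]

lemmas ideal_P = primeideal.axioms(1)[OF prime_P]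
lemmas P_zero = additive_subgroup.zero_closed[OF ideal.axioms(1)[OF ideal_P]]
lemmas P_add = additive_subgroup.a_closed[OF ideal.axioms(1)[OF ideal_P]]
lemmas P_minus = additive_subgroup.a_inv_closed[OF ideal.axioms(1)[OF ideal_P]]
lemmas P_mult = ideal.I_l_closed[OF ideal_P]
lemmas P_prime = primeideal.I_prime[OF prime_P]

lemma P_mult_iff: "f \<in> carrier S ==> g \<in> carrier S ==> f \<otimes>[V] g \<in> P \<longleftrightarrow> f \<in> P \<or> g \<in> P"
 using P_prime P_mult PR.m_comm by metis

lemma P_one: "\<one>[V] \<notin> P"
 using primeideal.I_notcarr[OF prime_P] ideal.one_imp_carrier[OF ideal_P] by blast

definition "frel f g f' g' \<longleftrightarrow> (\<exists>h. h \<in> carrier S & h \<notin> P & h \<otimes>[V] (f \<otimes>[V] g' \<ominus>[V] f' \<otimes>[V] g) \<in> I)"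

lemma cls_eq: "cls f g = {(f', g') \<in> pairs. frel f g f' g'}"
 unfolding mfrac_def Let_def frel_def by blast

lemma pairsD: "(f, g) \<in> pairs ==> f \<in> carrier S" "(f, g) \<in> pairs ==> g \<in> carrier S" "(f, g) \<in> pairs ==> g \<notin> P"
 by (auto simp: mfrac_pairs_def homog_iff)

lemma pairsI: "f \<in> mhomog K V b e ==> g \<in> mhomog K V b e ==> g \<notin> P ==> (f, g) \<in> pairs"
 by (auto simp: mfrac_pairs_def)

lemma pairsE:
 assumes "(f, g) \<in> pairs"
 obtains e where "f \<in> mhomog K V b e" "g \<in> mhomog K V b e" "g \<notin> P"
 using assms by (auto simp: mfrac_pairs_def)

lemma frel_refl: "f \<in> carrier S ==> g \<in> carrier S ==> frel f g f g"
 unfolding frel_def using P_one I_zero by (intro exI[of _ "\<one>[V]"]) (simp add: PR.minus_eq PR.r_neg)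

lemma frelI: "f \<otimes>[V] g' = f' \<otimes>[V] g ==> f \<in> carrier S ==> g \<in> carrier S ==> f' \<in> carrier S ==> g' \<in> carrier S ==> frel f g f' g'"
 unfolding frel_def using P_one I_zero by (intro exI[of _ "\<one>[V]"]) (simp add: PR.minus_eq PR.r_neg)

lemma frel_sym:
 assumes "frel f g f' g'" "f \<in> carrier S" "g \<in> carrier S" "f' \<in> carrier S" "g' \<in> carrier S"
 shows "frel f' g' f g"
proof -
 obtain h where h: "h \<in> carrier S" "h \<notin> P" "h \<otimes>[V] (f \<otimes>[V] g' \<ominus>[V] f' \<otimes>[V] g) \<in> I"
  using assms(1) by (auto simp: frel_def)
 have "\<ominus>[V] (h \<otimes>[V] (f \<otimes>[V] g' \<ominus>[V] f' \<otimes>[V] g)) = h \<otimes>[V] (f' \<otimes>[V] g \<ominus>[V] f \<otimes>[V] g')"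
  using h(1) assms(2-) by algebra
 thus ?thesis unfolding frel_def using h(1,2) I_minus[OF h(3)] by auto
qed

lemma frel_trans:
 assumes "frel f g f' g'" "frel f' g' f'' g''" "g' \<notin> P"
  and c: "f \<in> carrier S" "g \<in> carrier S" "f' \<in> carrier S" "g' \<in> carrier S" "f'' \<in> carrier S" "g'' \<in> carrier S"
 shows "frel f g f'' g''"
proof -
 obtain h where h: "h \<in> carrier S" "h \<notin> P" "h \<otimes>[V] (f \<otimes>[V] g' \<ominus>[V] f' \<otimes>[V] g) \<in> I"
  using assms(1) by (auto simp: frel_def)
 obtain k where k: "k \<in> carrier S" "k \<notin> P" "k \<otimes>[V] (f' \<otimes>[V] g'' \<ominus>[V] f'' \<otimes>[V] g') \<in> I"
  using assms(2) by (auto simp: frel_def)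
 have "(h \<otimes>[V] k \<otimes>[V] g') \<otimes>[V] (f \<otimes>[V] g'' \<ominus>[V] f'' \<otimes>[V] g) =
  (k \<otimes>[V] g'') \<otimes>[V] (h \<otimes>[V] (f \<otimes>[V] g' \<ominus>[V] f' \<otimes>[V] g)) \<oplus>[V]
  (h \<otimes>[V] g) \<otimes>[V] (k \<otimes>[V] (f' \<otimes>[V] g'' \<ominus>[V] f'' \<otimes>[V] g'))"
  using h(1) k(1) c by algebra
 also have "\<dots> \<in> I" by (intro I_add I_mult h(3) k(3)) (use h(1) k(1) c in auto)
 finally show ?thesis unfolding frel_def using h(1,2) k(1,2) assms(3) c
  by (intro exI[of _ "h \<otimes>[V] k \<otimes>[V] g'"]) (simp add: P_mult_iff)
qed

lemma cls_eq_iff: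
 assumes "(f, g) \<in> pairs" "(f', g') \<in> pairs"
 shows "cls f g = cls f' g' \<longleftrightarrow> frel f g f' g'"
proof
 note c = pairsD(1,2)[OF assms(1)] pairsD(1,2)[OF assms(2)]
 assume "cls f g = cls f' g'"
 moreover have "(f', g') \<in> cls f' g'" using assms(2) c frel_refl by (simp add: cls_eq)
 ultimately have "(f', g') \<in> cls f g" by simp
 thus "frel f g f' g'" by (simp add: cls_eq)
next
 note c = pairsD(1,2)[OF assms(1)] pairsD(1,2)[OF assms(2)]
 assume r: "frel f g f' g'"
 have r': "frel f' g' f g" by (rule frel_sym[OF r c])
 show "cls f g = cls f' g'"
  unfolding cls_eq using frel_trans[OF r _ pairsD(3)[OF assms(2)] c] frel_trans[OF r' _ pairsD(3)[OF assms(1)]] c pairsD(1,2)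
  by blast
qed

lemma cls_eqI: "(f, g) \<in> pairs ==> (f', g') \<in> pairs ==> f \<otimes>[V] g' = f' \<otimes>[V] g ==> cls f g = cls f' g'"
 using frelI pairsD cls_eq_iff by metis

lemma pairs_mult: "(f, g) \<in> pairs ==> (f', g') \<in> pairs ==> (f \<otimes>[V] f', g \<otimes>[V] g') \<in> pairs"
 by (elim pairsE, rule pairsI) (auto intro: homog_mult simp: P_mult_iff homogD)

lemma pairs_add:
 assumes "(f, g) \<in> pairs" "(f', g') \<in> pairs"
 shows "(f \<otimes>[V] g' \<oplus>[V] f' \<otimes>[V] g, g \<otimes>[V] g') \<in> pairs"
proof -
 obtain e e' where e: "f \<in> mhomog K V b e" "g \<in> mhomog K V b e" "g \<notin> P" and e': "f' \<in> mhomog K V b e'" "g' \<in> mhomog K V b e'" "g' \<notin> P"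
  using assms pairsE by metis
 have "f' \<otimes>[V] g \<in> mhomog K V b (e + e')" using homog_mult[OF e'(1) e(2)] by (simp add: add.commute)
 thus ?thesis using homog_add[OF homog_mult[OF e(1) e'(2)]] homog_mult[OF e(2) e'(2)] e e'
  by (intro pairsI) (auto simp: P_mult_iff homogD)
qed

lemma OP_simps: "carrier OP = {cls f g | f g. (f, g) \<in> pairs}" "\<one>\<^bsub>OP\<^esub> = cls \<one>[V] \<one>[V]" "\<zero>\<^bsub>OP\<^esub> = cls \<zero>[V] \<one>[V]"
 by (simp_all add: mproj_local_ring_def Let_def)

lemma cls_carrier: "(f, g) \<in> pairs ==> cls f g \<in> carrier OP"
 unfolding OP_simps by blast

lemma cls_ops:
 assumes p: "(f, g) \<in> pairs" and p': "(f', g') \<in> pairs"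
 shows "cls f g \<otimes>\<^bsub>OP\<^esub> cls f' g' = cls (f \<otimes>[V] f') (g \<otimes>[V] g')"
  "cls f g \<oplus>\<^bsub>OP\<^esub> cls f' g' = cls (f \<otimes>[V] g' \<oplus>[V] f' \<otimes>[V] g) (g \<otimes>[V] g')"
proof -
 note c = pairsD(1,2)[OF p] pairsD(1,2)[OF p']
 have self: "(f, g) \<in> cls f g" "(f', g') \<in> cls f' g'" using p p' c frel_refl by (auto simp: cls_eq)
 have "frel (f \<otimes>[V] f') (g \<otimes>[V] g') (u \<otimes>[V] u') (v \<otimes>[V] v') &
  frel (f \<otimes>[V] g' \<oplus>[V] f' \<otimes>[V] g) (g \<otimes>[V] g') (u \<otimes>[V] v' \<oplus>[V] u' \<otimes>[V] v) (v \<otimes>[V] v')"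
  if uv: "(u, v) \<in> pairs" "frel f g u v" and uv': "(u', v') \<in> pairs" "frel f' g' u' v'" for u v u' v'
 proof -
  note d = pairsD(1,2)[OF uv(1)] pairsD(1,2)[OF uv'(1)]
  obtain h where h: "h \<in> carrier S" "h \<notin> P" "h \<otimes>[V] (f \<otimes>[V] v \<ominus>[V] u \<otimes>[V] g) \<in> I"
  using uv(2) by (auto simp: frel_def)
  obtain k where k: "k \<in> carrier S" "k \<notin> P" "k \<otimes>[V] (f' \<otimes>[V] v' \<ominus>[V] u' \<otimes>[V] g') \<in> I"
  using uv'(2) by (auto simp: frel_def)
  have hk: "h \<otimes>[V] k \<in> carrier S" "h \<otimes>[V] k \<notin> P" using h k by (auto simp: P_mult_iff)
  have "(h \<otimes>[V] k) \<otimes>[V] ((f \<otimes>[V] f') \<otimes>[V] (v \<otimes>[V] v') \<ominus>[V] (u \<otimes>[V] u') \<otimes>[V] (g \<otimes>[V] g')) =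
  (k \<otimes>[V] (f' \<otimes>[V] v')) \<otimes>[V] (h \<otimes>[V] (f \<otimes>[V] v \<ominus>[V] u \<otimes>[V] g)) \<oplus>[V]
  (h \<otimes>[V] (u \<otimes>[V] g)) \<otimes>[V] (k \<otimes>[V] (f' \<otimes>[V] v' \<ominus>[V] u' \<otimes>[V] g'))"
  using h(1) k(1) c d by algebra
  also have "\<dots> \<in> I" by (intro I_add I_mult h(3) k(3)) (use h(1) k(1) c d in auto)
  finally have 1: "frel (f \<otimes>[V] f') (g \<otimes>[V] g') (u \<otimes>[V] u') (v \<otimes>[V] v')" unfolding frel_def using hk by blast
  have "(h \<otimes>[V] k) \<otimes>[V] ((f \<otimes>[V] g' \<oplus>[V] f' \<otimes>[V] g) \<otimes>[V] (v \<otimes>[V] v') \<ominus>[V] (u \<otimes>[V] v' \<oplus>[V] u' \<otimes>[V] v) \<otimes>[V] (g \<otimes>[V] g')) =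
  (k \<otimes>[V] (g' \<otimes>[V] v')) \<otimes>[V] (h \<otimes>[V] (f \<otimes>[V] v \<ominus>[V] u \<otimes>[V] g)) \<oplus>[V]
  (h \<otimes>[V] (g \<otimes>[V] v)) \<otimes>[V] (k \<otimes>[V] (f' \<otimes>[V] v' \<ominus>[V] u' \<otimes>[V] g'))"
  using h(1) k(1) c d by algebra
  also have "\<dots> \<in> I" by (intro I_add I_mult h(3) k(3)) (use h(1) k(1) c d in auto)
  finally show ?thesis using 1 unfolding frel_def using hk by blast
 qed
 hence eq: "cls (u \<otimes>[V] u') (v \<otimes>[V] v') = cls (f \<otimes>[V] f') (g \<otimes>[V] g')"
  "cls (u \<otimes>[V] v' \<oplus>[V] u' \<otimes>[V] v) (v \<otimes>[V] v') = cls (f \<otimes>[V] g' \<oplus>[V] f' \<otimes>[V] g) (g \<otimes>[V] g')"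
  if "(u, v) \<in> cls f g" "(u', v') \<in> cls f' g'" for u v u' v'
  using that cls_eq_iff[OF pairs_mult[OF p p'] pairs_mult[of u v u' v']]
  cls_eq_iff[OF pairs_add[OF p p'] pairs_add[of u v u' v']] by (auto simp: cls_eq[of f] cls_eq[of f'])
 have "cls f g \<otimes>\<^bsub>OP\<^esub> cls f' g' = (\<Union>(u, v)\<in>cls f g. \<Union>(u', v')\<in>cls f' g'. cls (u \<otimes>[V] u') (v \<otimes>[V] v'))"
  by (simp add: mproj_local_ring_def Let_def)
 also have "\<dots> = (\<Union>(u, v)\<in>cls f g. \<Union>(u', v')\<in>cls f' g'. cls (f \<otimes>[V] f') (g \<otimes>[V] g'))"
  by (intro SUP_cong refl) (auto simp: eq)
 also have "\<dots> = cls (f \<otimes>[V] f') (g \<otimes>[V] g')" using self by auto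
 finally show "cls f g \<otimes>\<^bsub>OP\<^esub> cls f' g' = cls (f \<otimes>[V] f') (g \<otimes>[V] g')" .
 have "cls f g \<oplus>\<^bsub>OP\<^esub> cls f' g' = (\<Union>(u, v)\<in>cls f g. \<Union>(u', v')\<in>cls f' g'. cls (u \<otimes>[V] v' \<oplus>[V] u' \<otimes>[V] v) (v \<otimes>[V] v'))"
  by (simp add: mproj_local_ring_def Let_def)
 also have "\<dots> = (\<Union>(u, v)\<in>cls f g. \<Union>(u', v')\<in>cls f' g'. cls (f \<otimes>[V] g' \<oplus>[V] f' \<otimes>[V] g) (g \<otimes>[V] g'))"
  by (intro SUP_cong refl) (auto simp: eq)
 also have "\<dots> = cls (f \<otimes>[V] g' \<oplus>[V] f' \<otimes>[V] g) (g \<otimes>[V] g')" using self by auto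
 finally show "cls f g \<oplus>\<^bsub>OP\<^esub> cls f' g' = cls (f \<otimes>[V] g' \<oplus>[V] f' \<otimes>[V] g) (g \<otimes>[V] g')" .
qed

lemma pairs_one: "(\<one>[V], \<one>[V]) \<in> pairs" and pairs_zero: "(\<zero>[V], \<one>[V]) \<in> pairs"
 using P_one by (auto intro: pairsI homog_one homog_zero)

lemma cls_self: "(g, g) \<in> pairs ==> cls g g = \<one>\<^bsub>OP\<^esub>"
 unfolding OP_simps by (rule cls_eqI) (use pairs_one pairsD in auto)

lemma cls_zero: "(\<zero>[V], g) \<in> pairs ==> cls \<zero>[V] g = \<zero>\<^bsub>OP\<^esub>"
 unfolding OP_simps by (rule cls_eqI) (use pairs_zero pairsD in auto)

lemma cls_cancel: "(f, g) \<in> pairs ==> (h, h) \<in> pairs ==> cls (f \<otimes>[V] h) (g \<otimes>[V] h) = cls f g"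
 by (rule cls_eqI) (use pairs_mult pairsD in "auto simp: PR.m_ac")

lemma cls_add_same:
 assumes f: "f \<in> mhomog K V b e" and f': "f' \<in> mhomog K V b e" and g: "g \<in> mhomog K V b e" "g \<notin> P"
 shows "cls (f \<oplus>[V] f') g = cls f g \<oplus>\<^bsub>OP\<^esub> cls f' g"
proof -
 note p = pairsI[OF f g] pairsI[OF f' g] pairsI[OF homog_add[OF f f'] g]
 have "cls (f \<oplus>[V] f') g = cls (f \<otimes>[V] g \<oplus>[V] f' \<otimes>[V] g) (g \<otimes>[V] g)"
  by (rule cls_eqI[OF p(3) pairs_add[OF p(1,2)]])
  (use homogD[OF f] homogD[OF f'] homogD[OF g(1)] in "simp add: PR.m_ac PR.l_distr PR.r_distr")
 thus ?thesis by (simp add: cls_ops[OF p(1,2)])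
qed

lemma OP_cring: "cring OP"
proof (rule cringI)
 show "abelian_group OP"
 proof (rule abelian_groupI)
  fix x y assume "x \<in> carrier OP" "y \<in> carrier OP"
  then obtain f g f' g' where *: "x = cls f g" "(f, g) \<in> pairs" "y = cls f' g'" "(f', g') \<in> pairs" by (auto simp: OP_simps)
  note c = pairsD(1,2)[OF *(2)] pairsD(1,2)[OF *(4)]
  show "x \<oplus>\<^bsub>OP\<^esub> y \<in> carrier OP" using * by (simp add: cls_ops cls_carrier pairs_add)
  show "x \<oplus>\<^bsub>OP\<^esub> y = y \<oplus>\<^bsub>OP\<^esub> x" using * c by (simp add: cls_ops PR.m_comm PR.a_comm)
 next
  fix x y z assume "x \<in> carrier OP" "y \<in> carrier OP" "z \<in> carrier OP"
  then obtain f g f' g' f'' g'' where *: "x = cls f g" "(f, g) \<in> pairs" "y = cls f' g'" "(f', g') \<in> pairs"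
  "z = cls f'' g''" "(f'', g'') \<in> pairs" unfolding OP_simps by blast
  note c = pairsD(1,2)[OF *(2)] pairsD(1,2)[OF *(4)] pairsD(1,2)[OF *(6)]
  show "x \<oplus>\<^bsub>OP\<^esub> y \<oplus>\<^bsub>OP\<^esub> z = x \<oplus>\<^bsub>OP\<^esub> (y \<oplus>\<^bsub>OP\<^esub> z)"
  using * c by (simp add: cls_ops pairs_add PR.m_ac PR.a_ac PR.l_distr PR.r_distr)
 next
  fix x assume "x \<in> carrier OP"
  then obtain f g where *: "x = cls f g" "(f, g) \<in> pairs" by (auto simp: OP_simps)
  note c = pairsD(1,2)[OF *(2)]
  show "\<zero>\<^bsub>OP\<^esub> \<oplus>\<^bsub>OP\<^esub> x = x" unfolding OP_simps(3) using * c by (simp add: cls_ops[OF pairs_zero])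
  obtain e where e: "f \<in> mhomog K V b e" "g \<in> mhomog K V b e" "g \<notin> P" using *(2) pairsE by metis
  have "\<ominus>[V] f \<in> mhomog K V b e" using homog_minus[OF homog_zero e(1)] c(1) by (simp add: PR.minus_eq)
  from cls_add_same[OF this e(1,2,3)] pairsI[OF this e(2,3)] have
  "cls (\<ominus>[V] f) g \<oplus>\<^bsub>OP\<^esub> x = \<zero>\<^bsub>OP\<^esub>" "(\<ominus>[V] f, g) \<in> pairs"
  using c cls_zero[OF pairsI[OF homog_zero e(2,3)]] by (simp_all add: *(1) PR.l_neg)
  thus "\<exists>y\<in>carrier OP. y \<oplus>\<^bsub>OP\<^esub> x = \<zero>\<^bsub>OP\<^esub>" using cls_carrier by blast
 qed (use cls_carrier[OF pairs_zero] in "simp add: OP_simps(3)")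
 show "comm_monoid OP"
 proof (rule comm_monoidI)
  fix x y assume "x \<in> carrier OP" "y \<in> carrier OP"
  then obtain f g f' g' where *: "x = cls f g" "(f, g) \<in> pairs" "y = cls f' g'" "(f', g') \<in> pairs" by (auto simp: OP_simps)
  note c = pairsD(1,2)[OF *(2)] pairsD(1,2)[OF *(4)]
  show "x \<otimes>\<^bsub>OP\<^esub> y \<in> carrier OP" using * by (simp add: cls_ops cls_carrier pairs_mult)
  show "x \<otimes>\<^bsub>OP\<^esub> y = y \<otimes>\<^bsub>OP\<^esub> x" using * c by (simp add: cls_ops PR.m_comm)
 next
  fix x y z assume "x \<in> carrier OP" "y \<in> carrier OP" "z \<in> carrier OP"
  then obtain f g f' g' f'' g'' where *: "x = cls f g" "(f, g) \<in> pairs" "y = cls f' g'" "(f', g') \<in> pairs"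
  "z = cls f'' g''" "(f'', g'') \<in> pairs" unfolding OP_simps by blast
  note c = pairsD(1,2)[OF *(2)] pairsD(1,2)[OF *(4)] pairsD(1,2)[OF *(6)]
  show "x \<otimes>\<^bsub>OP\<^esub> y \<otimes>\<^bsub>OP\<^esub> z = x \<otimes>\<^bsub>OP\<^esub> (y \<otimes>\<^bsub>OP\<^esub> z)"
  using * c by (simp add: cls_ops pairs_mult PR.m_ac)
 next
  fix x assume "x \<in> carrier OP"
  then obtain f g where *: "x = cls f g" "(f, g) \<in> pairs" by (auto simp: OP_simps)
  show "\<one>\<^bsub>OP\<^esub> \<otimes>\<^bsub>OP\<^esub> x = x" unfolding OP_simps(2) using * pairsD[OF *(2)] by (simp add: cls_ops[OF pairs_one])
 qed (use cls_carrier[OF pairs_one] in "simp add: OP_simps(2)")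
 fix x y z assume "x \<in> carrier OP" "y \<in> carrier OP" "z \<in> carrier OP"
 then obtain f g f' g' f'' g'' where *: "x = cls f g" "(f, g) \<in> pairs" "y = cls f' g'" "(f', g') \<in> pairs"
  "z = cls f'' g''" "(f'', g'') \<in> pairs" unfolding OP_simps by blast
 note c = pairsD(1,2)[OF *(2)] pairsD(1,2)[OF *(4)] pairsD(1,2)[OF *(6)]
 have h: "(g'', g'') \<in> pairs" using *(6) pairsE pairsI by metis
 have "x \<otimes>\<^bsub>OP\<^esub> z \<oplus>\<^bsub>OP\<^esub> y \<otimes>\<^bsub>OP\<^esub> z =
  cls ((f \<otimes>[V] g' \<oplus>[V] f' \<otimes>[V] g) \<otimes>[V] f'' \<otimes>[V] g'') ((g \<otimes>[V] g') \<otimes>[V] g'' \<otimes>[V] g'')"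
  using * c by (simp add: cls_ops pairs_mult pairs_add PR.m_ac PR.a_ac PR.l_distr PR.r_distr)
 also have "\<dots> = cls ((f \<otimes>[V] g' \<oplus>[V] f' \<otimes>[V] g) \<otimes>[V] f'') ((g \<otimes>[V] g') \<otimes>[V] g'')"
  by (rule cls_cancel[OF pairs_mult[OF pairs_add[OF *(2,4)] *(6)] h])
 also have "\<dots> = (x \<oplus>\<^bsub>OP\<^esub> y) \<otimes>\<^bsub>OP\<^esub> z" using * by (simp add: cls_ops pairs_add)
 finally show "(x \<oplus>\<^bsub>OP\<^esub> y) \<otimes>\<^bsub>OP\<^esub> z = x \<otimes>\<^bsub>OP\<^esub> z \<oplus>\<^bsub>OP\<^esub> y \<otimes>\<^bsub>OP\<^esub> z" ..
qed

sublocale OP: cring OP by (rule OP_cring)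

lemma cls_eq_zero_iff:
 assumes "(f, g) \<in> pairs"
 shows "cls f g = \<zero>\<^bsub>OP\<^esub> \<longleftrightarrow> (\<exists>h. h \<in> carrier S & h \<notin> P & h \<otimes>[V] f \<in> I)"
 unfolding OP_simps(3) cls_eq_iff[OF assms pairs_zero] frel_def
 using pairsD[OF assms] by (auto simp: PR.minus_eq)

abbreviation "MP \<equiv> mproj_max_ideal K V b I P"

lemma MP_iff:
 assumes p: "(f, g) \<in> pairs"
 shows "cls f g \<in> MP \<longleftrightarrow> f \<in> P"
proof
 assume "cls f g \<in> MP"
 then obtain f' g' where *: "cls f g = cls f' g'" "(f', g') \<in> pairs" "f' \<in> P" by (auto simp: mproj_max_ideal_def)
 note c = pairsD(1,2)[OF p] pairsD(1,2)[OF *(2)]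
 obtain h where h: "h \<in> carrier S" "h \<notin> P" "h \<otimes>[V] (f \<otimes>[V] g' \<ominus>[V] f' \<otimes>[V] g) \<in> I"
  using * cls_eq_iff[OF p *(2)] by (auto simp: frel_def)
 have "f \<otimes>[V] g' \<ominus>[V] f' \<otimes>[V] g \<in> P" using h I_P c by (auto simp: P_mult_iff)
 moreover have "f' \<otimes>[V] g \<in> P" using * c by (simp add: P_mult_iff)
 ultimately have "(f \<otimes>[V] g' \<ominus>[V] f' \<otimes>[V] g) \<oplus>[V] f' \<otimes>[V] g \<in> P" by (rule P_add)
 hence "f \<otimes>[V] g' \<in> P" using c by (simp add: PR.minus_eq PR.a_assoc PR.l_neg)
 thus "f \<in> P" using c pairsD(3)[OF *(2)] by (simp add: P_mult_iff)
qed (use p in "auto simp: mproj_max_ideal_def")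

lemma MP_sub: "MP \<subseteq> carrier OP"
 by (auto simp: mproj_max_ideal_def OP_simps)

lemma MP_maximal: "maximalideal MP OP"
proof (rule maximalidealI)
 show "ideal MP OP"
 proof (rule idealI)
  show "subgroup MP (add_monoid OP)"
  proof
  show "MP \<subseteq> carrier (add_monoid OP)" using MP_sub by simp
  show "\<one>\<^bsub>add_monoid OP\<^esub> \<in> MP" using MP_iff[OF pairs_zero] P_zero by (simp add: OP_simps(3))
  fix x y assume "x \<in> MP" "y \<in> MP"
  then obtain f g f' g' where *: "x = cls f g" "(f, g) \<in> pairs" "f \<in> P" "y = cls f' g'" "(f', g') \<in> pairs" "f' \<in> P"
  by (auto simp: mproj_max_ideal_def)
  have "f \<otimes>[V] g' \<oplus>[V] f' \<otimes>[V] g \<in> P" using pairsD * by (intro P_add) (simp_all add: P_mult_iff)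
  thus "x \<otimes>\<^bsub>add_monoid OP\<^esub> y \<in> MP" using * by (simp add: cls_ops MP_iff pairs_add)
  next
  fix x assume "x \<in> MP"
  then obtain f g where *: "x = cls f g" "(f, g) \<in> pairs" "f \<in> P" by (auto simp: mproj_max_ideal_def)
  obtain e where e: "f \<in> mhomog K V b e" "g \<in> mhomog K V b e" "g \<notin> P" using *(2) pairsE by metis
  have m: "\<ominus>[V] f \<in> mhomog K V b e" using homog_minus[OF homog_zero e(1)] homogD[OF e(1)] by (simp add: PR.minus_eq)
  from cls_add_same[OF this e(1,2,3)] have
  "cls (\<ominus>[V] f) g \<oplus>\<^bsub>OP\<^esub> x = \<zero>\<^bsub>OP\<^esub>"
  using pairsD[OF *(2)] cls_zero[OF pairsI[OF homog_zero e(2,3)]] by (simp_all add: *(1) PR.l_neg)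
  hence "\<ominus>\<^bsub>OP\<^esub> x = cls (\<ominus>[V] f) g"
  using * cls_carrier pairsI[OF m e(2,3)] by (intro OP.minus_equality) auto
  moreover have "cls (\<ominus>[V] f) g \<in> MP" using MP_iff[OF pairsI[OF m e(2,3)]] P_minus[OF *(3)] by simp
  ultimately show "inv\<^bsub>add_monoid OP\<^esub> x \<in> MP" by (simp add: a_inv_def)
  qed
  fix a x assume "a \<in> MP" "x \<in> carrier OP"
  then obtain f g f' g' where *: "a = cls f g" "(f, g) \<in> pairs" "f \<in> P" "x = cls f' g'" "(f', g') \<in> pairs"
  by (auto simp: mproj_max_ideal_def OP_simps)
  thus "x \<otimes>\<^bsub>OP\<^esub> a \<in> MP" "a \<otimes>\<^bsub>OP\<^esub> x \<in> MP"
  using pairsD[OF *(2)] pairsD[OF *(5)] by (simp_all add: cls_ops MP_iff pairs_mult P_mult_iff)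
 qed (rule OP.ring_axioms)
 show "carrier OP ~= MP" using MP_iff[OF pairs_one] P_one cls_carrier[OF pairs_one] by auto
 fix J assume J: "ideal J OP" "MP \<subseteq> J" "J \<subseteq> carrier OP"
 show "J = MP \<or> J = carrier OP"
 proof (rule disjCI)
  assume "J ~= carrier OP"
  have "x \<in> MP" if xJ: "x \<in> J" for x
  proof (rule ccontr)
  assume x: "x \<notin> MP"
  obtain f g where *: "x = cls f g" "(f, g) \<in> pairs" using xJ J(3) by (auto simp: OP_simps)
  have f: "f \<notin> P" using MP_iff[OF *(2)] x * by simp
  obtain e where e: "f \<in> mhomog K V b e" "g \<in> mhomog K V b e" "g \<notin> P" using *(2) pairsE by metis
  note gf = pairsI[OF e(2,1) f]
  have "x \<otimes>\<^bsub>OP\<^esub> cls g f = cls (f \<otimes>[V] g) (f \<otimes>[V] g)"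
  using * gf pairsD[OF *(2)] by (simp add: cls_ops PR.m_comm)
  also have "\<dots> = \<one>\<^bsub>OP\<^esub>" using pairs_mult[OF *(2) gf] pairsD[OF *(2)] by (intro cls_self) (simp add: PR.m_comm)
  finally have "\<one>\<^bsub>OP\<^esub> \<in> J" using ideal.I_r_closed[OF J(1) xJ cls_carrier[OF gf]] by simp
  thus False using ideal.one_imp_carrier[OF J(1)] `J ~= carrier OP` by simp
  qed
  thus "J = MP" using J(2) by blast
 qed
qed

lemma residue_field: "field (mproj_residue_field K V b I P)"
 unfolding mproj_residue_field_def by (rule maximalideal.quotient_is_field[OF MP_maximal OP_cring])

end

section \<open>The map of stalks at the generic point\<close>

context mpoly
begin

abbreviation (input) "hg V \<equiv> mhomog K V (%_. ())"
abbreviation (input) "pts V \<equiv> mproj_points K V (%_. ()) {\<zero>[V]}"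
abbreviation (input) "ptop V \<equiv> mproj_top K V (%_. ()) {\<zero>[V]}"

lemma topspace_mproj: "topspace (mproj_top K V b I) = mproj_points K V b I"
proof -
 have "\<one>[V] \<notin> P" if "P \<in> mproj_points K V b I" for P
 proof -
  have P: "primeideal P (PR V)" using that by (simp add: mproj_points_def)
  show ?thesis using primeideal.I_notcarr[OF P] ideal.one_imp_carrier[OF primeideal.axioms(1)[OF P]] by blast
 qed
 hence "mproj_points K V b I = {P \<in> mproj_points K V b I. \<one>[V] \<notin> P}" by blast
 hence "mproj_points K V b I \<in> {{P \<in> mproj_points K V b I. f \<notin> P} | f e. f \<in> mhomog K V b e}"
  using homog_one[of V b] by blast
 thus ?thesis unfolding mproj_top_def topology_generated_by_topspace by blast
qed

lemma openin_principal: "f \<in> mhomog K V b e ==> openin (mproj_top K V b I) {P \<in> mproj_points K V b I. f \<notin> P}"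
 unfolding mproj_top_def by (rule topology_generated_by_Basis) blast

lemma mlocal_point:
 assumes "ideal I (PR V)" "P \<in> mproj_points K V b I"
 shows "mlocal K V I P"
proof -
 have "primeideal P (PR V)" "I \<subseteq> P" using assms(2) by (simp_all add: mproj_points_def)
 thus ?thesis by (intro mlocal.intro mlocal_axioms.intro assms(1) mpoly_axioms)
qed

lemma zero_ideal: "ideal {\<zero>[V]} (PR V)"
 by (rule PR.zeroideal)

lemma fraction_section:
 assumes "openin (mproj_top K V b I) A" "u \<in> mhomog K V b e" "v \<in> mhomog K V b e" "!!Q. Q \<in> A ==> v \<notin> Q"
  and I: "ideal I (PR V)"
 shows "(\<lambda>Q\<in>A. mfrac K V b I Q u v) \<in> carrier (mproj_sections K V b I A)"
proof -
 have A: "A \<subseteq> mproj_points K V b I" using openin_subset[OF assms(1)] by (simp add: topspace_mproj)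
 have "mfrac K V b I Q u v \<in> carrier (mproj_local_ring K V b I Q)" if "Q \<in> A" for Q
 proof -
  interpret mlocal K V b I Q by (rule mlocal_point[OF I]) (use that A in auto)
  show ?thesis by (rule cls_carrier[OF pairsI[OF assms(2,3) assms(4)[OF that]]])
 qed
 moreover have "\<forall>P\<in>A. \<exists>W f g e. openin (mproj_top K V b I) W & P \<in> W & W \<subseteq> A & f \<in> mhomog K V b e & g \<in> mhomog K V b e &
  (\<forall>Q\<in>W. g \<notin> Q & (\<lambda>Q\<in>A. mfrac K V b I Q u v) Q = mfrac K V b I Q f g)"
  by (intro ballI exI[of _ A] exI[of _ u] exI[of _ v] exI[of _ e]) (use assms(1-4) in simp)
 ultimately show ?thesis unfolding mproj_sections_def Let_def by simp
qed

text \<open>The rules for fractions of equal multidegree with denominators in \<open>N\<close> and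
  values in a ring \<open>Q\<close>. They hold for classes in a local ring as well as for rational
  functions pulled back along a birational map, so \<open>substitution\<close> can be used in both
  directions.\<close>

definition frac_fun ::
 "'v set => ('v => 'b) => ('v multiset => 'a) set => 'o ring => ('a => 'o) =>
  (('v multiset => 'a) => ('v multiset => 'a) => 'o) => bool" where
 "frac_fun V b N Q ka Ph \<longleftrightarrow> cring Q & \<one>[V] \<in> N & (\<forall>v\<in>N. \<forall>v'\<in>N. v \<otimes>[V] v' \<in> N) &
  (\<forall>e u v. u \<in> mhomog K V b e & v \<in> mhomog K V b e & v \<in> N -->
  Ph u v \<in> carrier Q & Ph v v = \<one>\<^bsub>Q\<^esub> &
  (\<forall>u'. u' \<in> mhomog K V b e --> Ph (u \<oplus>[V] u') v = Ph u v \<oplus>\<^bsub>Q\<^esub> Ph u' v) &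
  (\<forall>e' u' v'. u' \<in> mhomog K V b e' & v' \<in> mhomog K V b e' & v' \<in> N -->
  Ph (u \<otimes>[V] u') (v \<otimes>[V] v') = Ph u v \<otimes>\<^bsub>Q\<^esub> Ph u' v')) &
  (\<forall>c\<in>carrier K. Ph (mono c {#}) \<one>[V] = ka c)"

lemma frac_funD:
 assumes "frac_fun V b N Q ka Ph"
 shows "cring Q" "\<one>[V] \<in> N" "v \<in> N ==> v' \<in> N ==> v \<otimes>[V] v' \<in> N"
  "u \<in> mhomog K V b e ==> v \<in> mhomog K V b e ==> v \<in> N ==> Ph u v \<in> carrier Q"
  "v \<in> mhomog K V b e ==> v \<in> N ==> Ph v v = \<one>\<^bsub>Q\<^esub>"
  "u \<in> mhomog K V b e ==> u' \<in> mhomog K V b e ==> v \<in> mhomog K V b e ==> v \<in> N ==>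
  Ph (u \<oplus>[V] u') v = Ph u v \<oplus>\<^bsub>Q\<^esub> Ph u' v"
  "u \<in> mhomog K V b e ==> v \<in> mhomog K V b e ==> v \<in> N ==>
  u' \<in> mhomog K V b e' ==> v' \<in> mhomog K V b e' ==> v' \<in> N ==>
  Ph (u \<otimes>[V] u') (v \<otimes>[V] v') = Ph u v \<otimes>\<^bsub>Q\<^esub> Ph u' v'"
  "c \<in> carrier K ==> Ph (mono c {#}) \<one>[V] = ka c"
 using assms unfolding frac_fun_def by simp_all

end

context mpoly_field
begin

lemma generic_point:
 fixes V :: "'v :: linorder set"
 assumes "V ~= {}"
 shows "{\<zero>[V]} \<in> pts V"
proof -
 interpret D: domain "PR V" by (rule PR_domain)
 have "primeideal {\<zero>[V]} (PR V)" by (rule D.zeroprimeideal)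
 moreover have "mcomponent K b e \<zero>[V] = \<zero>[V]" for b :: "'v => unit" and e by (simp add: mcomponent_def PR_simps)
 moreover obtain v where "v \<in> V" using assms by blast
 moreover have "mp_var K v ~= \<zero>[V]" for v by (auto simp: mp_var_mono mono_def PR_simps fun_eq_iff)
 ultimately show ?thesis unfolding mproj_points_def by auto
qed

lemma generic_point_open:
 fixes V :: "'v :: linorder set"
 assumes "V ~= {}" "openin (ptop V) A" "A ~= {}"
 shows "{\<zero>[V]} \<in> A"
proof -
 have "generate_topology_on {{P \<in> pts V. f \<notin> P} | f e. f \<in> hg V e} A"
  using assms(2) unfolding mproj_top_def by (rule openin_topology_generated_by)
 hence "A ~= {} --> {\<zero>[V]} \<in> A"
 proof induction
  case (Basis s)
  then obtain f where f: "s = {P \<in> pts V. f \<notin> P}" by blast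
  show ?case
  proof
  assume "s ~= {}"
  then obtain P where "P \<in> pts V" "f \<notin> P" using f by blast
  hence "f ~= \<zero>[V]" by (auto simp: mproj_points_def)
  thus "{\<zero>[V]} \<in> s" using generic_point[OF assms(1)] by (simp add: f)
  qed
 qed auto
 thus ?thesis using assms(3) by blast
qed

lemma dense_open_generic:
 fixes V :: "'v :: linorder set"
 assumes "V ~= {}" "openin (ptop V) A"
 shows "dense_open (ptop V) A \<longleftrightarrow> {\<zero>[V]} \<in> A"
proof
 assume "dense_open (ptop V) A"
 hence "A ~= {}" using generic_point[OF assms(1)] unfolding dense_open_def
  by (metis closure_of_empty empty_iff topspace_mproj)
 thus "{\<zero>[V]} \<in> A" by (rule generic_point_open[OF assms])
next
 assume A: "{\<zero>[V]} \<in> A"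
 have cl: "x \<in> ptop V closure_of A" if "x \<in> topspace (ptop V)" for x
  unfolding in_closure_of using that A generic_point_open[OF assms(1)] by blast
 show "dense_open (ptop V) A"
  unfolding dense_open_def by (intro conjI assms(2) equalityI subsetI cl) (simp_all add: in_closure_of)
qed

text \<open>\<open>P\<close> is the point lying over the generic point of the projective space.
  Sections over neighbourhoods of the generic point pull back to germs at \<open>P\<close>.
  Conversely a fraction f / g is a section near \<open>P\<close>, hence comes from a section of the
  projective space, which is a fraction near the generic point.\<close>

theorem birational_frac_fun:
 fixes W :: "'w :: linorder set" and V :: "'v set" and b :: "'v => 'c"
 assumes "birational_over K (mproj K V b I) (proj_space K W)" "W ~= {}" and I: "ideal I (PR V)"
 obtains P Ps where "P \<in> mproj_points K V b I"
  "frac_fun W (%_. ()) (carrier (PR W) - {\<zero>[W]}) (mproj_local_ring K V b I P)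
  (%c. mfrac K V b I P (mono c {#}) \<one>[V]) Ps"
  "!!f g. (f, g) \<in> mfrac_pairs K V b P ==> \<exists>e u v. u \<in> hg W e & v \<in> hg W e &
  v \<in> carrier (PR W) - {\<zero>[W]} & mfrac K V b I P f g = Ps u v"
proof -
 let ?TX = "mproj_top K V b I" and ?Z = "{\<zero>[W]}"
 let ?TY = "mproj_top K W (%_. ()) ?Z"
 let ?SX = "mproj_sections K V b I" and ?SY = "mproj_sections K W (%_. ()) ?Z"
 let ?cY = "mfrac K W (%_. ()) ?Z" and ?cX = "mfrac K V b I" and ?OX = "mproj_local_ring K V b I"
 have sel: "space_top (mproj K V b I) = ?TX" "sections (mproj K V b I) = ?SX"
  "space_top (proj_space K W) = ?TY" "sections (proj_space K W) = ?SY"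
  "scalar (mproj K V b I) = (%U c. \<lambda>Q\<in>U. ?cX Q (mp_const K c) \<one>[V])"
  "scalar (proj_space K W) = (%U c. \<lambda>Q\<in>U. ?cY Q (mp_const K c) \<one>[W])"
  by (simp_all add: mproj_def proj_space_def)
 obtain U B where U: "dense_open ?TX U" and B: "dense_open ?TY B"
  and UB: "open_iso_over K (mproj K V b I) U (proj_space K W) B"
  using assms(1) unfolding birational_over_def sel by - (elim exE conjE, rule that)
 obtain ph th where homeo: "homeomorphic_map (subtopology ?TX U) (subtopology ?TY B) ph"
  and th: "\<forall>A. openin ?TY A & A \<subseteq> B -->
  th A \<in> ring_iso (?SY A) (?SX {x\<in>U. ph x \<in> A}) &
  (\<forall>c\<in>carrier K. th A (\<lambda>Q\<in>A. ?cY Q (mp_const K c) \<one>[W]) = (\<lambda>Q\<in>{x \<in> U. ph x \<in> A}. ?cX Q (mp_const K c) \<one>[V])) &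
  (\<forall>B s. openin ?TY B & B \<subseteq> A & s \<in> carrier (?SY A) -->
  th B (restrict s B) = restrict (th A s) {x\<in>U. ph x \<in> B})"
  using UB unfolding open_iso_over_def sel by - (elim exE conjE, rule that)
 have iso: "th A \<in> ring_iso (?SY A) (?SX {x \<in> U. ph x \<in> A})" if "openin ?TY A" "A \<subseteq> B" for A
  using th that by simp
 have scal: "th A (\<lambda>Q\<in>A. ?cY Q (mp_const K c) \<one>[W]) = (\<lambda>Q\<in>{x \<in> U. ph x \<in> A}. ?cX Q (mp_const K c) \<one>[V])"
  if "openin ?TY A" "A \<subseteq> B" "c \<in> carrier K" for A c
  using th that by simp
 have restr: "th A' (restrict s A') = restrict (th A s) {x \<in> U. ph x \<in> A'}"
  if "openin ?TY A" "A \<subseteq> B" "openin ?TY A'" "A' \<subseteq> A" "s \<in> carrier (?SY A)" for A A' s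
  using th that by simp
 have Uo: "openin ?TX U" and Bo: "openin ?TY B" using U B by (auto simp: dense_open_def)
 have xiB: "?Z \<in> B" using B dense_open_generic[OF assms(2) Bo] by simp
 have tU: "topspace (subtopology ?TX U) = U" and tB: "topspace (subtopology ?TY B) = B"
  using openin_subset[OF Uo] openin_subset[OF Bo] by auto
 have phU: "ph ` U = B" and inj: "inj_on ph U"
  using homeomorphic_imp_surjective_map[OF homeo] homeomorphic_imp_injective_map[OF homeo] tU tB by auto
 obtain P where P: "P \<in> U" "ph P = ?Z" using xiB phU by auto
 define pre where "pre = (%A. {x \<in> U. ph x \<in> A})"
 have Pp: "P \<in> mproj_points K V b I" using P(1) openin_subset[OF Uo] by (auto simp: topspace_mproj)
 interpret X: mlocal K V b I P by (rule mlocal_point[OF I Pp])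
 have Ppre: "P \<in> pre A" if "?Z \<in> A" for A using that P by (simp add: pre_def)
 define dom where "dom = (%v. {Q \<in> B. v \<notin> Q})"
 have dom: "openin ?TY (dom v)" "dom v \<subseteq> B" if "v \<in> hg W e" for v e
 proof -
  have "dom v = B \<inter> {Q \<in> mproj_points K W (%_. ()) ?Z. v \<notin> Q}"
  using openin_subset[OF Bo] by (auto simp: dom_def topspace_mproj)
  thus "openin ?TY (dom v)" using Bo openin_principal[OF that] by (simp add: openin_Int)
 qed (auto simp: dom_def)
 have xidom: "?Z \<in> dom v" if "v ~= \<zero>[W]" for v using that xiB by (simp add: dom_def)
 define sec where "sec = (%u v A. \<lambda>Q\<in>A. ?cY Q u v)"
 \<comment> \<open>The germ at \<open>P\<close> of the pull-back of u / v; by \<open>Ps_eq\<close>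
   any smaller neighbourhood of the generic point gives the same germ.\<close>
 define Ps where "Ps = (%u v. th (dom v) (sec u v (dom v)) P)"
 have secc: "sec u v A \<in> carrier (?SY A)"
  if "u \<in> hg W e" "v \<in> hg W e" "openin ?TY A" "A \<subseteq> dom v" for u v A e
  unfolding sec_def by (rule fraction_section[OF that(3,1,2) _ zero_ideal]) (use that(4) in "auto simp: dom_def")
 have Ps_eq: "Ps u v = th A (sec u v A) P"
  if "u \<in> hg W e" "v \<in> hg W e" "openin ?TY A" "A \<subseteq> dom v" "?Z \<in> A" for u v A e
 proof -
  have "sec u v A = restrict (sec u v (dom v)) A" using that(4) by (auto simp: sec_def fun_eq_iff)
  hence "th A (sec u v A) = restrict (th (dom v) (sec u v (dom v))) (pre A)"
  using restr[OF dom[OF that(2)] that(3,4) secc[OF that(1,2) dom(1)[OF that(2)]]] by (simp add: pre_def)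
  thus ?thesis using Ppre[OF that(5)] by (simp add: Ps_def)
 qed
 have point: "Q \<in> mproj_points K W (%_. ()) ?Z" if "Q \<in> B" for Q using that openin_subset[OF Bo] by (auto simp: topspace_mproj)
 have hom: "th A \<in> Ring.ring_hom (?SY A) (?SX (pre A))" if "openin ?TY A" "A \<subseteq> B" for A
  using iso[OF that] by (simp add: ring_iso_def pre_def)
 have Ps_closed: "Ps u v \<in> carrier (?OX P)"
  if "u \<in> hg W e" "v \<in> hg W e" "v ~= \<zero>[W]" for u v e
 proof -
  have "th (dom v) (sec u v (dom v)) \<in> carrier (?SX (pre (dom v)))"
  by (rule ring_hom_closed[OF hom[OF dom[OF that(2)]] secc[OF that(1,2) dom(1)[OF that(2)]]]) simp
  thus ?thesis using Ppre[OF xidom[OF that(3)]] unfolding Ps_def mproj_sections_def Let_def by auto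
 qed
 have Ps_one: "Ps v v = \<one>\<^bsub>?OX P\<^esub>" if "v \<in> hg W e" "v ~= \<zero>[W]" for v e
 proof -
  have "?cY Q v v = \<one>\<^bsub>mproj_local_ring K W (%_. ()) ?Z Q\<^esub>" if Q: "Q \<in> dom v" for Q
  proof -
  interpret Y: mlocal K W "%_. ()" ?Z Q by (rule mlocal_point[OF zero_ideal point]) (use Q in "auto simp: dom_def")
  show ?thesis by (rule Y.cls_self[OF Y.pairsI]) (use `v \<in> mhomog _ _ _ _` Q in "auto simp: dom_def")
  qed
  hence "sec v v (dom v) = \<one>\<^bsub>?SY (dom v)\<^esub>" by (auto simp: sec_def mproj_sections_def Let_def fun_eq_iff)
  hence "th (dom v) (sec v v (dom v)) = \<one>\<^bsub>?SX (pre (dom v))\<^esub>" using ring_hom_one[OF hom[OF dom[OF that(1)]]] by simp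
  thus ?thesis using Ppre[OF xidom[OF that(2)]] by (simp add: Ps_def mproj_sections_def Let_def)
 qed
 have Ps_add: "Ps (u \<oplus>[W] u') v = Ps u v \<oplus>\<^bsub>?OX P\<^esub> Ps u' v"
  if "u \<in> hg W e" "v \<in> hg W e" "v ~= \<zero>[W]" "u' \<in> hg W e" for u v u' e
 proof -
  have "?cY Q (u \<oplus>[W] u') v = ?cY Q u v \<oplus>\<^bsub>mproj_local_ring K W (%_. ()) ?Z Q\<^esub> ?cY Q u' v" if Q: "Q \<in> dom v" for Q
  proof -
  interpret Y: mlocal K W "%_. ()" ?Z Q by (rule mlocal_point[OF zero_ideal point]) (use Q in "auto simp: dom_def")
  show ?thesis by (rule Y.cls_add_same) (use `u \<in> _` `u' \<in> _` `v \<in> mhomog _ _ _ _` Q in "auto simp: dom_def")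
  qed
  hence "sec (u \<oplus>[W] u') v (dom v) = sec u v (dom v) \<oplus>\<^bsub>?SY (dom v)\<^esub> sec u' v (dom v)"
  by (auto simp: sec_def mproj_sections_def Let_def fun_eq_iff)
  hence "th (dom v) (sec (u \<oplus>[W] u') v (dom v)) = th (dom v) (sec u v (dom v)) \<oplus>\<^bsub>?SX (pre (dom v))\<^esub> th (dom v) (sec u' v (dom v))"
  using ring_hom_add[OF hom[OF dom[OF that(2)]] secc[OF that(1,2) dom(1)[OF that(2)]] secc[OF that(4,2) dom(1)[OF that(2)]]] by simp
  thus ?thesis using Ppre[OF xidom[OF that(3)]] by (simp add: Ps_def mproj_sections_def Let_def)
 qed
 have Ps_mult: "Ps (u \<otimes>[W] u') (v \<otimes>[W] v') = Ps u v \<otimes>\<^bsub>?OX P\<^esub> Ps u' v'"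
  if uv: "u \<in> hg W e" "v \<in> hg W e" "v ~= \<zero>[W]"
  and uv': "u' \<in> hg W e'" "v' \<in> hg W e'" "v' ~= \<zero>[W]" for u v u' v' e e'
 proof -
  define A where "A = dom v \<inter> dom v'"
  have A: "openin ?TY A" "A \<subseteq> dom v" "A \<subseteq> dom v'" "?Z \<in> A" "A \<subseteq> B"
  using dom[OF uv(2)] dom[OF uv'(2)] xidom uv(3) uv'(3) by (auto simp: A_def)
  have Q: "v \<otimes>[W] v' \<notin> Q & ?cY Q (u \<otimes>[W] u') (v \<otimes>[W] v') = ?cY Q u v \<otimes>\<^bsub>mproj_local_ring K W (%_. ()) ?Z Q\<^esub> ?cY Q u' v'"
  if Q: "Q \<in> A" for Q
  proof -
  interpret Y: mlocal K W "%_. ()" ?Z Q by (rule mlocal_point[OF zero_ideal point]) (use Q A in auto)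
  have n: "v \<notin> Q" "v' \<notin> Q" using Q by (auto simp: A_def dom_def)
  show ?thesis using Y.cls_ops(1)[OF Y.pairsI[OF uv(1,2) n(1)] Y.pairsI[OF uv'(1,2) n(2)]] n
  by (simp add: Y.P_mult_iff homogD[OF uv(2)] homogD[OF uv'(2)])
  qed
  hence s: "sec (u \<otimes>[W] u') (v \<otimes>[W] v') A = sec u v A \<otimes>\<^bsub>?SY A\<^esub> sec u' v' A"
  by (auto simp: sec_def mproj_sections_def Let_def fun_eq_iff)
  have d: "A \<subseteq> dom (v \<otimes>[W] v')" using Q A by (auto simp: dom_def)
  have "th A (sec u v A \<otimes>\<^bsub>?SY A\<^esub> sec u' v' A) = th A (sec u v A) \<otimes>\<^bsub>?SX (pre A)\<^esub> th A (sec u' v' A)"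
  by (rule ring_hom_mult[OF hom[OF A(1,5)] secc[OF uv(1,2) A(1,2)] secc[OF uv'(1,2) A(1,3)]])
  hence "th A (sec (u \<otimes>[W] u') (v \<otimes>[W] v') A) P = th A (sec u v A) P \<otimes>\<^bsub>?OX P\<^esub> th A (sec u' v' A) P"
  using Ppre[OF A(4)] by (simp add: s mproj_sections_def Let_def)
  thus ?thesis
  by (simp add: Ps_eq[OF homog_mult[OF uv(1) uv'(1)] homog_mult[OF uv(2) uv'(2)] A(1) d A(4)]
  Ps_eq[OF uv(1,2) A(1,2,4)] Ps_eq[OF uv'(1,2) A(1,3,4)])
 qed
 have Ps_scalar: "Ps (mp_const K c) \<one>[W] = ?cX P (mp_const K c) \<one>[V]" if c: "c \<in> carrier K" for c
 proof -
  have h: "mp_const K c \<in> hg W {#}" unfolding mp_const_mono by (rule homog_mono) (use c in auto)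
  have d: "B \<subseteq> dom \<one>[W]"
  proof
  fix Q assume Q: "Q \<in> B"
  interpret Y: mlocal K W "%_. ()" ?Z Q by (rule mlocal_point[OF zero_ideal point[OF Q]])
  show "Q \<in> dom \<one>[W]" using Y.P_one Q by (simp add: dom_def)
  qed
  have "Ps (mp_const K c) \<one>[W] = th B (sec (mp_const K c) \<one>[W] B) P" by (rule Ps_eq[OF h homog_one Bo d xiB])
  also have "\<dots> = (\<lambda>Q\<in>pre B. ?cX Q (mp_const K c) \<one>[V]) P" using scal[OF Bo order_refl c] by (simp add: sec_def pre_def)
  finally show ?thesis using Ppre[OF xiB] by simp
 qed
 have Ps_surj: "\<exists>e u v. u \<in> hg W e & v \<in> hg W e & v \<in> carrier (PR W) - {\<zero>[W]} & ?cX P f g = Ps u v"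
  if fg: "(f, g) \<in> mfrac_pairs K V b P" for f g
 proof -
  obtain e where e: "f \<in> mhomog K V b e" "g \<in> mhomog K V b e" "g \<notin> P" using X.pairsE[OF fg] by blast
  define C where "C = U \<inter> {Q \<in> mproj_points K V b I. g \<notin> Q}"
  have C: "openin ?TX C" "C \<subseteq> U" "P \<in> C" using Uo openin_principal[OF e(2)] P(1) Pp e(3) by (auto simp: C_def openin_Int)
  have Co: "openin (subtopology ?TX U) C" using C(1,2) by (simp add: openin_open_subtopology[OF Uo])
  have "openin (subtopology ?TY B) (ph ` C)"
  using homeomorphic_imp_open_map[OF homeo] Co by (simp add: open_map_def)
  hence A: "openin ?TY (ph ` C)" "ph ` C \<subseteq> B" by (simp_all add: openin_open_subtopology[OF Bo])
  have preA: "pre (ph ` C) = C" using inj C(2) by (auto simp: pre_def inj_on_def)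
  define t where "t = (\<lambda>Q\<in>C. ?cX Q f g)"
  have t: "t \<in> carrier (?SX C)" unfolding t_def by (rule fraction_section[OF C(1) e(1,2) _ I]) (auto simp: C_def)
  have "th (ph ` C) ` carrier (?SY (ph ` C)) = carrier (?SX C)"
  using iso[OF A] preA by (simp add: ring_iso_def bij_betw_def pre_def)
  hence "t \<in> th (ph ` C) ` carrier (?SY (ph ` C))" using t by (simp only:)
  then obtain s where s: "s \<in> carrier (?SY (ph ` C))" "th (ph ` C) s = t" by (elim imageE, intro that) simp_all
  have xi: "?Z \<in> ph ` C" using P(2) C(3) by (metis image_eqI)
  obtain D u v e' where D: "openin ?TY D" "?Z \<in> D" "D \<subseteq> ph ` C"
  and uv: "u \<in> hg W e'" "v \<in> hg W e'" "!!Q. Q \<in> D ==> v \<notin> Q & s Q = ?cY Q u v"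
  using s(1) xi unfolding mproj_sections_def Let_def by auto
  have DB: "D \<subseteq> B" using D(3) A(2) by blast
  have Dd: "D \<subseteq> dom v" using uv(3) DB by (auto simp: dom_def)
  have "Ps u v = th D (sec u v D) P" by (rule Ps_eq[OF uv(1,2) D(1) Dd D(2)])
  also have "sec u v D = restrict s D" using uv(3) by (auto simp: sec_def fun_eq_iff)
  also have "th D (restrict s D) = restrict t (pre D)" using restr[OF A D(1,3) s(1)] by (simp add: s(2) pre_def)
  finally have "?cX P f g = Ps u v" using Ppre[OF D(2)] C(3) by (simp add: t_def)
  moreover have "v \<in> carrier (PR W) - {\<zero>[W]}" using uv(3)[OF D(2)] homogD[OF uv(2)] by auto
  ultimately show ?thesis using uv(1,2) by blast
 qed
 interpret D: domain "PR W" by (rule PR_domain)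
 show ?thesis
 proof (rule that[OF Pp _ Ps_surj])
  show "frac_fun W (%_. ()) (carrier (PR W) - {\<zero>[W]}) (?OX P) (%c. ?cX P (mono c {#}) \<one>[V]) Ps"
  unfolding frac_fun_def
  apply (intro conjI allI impI ballI)
  subgoal by (rule X.OP_cring)
  subgoal using D.one_not_zero by simp
  subgoal using D.integral by auto
  subgoal by (elim conjE, rule Ps_closed) auto
  subgoal by (elim conjE, rule Ps_one) auto
  subgoal by (elim conjE, rule Ps_add) auto
  subgoal by (elim conjE, rule Ps_mult) auto
  subgoal using Ps_scalar by (simp add: mp_const_mono)
  done
 qed
qed

end

section \<open>Substitution\<close>

context mpoly
begin

lemma frac_fun_zero:
 assumes F: "frac_fun V b N Q ka Ph" and v: "v \<in> mhomog K V b e" "v \<in> N"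
 shows "Ph \<zero>[V] v = \<zero>\<^bsub>Q\<^esub>"
proof -
 interpret Q: cring Q by (rule frac_funD(1)[OF F])
 have z: "\<zero>[V] \<in> mhomog K V b e" by (rule homog_zero)
 have "Ph \<zero>[V] v = Ph \<zero>[V] v \<oplus>\<^bsub>Q\<^esub> Ph \<zero>[V] v"
  using frac_funD(6)[OF F z z v] by simp
 thus ?thesis using frac_funD(4)[OF F z v] by (metis Q.r_zero Q.zero_closed Q.add.l_cancel)
qed

lemma homog_pow: "s \<in> mhomog K V b be ==> s [^]\<^bsub>PR V\<^esub> (e :: nat) \<in> mhomog K V b (repeat_mset e be)"
proof (induction e)
 case (Suc e)
 from homog_mult[OF Suc.IH[OF Suc.prems] Suc.prems] show ?case by (simp add: add.commute)
qed (simp add: homog_one)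

lemma frac_fun_pow: "frac_fun V b N Q ka Ph ==> s \<in> N ==> s [^]\<^bsub>PR V\<^esub> (e :: nat) \<in> N"
 by (induction e) (auto simp: frac_funD)

lemma mono_add_mset: "c \<in> carrier K ==> mono c (add_mset x m) = mono c m \<otimes>[V] mono \<one> {#x#}"
 by (subst mono_mult_mono) auto

text \<open>Replacing each variable j / s of the form \<open>p\<close> by \<open>h j / hs\<close>
  and multiplying out gives one numerator \<open>q\<close> over \<open>hs ^ e\<close>. The identity
  in \<open>Q\<close> and the identity of values are proved together because both refer to the same
  \<open>q\<close>.\<close>

theorem substitution:
 fixes V1 :: "'v set" and V2 :: "'w set" and Ph1 Ph2 :: "_ => _ => 'o"
 assumes F1: "frac_fun V1 b1 N1 Q ka Ph1" and F2: "frac_fun V2 b2 N2 Q ka Ph2"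
  and s: "s \<in> mhomog K V1 b1 be" "s \<in> N1" and J: "J \<subseteq> V1" "!!j. j \<in> J ==> {#b1 j#} = be"
  and h: "!!j. j \<in> J ==> h j \<in> mhomog K V2 b2 dl" and hs: "hs \<in> mhomog K V2 b2 dl" "hs \<in> N2"
  and eq: "!!j. j \<in> J ==> Ph1 (mono \<one> {#j#}) s = Ph2 (h j) hs"
  and p: "p \<in> carrier (PR V1)" "!!m. p m ~= \<zero> ==> set_mset m \<subseteq> J & size m = e"
 shows "\<exists>q. q \<in> mhomog K V2 b2 (repeat_mset e dl) & Ph1 p (s [^]\<^bsub>PR V1\<^esub> e) = Ph2 q (hs [^]\<^bsub>PR V2\<^esub> e) &
  (\<forall>A (ph :: 'a => 'r :: comm_ring_1). partial_hom K A ph & (\<forall>m. p m \<in> A) & (\<forall>j\<in>J. \<forall>m. h j m \<in> A) -->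
  subst_rel K A ph q p h)"
proof -
 interpret Q: cring Q by (rule frac_funD(1)[OF F1])
 have Js: "image_mset b1 m = repeat_mset (size m) be" if "set_mset m \<subseteq> J" for m
  using that by (induction m) (auto simp: J(2)[symmetric])
 note se = homog_pow[OF s(1)] frac_fun_pow[OF F1 s(2)]
 note he = homog_pow[OF hs(1)] frac_fun_pow[OF F2 hs(2)]
 have monoms: "\<exists>q. q \<in> mhomog K V2 b2 (repeat_mset (size m) dl) &
  Ph1 (mono c m) (s [^]\<^bsub>PR V1\<^esub> size m) = Ph2 q (hs [^]\<^bsub>PR V2\<^esub> size m) &
  (\<forall>A (ph :: 'a => 'r). partial_hom K A ph & c \<in> A & (\<forall>j\<in>J. \<forall>m. h j m \<in> A) -->
  subst_rel K A ph q (mono c m) h)"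
  if c: "c \<in> carrier K" and m: "set_mset m \<subseteq> J" for c m
  using m
 proof (induction m)
  case empty
  show ?case
  proof (intro exI[of _ "mono c {#}"] conjI allI impI)
  show "mono c {#} \<in> mhomog K V2 b2 (repeat_mset (size ({#} :: 'v multiset)) dl)" using c by (auto intro: homog_mono)
  show "Ph1 (mono c {#}) (s [^]\<^bsub>PR V1\<^esub> size ({#} :: 'v multiset)) = Ph2 (mono c {#}) (hs [^]\<^bsub>PR V2\<^esub> size ({#} :: 'v multiset))"
  using frac_funD(8)[OF F1 c] frac_funD(8)[OF F2 c] by simp
  fix A and ph :: "'a => 'r" assume *: "partial_hom K A ph & c \<in> A & (\<forall>j\<in>J. \<forall>m. h j m \<in> A)"
  then interpret phom K A ph by unfold_locales auto
  show "mono c {#} m \<in> A" for m :: "'w multiset" using * A0 by (simp add: mono_def)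
  show "peval K ph (mono c {#}) a = peval K ph (mono c {#}) (%j. peval K ph (h j) a)" for a by (simp add: peval_mono)
  qed
 next
  case (add x m)
  then obtain q where q: "q \<in> mhomog K V2 b2 (repeat_mset (size m) dl)"
  "Ph1 (mono c m) (s [^]\<^bsub>PR V1\<^esub> size m) = Ph2 q (hs [^]\<^bsub>PR V2\<^esub> size m)"
  and qe: "!!A (ph :: 'a => 'r). partial_hom K A ph & c \<in> A & (\<forall>j\<in>J. \<forall>m. h j m \<in> A) ==>
  subst_rel K A ph q (mono c m) h"
  by auto
  have x: "x \<in> J" and mJ: "set_mset m \<subseteq> J" using add.prems by auto
  have hx: "h x \<in> mhomog K V2 b2 dl" by (rule h[OF x])
  have cm: "mono c m \<in> mhomog K V1 b1 (repeat_mset (size m) be)"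
  using mJ J(1) by (intro homog_mono c Js) auto
  have vx: "mono \<one> {#x#} \<in> mhomog K V1 b1 be" using x J by (intro homog_mono) auto
  show ?case
  proof (intro exI[of _ "q \<otimes>[V2] h x"] conjI allI impI)
  show "q \<otimes>[V2] h x \<in> mhomog K V2 b2 (repeat_mset (size (add_mset x m)) dl)"
  using homog_mult[OF q(1) hx] by (simp add: add.commute)
  have "Ph1 (mono c (add_mset x m)) (s [^]\<^bsub>PR V1\<^esub> size (add_mset x m)) =
  Ph1 (mono c m \<otimes>[V1] mono \<one> {#x#}) (s [^]\<^bsub>PR V1\<^esub> size m \<otimes>[V1] s)"
  using mono_add_mset[OF c, of x m V1] by simp
  also have "\<dots> = Ph2 q (hs [^]\<^bsub>PR V2\<^esub> size m) \<otimes>\<^bsub>Q\<^esub> Ph2 (h x) hs"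
  using frac_funD(7)[OF F1 cm se(1) se(2) vx s] by (simp add: q(2) eq[OF x])
  also have "\<dots> = Ph2 (q \<otimes>[V2] h x) (hs [^]\<^bsub>PR V2\<^esub> size (add_mset x m))"
  using frac_funD(7)[OF F2 q(1) he(1) he(2) hx hs] by simp
  finally show "Ph1 (mono c (add_mset x m)) (s [^]\<^bsub>PR V1\<^esub> size (add_mset x m)) =
  Ph2 (q \<otimes>[V2] h x) (hs [^]\<^bsub>PR V2\<^esub> size (add_mset x m))" .
  fix A and ph :: "'a => 'r" assume *: "partial_hom K A ph & c \<in> A & (\<forall>j\<in>J. \<forall>m. h j m \<in> A)"
  then interpret phom K A ph by unfold_locales auto
  have PA: "q \<in> PA V2" "h x \<in> PA V2" using qe[OF *] * x homogD[OF q(1)] homogD[OF hx] by (auto simp: PA_def)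
  show "(q \<otimes>[V2] h x) m \<in> A" for m using PA_closed(2)[OF PA] by (rule PA_D)
  show "peval K ph (q \<otimes>[V2] h x) a = peval K ph (mono c (add_mset x m)) (%j. peval K ph (h j) a)" for a
  using qe[OF *] by (simp add: peval_mult[OF PA] peval_mono ac_simps)
  qed
 qed
 define Cond where "Cond = (%A (ph :: 'a => 'r). partial_hom K A ph & (\<forall>m. p m \<in> A) & (\<forall>j\<in>J. \<forall>m. h j m \<in> A))"
 have ph: "f \<in> mhomog K V1 b1 (repeat_mset e be)" if "f \<in> carrier (PR V1)" "!!m. f m ~= \<zero> ==> p m ~= \<zero>" for f
  unfolding homog_iff using that p(2) Js by metis
 have "p \<in> carrier (PR V1) --> (\<exists>q. p \<in> mhomog K V1 b1 (repeat_mset e be) & q \<in> mhomog K V2 b2 (repeat_mset e dl) &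
  Ph1 p (s [^]\<^bsub>PR V1\<^esub> e) = Ph2 q (hs [^]\<^bsub>PR V2\<^esub> e) &
  (\<forall>A ph. Cond A ph --> (\<forall>m. p m \<in> A) & subst_rel K A ph q p h))"
  (is "_ --> ?Q p")
 proof
  assume "p \<in> carrier (PR V1)"
  thus "?Q p"
  proof (induction rule: poly_induct)
  case zero
  show ?case
  proof (intro exI[of _ "\<zero>[V2]"] conjI allI impI homog_zero)
  show "Ph1 \<zero>[V1] (s [^]\<^bsub>PR V1\<^esub> e) = Ph2 \<zero>[V2] (hs [^]\<^bsub>PR V2\<^esub> e)"
  by (simp add: frac_fun_zero[OF F1 se] frac_fun_zero[OF F2 he])
  fix A ph assume "Cond A ph"
  then interpret phom K A ph by unfold_locales (auto simp: Cond_def)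
  show "\<zero>[V1] m \<in> A" "\<zero>[V2] m' \<in> A" for m m' using A0 by (simp_all add: PR_simps(2))
  show "peval K ph \<zero>[V2] a = peval K ph \<zero>[V1] (%j. peval K ph (h j) a)" for a by (simp add: peval_zero)
  qed
  next
  case (add c m g)
  then obtain q where q: "g \<in> mhomog K V1 b1 (repeat_mset e be)" "q \<in> mhomog K V2 b2 (repeat_mset e dl)"
  "Ph1 g (s [^]\<^bsub>PR V1\<^esub> e) = Ph2 q (hs [^]\<^bsub>PR V2\<^esub> e)"
  and qe: "!!A ph. Cond A ph ==> (\<forall>m. g m \<in> A) & subst_rel K A ph q g h"
  by auto
  have m: "set_mset m \<subseteq> J" "size m = e" using p(2)[of m] add.hyps by auto
  obtain r where r: "r \<in> mhomog K V2 b2 (repeat_mset e dl)"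
  "Ph1 (mono c m) (s [^]\<^bsub>PR V1\<^esub> e) = Ph2 r (hs [^]\<^bsub>PR V2\<^esub> e)"
  and re: "!!A (ph :: 'a => 'r). partial_hom K A ph & c \<in> A & (\<forall>j\<in>J. \<forall>m. h j m \<in> A) ==>
  subst_rel K A ph r (mono c m) h"
  using monoms[OF add.hyps(1) m(1)] unfolding m(2) by blast
  have cm: "mono c m \<in> mhomog K V1 b1 (repeat_mset e be)"
  using m J(1) Js by (intro homog_mono add.hyps) auto
  show ?case
  proof (intro exI[of _ "r \<oplus>[V2] q"] conjI allI impI homog_add cm q r)
  show "Ph1 (mono c m \<oplus>[V1] g) (s [^]\<^bsub>PR V1\<^esub> e) = Ph2 (r \<oplus>[V2] q) (hs [^]\<^bsub>PR V2\<^esub> e)"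
  by (simp add: frac_funD(6)[OF F1 cm q(1) se] frac_funD(6)[OF F2 r(1) q(2) he] q(3) r(2))
  fix A ph assume C: "Cond A ph"
  then interpret phom K A ph by unfold_locales (auto simp: Cond_def)
  have cA: "c \<in> A" using C add.hyps by (auto simp: Cond_def)
  have *: "partial_hom K A ph & c \<in> A & (\<forall>j\<in>J. \<forall>m. h j m \<in> A)" using C cA by (auto simp: Cond_def)
  have "mono c m \<in> PA V1" by (rule PA_mono[OF cA]) (use m J(1) in auto)
  moreover have "g \<in> PA V1" "r \<in> PA V2" "q \<in> PA V2"
  using re[OF *] qe[OF C] homogD[OF r(1)] homogD[OF q(2)] homogD[OF q(1)] by (simp_all add: PA_def)
  ultimately have PA: "mono c m \<in> PA V1" "g \<in> PA V1" "r \<in> PA V2" "q \<in> PA V2" by auto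
  show "(mono c m \<oplus>[V1] g) m' \<in> A" for m' using PA_closed(1)[OF PA(1,2)] by (rule PA_D)
  show "(r \<oplus>[V2] q) m' \<in> A" for m' using PA_closed(1)[OF PA(3,4)] by (rule PA_D)
  show "peval K ph (r \<oplus>[V2] q) a = peval K ph (mono c m \<oplus>[V1] g) (%j. peval K ph (h j) a)" for a
  using re[OF *] qe[OF C] by (simp add: peval_add[OF PA(1,2)] peval_add[OF PA(3,4)])
  qed
  qed
 qed
 hence "?Q p" using p(1) by (rule mp)
 then obtain q where q: "q \<in> mhomog K V2 b2 (repeat_mset e dl)" "Ph1 p (s [^]\<^bsub>PR V1\<^esub> e) = Ph2 q (hs [^]\<^bsub>PR V2\<^esub> e)"
  and qe: "\<forall>A ph. Cond A ph --> (\<forall>m. p m \<in> A) & subst_rel K A ph q p h"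
  by - (elim exE conjE, rule that)
 show ?thesis
 proof (intro exI[of _ q] conjI q allI impI)
  fix A and ph :: "'a => 'r" assume "partial_hom K A ph & (\<forall>m. p m \<in> A) & (\<forall>j\<in>J. \<forall>m. h j m \<in> A)"
  hence C: "Cond A ph" unfolding Cond_def .
  show "q m \<in> A" for m using qe[THEN spec, THEN spec, THEN mp, OF C] by simp
  show "peval K ph q a = peval K ph p (%j. peval K ph (h j) a)" for a
  using qe[THEN spec, THEN spec, THEN mp, OF C] by simp
 qed
qed

lemma common_denominator:
 assumes F: "frac_fun V b N Q ka Ph" and "finite J"
  and "!!j. j \<in> J ==> \<exists>e u v. u \<in> mhomog K V b e & v \<in> mhomog K V b e & v \<in> N & y j = Ph u v"
 shows "\<exists>e h hs. hs \<in> mhomog K V b e & hs \<in> N & (\<forall>j\<in>J. h j \<in> mhomog K V b e & y j = Ph (h j) hs)"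
 using assms(2,3)
proof (induction J rule: finite_induct)
 case empty
 show ?case using homog_one frac_funD(2)[OF F] by blast
next
 case (insert k J)
 interpret Q: cring Q by (rule frac_funD(1)[OF F])
 obtain e h hs where h: "hs \<in> mhomog K V b e" "hs \<in> N" "!!j. j \<in> J ==> h j \<in> mhomog K V b e & y j = Ph (h j) hs"
 proof -
  have "\<exists>e h hs. hs \<in> mhomog K V b e & hs \<in> N & (\<forall>j\<in>J. h j \<in> mhomog K V b e & y j = Ph (h j) hs)"
  by (rule insert.IH) (use insert.prems in blast)
  thus ?thesis using that by blast
 qed
 obtain e' u v where u: "u \<in> mhomog K V b e'" "v \<in> mhomog K V b e'" "v \<in> N" "y k = Ph u v" using insert.prems by blast
 define h' where "h' = (%j. if j = k then hs \<otimes>[V] u else h j \<otimes>[V] v)"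
 show ?case
 proof (intro exI[of _ "e + e'"] exI[of _ h'] exI[of _ "hs \<otimes>[V] v"] conjI ballI)
  fix j assume j: "j \<in> insert k J"
  show "h' j \<in> mhomog K V b (e + e')" using j h u insert.hyps by (auto simp: h'_def intro: homog_mult)
  show "y j = Ph (h' j) (hs \<otimes>[V] v)"
  proof (cases "j = k")
  case True
  thus ?thesis using frac_funD(7)[OF F h(1,1,2) u(1,2,3)] frac_funD(5)[OF F h(1,2)] frac_funD(4)[OF F u(1,2,3)] u(4)
  by (simp add: h'_def)
  next
  case False
  hence hj: "h j \<in> mhomog K V b e" "y j = Ph (h j) hs" using j h(3) by auto
  show ?thesis using False frac_funD(7)[OF F hj(1) h(1,2) u(2,2,3)] frac_funD(5)[OF F u(2,3)] frac_funD(4)[OF F hj(1) h(1,2)] hj(2)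
  by (simp add: h'_def)
  qed
 qed (use h u homog_mult frac_funD(3)[OF F] in auto)
qed

end

context mlocal
begin

lemma frac_fun_cls: "frac_fun V b (carrier S - P) OP (%c. cls (mono c {#}) \<one>[V]) cls"
 unfolding frac_fun_def
proof (intro conjI allI impI ballI)
 show "v \<otimes>[V] v' \<in> carrier S - P" if "v \<in> carrier S - P" "v' \<in> carrier S - P" for v v'
  using that by (simp add: P_mult_iff)
 fix e u v assume uv: "u \<in> mhomog K V b e & v \<in> mhomog K V b e & v \<in> carrier S - P"
 hence p: "(u, v) \<in> pairs" "(v, v) \<in> pairs" by (auto intro: pairsI)
 show "cls u v \<in> carrier OP" by (rule cls_carrier[OF p(1)])
 show "cls v v = \<one>\<^bsub>OP\<^esub>" by (rule cls_self[OF p(2)])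
 show "cls (u \<oplus>[V] u') v = cls u v \<oplus>\<^bsub>OP\<^esub> cls u' v" if "u' \<in> mhomog K V b e" for u'
  by (rule cls_add_same) (use uv that in auto)
 show "cls (u \<otimes>[V] u') (v \<otimes>[V] v') = cls u v \<otimes>\<^bsub>OP\<^esub> cls u' v'"
  if "u' \<in> mhomog K V b e' & v' \<in> mhomog K V b e' & v' \<in> carrier S - P" for e' u' v'
  by (rule cls_ops(1)[OF p(1), symmetric]) (use that in "auto intro: pairsI")
qed (use P_one OP_cring in auto)

lemma common_multiplier:
 assumes "finite Z" "!!z. z \<in> Z ==> z \<in> carrier S & (\<exists>h. h \<in> carrier S & h \<notin> P & h \<otimes>[V] z \<in> I)"
 shows "\<exists>h. h \<in> carrier S & h \<notin> P & (\<forall>z\<in>Z. h \<otimes>[V] z \<in> I)"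
 using assms
proof (induction Z rule: finite_induct)
 case (insert z Z)
 have "\<exists>h. h \<in> carrier S & h \<notin> P & (\<forall>z\<in>Z. h \<otimes>[V] z \<in> I)" by (rule insert.IH) (use insert.prems in blast)
 then obtain h where h: "h \<in> carrier S" "h \<notin> P" "\<forall>z\<in>Z. h \<otimes>[V] z \<in> I" by blast
 obtain k where k: "k \<in> carrier S" "k \<notin> P" "k \<otimes>[V] z \<in> I" using insert.prems by blast
 have "h \<otimes>[V] k \<otimes>[V] y \<in> I" if y: "y \<in> insert z Z" for y
 proof -
  have yc: "y \<in> carrier S" using insert.prems y by blast
  show ?thesis
  proof (cases "y = z")
  case True
  thus ?thesis using I_mult[OF k(3) h(1)] h(1) k(1) yc by (simp add: PR.m_assoc)
  next
  case False
  have "k \<otimes>[V] (h \<otimes>[V] y) \<in> I" using I_mult[OF _ k(1)] h(3) y False by simp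
  thus ?thesis using h(1) k(1) yc by (simp add: PR.m_ac)
  qed
 qed
 thus ?case using h k by (intro exI[of _ "h \<otimes>[V] k"]) (simp add: P_mult_iff)
qed (use P_one in blast)

end

section \<open>Hypersurfaces\<close>

lemma inj_on_image_Inl: "inj_on (image_mset (Inl :: 'v => 'v + 'w)) A"
proof (rule inj_onI)
 fix x y :: "'v multiset" assume "image_mset (Inl :: 'v => 'v + 'w) x = image_mset Inl y"
 hence "image_mset projl (image_mset (Inl :: 'v => 'v + 'w) x) = image_mset projl (image_mset (Inl :: 'v => 'v + 'w) y)" by simp
 thus "x = y" by (simp add: multiset.map_comp comp_def)
qed

context mpoly
begin

lemma mp_Inl_image: "mp_Inl K p (image_mset Inl m) = p m"
 by (simp add: mp_Inl_def multiset.map_comp comp_def)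

lemma mp_Inl_nonzero:
 assumes "mp_Inl K p m ~= \<zero>"
 obtains m' where "m = image_mset Inl m'" "p m' ~= \<zero>"
proof -
 have "\<forall>x\<in>#m. isl x" and p: "p (image_mset projl m) ~= \<zero>" using assms by (auto simp: mp_Inl_def split: if_splits)
 hence "image_mset (%x. Inl (projl x)) m = image_mset (%x. x) m" by (intro image_mset_cong) auto
 hence "m = image_mset Inl (image_mset projl m)" by (simp add: multiset.map_comp comp_def)
 thus ?thesis using that p by blast
qed

lemma mp_Inl_closed:
 fixes V :: "'v set" and W :: "'w set"
 assumes p: "p \<in> carrier (PR V)"
 shows "mp_Inl K p \<in> carrier (PR (Sum_Type.Plus V W))"
 unfolding carrier_iff
proof (intro conjI allI impI)
 show "mp_Inl K p m \<in> carrier K" for m using carrierD(1)[OF p] by (simp add: mp_Inl_def)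
 have "{m. mp_Inl K p m ~= \<zero>} \<subseteq> image_mset Inl ` {m. p m ~= \<zero>}" by (auto elim!: mp_Inl_nonzero)
 thus "finite {m. mp_Inl K p m ~= \<zero>}" by (rule finite_subset) (intro finite_imageI carrierD(2)[OF p])
 fix m :: "('v + 'w) multiset" assume "mp_Inl K p m ~= \<zero>"
 then obtain m' where "m = image_mset Inl m'" "p m' ~= \<zero>" by (rule mp_Inl_nonzero)
 thus "set_mset m \<subseteq> Sum_Type.Plus V W" using carrierD(3)[OF p] by auto
qed

lemma mp_Inl_mult:
 fixes V :: "'v set" and W :: "'w set"
 assumes p: "p \<in> carrier (PR V)" and q: "q \<in> carrier (PR V)"
 shows "mp_Inl K (p \<otimes>[V] q) = mp_Inl K p \<otimes>[(Sum_Type.Plus V W)] mp_Inl K q"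
proof
 fix m :: "('v + 'w) multiset"
 show "mp_Inl K (p \<otimes>[V] q) m = (mp_Inl K p \<otimes>[(Sum_Type.Plus V W)] mp_Inl K q) m"
 proof (cases "\<forall>x\<in>#m. isl x")
  case True
  define m' where "m' = image_mset projl m"
  have "image_mset (%x. Inl (projl x)) m = image_mset (%x. x) m" using True by (intro image_mset_cong) auto
  hence m: "m = image_mset Inl m'" by (simp add: m'_def multiset.map_comp comp_def)
  have sub: "{a. a \<subseteq># m} = image_mset Inl ` {a. a \<subseteq># m'}"
  proof (intro equalityI subsetI)
  fix a assume "a \<in> {a. a \<subseteq># m}"
  hence a: "a \<subseteq># m" by simp
  have "image_mset (%x. Inl (projl x)) a = image_mset (%x. x) a"
  using True a by (intro image_mset_cong) (metis mset_subset_eqD sum.collapse(1))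
  hence "a = image_mset Inl (image_mset projl a)" by (simp add: multiset.map_comp comp_def)
  moreover have "image_mset projl a \<subseteq># m'" unfolding m'_def by (rule image_mset_subseteq_mono[OF a])
  ultimately show "a \<in> image_mset Inl ` {a. a \<subseteq># m'}" by blast
  qed (auto simp: m intro: image_mset_subseteq_mono)
  have "(mp_Inl K p \<otimes>[(Sum_Type.Plus V W)] mp_Inl K q) m =
  (\<Oplus>a\<in>image_mset Inl ` {a. a \<subseteq># m'}. mp_Inl K p a \<otimes> mp_Inl K q (m - a))" by (simp add: PR_simps sub)
  also have "\<dots> = (\<Oplus>a\<in>{a. a \<subseteq># m'}. mp_Inl K p (image_mset Inl a :: ('v + 'w) multiset) \<otimes> mp_Inl K q (m - image_mset Inl a))"
  by (rule finsum_reindex[OF _ inj_on_image_Inl]) (use carrierD(1)[OF p] carrierD(1)[OF q] in "auto simp: mp_Inl_def")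
  also have "\<dots> = (\<Oplus>a\<in>{a. a \<subseteq># m'}. p a \<otimes> q (m' - a))"
  proof (rule finsum_cong')
  fix a assume "a \<in> {a. a \<subseteq># m'}"
  hence "m - image_mset Inl a = image_mset Inl (m' - a)" by (simp add: m image_mset_Diff)
  thus "mp_Inl K p (image_mset Inl a :: ('v + 'w) multiset) \<otimes> mp_Inl K q (m - image_mset Inl a) = p a \<otimes> q (m' - a)" by (simp add: mp_Inl_image)
  qed (use carrierD(1)[OF p] carrierD(1)[OF q] in auto)
  finally show ?thesis unfolding m mp_Inl_image by (simp add: PR_simps)
 next
  case False
  have "mp_Inl K p a \<otimes> mp_Inl K q (m - a) = \<zero>" if a: "a \<subseteq># m" for a
  proof (rule ccontr)
  assume "mp_Inl K p a \<otimes> mp_Inl K q (m - a) ~= \<zero>"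
  moreover have "mp_Inl K p a \<in> carrier K" "mp_Inl K q (m - a) \<in> carrier K"
  using carrierD(1)[OF p] carrierD(1)[OF q] by (auto simp: mp_Inl_def)
  ultimately have "mp_Inl K p a ~= \<zero>" "mp_Inl K q (m - a) ~= \<zero>" by auto
  hence "\<forall>x\<in>#a. isl x" "\<forall>x\<in>#(m - a). isl x" by (auto simp: mp_Inl_def split: if_splits)
  moreover have "m = a + (m - a)" using a by simp
  ultimately show False using False by (metis union_iff)
  qed
  hence "(mp_Inl K p \<otimes>[(Sum_Type.Plus V W)] mp_Inl K q) m = \<zero>"
  unfolding PR_simps by (intro add.finprod_one_eqI) auto
  moreover have "mp_Inl K (p \<otimes>[V] q) m = \<zero>" using False by (auto simp: mp_Inl_def)
  ultimately show ?thesis by simp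
 qed
qed

lemma mp_Inl_homog:
 fixes V :: "'v set" and W :: "'w set"
 assumes "p \<in> carrier (PR V)" "!!m. p m ~= \<zero> ==> size m = d"
 shows "mp_Inl K p \<in> mhomog K (Sum_Type.Plus V W) isl (replicate_mset d True)"
 unfolding homog_iff
proof (intro conjI allI impI mp_Inl_closed[OF assms(1)])
 fix m :: "('v + 'w) multiset" assume "mp_Inl K p m ~= \<zero>"
 then obtain m' where "m = image_mset Inl m'" "p m' ~= \<zero>" by (rule mp_Inl_nonzero)
 thus "image_mset isl m = replicate_mset d True" using assms(2)[of m'] by (simp add: multiset.map_comp comp_def image_mset_const_eq)
qed

lemma principal_ideal:
 fixes V :: "'v set" and W :: "'w set"
 assumes F: "F \<in> carrier (PR V)" and G: "!!f. f \<in> G ==> \<exists>t\<in>carrier (PR V). f = t \<otimes>[V] F"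
  and z: "z \<in> Idl\<^bsub>PR (Sum_Type.Plus V W)\<^esub> (mp_Inl K ` (Idl\<^bsub>PR V\<^esub> G))"
 shows "\<exists>t\<in>carrier (PR (Sum_Type.Plus V W)). z = t \<otimes>[(Sum_Type.Plus V W)] mp_Inl K F"
proof -
 let ?U = "Sum_Type.Plus V W"
 note FI = mp_Inl_closed[OF F, of W]
 have 1: "Idl\<^bsub>PR V\<^esub> G \<subseteq> PIdl\<^bsub>PR V\<^esub> F"
  by (rule PR.genideal_minimal[OF PR.cgenideal_ideal[OF F]]) (use G in "auto simp: cgenideal_def")
 have "(mp_Inl K ` (Idl\<^bsub>PR V\<^esub> G) :: (('v + 'w) multiset => 'a) set) \<subseteq> PIdl\<^bsub>PR ?U\<^esub> (mp_Inl K F)"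
 proof
  fix y :: "('v + 'w) multiset => 'a" assume "y \<in> mp_Inl K ` (Idl\<^bsub>PR V\<^esub> G)"
  then obtain t where "t \<in> carrier (PR V)" "y = mp_Inl K (t \<otimes>[V] F)" using 1 by (auto simp: cgenideal_def)
  thus "y \<in> PIdl\<^bsub>PR ?U\<^esub> (mp_Inl K F)"
  using mp_Inl_mult[OF _ F, of t W] mp_Inl_closed[of t V W] by (auto simp: cgenideal_def)
 qed
 from PR.genideal_minimal[OF PR.cgenideal_ideal[OF FI] this] z show ?thesis by (auto simp: cgenideal_def)
qed

end

lemma (in phom) peval_mp_Inl:
 assumes "p \<in> carrier (PR V)"
 shows "peval K h (mp_Inl K p) a = peval K h p (%i. a (Inl i))"
proof -
 have "{m. mp_Inl K p m ~= \<zero>} \<subseteq> image_mset Inl ` {m. p m ~= \<zero>}" by (auto elim!: mp_Inl_nonzero)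
 hence "peval K h (mp_Inl K p) a = (\<Sum>m\<in>image_mset Inl ` {m. p m ~= \<zero>}. h (mp_Inl K p m) * (\<Prod>x\<in>#m. a x))"
  by (intro peval_superset finite_imageI carrierD(2)[OF assms])
 also have "\<dots> = (\<Sum>m\<in>{m. p m ~= \<zero>}. h (p m) * (\<Prod>x\<in>#m. a (Inl x)))"
  by (subst sum.reindex[OF inj_on_image_Inl]) (simp add: mp_Inl_image multiset.map_comp comp_def)
 finally show ?thesis by (simp add: peval_def mev_def)
qed

context mpoly_field
begin

text \<open>Division with remainder in the variable \<open>w\<close>: by \<open>Fm\<close> the only
  monomial of top degree in \<open>w\<close> is the pure power, and its coefficient is
  invertible.\<close>

lemma reduce_mod:
 assumes F: "F \<in> carrier (PR U)" "F (replicate_mset d w) ~= \<zero>"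
  and Fm: "!!m. F m ~= \<zero> ==> count m w \<le> d & (count m w = d --> m = replicate_mset d w)"
  and G: "G \<in> carrier (PR U)"
 shows "\<exists>R t. R \<in> carrier (PR U) & t \<in> carrier (PR U) & G = R \<oplus>[U] F \<otimes>[U] t & (\<forall>m. R m ~= \<zero> --> count m w < d)"
proof -
 let ?D = "replicate_mset d w"
 have FD: "F ?D \<in> carrier K" "F ?D ~= \<zero>" using carrierD(1)[OF F(1)] F(2) by auto
 note iF = inv_closed_mult[OF FD]
 have "\<exists>R t. R \<in> carrier (PR U) & t \<in> carrier (PR U) & G = R \<oplus>[U] F \<otimes>[U] t & (\<forall>m. R m ~= \<zero> --> count m w < d)"
  if "G \<in> carrier (PR U)" "!!m. G m ~= \<zero> ==> count m w < k" for G k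
  using that
 proof (induction k arbitrary: G)
  case (Suc k)
  show ?case
  proof (cases "Suc k \<le> d")
  case True
  have "G = G \<oplus>[U] F \<otimes>[U] \<zero>[U]" using Suc.prems(1) F(1) by simp
  thus ?thesis using Suc.prems True by (intro exI[of _ G] exI[of _ "\<zero>[U]"]) (auto intro: less_le_trans)
  next
  case False
  note Gc = carrierD[OF Suc.prems(1)]
  define t where "t = (%m. if count m w + d = k then m_inv K (F ?D) \<otimes> G (m + ?D) else \<zero>)"
  have tn: "count m w + d = k & G (m + ?D) ~= \<zero>" if "t m ~= \<zero>" for m
  using that iF(1) by (auto simp: t_def split: if_splits)
  have t: "t \<in> carrier (PR U)"
  unfolding carrier_iff
  proof (intro conjI allI impI)
  show "t m \<in> carrier K" for m using iF(1) Gc(1) by (simp add: t_def)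
  have "{m. t m ~= \<zero>} \<subseteq> (%m. m - ?D) ` {m. G m ~= \<zero>}"
  proof
  fix m assume "m \<in> {m. t m ~= \<zero>}"
  thus "m \<in> (%m. m - ?D) ` {m. G m ~= \<zero>}" using tn by (intro image_eqI[of _ _ "m + ?D"]) auto
  qed
  thus "finite {m. t m ~= \<zero>}" by (rule finite_subset) (intro finite_imageI Gc(2))
  show "set_mset m \<subseteq> U" if "t m ~= \<zero>" for m using Gc(3)[of "m + ?D"] tn[OF that] by auto
  qed
  have Ft: "F \<otimes>[U] t \<in> carrier (PR U)" using F(1) t by simp
  define G' where "G' = G \<ominus>[U] F \<otimes>[U] t"
  have G': "G' \<in> carrier (PR U)" unfolding G'_def using Suc.prems(1) Ft by simp
  have G'm: "count m w < k" if "G' m ~= \<zero>" for m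
  proof (rule ccontr)
  assume ge: "~ count m w < k"
  have term0: "a = ?D & count m w = k" if "a \<subseteq># m" "F a \<otimes> t (m - a) ~= \<zero>" for a
  proof -
  have "F a ~= \<zero>" "t (m - a) ~= \<zero>" using that(2) carrierD(1)[OF F(1)] carrierD(1)[OF t] by auto
  hence "count a w \<le> d" "count a w = d --> a = ?D" "count (m - a) w + d = k"
  using Fm[of a] tn[of "m - a"] by blast+
  moreover have "count a w \<le> count m w" using that(1) by (simp add: mset_subset_eq_count)
  ultimately show ?thesis using ge by (auto simp: not_less)
  qed
  have "(F \<otimes>[U] t) m = G m"
  proof (cases "count m w = k")
  case True
  have sub: "?D \<subseteq># m" using True False by (simp add: count_le_replicate_mset_subset_eq[symmetric])
  have "(\<Oplus>a\<in>{a. a \<subseteq># m}. F a \<otimes> t (m - a)) = F ?D \<otimes> t (m - ?D)"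
  proof (rule finsum_single)
  show "F a \<otimes> t (m - a) = \<zero>" if "a \<in> {a. a \<subseteq># m}" "a ~= ?D" for a
  using term0[of a] that by auto
  show "F ?D \<otimes> t (m - ?D) \<in> carrier K" using carrierD(1)[OF F(1)] carrierD(1)[OF t] by (intro m_closed)
  qed (use sub finite_submultisets in auto)
  also have "t (m - ?D) = m_inv K (F ?D) \<otimes> G m" using True False sub by (simp add: t_def)
  also have "F ?D \<otimes> \<dots> = G m" using iF FD Gc(1) by (simp add: m_assoc[symmetric])
  finally show ?thesis by (simp add: PR_simps)
  next
  case ne: False
  have "(\<Oplus>a\<in>{a. a \<subseteq># m}. F a \<otimes> t (m - a)) = \<zero>"
  proof (rule add.finprod_one_eqI)
  fix a assume "a \<in> {a. a \<subseteq># m}"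
  thus "F a \<otimes> t (m - a) = \<zero>" using term0[of a] ne by auto
  qed
  moreover have "G m = \<zero>" using Suc.prems(2)[of m] ge ne by auto
  ultimately show ?thesis by (simp add: PR_simps)
  qed
  hence "G' m = \<zero>" unfolding G'_def minus_coeff[OF Suc.prems(1) Ft] using Gc(1) by (simp add: r_right_minus_eq)
  thus False using that by simp
  qed
  from Suc.IH[OF G' G'm] obtain R t' where R: "R \<in> carrier (PR U)" "t' \<in> carrier (PR U)" "G' = R \<oplus>[U] F \<otimes>[U] t'"
  "\<forall>m. R m ~= \<zero> --> count m w < d" by blast
  have "G = G' \<oplus>[U] F \<otimes>[U] t" using Suc.prems(1) Ft by (simp add: G'_def PR.minus_eq PR.a_assoc PR.l_neg)
  also have "\<dots> = R \<oplus>[U] F \<otimes>[U] (t' \<oplus>[U] t)" unfolding R(3) using R(1,2) F(1) t by (simp add: PR.r_distr PR.a_assoc)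
  finally show ?thesis using R t by (intro exI[of _ R] exI[of _ "t' \<oplus>[U] t"]) auto
  qed
 next
  case 0
  have "G = G \<oplus>[U] F \<otimes>[U] \<zero>[U]" using 0 F(1) by simp
  thus ?case using 0 by (intro exI[of _ G] exI[of _ "\<zero>[U]"]) auto
 qed
 moreover have "count m w < Suc (Max ((%m. count m w) ` {m. G m ~= \<zero>}))" if "G m ~= \<zero>" for m
  using that carrierD(2)[OF G] by (intro le_imp_less_Suc Max_ge) auto
 ultimately show ?thesis using G by blast
qed

end

section \<open>Stably rational hypersurfaces\<close>

lemma repeat_mset_single: "repeat_mset k {#x#} = replicate_mset k x"
 by (rule multiset_eqI) simp

lemma unit_multiset: "e = replicate_mset (size e) ()"
proof -
 have "(%_. ()) = (id :: unit => unit)" by auto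
 thus ?thesis using image_mset_const_eq[of "()" e] by simp
qed

context mpoly_field
begin

text \<open>Expressing the ratios of hypersurface coordinates by fractions on the projective space
  gives \<open>g\<close>; expressing its coordinates at \<open>P\<close> gives \<open>f\<close>. The
  two translations are inverse, so g(f) is proportional to the coordinates up to a multiplier
  \<open>H\<close> outside \<open>P\<close>. The evaluation rings \<open>'r1\<close> and
  \<open>'r2\<close> are fixed in advance because the witnesses precede the quantification over
  points.\<close>

theorem birational_data:
 fixes G :: "(nat multiset => 'a) set"
 assumes F0: "F0 \<in> carrier (PR {..M})" "!!m. F0 m ~= \<zero> ==> size m = d" "F0 \<in> G"
  and G: "!!f. f \<in> G ==> \<exists>t\<in>carrier (PR {..M}). f = t \<otimes>[{..M}] F0"
  and rat: "stably_rational K {..M} (Idl\<^bsub>PR {..M}\<^esub> G)"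
 shows "\<exists>(r :: nat) (n :: nat) e g f q H P i0. let U = Sum_Type.Plus {..M} {..r}; I = Idl\<^bsub>PR U\<^esub> (mp_Inl K ` (Idl\<^bsub>PR {..M}\<^esub> G)) in
  primeideal P (PR U) & I \<subseteq> P & mp_Inl K F0 \<in> I & i0 \<le> M & H \<in> carrier (PR U) & H \<notin> P & q i0 \<notin> P &
  (\<forall>i\<le>M. q i \<in> carrier (PR U) & g i \<in> carrier (PR {..n}) & (\<forall>m. g i m ~= \<zero> --> size m = e)) &
  (\<forall>j\<le>n. f j \<in> carrier (PR U)) &
  (\<forall>i\<le>M. \<forall>j\<le>M. H \<otimes>[U] (q i \<otimes>[U] mono \<one> {#Inl j#} \<ominus>[U] q j \<otimes>[U] mono \<one> {#Inl i#}) \<in> I) &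
  (\<forall>A (ph :: 'a => 'r1 :: comm_ring_1). partial_hom K A ph & (\<forall>m. F0 m \<in> A) & (\<forall>i\<le>M. \<forall>m. g i m \<in> A) -->
  (\<forall>a. peval K ph F0 (%i. peval K ph (g i) a) = 0)) &
  (\<forall>i\<le>M. \<forall>A (ph :: 'a => 'r2 :: comm_ring_1). partial_hom K A ph & (\<forall>m. g i m \<in> A) & (\<forall>j\<le>n. \<forall>m. f j m \<in> A) -->
  subst_rel K A ph (q i) (g i) f)"
proof -
 obtain r n :: nat where bir: "birational_over K (proj_scheme_times K {..M} (Idl\<^bsub>PR {..M}\<^esub> G) {..r}) (proj_space K {..n})"
  using rat unfolding stably_rational_def by blast
 define U where "U = Sum_Type.Plus {..M} {..r}"
 define I where "I = Idl\<^bsub>PR U\<^esub> (mp_Inl K ` (Idl\<^bsub>PR {..M}\<^esub> G))"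
 have Gc: "G \<subseteq> carrier (PR {..M})" using G F0(1) by auto
 have IG: "ideal (Idl\<^bsub>PR {..M}\<^esub> G) (PR {..M})" by (rule PR.genideal_ideal[OF Gc])
 have Ic: "mp_Inl K ` (Idl\<^bsub>PR {..M}\<^esub> G) \<subseteq> carrier (PR U)"
  using additive_subgroup.a_subset[OF ideal.axioms(1)[OF IG]] mp_Inl_closed unfolding U_def by blast
 have I: "ideal I (PR U)" unfolding I_def by (rule PR.genideal_ideal[OF Ic])
 have FI: "mp_Inl K F0 \<in> I" unfolding I_def
  using PR.genideal_self[OF Ic] PR.genideal_self[OF Gc] F0(3) by blast
 define N2 where "N2 = carrier (PR {..n}) - {\<zero>[{..n}]}"
 obtain P Ps where P: "P \<in> mproj_points K U isl I"
  and F2': "frac_fun {..n} (%_. ()) N2 (mproj_local_ring K U isl I P) (%c. mfrac K U isl I P (mono c {#}) \<one>[U]) Ps"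
  and surj: "!!f g. (f, g) \<in> mfrac_pairs K U isl P ==>
  \<exists>e u v. u \<in> hg {..n} e & v \<in> hg {..n} e & v \<in> N2 & mfrac K U isl I P f g = Ps u v"
  unfolding N2_def by (rule birational_frac_fun[OF _ _ I, of isl "{..n}"]) (use bir in "auto simp: proj_scheme_times_def U_def I_def")
 interpret L: mlocal K U isl I P by (rule mlocal_point[OF I P])
 define vr where "vr = (%i. mono \<one> {#Inl i :: nat + nat#})"
 have Xh: "vr i \<in> mhomog K U isl {#True#}" if "i \<le> M" for i
  unfolding vr_def by (rule homog_mono) (use that in "auto simp: U_def")
 note Xc = homogD[OF Xh]
 obtain i0 where i0: "i0 \<le> M" "vr i0 \<notin> P"
 proof -
  have "Inl 0 \<in> U" by (auto simp: U_def)
  hence "True \<in> isl ` U" by (intro image_eqI[of _ _ "Inl 0"]) auto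
  then obtain v where v: "v \<in> U" "isl v" "mp_var K v \<notin> P" using P unfolding mproj_points_def by blast
  then obtain i where "v = Inl i" "i \<le> M" unfolding U_def by auto
  thus ?thesis using that v(3) by (simp add: mp_var_mono vr_def)
 qed
 define N1 where "N1 = carrier (PR U) - P"
 define ka where "ka = (%c. L.cls (mono c {#}) \<one>[U])"
 have F1: "frac_fun U isl N1 L.OP ka L.cls" using L.frac_fun_cls by (simp add: N1_def ka_def)
 have F2: "frac_fun {..n} (%_. ()) N2 L.OP ka Ps"
  using F2' by (simp add: ka_def)
 have Xi0: "vr i0 \<in> N1" using i0 Xc by (simp add: N1_def)
 define x where "x = (%i. L.cls (vr i) (vr i0))"
 have xp: "(vr i, vr i0) \<in> L.pairs" if "i \<le> M" for i by (rule L.pairsI[OF Xh[OF that] Xh[OF i0(1)] i0(2)])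
 have ex: "\<exists>e u v. u \<in> hg {..n} e & v \<in> hg {..n} e & v \<in> N2 & x i = Ps u v" if "i \<in> {..M}" for i
  unfolding x_def by (rule surj[OF xp]) (use that in simp)
 have "\<exists>e h hs. hs \<in> hg {..n} e & hs \<in> N2 & (\<forall>j\<in>{..M}. h j \<in> hg {..n} e & x j = Ps (h j) hs)"
  by (rule common_denominator[OF F2 finite_atMost ex])
 then obtain e1 g gs where
  gs: "gs \<in> hg {..n} e1" "gs \<in> N2" and gx: "\<forall>j\<in>{..M}. g j \<in> hg {..n} e1 & x j = Ps (g j) gs"
  by - (elim exE conjE, rule that)
 have g: "g i \<in> hg {..n} e1" "x i = Ps (g i) gs" if "i \<le> M" for i
  using gx that by auto
 define e where "e = size e1"
 have e1: "e1 = replicate_mset e ()" unfolding e_def by (rule unit_multiset)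
 have gm: "size m = e" "set_mset m \<subseteq> {..n}" if "i \<le> M" "g i m ~= \<zero>" for i m
  using g(1)[OF that(1)] that(2) carrierD(3)[OF homogD[OF g(1)[OF that(1)]] that(2)] unfolding homog_iff e_def by auto
 have xI: "x i0 = \<one>\<^bsub>L.OP\<^esub>" unfolding x_def by (rule L.cls_self[OF xp[OF i0(1)]])
 have F0I: "mp_Inl K F0 \<in> mhomog K U isl (replicate_mset d True)"
  unfolding U_def by (rule mp_Inl_homog[OF F0(1,2)])
 have one: "\<one>\<^bsub>L.OP\<^esub> ~= \<zero>\<^bsub>L.OP\<^esub>"
 proof
  assume "\<one>\<^bsub>L.OP\<^esub> = \<zero>\<^bsub>L.OP\<^esub>"
  then obtain h where "h \<in> carrier (PR U)" "h \<notin> P" "h \<otimes>[U] \<one>[U] \<in> I"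
  unfolding L.OP_simps(2) using L.cls_eq_zero_iff[OF L.pairs_one] by blast
  thus False using L.I_P by auto
 qed
 \<comment> \<open>Every nonzero form may serve as a denominator, so \<open>Ps\<close> sends nonzero
   fractions to units; a fraction that becomes zero therefore has zero numerator.\<close>
 have invPs: "Ps u v \<otimes>\<^bsub>L.OP\<^esub> Ps v u = \<one>\<^bsub>L.OP\<^esub>" if "u \<in> hg {..n} c" "v \<in> hg {..n} c" "u \<in> N2" "v \<in> N2" for u v c
  using frac_funD(7)[OF F2 that(1,2,4,2,1,3)] frac_funD(5)[OF F2 homog_mult[OF that(1,2)] frac_funD(3)[OF F2 that(3,4)]]
  homogD[OF that(1)] homogD[OF that(2)] by (simp add: PR.m_comm)
 have A: "\<forall>A (ph :: 'a => 'r1). partial_hom K A ph & (\<forall>m. F0 m \<in> A) & (\<forall>i\<le>M. \<forall>m. g i m \<in> A) -->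
  (\<forall>a. peval K ph F0 (%i. peval K ph (g i) a) = 0)"
 proof -
  have "\<exists>q. q \<in> hg {..n} (repeat_mset d e1) & L.cls (mp_Inl K F0) (vr i0 [^]\<^bsub>PR U\<^esub> d) = Ps q (gs [^]\<^bsub>PR {..n}\<^esub> d) &
  (\<forall>A (ph :: 'a => 'r1). partial_hom K A ph & (\<forall>m :: (nat + nat) multiset. mp_Inl K F0 m \<in> A) & (\<forall>j\<in>(Inl ` {..M} :: (nat + nat) set). \<forall>m. g (projl j) m \<in> A) -->
  subst_rel K A ph q (mp_Inl K F0) (%j :: nat + nat. (g (projl j))))"
  proof (rule substitution[OF F1 F2 Xh[OF i0(1)] Xi0])
  show "set_mset m \<subseteq> Inl ` {..M} & size m = d" if nz: "mp_Inl K F0 m ~= \<zero>" for m :: "(nat + nat) multiset"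
  proof -
  from nz obtain m' where "m = image_mset Inl m'" "F0 m' ~= \<zero>" by (rule mp_Inl_nonzero)
  thus ?thesis using F0(2) carrierD(3)[OF F0(1)] by auto
  qed
  show "mp_Inl K F0 \<in> carrier (PR U)" by (rule homogD[OF F0I])
  qed (use gs g in "auto simp: U_def x_def vr_def")
  then obtain q where q: "q \<in> hg {..n} (repeat_mset d e1)" "L.cls (mp_Inl K F0) (vr i0 [^]\<^bsub>PR U\<^esub> d) = Ps q (gs [^]\<^bsub>PR {..n}\<^esub> d)"
  and qe: "!!A (ph :: 'a => 'r1). partial_hom K A ph & (\<forall>m :: (nat + nat) multiset. mp_Inl K F0 m \<in> A) & (\<forall>j\<in>(Inl ` {..M} :: (nat + nat) set). \<forall>m. g (projl j) m \<in> A) ==>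
  subst_rel K A ph q (mp_Inl K F0) (%j :: nat + nat. (g (projl j)))"
  by - (elim exE conjE, rule that, auto)
  have pr: "(mp_Inl K F0, vr i0 [^]\<^bsub>PR U\<^esub> d) \<in> L.pairs"
  using homog_pow[OF Xh[OF i0(1)], of d] F0I frac_fun_pow[OF F1 Xi0, of d]
  by (intro L.pairsI[of _ "replicate_mset d True"]) (auto simp: repeat_mset_single N1_def)
  have "L.cls (mp_Inl K F0) (vr i0 [^]\<^bsub>PR U\<^esub> d) = \<zero>\<^bsub>L.OP\<^esub>"
  unfolding L.cls_eq_zero_iff[OF pr] using L.P_one FI homogD[OF F0I] by (intro exI[of _ "\<one>[U]"]) simp
  hence z: "Ps q (gs [^]\<^bsub>PR {..n}\<^esub> d) = \<zero>\<^bsub>L.OP\<^esub>" using q(2) by simp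
  have q0: "q = \<zero>[{..n}]"
  proof (rule ccontr)
  assume "q ~= \<zero>[{..n}]"
  hence qN: "q \<in> N2" using homogD[OF q(1)] by (simp add: N2_def)
  from invPs[OF q(1) homog_pow[OF gs(1)] qN frac_fun_pow[OF F2 gs(2)]] z
  have "\<zero>\<^bsub>L.OP\<^esub> \<otimes>\<^bsub>L.OP\<^esub> Ps (gs [^]\<^bsub>PR {..n}\<^esub> d) q = \<one>\<^bsub>L.OP\<^esub>" by simp
  thus False using one frac_funD(4)[OF F2 homog_pow[OF gs(1)] q(1) qN] by simp
  qed
  show ?thesis
  proof (intro allI impI)
  fix A and ph :: "'a => 'r1" and a
  assume *: "partial_hom K A ph & (\<forall>m. F0 m \<in> A) & (\<forall>i\<le>M. \<forall>m. g i m \<in> A)"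
  then interpret phom K A ph by unfold_locales auto
  have "partial_hom K A ph & (\<forall>m :: (nat + nat) multiset. mp_Inl K F0 m \<in> A) & (\<forall>j\<in>(Inl ` {..M} :: (nat + nat) set). \<forall>m. g (projl j) m \<in> A)"
  using * A0 by (auto simp: mp_Inl_def)
  from qe[OF this] have "peval K ph (mp_Inl K F0) (%j :: nat + nat. peval K ph (g (projl j)) a) = 0"
  unfolding q0 by (simp add: peval_zero)
  thus "peval K ph F0 (%i. peval K ph (g i) a) = 0" by (simp add: peval_mp_Inl[OF F0(1)])
  qed
 qed
 define T0 :: "nat multiset => 'a" where "T0 = mono \<one> {#0#}"
 have T0: "T0 \<in> hg {..n} {#()#}" unfolding T0_def by (rule homog_mono) auto
 have T0N: "T0 \<in> N2" using homogD[OF T0] by (auto simp: N2_def T0_def PR_simps(2) mono_def fun_eq_iff)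
 have Tj: "mono \<one> {#j#} \<in> hg {..n} {#()#}" if "j \<le> n" for j by (rule homog_mono) (use that in auto)
 have ex': "\<exists>e u v. u \<in> mhomog K U isl e & v \<in> mhomog K U isl e & v \<in> N1 & Ps (mono \<one> {#j#}) T0 = L.cls u v" if "j \<in> {..n}" for j
 proof -
  have "Ps (mono \<one> {#j#}) T0 \<in> carrier L.OP" using frac_funD(4)[OF F2 Tj T0 T0N] that by simp
  then obtain u v where "Ps (mono \<one> {#j#}) T0 = L.cls u v" "(u, v) \<in> L.pairs" unfolding L.OP_simps by blast
  thus ?thesis using L.pairsD(2) by (elim L.pairsE) (auto simp: N1_def homog_iff)
 qed
 have "\<exists>e h hs. hs \<in> mhomog K U isl e & hs \<in> N1 & (\<forall>j\<in>{..n}. h j \<in> mhomog K U isl e & Ps (mono \<one> {#j#}) T0 = L.cls (h j) hs)"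
  by (rule common_denominator[OF F1 finite_atMost ex'])
 then obtain dl f fs where
  fs: "fs \<in> mhomog K U isl dl" "fs \<in> N1" and fx: "\<forall>j\<in>{..n}. f j \<in> mhomog K U isl dl & Ps (mono \<one> {#j#}) T0 = L.cls (f j) fs"
  by - (elim exE conjE, rule that)
 have f: "f j \<in> mhomog K U isl dl" "Ps (mono \<one> {#j#}) T0 = L.cls (f j) fs" if "j \<le> n" for j
  using fx that by auto
 have "\<forall>i\<in>{..M}. \<exists>q. q \<in> mhomog K U isl (repeat_mset e dl) & Ps (g i) (T0 [^]\<^bsub>PR {..n}\<^esub> e) = L.cls q (fs [^]\<^bsub>PR U\<^esub> e) &
  (\<forall>A (ph :: 'a => 'r2). partial_hom K A ph & (\<forall>m. g i m \<in> A) & (\<forall>j\<in>{..n}. \<forall>m. f j m \<in> A) -->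
  subst_rel K A ph q (g i) f)"
 proof
  fix i assume i: "i \<in> {..M}"
  show "\<exists>q. q \<in> mhomog K U isl (repeat_mset e dl) & Ps (g i) (T0 [^]\<^bsub>PR {..n}\<^esub> e) = L.cls q (fs [^]\<^bsub>PR U\<^esub> e) &
  (\<forall>A (ph :: 'a => 'r2). partial_hom K A ph & (\<forall>m. g i m \<in> A) & (\<forall>j\<in>{..n}. \<forall>m. f j m \<in> A) -->
  subst_rel K A ph q (g i) f)"
  by (rule substitution[OF F2 F1 T0 T0N]) (use i fs f gm homogD[OF g(1)] in auto)
 qed
 from bchoice[OF this] obtain q where
  q: "!!i. i \<le> M ==> q i \<in> mhomog K U isl (repeat_mset e dl)" "!!i. i \<le> M ==> Ps (g i) (T0 [^]\<^bsub>PR {..n}\<^esub> e) = L.cls (q i) (fs [^]\<^bsub>PR U\<^esub> e)"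
  and qe: "!!i A (ph :: 'a => 'r2). i \<le> M ==> partial_hom K A ph & (\<forall>m. g i m \<in> A) & (\<forall>j\<in>{..n}. \<forall>m. f j m \<in> A) ==>
  subst_rel K A ph (q i) (g i) f"
  by - (elim exE, rule that, auto)
 have Te: "T0 [^]\<^bsub>PR {..n}\<^esub> e \<in> hg {..n} e1" "T0 [^]\<^bsub>PR {..n}\<^esub> e \<in> N2"
  using homog_pow[OF T0, of e] frac_fun_pow[OF F2 T0N] by (simp_all add: e1 repeat_mset_single)
 have fe: "fs [^]\<^bsub>PR U\<^esub> e \<in> mhomog K U isl (repeat_mset e dl)" "fs [^]\<^bsub>PR U\<^esub> e \<notin> P"
  using homog_pow[OF fs(1)] frac_fun_pow[OF F1 fs(2), of e] by (auto simp: N1_def)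
 \<comment> \<open>Coordinate i is \<open>g i\<close> over \<open>gs\<close>, the composite is
   \<open>g i\<close> over \<open>T0 ^ e\<close>; \<open>y\<close> is the ratio of the denominators,
   the same for all i.\<close>
 define y where "y = Ps gs (T0 [^]\<^bsub>PR {..n}\<^esub> e)"
 have y: "y \<in> carrier L.OP" unfolding y_def by (rule frac_funD(4)[OF F2 gs(1) Te])
 have xc: "x i \<in> carrier L.OP" if "i \<le> M" for i unfolding x_def by (rule L.cls_carrier[OF xp[OF that]])
 have qp: "(q i, fs [^]\<^bsub>PR U\<^esub> e) \<in> L.pairs" if "i \<le> M" for i by (rule L.pairsI[OF q(1)[OF that] fe])
 have c: "L.cls (q i) (fs [^]\<^bsub>PR U\<^esub> e) = x i \<otimes>\<^bsub>L.OP\<^esub> y" if i: "i \<le> M" for i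
 proof -
  have "Ps (g i) (T0 [^]\<^bsub>PR {..n}\<^esub> e) = Ps (g i) (T0 [^]\<^bsub>PR {..n}\<^esub> e) \<otimes>\<^bsub>L.OP\<^esub> Ps gs gs"
  using frac_funD(5)[OF F2 gs] frac_funD(4)[OF F2 g(1)[OF i] Te] by simp
  also have "\<dots> = Ps (g i \<otimes>[{..n}] gs) (T0 [^]\<^bsub>PR {..n}\<^esub> e \<otimes>[{..n}] gs)"
  using frac_funD(7)[OF F2 g(1)[OF i] Te gs(1,1,2)] by simp
  also have "T0 [^]\<^bsub>PR {..n}\<^esub> e \<otimes>[{..n}] gs = gs \<otimes>[{..n}] T0 [^]\<^bsub>PR {..n}\<^esub> e"
  using homogD[OF Te(1)] homogD[OF gs(1)] by (rule PR.m_comm)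
  also have "Ps (g i \<otimes>[{..n}] gs) (gs \<otimes>[{..n}] T0 [^]\<^bsub>PR {..n}\<^esub> e) = x i \<otimes>\<^bsub>L.OP\<^esub> y"
  using frac_funD(7)[OF F2 g(1)[OF i] gs gs(1) Te] by (simp add: y_def g(2)[OF i])
  finally show ?thesis using q(2)[OF i] by simp
 qed
 have qi0: "q i0 \<notin> P"
 proof
  assume "q i0 \<in> P"
  hence "L.cls (q i0) (fs [^]\<^bsub>PR U\<^esub> e) \<in> L.MP" using L.MP_iff[OF qp[OF i0(1)]] by simp
  hence "y \<in> L.MP" using c[OF i0(1)] xI y by simp
  hence "y \<otimes>\<^bsub>L.OP\<^esub> Ps (T0 [^]\<^bsub>PR {..n}\<^esub> e) gs \<in> L.MP"
  using ideal.I_r_closed[OF maximalideal.axioms(1)[OF L.MP_maximal]] frac_funD(4)[OF F2 Te(1) gs] by blast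
  hence "\<one>\<^bsub>L.OP\<^esub> \<in> L.MP" using invPs[OF gs(1) Te(1) gs(2) Te(2)] by (simp add: y_def)
  thus False using L.MP_iff[OF L.pairs_one] L.P_one by (simp add: L.OP_simps(2))
 qed
 define z where "z = (%(i, j). q i \<otimes>[U] vr j \<ominus>[U] q j \<otimes>[U] vr i)"
 have qc: "q i \<in> carrier (PR U)" if "i \<le> M" for i by (rule homogD[OF q(1)[OF that]])
 have "\<exists>h. h \<in> carrier (PR U) & h \<notin> P & h \<otimes>[U] z (i, j) \<in> I" if ij: "i \<le> M" "j \<le> M" for i j
 proof -
  let ?D = "fs [^]\<^bsub>PR U\<^esub> e \<otimes>[U] vr i0"
  have Dc: "?D \<in> carrier (PR U)" "?D \<notin> P" using homogD[OF fe(1)] Xc[OF i0(1)] fe(2) i0(2) by (auto simp: L.P_mult_iff)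
  have "L.cls (q i) (fs [^]\<^bsub>PR U\<^esub> e) \<otimes>\<^bsub>L.OP\<^esub> x j = L.cls (q j) (fs [^]\<^bsub>PR U\<^esub> e) \<otimes>\<^bsub>L.OP\<^esub> x i"
  unfolding c[OF ij(1)] c[OF ij(2)] using xc[OF ij(1)] xc[OF ij(2)] y by (simp add: L.OP.m_ac)
  hence "L.cls (q i \<otimes>[U] vr j) ?D = L.cls (q j \<otimes>[U] vr i) ?D"
  unfolding x_def using L.cls_ops(1)[OF qp[OF ij(1)] xp[OF ij(2)]] L.cls_ops(1)[OF qp[OF ij(2)] xp[OF ij(1)]] by simp
  hence "L.frel (q i \<otimes>[U] vr j) ?D (q j \<otimes>[U] vr i) ?D"
  using L.cls_eq_iff[OF L.pairs_mult[OF qp[OF ij(1)] xp[OF ij(2)]] L.pairs_mult[OF qp[OF ij(2)] xp[OF ij(1)]]] by simp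
  then obtain h where h: "h \<in> carrier (PR U)" "h \<notin> P"
  "h \<otimes>[U] (q i \<otimes>[U] vr j \<otimes>[U] ?D \<ominus>[U] q j \<otimes>[U] vr i \<otimes>[U] ?D) \<in> I" unfolding L.frel_def by blast
  define a where "a = q i \<otimes>[U] vr j"
  define b where "b = q j \<otimes>[U] vr i"
  have ab: "a \<in> carrier (PR U)" "b \<in> carrier (PR U)" using qc ij Xc by (auto simp: a_def b_def)
  have "h \<otimes>[U] (a \<otimes>[U] ?D \<ominus>[U] b \<otimes>[U] ?D) = h \<otimes>[U] ?D \<otimes>[U] (a \<ominus>[U] b)"
  using ab h(1) Dc(1) by (simp add: PR.minus_eq PR.r_distr PR.l_distr PR.l_minus PR.r_minus PR.m_ac)
  hence "h \<otimes>[U] ?D \<otimes>[U] z (i, j) \<in> I" using h(3) unfolding z_def a_def b_def by simp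
  thus ?thesis using h Dc by (intro exI[of _ "h \<otimes>[U] ?D"]) (simp add: L.P_mult_iff)
 qed
 hence "\<exists>h. h \<in> carrier (PR U) & h \<notin> P & (\<forall>y\<in>z ` ({..M} \<times> {..M}). h \<otimes>[U] y \<in> I)"
  by (intro L.common_multiplier) (auto simp: z_def qc Xc)
 then obtain H where H: "H \<in> carrier (PR U)" "H \<notin> P" "!!i j. i \<le> M ==> j \<le> M ==> H \<otimes>[U] z (i, j) \<in> I" by auto
 show ?thesis
  apply (rule exI[of _ r], rule exI[of _ n], rule exI[of _ e], rule exI[of _ g], rule exI[of _ f], rule exI[of _ q],
  rule exI[of _ H], rule exI[of _ P], rule exI[of _ i0])
  unfolding Let_def U_def[symmetric] I_def[symmetric]
 proof (intro conjI A L.prime_P L.I_P FI i0(1) H(1,2) qi0 allI impI)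
  show "q i \<in> carrier (PR U)" "g i \<in> carrier (PR {..n})" if "i \<le> M" for i using qc g(1) that homogD by blast+
  show "size m = e" if "i \<le> M" "g i m ~= \<zero>" for i m using gm that by blast
  show "f j \<in> carrier (PR U)" if "j \<le> n" for j using f(1)[OF that] homogD by blast
  show "H \<otimes>[U] (q i \<otimes>[U] mono \<one> {#Inl j#} \<ominus>[U] q j \<otimes>[U] mono \<one> {#Inl i#}) \<in> I"
  if "i \<le> M" "j \<le> M" for i j using H(3)[OF that] by (simp add: z_def vr_def)
  fix i A and ph :: "'a => 'r2"
  assume i: "i \<le> M" and *: "partial_hom K A ph & (\<forall>m. g i m \<in> A) & (\<forall>j\<le>n. \<forall>m. f j m \<in> A)"
  hence **: "partial_hom K A ph & (\<forall>m. g i m \<in> A) & (\<forall>j\<in>{..n}. \<forall>m. f j m \<in> A)" by auto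
  show "q i m \<in> A" for m using qe[OF i **] by blast
  show "peval K ph (q i) a = peval K ph (g i) (%j. peval K ph (f j) a)" for a using qe[OF i **] by blast
 qed
qed

end

lemma replicate_mset_if_count:
 assumes "count m w = size m"
 shows "m = replicate_mset (size m) w"
proof -
 have "replicate_mset (size m) w \<subseteq># m" using assms by (simp add: count_le_replicate_mset_subset_eq[symmetric])
 then obtain r where r: "m = replicate_mset (size m) w + r" by (metis subset_mset.le_iff_add)
 hence "size m = size (replicate_mset (size m) w + r)" by (rule arg_cong)
 hence "size r = 0" by simp
 thus ?thesis using r by simp
qed

lemma (in mpoly) finite_coeffs: "p \<in> carrier (PR V) ==> finite (range p)"
proof -
 assume p: "p \<in> carrier (PR V)"
 have "range p \<subseteq> insert \<zero> (p ` {m. p m ~= \<zero>})" by auto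
 thus ?thesis by (rule finite_subset) (use carrierD(2)[OF p] in simp)
qed

lemma (in mpoly) peval_cong:
 assumes "p \<in> carrier (PR V)" "!!v. v \<in> V ==> a v = a' v"
 shows "peval K h p a = peval K h p a'"
proof -
 have "image_mset a m = image_mset a' m" if "p m ~= \<zero>" for m
  using carrierD(3)[OF assms(1) that] assms(2) by (intro image_mset_cong) auto
 thus ?thesis unfolding peval_def mev_def by (intro sum.cong) auto
qed

text \<open>Stable rationality is turned into finitely many polynomial identities, so one embedding
  of their coefficients suffices. Injectivity of the embedding on \<open>A\<close> preserves
  supports and hence nonvanishing.\<close>

theorem (in shape) not_stably_rational:
 fixes K :: "'a ring" and F0 :: "nat multiset => 'a"
 assumes K: "field K" and char2: "(2 :: 'o :: field) = 0"
  and F0: "F0 \<in> carrier (mpoly_ring K {..Suc N})" "!!m. F0 m ~= \<zero>\<^bsub>K\<^esub> \<longleftrightarrow> m \<in> mons" "F0 \<in> G"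
  and G: "!!f. f \<in> G ==> \<exists>t\<in>carrier (mpoly_ring K {..Suc N}). f = t \<otimes>\<^bsub>mpoly_ring K {..Suc N}\<^esub> F0"
  and embed: "!!S. finite S ==> S \<subseteq> carrier K ==> \<exists>A (io :: 'a => 'o fls). partial_hom K A io & S \<subseteq> A &
  (\<forall>x\<in>A. io x = 0 --> x = \<zero>\<^bsub>K\<^esub>) &
  (\<forall>m\<in>mons. \<exists>F'. io (F0 m) = fps_to_fls F' & fps_nth F' 0 = form_coeff m)"
 shows "~ stably_rational K {..Suc N} (Idl\<^bsub>mpoly_ring K {..Suc N}\<^esub> G)"
proof
 assume rat: "stably_rational K {..Suc N} (Idl\<^bsub>mpoly_ring K {..Suc N}\<^esub> G)"
 interpret mpoly_field K by (rule mpoly_field.intro[OF K])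
 have sz: "size m = d" if "F0 m ~= \<zero>\<^bsub>K\<^esub>" for m using that F0(2) by (auto simp: mons_def)
 obtain r n' :: nat and e g f q H P i0 where dat: "let U = Sum_Type.Plus {..Suc N} {..r}; I = Idl\<^bsub>PR U\<^esub> (mp_Inl K ` (Idl\<^bsub>PR {..Suc N}\<^esub> G)) in
  primeideal P (PR U) & I \<subseteq> P & mp_Inl K F0 \<in> I & i0 \<le> Suc N & H \<in> carrier (PR U) & H \<notin> P & q i0 \<notin> P &
  (\<forall>i\<le>Suc N. q i \<in> carrier (PR U) & g i \<in> carrier (PR {..n'}) & (\<forall>m. g i m ~= \<zero>\<^bsub>K\<^esub> --> size m = e)) &
  (\<forall>j\<le>n'. f j \<in> carrier (PR U)) &
  (\<forall>i\<le>Suc N. \<forall>j\<le>Suc N. H \<otimes>[U] (q i \<otimes>[U] mono \<one>\<^bsub>K\<^esub> {#Inl j#} \<ominus>[U] q j \<otimes>[U] mono \<one>\<^bsub>K\<^esub> {#Inl i#}) \<in> I) &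
  (\<forall>A (ph :: 'a => 'o ratf fls fls poly). partial_hom K A ph & (\<forall>m. F0 m \<in> A) & (\<forall>i\<le>Suc N. \<forall>m. g i m \<in> A) -->
  (\<forall>a. peval K ph F0 (%i. peval K ph (g i) a) = 0)) &
  (\<forall>i\<le>Suc N. \<forall>A (ph :: 'a => 'o ratf fls fls). partial_hom K A ph & (\<forall>m. g i m \<in> A) & (\<forall>j\<le>n'. \<forall>m. f j m \<in> A) -->
  subst_rel K A ph (q i) (g i) f)"
  using birational_data[where ?'r1.0 = "'o ratf fls fls poly" and ?'r2.0 = "'o ratf fls fls", OF F0(1) sz F0(3) G rat]
  by - (drule meta_mp, assumption, drule meta_mp, assumption, elim exE, rule that)
 define U where "U = Sum_Type.Plus {..Suc N} {..r}"
 define I where "I = Idl\<^bsub>PR U\<^esub> (mp_Inl K ` (Idl\<^bsub>PR {..Suc N}\<^esub> G))"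
 define F where "F = (mp_Inl K F0 :: (nat + nat) multiset => 'a)"
 note d0 = dat[unfolded Let_def, folded U_def, folded I_def, folded F_def]
 note d1 = conjunct2[OF d0] note d2 = conjunct2[OF d1] note d3 = conjunct2[OF d2] note d4 = conjunct2[OF d3] note d5 = conjunct2[OF d4]
 note d6 = conjunct2[OF d5] note d7 = conjunct2[OF d6] note d8 = conjunct2[OF d7] note d9 = conjunct2[OF d8] note d10 = conjunct2[OF d9] note d11 = conjunct2[OF d10]
 note P = conjunct1[OF d0] conjunct1[OF d1] conjunct1[OF d2] and i0 = conjunct1[OF d3] and H = conjunct1[OF d4] conjunct1[OF d5] and qP = conjunct1[OF d6]
 have q: "q i \<in> carrier (PR U)" and g: "g i \<in> carrier (PR {..n'})" "g i m ~= \<zero>\<^bsub>K\<^esub> ==> size m = e" if "i \<le> Suc N" for i m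
  using conjunct1[OF d7] that by simp_all
 have f: "f j \<in> carrier (PR U)" if "j \<le> n'" for j using conjunct1[OF d8] that by simp
 have HI: "H \<otimes>[U] (q i \<otimes>[U] mono \<one>\<^bsub>K\<^esub> {#Inl j#} \<ominus>[U] q j \<otimes>[U] mono \<one>\<^bsub>K\<^esub> {#Inl i#}) \<in> I"
  if "i \<le> Suc N" "j \<le> Suc N" for i j using conjunct1[OF d9] that by blast
 have ev1: "peval K ph F0 (%i. peval K ph (g i) a) = 0"
  if "partial_hom K A ph" "\<forall>m. F0 m \<in> A" "\<forall>i\<le>Suc N. \<forall>m. g i m \<in> A" for A a and ph :: "'a => 'o ratf fls fls poly"
  using conjunct1[OF d10] that by blast
 have ev2: "subst_rel K A ph (q i) (g i) f"
  if "i \<le> Suc N" "partial_hom K A ph" "\<forall>m. g i m \<in> A" "\<forall>j\<le>n'. \<forall>m. f j m \<in> A" for i A and ph :: "'a => 'o ratf fls fls"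
  using d11 that by blast
 have Fc: "F \<in> carrier (PR U)" unfolding F_def U_def by (rule mp_Inl_closed[OF F0(1)])
 have pr: "\<exists>t. t \<in> carrier (PR U) & z = t \<otimes>[U] F" if "z \<in> I" for z
  using principal_ideal[OF F0(1) G, of G z "{..r}"] that unfolding I_def U_def F_def by blast
 define tt where "tt = (%i j. SOME t. t \<in> carrier (PR U) &
  H \<otimes>[U] (q i \<otimes>[U] mono \<one>\<^bsub>K\<^esub> {#Inl j#} \<ominus>[U] q j \<otimes>[U] mono \<one>\<^bsub>K\<^esub> {#Inl i#}) = t \<otimes>[U] F)"
 have tt: "tt i j \<in> carrier (PR U)" "H \<otimes>[U] (q i \<otimes>[U] mono \<one>\<^bsub>K\<^esub> {#Inl j#} \<ominus>[U] q j \<otimes>[U] mono \<one>\<^bsub>K\<^esub> {#Inl i#}) = tt i j \<otimes>[U] F"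
  if "i \<le> Suc N" "j \<le> Suc N" for i j
  using someI_ex[OF pr[OF HI[OF that]]] unfolding tt_def by blast+
 have Fw: "F (replicate_mset d (Inl cw)) ~= \<zero>\<^bsub>K\<^esub>"
 proof -
  have "replicate_mset d (Inl cw :: nat + nat) = image_mset Inl (replicate_mset d cw)" by (simp add: image_replicate_mset)
  hence "F (replicate_mset d (Inl cw)) = F0 (replicate_mset d cw)" unfolding F_def by (simp only: mp_Inl_image)
  thus ?thesis using F0(2)[of "replicate_mset d cw"] by (auto simp: mons_def)
 qed
 have Fm: "count m (Inl cw) \<le> d & (count m (Inl cw) = d --> m = replicate_mset d (Inl cw))" if nz: "F m ~= \<zero>\<^bsub>K\<^esub>" for m
 proof -
  from nz obtain m' where "m = image_mset Inl m'" "F0 m' ~= \<zero>\<^bsub>K\<^esub>" unfolding F_def by (rule mp_Inl_nonzero)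
  hence s: "size m = d" using sz by simp
  thus ?thesis using count_le_size[of m "Inl cw"] replicate_mset_if_count[of m "Inl cw"] by simp
 qed
 obtain RH tH where RH: "RH \<in> carrier (PR U)" "tH \<in> carrier (PR U)" "H = RH \<oplus>[U] F \<otimes>[U] tH" "\<forall>m. RH m ~= \<zero>\<^bsub>K\<^esub> --> count m (Inl cw) < d"
  using reduce_mod[OF Fc Fw Fm H(1)] by blast
 obtain RG tG where RG: "RG \<in> carrier (PR U)" "tG \<in> carrier (PR U)" "q i0 = RG \<oplus>[U] F \<otimes>[U] tG" "\<forall>m. RG m ~= \<zero>\<^bsub>K\<^esub> --> count m (Inl cw) < d"
  using reduce_mod[OF Fc Fw Fm q[OF i0]] by blast
 \<comment> \<open>The equation \<open>F\<close> lies in \<open>P\<close>, so a polynomial outside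
   \<open>P\<close> has a nonzero remainder modulo \<open>F\<close>.\<close>
 have nonzero: "\<exists>m. R m ~= \<zero>\<^bsub>K\<^esub>" if "R \<in> carrier (PR U)" "t \<in> carrier (PR U)" "R \<oplus>[U] F \<otimes>[U] t \<notin> P" for R t
 proof (rule ccontr)
  assume "~ ?thesis"
  hence "R = \<zero>[U]" by (auto simp: PR_simps)
  moreover have "F \<otimes>[U] t \<in> P" using ideal.I_r_closed[OF primeideal.axioms(1)[OF P(1)]] P(2,3) that(2) by blast
  ultimately show False using that Fc by simp
 qed
 \<comment> \<open>All coefficients that occur, including the cofactors \<open>tt\<close>,
   \<open>tH\<close>, \<open>tG\<close> witnessing membership in the ideal, so that the identities
   survive the embedding.\<close>
 define S where "S = range F0 \<union> range H \<union> range RH \<union> range tH \<union> range RG \<union> range tG \<union>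
  (\<Union>i\<in>{..Suc N}. range (g i)) \<union> (\<Union>j\<in>{..n'}. range (f j)) \<union> (\<Union>i\<in>{..Suc N}. \<Union>j\<in>{..Suc N}. range (tt i j))"
 have "finite S" unfolding S_def
  using finite_coeffs[OF F0(1)] finite_coeffs[OF H(1)] finite_coeffs[OF RH(1)] finite_coeffs[OF RH(2)]
  finite_coeffs[OF RG(1)] finite_coeffs[OF RG(2)] finite_coeffs[OF g(1)] finite_coeffs[OF f] finite_coeffs[OF tt(1)] by simp
 moreover have "S \<subseteq> carrier K" unfolding S_def
  using carrierD(1)[OF F0(1)] carrierD(1)[OF H(1)] carrierD(1)[OF RH(1)] carrierD(1)[OF RH(2)]
  carrierD(1)[OF RG(1)] carrierD(1)[OF RG(2)] carrierD(1)[OF g(1)] carrierD(1)[OF f] carrierD(1)[OF tt(1)] by auto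
 ultimately obtain A and io :: "'a => 'o fls" where io: "partial_hom K A io" "S \<subseteq> A" "!!x. x \<in> A ==> io x = 0 ==> x = \<zero>\<^bsub>K\<^esub>"
  "\<forall>m\<in>mons. \<exists>F'. io (F0 m) = fps_to_fls F' & fps_nth F' 0 = form_coeff m"
  using embed[of S] by blast
 obtain F' where F': "!!m. m \<in> mons ==> io (F0 m) = fps_to_fls (F' m) & fps_nth (F' m) 0 = form_coeff m"
  using bchoice[OF io(4)] by blast
 have io0: "io \<zero>\<^bsub>K\<^esub> = 0" using io(1) by (simp add: partial_hom_def)
 note h2 = partial_hom_compose[OF io(1) comm_ring_hom_lift]
 note h1 = partial_hom_compose[OF h2 comm_ring_hom_const_poly]
 interpret E2: phom K A "%x. lift (io x)" by unfold_locales (rule h2)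
 have SA: "x \<in> A" if "x \<in> S" for x using io(2) that by (rule subsetD)
 have inA1: "F0 m1 \<in> A" "H m2 \<in> A" "RH m2 \<in> A" "tH m2 \<in> A" "RG m2 \<in> A" "tG m2 \<in> A" for m1 m2
  by (rule SA, simp add: S_def)+
 have "g i m \<in> A" if "i \<le> Suc N" for i m
  by (rule SA, unfold S_def, rule UnI1, rule UnI1, rule UnI2, rule UN_I[of i]) (use that in auto)
 moreover have "f j m \<in> A" if "j \<le> n'" for j m
  by (rule SA, unfold S_def, rule UnI1, rule UnI2, rule UN_I[of j]) (use that in auto)
 moreover have "tt i j m \<in> A" if "i \<le> Suc N" "j \<le> Suc N" for i j m
  by (rule SA, unfold S_def, rule UnI2, rule UN_I[of i], use that in simp, rule UN_I[of j]) (use that in auto)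
 ultimately have inA: "F0 m1 \<in> A" "H m2 \<in> A" "RH m2 \<in> A" "tH m2 \<in> A" "RG m2 \<in> A" "tG m2 \<in> A"
  "i \<le> Suc N ==> g i m1 \<in> A" "j \<le> n' ==> f j m2 \<in> A" "i \<le> Suc N ==> i' \<le> Suc N ==> tt i i' m2 \<in> A" for m1 m2 i i' j
  using inA1 by simp_all
 have FA: "F m \<in> A" for m using inA(1) E2.A0 by (simp add: F_def mp_Inl_def)
 have PA: "F \<in> E2.PA U" "H \<in> E2.PA U" "RH \<in> E2.PA U" "tH \<in> E2.PA U" "RG \<in> E2.PA U" "tG \<in> E2.PA U"
  and PAt: "i \<le> Suc N ==> j \<le> Suc N ==> tt i j \<in> E2.PA U" for i j
  using FA inA Fc H RH RG tt(1) by (auto simp: E2.PA_def)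
 have supp: "{m. io (p m) ~= 0} = {m. p m ~= \<zero>\<^bsub>K\<^esub>}" if "!!m. p m \<in> A" for p :: "'v multiset => 'a"
  using io(3)[OF that] io0 by auto
 have pev2: "pev lift (%m. io (p m)) a = peval K (%x. lift (io x)) p a" if "!!m. p m \<in> A" for p :: "'v multiset => 'a" and a
  unfolding pev_def peval_def by (simp add: supp[OF that])
 have mev2: "mev mons (%m. lift (io (F0 m))) c = peval K (%x. lift (io x)) F0 c" for c
  unfolding peval_def F0(2) by simp
 define f' where "f' = (%j. if j \<le> n' then f j else (%_. \<zero>\<^bsub>K\<^esub>))"
 have f'A: "f' j m \<in> A" for j m using inA(8) E2.A0 by (simp add: f'_def)
 have qA: "q i \<in> E2.PA U" and qe: "peval K (%x. lift (io x)) (q i) a = pev lift (%m. io (g i m)) (%j. pev lift (%m. io (f' j m)) a)"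
  if "i \<le> Suc N" for i a
 proof -
  have *: "\<forall>m. g i m \<in> A" "\<forall>j\<le>n'. \<forall>m. f j m \<in> A" using inA that by auto
  note ** = ev2[OF that h2 *]
  show "q i \<in> E2.PA U" using ** q[OF that] by (simp add: E2.PA_def)
  have "peval K (%x. lift (io x)) (q i) a = peval K (%x. lift (io x)) (g i) (%j. peval K (%x. lift (io x)) (f j) a)" using ** by blast
  also have "\<dots> = peval K (%x. lift (io x)) (g i) (%j. peval K (%x. lift (io x)) (f' j) a)"
  by (rule peval_cong[OF g(1)[OF that]]) (simp add: f'_def)
  finally show "peval K (%x. lift (io x)) (q i) a = pev lift (%m. io (g i m)) (%j. pev lift (%m. io (f' j m)) a)"
  using * f'A by (simp add: pev2)
 qed
 have Fa: "peval K (%x. lift (io x)) F a = 0" if "mev mons (%m. lift (io (F0 m))) (%c. a (Inl c)) = 0" for a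
  using that unfolding mev2 F_def E2.peval_mp_Inl[OF F0(1)] .
 show False
 proof (rule obstruction[OF char2, of "%m. io (F0 m)" F' "%i m. io (g i m)" e "%m. io (RG m)" "%m. io (RH m)" "%j m. io (f' j m)" i0])
  show "io (F0 m) = fps_to_fls (F' m)" "fps_nth (F' m) 0 = form_coeff m" if "m \<in> mons" for m using F'[OF that] by auto
  show "finite {m. io (g i m) ~= 0}" if "i \<le> Suc N" for i using supp[of "g i"] inA(7)[OF that] carrierD(2)[OF g(1)[OF that]] by simp
  show "size m = e" if "i \<le> Suc N" "io (g i m) ~= 0" for i m
  by (rule g(2)[OF that(1)], rule notI) (use that(2) io0 in simp)
  show "mev mons (%m. [:lift (io (F0 m)):]) (%i. pev (%c. [:lift c:]) (%m. io (g i m)) a) = 0" for a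
  proof -
  have "peval K (%x. [:lift (io x):]) F0 (%i. peval K (%x. [:lift (io x):]) (g i) a) = 0"
  by (rule ev1[OF h1]) (use inA in auto)
  moreover have "peval K (%x. [:lift (io x):]) F0 (%i. peval K (%x. [:lift (io x):]) (g i) a) =
  peval K (%x. [:lift (io x):]) F0 (%i. pev (%c. [:lift c:]) (%m. io (g i m)) a)"
  by (rule peval_cong[OF F0(1)]) (simp add: pev_def peval_def supp inA)
  ultimately show ?thesis unfolding peval_def[of K _ F0] F0(2) by simp
  qed
  show "finite {m. io (RG m) ~= 0}" "finite {m. io (RH m) ~= 0}"
  using supp[of RG] supp[of RH] inA carrierD(2)[OF RG(1)] carrierD(2)[OF RH(1)] by simp_all
  show "\<exists>m. io (RG m) ~= 0" using nonzero[OF RG(1,2)] qP RG(3) io(3)[OF inA(5)] by metis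
  show "\<exists>m. io (RH m) ~= 0" using nonzero[OF RH(1,2)] H(2) RH(3) io(3)[OF inA(3)] by metis
  show "count m (Inl cw) < d" if "io (RG m) ~= 0" for m
  by (rule RG(4)[rule_format], rule notI) (use that io0 in simp)
  show "count m (Inl cw) < d" if "io (RH m) ~= 0" for m
  by (rule RH(4)[rule_format], rule notI) (use that io0 in simp)
  show "i0 \<le> Suc N" by (rule i0)
  fix a :: "nat + nat => 'o ratf fls fls" assume a0: "mev mons (%m. lift (io (F0 m))) (%c. a (Inl c)) = 0"
  let ?h = "%x. lift (io x)"
  have "peval K ?h (q i0) a = peval K ?h RG a"
  using E2.peval_add[OF PA(5) E2.PA_closed(2)[OF PA(1,6)]] E2.peval_mult[OF PA(1,6)] Fa[OF a0] by (simp add: RG(3))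
  thus "pev lift (%m. io (g i0 m)) (%j. pev lift (%m. io (f' j m)) a) = pev lift (%m. io (RG m)) a"
  using qe[OF i0] inA(5) by (simp add: pev2)
  have Ha: "peval K ?h H a = peval K ?h RH a"
  using E2.peval_add[OF PA(3) E2.PA_closed(2)[OF PA(1,4)]] E2.peval_mult[OF PA(1,4)] Fa[OF a0] by (simp add: RH(3))
  fix i j assume ij: "i \<le> Suc N" "j \<le> Suc N"
  have vA: "mono \<one>\<^bsub>K\<^esub> {#Inl c#} \<in> E2.PA U" if "c \<le> Suc N" for c using that E2.A1 by (intro E2.PA_mono) (auto simp: U_def)
  note qv = E2.PA_closed(2)[OF qA[OF ij(1)] vA[OF ij(2)]] E2.PA_closed(2)[OF qA[OF ij(2)] vA[OF ij(1)]]
  have "peval K ?h (H \<otimes>[U] (q i \<otimes>[U] mono \<one>\<^bsub>K\<^esub> {#Inl j#} \<ominus>[U] q j \<otimes>[U] mono \<one>\<^bsub>K\<^esub> {#Inl i#})) a =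
  peval K ?h H a * (peval K ?h (q i) a * a (Inl j) - peval K ?h (q j) a * a (Inl i))"
  using E2.peval_mult[OF PA(2) E2.PA_closed(3)[OF qv]] E2.peval_minus[OF qv]
  E2.peval_mult[OF qA[OF ij(1)] vA[OF ij(2)]] E2.peval_mult[OF qA[OF ij(2)] vA[OF ij(1)]]
  by (simp add: E2.peval_mono E2.h1)
  moreover have "peval K ?h (tt i j \<otimes>[U] F) a = 0"
  using E2.peval_mult[OF PAt[OF ij] PA(1)] Fa[OF a0] by simp
  ultimately have "peval K ?h H a * (peval K ?h (q i) a * a (Inl j) - peval K ?h (q j) a * a (Inl i)) = 0"
  using tt(2)[OF ij] by simp
  thus "pev lift (%m. io (RH m)) a * (a (Inl j) * pev lift (%m. io (g i m)) (%j. pev lift (%m. io (f' j m)) a) -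
  a (Inl i) * pev lift (%m. io (g j m)) (%j. pev lift (%m. io (f' j m)) a)) = 0"
  unfolding Ha qe[OF ij(1)] qe[OF ij(2)] using inA(3) by (simp add: pev2 mult.commute)
 qed
qed

section \<open>Very general hypersurfaces\<close>

text \<open>Each parity is taken by \<open>2 ^ n\<close> subsets of \<open>{..n}\<close>: a subset
  of \<open>{..<n}\<close> is corrected by \<open>n\<close> if its parity is wrong. Two sets are
  prescribed and the rest chosen injectively.\<close>

lemma ex_parity_family:
 assumes "1 \<le> n" "N + 2 \<le> 2 ^ n" "i \<le> Suc N" "j \<le> Suc N" "i ~= j"
  and "A \<subseteq> {..n}" "B \<subseteq> {..n}" "A ~= B" "even (card A) = p" "even (card B) = p"
 shows "\<exists>T. inj_on T {..Suc N} & T i = A & T j = B & (\<forall>c\<le>Suc N. T c \<subseteq> {..n} & even (card (T c)) = p)"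
proof -
 define Y where "Y = {C. C \<subseteq> {..n} & even (card C) = p}"
 have fY: "finite Y" unfolding Y_def by (rule finite_subset[of _ "Pow {..n}"]) auto
 have "2 ^ n \<le> card Y"
 proof -
  let ?f = "%C. if even (card C) = p then C else insert n C"
  have inj: "inj_on ?f (Pow {..<n})"
  proof (rule inj_onI)
  fix C D assume CD: "C \<in> Pow {..<n}" "D \<in> Pow {..<n}" "?f C = ?f D"
  have "?f C - {n} = C" "?f D - {n} = D" using CD(1,2) by auto
  thus "C = D" using CD(3) by simp
  qed
  have "?f C \<in> Y" if "C \<in> Pow {..<n}" for C
  proof -
  have "finite C" "n \<notin> C" using that by (auto intro: finite_subset)
  hence "card (insert n C) = Suc (card C)" by simp
  thus ?thesis using that by (auto simp: Y_def)
  qed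
  hence "card (Pow {..<n}) \<le> card Y" by (intro card_inj_on_le[OF inj _ fY] image_subsetI)
  thus ?thesis by (simp add: card_Pow)
 qed
 hence cY: "N + 2 \<le> card Y" using assms(2) by simp
 have AB: "A \<in> Y" "B \<in> Y" using assms by (auto simp: Y_def)
 have "card (Y - {A, B}) = card Y - 2"
  using AB assms(8) fY by (subst card_Diff_subset) auto
 moreover have "card ({..Suc N} - {i, j}) = Suc (Suc N) - 2"
  using assms(3-5) by (subst card_Diff_subset) auto
 ultimately have "card ({..Suc N} - {i, j}) \<le> card (Y - {A, B})" using cY by simp
 then obtain f where f: "f ` ({..Suc N} - {i, j}) \<subseteq> Y - {A, B}" "inj_on f ({..Suc N} - {i, j})"
  using card_le_inj[of "{..Suc N} - {i, j}" "Y - {A, B}"] fY by auto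
 define T where "T = f(i := A, j := B)"
 have Tf: "T c = f c" "f c \<in> Y - {A, B}" if "c \<le> Suc N" "c ~= i" "c ~= j" for c
  using that f(1) by (auto simp: T_def)
 have Tij: "T i = A" "T j = B" using assms(5) by (auto simp: T_def)
 have "inj_on T {..Suc N}"
 proof (rule inj_onI)
  fix c c' assume cc: "c \<in> {..Suc N}" "c' \<in> {..Suc N}" "T c = T c'"
  show "c = c'"
  proof (cases "c \<in> {i, j} \<or> c' \<in> {i, j}")
  case True
  thus ?thesis using Tf[of c] Tf[of c'] Tij cc assms(8) by auto
  next
  case False
  hence "f c = f c'" using Tf cc by auto
  thus ?thesis using f(2) False cc by (auto dest: inj_onD)
  qed
 qed
 moreover have "T c \<in> Y" if "c \<le> Suc N" for c
  using Tf[of c] Tij AB that by (cases "c = i \<or> c = j") auto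
 ultimately show ?thesis using Tij by (intro exI[of _ T]) (auto simp: Y_def)
qed

text \<open>The choice n = min(N, d-2) is the largest allowed. For \<open>N \<ge> 2\<close> the
  bound gives N + 2 \<le> 2 N \<le> 2^(d-2), enough sets of the right parity; if n = N, then N + 2
  \<le> 2^N suffices.\<close>

lemma ex_shape:
 assumes "N \<ge> 1" "real d \<ge> log 2 (real N) + 3"
 shows "\<exists>n T. shape N n d T"
proof -
 have d3: "3 \<le> d" using assms zero_le_log_cancel_iff[of 2 "real N"] by linarith
 have "log 2 (real N) \<le> real (d - 3)" using assms d3 by (simp add: of_nat_diff)
 hence "real N \<le> 2 powr real (d - 3)" using assms(1) by (simp add: log_le_iff)
 hence "real N \<le> real (2 ^ (d - 3))" by (simp add: powr_realpow)
 hence Nd: "N \<le> 2 ^ (d - 3)" by linarith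
 show ?thesis
 proof (cases "N = 1")
  case True
  show ?thesis
  proof (cases "even d")
  case ev: True
  hence d4: "4 \<le> d" using d3 by presburger
  show ?thesis
  proof (intro exI)
  \<comment> \<open>For N = 1 there are three coordinates but only two subsets of
    \<open>{0, 1}\<close> of given parity, so coordinates 0 and 1 share one.\<close>
  show "shape N 1 d (%c. if c \<le> 1 then {0, 1} else {})"
  by unfold_locales (use True ev d4 in auto)
  qed
  next
  case od: False
  show ?thesis
  proof (intro exI)
  show "shape N 1 d (%c. if c \<le> 1 then {1} else {0})"
  by unfold_locales (use True od d3 in auto)
  qed
  qed
 next
  case False
  hence N2: "N \<ge> 2" using assms(1) by simp
  have d4: "4 \<le> d"
  proof (rule ccontr)
  assume "~ ?thesis"
  hence "d - 3 = 0" by simp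
  thus False using Nd N2 by simp
  qed
  define n where "n = min N (d - 2)"
  have n: "1 \<le> n" "n \<le> N" "n + 2 \<le> d" using N2 d4 by (auto simp: n_def)
  have pow: "N + 2 \<le> 2 ^ n"
  proof (cases "N \<le> d - 2")
  case True
  have "k + 2 \<le> 2 ^ k" if "2 \<le> k" for k :: nat
  using that by (induction k rule: nat_induct_at_least) auto
  thus ?thesis using True N2 by (simp add: n_def)
  next
  case False
  have "d - 2 = Suc (d - 3)" using d4 by simp
  moreover have "(2 :: nat) ^ 1 \<le> 2 ^ (d - 3)" using d4 by (intro power_increasing) auto
  ultimately show ?thesis using False Nd by (simp add: n_def)
  qed
  have "\<exists>T. inj_on T {..Suc N} & (even d & T (Suc n) = {} & T 0 = {0,1} \<or> odd d & T (Suc n) = {0} & T 1 = {1}) &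
  (\<forall>c\<le>Suc N. T c \<subseteq> {..n} & even (card (T c)) = even d)"
  proof (cases "even d")
  case True
  thus ?thesis using ex_parity_family[of n N "Suc n" 0 "{}" "{0, 1}" True] n pow by auto
  next
  case False
  thus ?thesis using ex_parity_family[of n N "Suc n" 1 "{0}" "{1}" False] n pow by auto
  qed
  then obtain T where T: "inj_on T {..Suc N}" "even d & T (Suc n) = {} & T 0 = {0,1} \<or> odd d & T (Suc n) = {0} & T 1 = {1}"
  and T': "\<forall>c\<le>Suc N. T c \<subseteq> {..n} & even (card (T c)) = even d"
  by - (elim exE conjE, rule that)
  have T3: "T c \<subseteq> {..n}" "even (card (T c)) = even d" if "c \<le> Suc N" for c using T' that by auto
  \<comment> \<open>At most n + 1 \<le> d - 1 elements, and d - 1 has the wrong parity.\<close>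
  have "card (T c) + 2 \<le> d" if "c \<le> Suc N" for c
  proof -
  have "card (T c) \<le> card {..n}" using T3(1)[OF that] by (intro card_mono) auto
  hence "card (T c) + 1 \<le> d" using n(3) by simp
  moreover have "card (T c) + 1 ~= d" using T3(2)[OF that] by auto
  ultimately show ?thesis by simp
  qed
  hence "shape N n d T"
  by (intro shape.intro) (use n T T3 in "simp_all only: simp_thms")
  thus ?thesis by blast
 qed
qed

context mpoly_field
begin

text \<open>Two stages: the elements of \<open>S\<close> go into an algebraic closure of the Laurent
  series field by extending \<open>GG\<close>, then \<open>discretize\<close> brings the finite
  extension they generate back to Laurent series. Constant terms of the prescribed series survive
  both.\<close>

theorem embed_finitely_generated:
 fixes e :: "'o :: alg_closed_field fls => 'w :: field" and GG :: "('a \<times> 'w) set"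
 assumes e: "comm_ring_hom e" and alg: "!!x. \<exists>p. p ~= 0 & poly (map_poly e p) x = 0"
  and closed: "!!p :: 'w poly. Polynomial.degree p > 0 ==> \<exists>x. poly p x = 0"
  and GG: "inj_graph K GG" "countable GG" and M: "finite M" "!!m. m \<in> M ==> (c m, e (fps_to_fls (s m))) \<in> GG"
  and S: "finite S" "S \<subseteq> carrier K"
 shows "\<exists>A (io :: 'a => 'o fls). partial_hom K A io & S \<subseteq> A & (\<forall>x\<in>A. io x = 0 --> x = \<zero>) &
  (\<forall>m\<in>M. \<exists>h. io (c m) = fps_to_fls h & fps_nth h 0 = fps_nth (s m) 0)"
proof -
 have unc: "uncountable (UNIV :: 'w set)"
  using uncountable_series[OF e, of 0] by (meson countable_subset subset_UNIV)
 obtain GG' where GG': "inj_graph K GG'" "GG \<subseteq> GG'" "S \<subseteq> fst ` GG'"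
  using extend_inj_graph[OF GG unc closed S] by blast
 note D = inj_graphD[OF GG'(1)] inj_graph_more[OF GG'(1)]
 have "\<forall>x\<in>S. \<exists>w. (x, w) \<in> GG'" using GG'(3) by fastforce
 from bchoice[OF this] obtain w where w: "!!x. x \<in> S ==> (x, w x) \<in> GG'" by blast
 have fin: "finite (w ` S)" using S(1) by simp
 obtain L rh where L: "w ` S \<subseteq> L" "is_subfield L" "range e \<subseteq> L" and rh1: "rh 1 = 1"
  and rha: "!!x y. x \<in> L ==> y \<in> L ==> rh (x + y) = rh x + rh y" and rhm: "!!x y. x \<in> L ==> y \<in> L ==> rh (x * y) = rh x * rh y"
  and rhe: "!!f. \<exists>h. rh (e (fps_to_fls f)) = fps_to_fls (h :: 'o fps) & fps_nth h 0 = fps_nth f 0"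
  using discretize[OF e alg fin] by blast
 note LD = is_subfieldD[OF L(2)]
 have rh0: "rh 0 = 0" using rha[OF LD(2) LD(2)] add_cancel_right_right[of "rh 0" "rh 0"] by simp
 have rhnz: "v = 0" if "v \<in> L" "rh v = 0" for v
 proof (rule ccontr)
  assume "v ~= 0"
  hence "rh v * rh (inverse v) = 1" using rhm[OF that(1) LD(5)[OF that(1)]] rh1 by simp
  thus False using that(2) by simp
 qed
 define A where "A = {x. \<exists>v\<in>L. (x, v) \<in> GG'}"
 define io where "io = (%x. rh (THE v. (x, v) \<in> GG'))"
 have io: "io x = rh v" if "(x, v) \<in> GG'" for x v
 proof -
  have "(THE v. (x, v) \<in> GG') = v"
  proof (rule the_equality)
  show "v' = v" if "(x, v') \<in> GG'" for v' by (rule D(10)[OF that `(x, v) \<in> GG'`])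
  qed (rule that)
  thus ?thesis by (simp add: io_def)
 qed
 have AI: "x \<in> A" if "(x, v) \<in> GG'" "v \<in> L" for x v using that by (auto simp: A_def)
 have "partial_hom K A io"
  unfolding partial_hom_def
 proof (intro conjI ballI subsetI)
  show "x \<in> carrier K" if "x \<in> A" for x using that D(2) by (auto simp: A_def)
  show "\<zero> \<in> A" "\<one> \<in> A" by (rule AI[OF D(6) LD(2)], rule AI[OF D(1) LD(1)])
  show "io \<zero> = 0" "io \<one> = 1" using io[OF D(6)] io[OF D(1)] rh0 rh1 by simp_all
  show "\<ominus> x \<in> A" if x: "x \<in> A" for x
  proof -
  obtain v where v: "v \<in> L" "(x, v) \<in> GG'" using x by (auto simp: A_def)
  show ?thesis by (rule AI[OF D(7)[OF v(2)] LD(7)[OF v(1)]])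
  qed
  fix x y assume "x \<in> A" "y \<in> A"
  then obtain u v where uv: "u \<in> L" "(x, u) \<in> GG'" "v \<in> L" "(y, v) \<in> GG'" by (auto simp: A_def)
  note a = D(8)[OF uv(2,4)] and m = D(5)[OF uv(2,4)]
  show "x \<oplus> y \<in> A" by (rule AI[OF a LD(6)[OF uv(1,3)]])
  show "x \<otimes> y \<in> A" by (rule AI[OF m LD(4)[OF uv(1,3)]])
  show "io (x \<oplus> y) = io x + io y" using io[OF a] io[OF uv(2)] io[OF uv(4)] rha[OF uv(1,3)] by simp
  show "io (x \<otimes> y) = io x * io y" using io[OF m] io[OF uv(2)] io[OF uv(4)] rhm[OF uv(1,3)] by simp
 qed
 moreover have "S \<subseteq> A" using AI[OF w] L(1) by blast
 moreover have "x = \<zero>" if x: "x \<in> A" "io x = 0" for x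
 proof -
  obtain v where v: "v \<in> L" "(x, v) \<in> GG'" using x(1) by (auto simp: A_def)
  have "v = 0" using rhnz[OF v(1)] io[OF v(2)] x(2) by simp
  thus ?thesis using D(3)[OF v(2)] by simp
 qed
 moreover have "\<exists>h. io (c m) = fps_to_fls h & fps_nth h 0 = fps_nth (s m) 0" if m: "m \<in> M" for m
 proof -
  have "(c m, e (fps_to_fls (s m))) \<in> GG'" using M(2)[OF m] GG'(2) by blast
  from io[OF this] rhe[of "s m"] show ?thesis by simp
 qed
 ultimately show ?thesis by blast
qed

text \<open>Polynomials over the prime field of a field of characteristic two.\<close>

definition "polys01 V = {f \<in> carrier (PR V). \<forall>m. f m \<in> {\<zero>, \<one>}}"

lemma countable_polys01:
 assumes "finite V"
 shows "countable (polys01 V)"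
proof -
 have c: "countable {A. finite A & A \<subseteq> {mu. set_mset mu \<subseteq> V}}" by (rule countable_forms[OF assms])
 have "polys01 V \<subseteq> (%A m. if m \<in> A then \<one> else \<zero>) ` {A. finite A & A \<subseteq> {mu. set_mset mu \<subseteq> V}}"
 proof
  fix f assume f: "f \<in> polys01 V"
  have "f = (%m. if m \<in> {m. f m ~= \<zero>} then \<one> else \<zero>)" using f by (auto simp: polys01_def fun_eq_iff)
  moreover have "{m. f m ~= \<zero>} \<in> {A. finite A & A \<subseteq> {mu. set_mset mu \<subseteq> V}}"
  using f carrierD(2,3)[of f V] by (auto simp: polys01_def)
  ultimately show "f \<in> (%A m. if m \<in> A then \<one> else \<zero>) ` {A. finite A & A \<subseteq> {mu. set_mset mu \<subseteq> V}}" by (rule image_eqI)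
 qed
 thus ?thesis using c by (meson countable_image countable_subset)
qed

lemma partial_hom_01:
 assumes "\<one> \<oplus> \<one> = \<zero>" "(2 :: 'w :: comm_ring_1) = 0"
 shows "partial_hom K {\<zero>, \<one>} (%c. if c = \<zero> then 0 else 1 :: 'w)"
proof -
 have m: "\<ominus> \<one> = \<one>" using assms(1) by (intro minus_equality) auto
 have "(1 :: 'w) + 1 = 0" using assms(2) by simp
 thus ?thesis using assms(1) m one_not_zero unfolding partial_hom_def by auto
qed

end

context mpoly_field
begin

text \<open>Sending f / v0^n to f(u), for forms f over the prime field, is well defined and
  injective: f vanishes at \<open>x\<close> only if f = 0, by \<open>gen\<close>, and f(u) = 0 only
  if f = 0, by the choice of \<open>u\<close>.\<close>

lemma initial_graph:
 fixes V :: "'v set" and u :: "'v => 'w :: field"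
 assumes ch: "\<one> \<oplus> \<one> = \<zero>" and ch2: "(2 :: 'w) = 0" and V: "finite V" "v0 \<in> V"
  and x: "x \<in> pts V"
  and gen: "!!f e. f \<in> hg V e ==> f \<in> polys01 V ==> f ~= \<zero>[V] ==> f \<notin> x"
  and u: "u v0 = 1" "!!A e. form_set V e A ==> (\<Sum>mu\<in>A. \<Prod>v\<in>#mu. u v) ~= 0"
 shows "\<exists>GG. inj_graph (mproj_residue_field K V (%_. ()) {\<zero>[V]} x) GG & countable GG &
  (\<forall>v\<in>V. (mproj_max_ideal K V (%_. ()) {\<zero>[V]} x +>\<^bsub>mproj_local_ring K V (%_. ()) {\<zero>[V]} x\<^esub>
  mfrac K V (%_. ()) {\<zero>[V]} x (mp_var K v) (mp_var K v0), u v) \<in> GG)"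
proof -
 interpret L: mlocal K V "%_. ()" "{\<zero>[V]}" x by (rule mlocal_point[OF zero_ideal x])
 define Q where "Q = mproj_residue_field K V (%_. ()) {\<zero>[V]} x"
 have QF: "Q = L.OP Quot L.MP" by (simp add: Q_def mproj_residue_field_def)
 interpret Q: field Q unfolding Q_def by (rule L.residue_field)
 have MI: "ideal L.MP L.OP" by (rule maximalideal.axioms(1)[OF L.MP_maximal])
 define pj where "pj = (%c. L.MP +>\<^bsub>L.OP\<^esub> c)"
 interpret pj: ring_hom_cring L.OP Q pj
  unfolding QF pj_def using ideal.rcos_ring_hom_cring[OF MI L.OP_cring] by simp
 have pj0: "pj c = \<zero>\<^bsub>Q\<^esub> \<longleftrightarrow> c \<in> L.MP" if c: "c \<in> carrier L.OP" for c
 proof -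
  have "c \<ominus>\<^bsub>L.OP\<^esub> \<zero>\<^bsub>L.OP\<^esub> \<in> L.MP \<longleftrightarrow> pj c = pj \<zero>\<^bsub>L.OP\<^esub>"
  unfolding pj_def by (rule L.OP.quotient_eq_iff_same_a_r_cos[OF MI c L.OP.zero_closed])
  thus ?thesis using c by (simp add: L.OP.minus_eq)
 qed
 define z where "z = mono \<one> {#v0#}"
 have z: "z \<in> hg V {#()#}" unfolding z_def by (rule homog_mono) (use V in auto)
 have mono01: "mono \<one> {#v#} \<in> polys01 V" "mono \<one> {#v#} ~= \<zero>[V]" if "v \<in> V" for v
  using that mono_closed[of \<one> "{#v#}" V] by (auto simp: polys01_def mono_def PR_simps(2) fun_eq_iff)
 have zx: "z \<notin> x" using gen[OF z] mono01[OF V(2)] by (simp add: z_def)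
 note zc = homogD[OF z]
 define zp where "zp = (%n :: nat. z [^]\<^bsub>PR V\<^esub> n)"
 have zph: "zp n \<in> hg V (replicate_mset n ())" for n
  using homog_pow[OF z, of n] by (simp add: zp_def repeat_mset_single)
 note zpc = homogD[OF zph]
 have zpx: "zp n \<notin> x" for n
  unfolding zp_def by (induction n) (use L.P_one zx zc in "auto simp: L.P_mult_iff")
 have zadd: "zp m \<otimes>[V] zp n = zp (m + n)" for m n unfolding zp_def using zc by (simp add: PR.nat_pow_mult)
 let ?h = "%c. if c = \<zero> then 0 else 1 :: 'w"
 interpret P: phom K "{\<zero>, \<one>}" ?h by unfold_locales (rule partial_hom_01[OF ch ch2])
 have PA: "P.PA V = polys01 V" by (simp add: P.PA_def polys01_def)
 have zpA: "zp n \<in> P.PA V" for n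
 proof (induction n)
  case 0
  show ?case unfolding zp_def PA polys01_def using PR.one_closed[of V] by (auto simp: PR_simps(1))
 next
  case (Suc n)
  have "z \<in> P.PA V" using mono01[OF V(2)] by (simp add: PA z_def)
  from P.PA_closed(2)[OF Suc this] show ?case by (simp add: zp_def)
 qed
 have zpe: "peval K ?h (zp n) u = 1" for n
 proof (induction n)
  case 0
  show ?case unfolding zp_def using P.peval_one[of V u] by simp
 next
  case (Suc n)
  have zA: "z \<in> P.PA V" using mono01[OF V(2)] by (simp add: PA z_def)
  have "peval K ?h z u = 1" unfolding z_def using P.peval_mono[of \<one> "{#v0#}" u] u(1) by (simp add: one_not_zero)
  thus ?case using P.peval_mult[OF zpA[of n] zA, of u] Suc by (simp add: zp_def)
 qed
 have rp: "replicate_mset (m + n) () = replicate_mset m () + replicate_mset n ()" for m n by (rule multiset_eqI) simp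
 define C where "C = (%n. polys01 V \<inter> hg V (replicate_mset n ()))"
 have CD: "f \<in> P.PA V" "f \<in> hg V (replicate_mset n ())" "(f, zp n) \<in> L.pairs" if "f \<in> C n" for f n
  using that zph zpx by (auto simp: C_def PA intro: L.pairsI)
 define gm where "gm = (%f n. (pj (L.cls f (zp n)), peval K ?h f u))"
 define GG where "GG = {gm f n | f n. f \<in> C n}"
 have GGI: "(pj (L.cls f (zp n)), peval K ?h f u) \<in> GG" if "f \<in> C n" for f n using that by (auto simp: GG_def gm_def)
 \<comment> \<open>Multiplying by powers of the coordinate \<open>v0\<close>, whose value under
   \<open>u\<close> is 1, gives two fractions a common denominator for the difference.\<close>
 have shift: "f \<otimes>[V] zp n \<in> C (m + n)" "L.cls (f \<otimes>[V] zp n) (zp (m + n)) = L.cls f (zp m)"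
  "peval K ?h (f \<otimes>[V] zp n) u = peval K ?h f u" if f: "f \<in> C m" for f m n
 proof -
  show "f \<otimes>[V] zp n \<in> C (m + n)"
  using P.PA_closed(2)[OF CD(1)[OF f] zpA] homog_mult[OF CD(2)[OF f] zph[of n]]
  by (simp add: C_def PA rp)
  show "L.cls (f \<otimes>[V] zp n) (zp (m + n)) = L.cls f (zp m)"
  unfolding zadd[symmetric] by (rule L.cls_cancel[OF CD(3)[OF f] L.pairsI[OF zph zph zpx]])
  show "peval K ?h (f \<otimes>[V] zp n) u = peval K ?h f u"
  by (simp add: P.peval_mult[OF CD(1)[OF f] zpA] zpe)
 qed
 have "inj_graph Q GG"
  unfolding inj_graph_def
 proof (intro conjI allI impI)
  have "\<one>[V] \<in> C 0" using zpA[of 0] homog_one[of V "%_. ()"] by (simp add: C_def PA zp_def)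
  from GGI[OF this] show "(\<one>\<^bsub>Q\<^esub>, 1) \<in> GG"
  using P.peval_one[of V u] pj.hom_one by (simp add: zp_def L.OP_simps(2)[symmetric])
  fix y v assume "(y, v) \<in> GG"
  then obtain f n where f: "f \<in> C n" "y = pj (L.cls f (zp n))" "v = peval K ?h f u" by (auto simp: GG_def gm_def)
  note fc = L.cls_carrier[OF CD(3)[OF f(1)]]
  show "y \<in> carrier Q" unfolding f(2) by (rule pj.hom_closed[OF fc])
  have "y = \<zero>\<^bsub>Q\<^esub> \<longleftrightarrow> f \<in> x" unfolding f(2) pj0[OF fc] by (rule L.MP_iff[OF CD(3)[OF f(1)]])
  also have "\<dots> \<longleftrightarrow> f = \<zero>[V]" using gen[OF CD(2)[OF f(1)]] f(1) L.P_zero by (auto simp: C_def)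
  also have "\<dots> \<longleftrightarrow> v = 0"
  proof
  assume "f = \<zero>[V]"
  thus "v = 0" unfolding f(3) using P.peval_zero[of V u] by simp
  next
  assume v: "v = 0"
  show "f = \<zero>[V]"
  proof (rule ccontr)
  assume "f ~= \<zero>[V]"
  hence ne: "{m. f m ~= \<zero>} ~= {}" by (auto simp: PR_simps(2) fun_eq_iff)
  note fh = homogD[OF CD(2)[OF f(1)]]
  have "size m = n" if "f m ~= \<zero>" for m
  proof -
  have "image_mset (%_. ()) m = replicate_mset n ()" using CD(2)[OF f(1)] that by (simp add: homog_iff)
  hence "size (image_mset (%_. ()) m) = size (replicate_mset n ())" by (rule arg_cong)
  thus ?thesis by simp
  qed
  hence "(\<Sum>mu\<in>{m. f m ~= \<zero>}. \<Prod>v\<in>#mu. u v) ~= 0"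
  using carrierD(2,3)[OF fh] ne by (intro u(2)[of _ n]) auto
  moreover have "v = (\<Sum>mu\<in>{m. f m ~= \<zero>}. \<Prod>v\<in>#mu. u v)" unfolding f(3) peval_def mev_def by simp
  ultimately show False using v by simp
  qed
  qed
  finally show "y = \<zero>\<^bsub>Q\<^esub> \<longleftrightarrow> v = 0" .
  fix y' v' assume "(y', v') \<in> GG"
  then obtain g m where g: "g \<in> C m" "y' = pj (L.cls g (zp m))" "v' = peval K ?h g u" by (auto simp: GG_def gm_def)
  note gc = L.cls_carrier[OF CD(3)[OF g(1)]]
  have fg: "f \<otimes>[V] g \<in> C (n + m)"
  using P.PA_closed(2)[OF CD(1)[OF f(1)] CD(1)[OF g(1)]] homog_mult[OF CD(2)[OF f(1)] CD(2)[OF g(1)]]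
  by (simp add: C_def PA rp)
  have "y \<otimes>\<^bsub>Q\<^esub> y' = pj (L.cls (f \<otimes>[V] g) (zp (n + m)))"
  using pj.hom_mult[OF fc gc] L.cls_ops(1)[OF CD(3)[OF f(1)] CD(3)[OF g(1)]] by (simp add: f(2) g(2) zadd)
  moreover have "v * v' = peval K ?h (f \<otimes>[V] g) u"
  by (simp add: f(3) g(3) P.peval_mult[OF CD(1)[OF f(1)] CD(1)[OF g(1)]])
  ultimately show "(y \<otimes>\<^bsub>Q\<^esub> y', v * v') \<in> GG" using GGI[OF fg] by simp
  define a where "a = f \<otimes>[V] zp m"
  define c where "c = g \<otimes>[V] zp n"
  have a: "a \<in> C (n + m)" "y = pj (L.cls a (zp (n + m)))" "v = peval K ?h a u"
  using shift[OF f(1), of m] f(2,3) by (simp_all add: a_def)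
  have c: "c \<in> C (n + m)" "y' = pj (L.cls c (zp (n + m)))" "v' = peval K ?h c u"
  using shift[OF g(1), of n] g(2,3) by (simp_all add: c_def add.commute)
  have ac: "a \<ominus>[V] c \<in> C (n + m)"
  using P.PA_closed(3)[OF CD(1)[OF a(1)] CD(1)[OF c(1)]] homog_minus[OF CD(2)[OF a(1)] CD(2)[OF c(1)]]
  by (simp add: C_def PA)
  note cc = homogD[OF CD(2)[OF a(1)]] homogD[OF CD(2)[OF c(1)]]
  have "L.cls a (zp (n + m)) = L.cls (a \<ominus>[V] c) (zp (n + m)) \<oplus>\<^bsub>L.OP\<^esub> L.cls c (zp (n + m))"
  using L.cls_add_same[OF CD(2)[OF ac] CD(2)[OF c(1)] zph zpx] cc by (simp add: PR.minus_eq PR.a_assoc PR.l_neg)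
  hence "y = pj (L.cls (a \<ominus>[V] c) (zp (n + m))) \<oplus>\<^bsub>Q\<^esub> y'"
  using pj.hom_add[OF L.cls_carrier[OF CD(3)[OF ac]] L.cls_carrier[OF CD(3)[OF c(1)]]] by (simp add: a(2) c(2))
  hence "y \<ominus>\<^bsub>Q\<^esub> y' = pj (L.cls (a \<ominus>[V] c) (zp (n + m)))"
  using pj.hom_closed[OF L.cls_carrier[OF CD(3)[OF ac]]] pj.hom_closed[OF L.cls_carrier[OF CD(3)[OF c(1)]]]
  by (simp add: c(2) Q.minus_eq Q.a_assoc Q.r_neg)
  moreover have "v - v' = peval K ?h (a \<ominus>[V] c) u"
  by (simp add: a(3) c(3) P.peval_minus[OF CD(1)[OF a(1)] CD(1)[OF c(1)]])
  ultimately show "(y \<ominus>\<^bsub>Q\<^esub> y', v - v') \<in> GG" using GGI[OF ac] by simp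
 qed
 moreover have "countable GG"
 proof (rule countable_subset)
  show "GG \<subseteq> (%(f, n). gm f n) ` (polys01 V \<times> UNIV)"
  proof
  fix p assume "p \<in> GG"
  then obtain f n where "p = gm f n" "f \<in> C n" unfolding GG_def by blast
  thus "p \<in> (%(f, n). gm f n) ` (polys01 V \<times> UNIV)" by (intro image_eqI[of _ _ "(f, n)"]) (auto simp: C_def)
  qed
  show "countable ((%(f, n). gm f n) ` (polys01 V \<times> (UNIV :: nat set)))"
  by (intro countable_image countable_SIGMA countable_polys01 V(1)) auto
 qed
 moreover have "(L.MP +>\<^bsub>L.OP\<^esub> L.cls (mp_var K v) (mp_var K v0), u v) \<in> GG" if v: "v \<in> V" for v
 proof -
  have "mono \<one> {#v#} \<in> hg V (replicate_mset 1 ())" by (rule homog_mono) (use v in auto)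
  hence "mono \<one> {#v#} \<in> C 1" using mono01[OF v] by (simp add: C_def)
  from GGI[OF this] show ?thesis
  using P.peval_mono[of \<one> "{#v#}" u] zc by (simp add: pj_def mp_var_mono zp_def z_def one_not_zero)
 qed
 ultimately show ?thesis unfolding Q_def by blast
qed

end

theorem corollary1p2:
  fixes k :: "'a ring" and N d :: nat
  assumes "field k"
    and "uncountable (carrier k)"
    and "\<one>\<^bsub>k\<^esub> \<oplus>\<^bsub>k\<^esub> \<one>\<^bsub>k\<^esub> = \<zero>\<^bsub>k\<^esub>"
    and "N \<ge> 1"
    and "real d \<ge> log 2 (real N) + 3"
  shows "very_general (space_top (hypersurface_space k (N + 1) d))
    (\<lambda>x. stably_irrational (hyp_residue_field k (N + 1) d x) {..N + 1} (hyp_ideal k (N + 1) d x))"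
proof -
 obtain n T where sh: "shape N n d T" using ex_shape[OF assms(4,5)] by blast
 interpret sh: shape N n d T by (rule sh)
 interpret k: mpoly_field k by (rule mpoly_field.intro[OF assms(1)])
 have mons: "monomials (N + 1) d = sh.mons" "monomials (Suc N) d = sh.mons" by (simp_all add: monomials_def sh.mons_def)
 define M where "M = sh.mons"
 note finM = sh.finite_mons[folded M_def] and zM = sh.zmono_mons[folded M_def]
 have Mne: "M ~= {}" using zM by auto
 let ?Z = "{\<zero>\<^bsub>mpoly_ring k M\<^esub>}"
 let ?T = "mproj_top k M (%_. ()) ?Z"
 let ?D = "%f. {P \<in> mproj_points k M (%_. ()) ?Z. f \<notin> P}"
 have top: "space_top (hypersurface_space k (N + 1) d) = ?T"
  by (simp add: proj_space_def mproj_def mons M_def)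
 \<comment> \<open>Outside these countably many hypersurfaces no nonzero form over the prime field
   vanishes; in particular no coordinate does, so every monomial occurs in the equation.\<close>
 define UU where "UU = {?D f | f e. f \<in> mhomog k M (%_. ()) e & f \<in> k.polys01 M & f ~= \<zero>\<^bsub>mpoly_ring k M\<^esub>}"
 have "countable UU"
  by (rule countable_subset[OF _ countable_image[OF k.countable_polys01[OF finM], of ?D]]) (auto simp: UU_def)
 moreover have "dense_open ?T A" if A: "A \<in> UU" for A
 proof -
  obtain f e where f: "A = ?D f" "f \<in> mhomog k M (%_. ()) e" "f ~= \<zero>\<^bsub>mpoly_ring k M\<^esub>" using A by (auto simp: UU_def)
  show ?thesis unfolding f(1) k.dense_open_generic[OF Mne k.openin_principal[OF f(2)]]
  using k.generic_point[OF Mne] f(3) by simp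
 qed
 moreover have "stably_irrational (hyp_residue_field k (N + 1) d x) {..N + 1} (hyp_ideal k (N + 1) d x)"
  if "x \<in> topspace ?T" "x \<in> \<Inter>UU" for x
 proof -
  have x: "x \<in> mproj_points k M (%_. ()) ?Z" using that(1) by (simp add: k.topspace_mproj)
  have gen: "f \<notin> x" if "f \<in> mhomog k M (%_. ()) e" "f \<in> k.polys01 M" "f ~= \<zero>\<^bsub>mpoly_ring k M\<^esub>" for f e
  proof -
  have "?D f \<in> UU" using that by (auto simp: UU_def)
  thus ?thesis using `x \<in> \<Inter>UU` by auto
  qed
  interpret L: mlocal k M "%_. ()" ?Z x by (rule k.mlocal_point[OF k.zero_ideal x])
  define K where "K = hyp_residue_field k (N + 1) d x"
  have Kd: "K = mproj_residue_field k M (%_. ()) ?Z x" by (simp add: K_def mons M_def)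
  have KF: "field K" unfolding Kd by (rule L.residue_field)
  interpret K: mpoly_field K by (rule mpoly_field.intro[OF KF])
  have KQ: "K = L.OP Quot L.MP" by (simp add: Kd mproj_residue_field_def)
  have MI: "ideal L.MP L.OP" by (rule maximalideal.axioms(1)[OF L.MP_maximal])
  define pj where "pj = (%c. L.MP +>\<^bsub>L.OP\<^esub> c)"
  interpret pj: ring_hom_cring L.OP K pj
  unfolding KQ pj_def using ideal.rcos_ring_hom_cring[OF MI L.OP_cring] by simp
  define HE where "HE = hyp_equation k (N + 1) d x"
  have hyp: "HE m0 = (%m. if m \<in> M then pj (L.cls (mp_var k m) (mp_var k m0)) else \<zero>\<^bsub>K\<^esub>)" for m0
  by (simp add: HE_def hyp_equation_def mons M_def[symmetric] pj_def Kd fun_eq_iff)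
  define F0 where "F0 = HE sh.zmono"
  have vh: "mp_var k m \<in> mhomog k M (%_. ()) {#()#}" if "m \<in> M" for m
  unfolding k.mp_var_mono by (rule k.homog_mono) (use that in auto)
  have v01: "mp_var k m \<in> k.polys01 M" "mp_var k m ~= \<zero>\<^bsub>mpoly_ring k M\<^esub>" if "m \<in> M" for m
  unfolding k.mp_var_mono using that k.mono_closed[of "\<one>\<^bsub>k\<^esub>" "{#m#}" M]
  by (auto simp: k.polys01_def k.mono_def k.PR_simps(2) fun_eq_iff)
  have vx: "mp_var k m \<notin> x" if "m \<in> M" for m by (rule gen[OF vh v01]) (use that in auto)
  have vp: "(mp_var k m, mp_var k m') \<in> L.pairs" if "m \<in> M" "m' \<in> M" for m m'
  by (rule L.pairsI[OF vh vh vx]) (use that in auto)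
  have pj0: "pj (L.cls (mp_var k m) (mp_var k m')) ~= \<zero>\<^bsub>K\<^esub>" if "m \<in> M" "m' \<in> M" for m m'
  proof
  assume "pj (L.cls (mp_var k m) (mp_var k m')) = \<zero>\<^bsub>K\<^esub>"
  hence "pj (L.cls (mp_var k m) (mp_var k m')) = pj \<zero>\<^bsub>L.OP\<^esub>" by simp
  hence "L.cls (mp_var k m) (mp_var k m') \<ominus>\<^bsub>L.OP\<^esub> \<zero>\<^bsub>L.OP\<^esub> \<in> L.MP"
  unfolding pj_def by (subst L.OP.quotient_eq_iff_same_a_r_cos[OF MI L.cls_carrier[OF vp[OF that]] L.OP.zero_closed])
  hence "L.cls (mp_var k m) (mp_var k m') \<in> L.MP" using L.cls_carrier[OF vp[OF that]] by (simp add: L.OP.minus_eq)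
  thus False using L.MP_iff[OF vp[OF that]] vx[OF that(1)] by simp
  qed
  have F0c: "HE m0 \<in> carrier (mpoly_ring K {..Suc N})" if m0: "m0 \<in> M" for m0
  unfolding K.carrier_iff
  proof (intro conjI allI impI)
  show "HE m0 m \<in> carrier K" for m
  unfolding hyp using pj.hom_closed[OF L.cls_carrier[OF vp[OF _ m0]]] by simp
  have s: "m \<in> M" if "HE m0 m ~= \<zero>\<^bsub>K\<^esub>" for m using that by (auto simp: hyp split: if_splits)
  show "finite {m. HE m0 m ~= \<zero>\<^bsub>K\<^esub>}" by (rule finite_subset[OF _ finM]) (use s in auto)
  show "set_mset m \<subseteq> {..Suc N}" if "HE m0 m ~= \<zero>\<^bsub>K\<^esub>" for m
  using s[OF that] by (auto simp: M_def sh.mons_def)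
  qed
  define G where "G = {HE m0 | m0. m0 \<in> monomials (N + 1) d & mp_var k m0 \<notin> x}"
  have GM: "G = {HE m0 | m0. m0 \<in> M}" using vx by (auto simp: G_def mons M_def)
  have "~ stably_rational K {..Suc N} (Idl\<^bsub>mpoly_ring K {..Suc N}\<^esub> G)"
  \<comment> \<open>The constants are an algebraic closure of the field with two elements,
    independent of \<open>k\<close>: the residue field enters only through the chosen images of the
    coefficients.\<close>
  proof (rule sh.not_stably_rational[where ?'o = "bit alg_closure" and ?F0.0 = F0, OF KF])
  have "(2 :: bit) = 0" by simp
  thus two: "(2 :: bit alg_closure) = 0" using to_ac_numeral[where ?'a = bit, of "num.Bit0 num.One"] by (metis to_ac_0)
  show "F0 \<in> carrier (mpoly_ring K {..Suc N})" unfolding F0_def by (rule F0c[OF zM])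
  show "F0 m ~= \<zero>\<^bsub>K\<^esub> \<longleftrightarrow> m \<in> sh.mons" for m using pj0[OF _ zM, of m] by (simp add: F0_def hyp M_def)
  show "F0 \<in> G" unfolding F0_def GM using zM by blast
  show "\<exists>t\<in>carrier (mpoly_ring K {..Suc N}). f = t \<otimes>\<^bsub>mpoly_ring K {..Suc N}\<^esub> F0" if fG: "f \<in> G" for f
  proof -
  obtain m0 where m0: "m0 \<in> M" "f = HE m0" using fG by (auto simp: GM)
  \<comment> \<open>The factor between the normalizations at \<open>m0\<close> and at
    \<open>zmono\<close>.\<close>
  define c where "c = pj (L.cls (mp_var k sh.zmono) (mp_var k m0))"
  have c: "c \<in> carrier K" unfolding c_def by (rule pj.hom_closed[OF L.cls_carrier[OF vp[OF zM m0(1)]]])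
  have "f m = (K.mono c {#} \<otimes>\<^bsub>mpoly_ring K {..Suc N}\<^esub> F0) m" for m
  proof -
  have "f m = c \<otimes>\<^bsub>K\<^esub> F0 m"
  proof (cases "m \<in> M")
  case True
  have "L.cls (mp_var k sh.zmono) (mp_var k m0) \<otimes>\<^bsub>L.OP\<^esub> L.cls (mp_var k m) (mp_var k sh.zmono) =
  L.cls (mp_var k m) (mp_var k m0)"
  unfolding L.cls_ops(1)[OF vp[OF zM m0(1)] vp[OF True zM]]
  using L.cls_cancel[OF vp[OF True m0(1)] vp[OF zM zM]] L.pairsD(1,2)[OF vp[OF True m0(1)]] L.pairsD(1)[OF vp[OF zM zM]]
  by (simp add: k.PR.m_comm)
  thus ?thesis using True pj.hom_mult[OF L.cls_carrier[OF vp[OF zM m0(1)]] L.cls_carrier[OF vp[OF True zM]]]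
  by (simp add: m0(2) F0_def hyp c_def)
  qed (use c in "simp add: m0(2) F0_def hyp")
  moreover have "F0 m \<in> carrier K" for m using K.carrierD(1)[OF F0c[OF zM]] by (simp add: F0_def)
  ultimately show ?thesis using K.mono_mult_coeff[OF c, where f = F0 and a = "{#}" and V = "{..Suc N}" and m = m] by simp
  qed
  thus ?thesis using K.mono_closed[OF c, of "{#}" "{..Suc N}"] by (intro bexI[of _ "K.mono c {#}"]) auto
  qed
  fix S assume S: "finite S" "S \<subseteq> carrier K"
  define e :: "bit alg_closure fls => bit alg_closure fls alg_closure" where "e = to_ac"
  have e: "comm_ring_hom e" unfolding e_def by (rule comm_ring_homI) auto
  \<comment> \<open>The admissible images of a coefficient: power series reducing to the coefficient
    of the special form. There are uncountably many, so algebraically independent ones can be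
    chosen.\<close>
  define U where "U = (%m. {e (fps_to_fls f) | f. fps_nth f 0 = sh.form_coeff m})"
  have "\<exists>u. u sh.zmono = 1 & (\<forall>m\<in>M - {sh.zmono}. u m \<in> U m) &
  (\<forall>A e. finite A & A ~= {} & (\<forall>mu\<in>A. set_mset mu \<subseteq> M & size mu = e) --> (\<Sum>mu\<in>A. \<Prod>x\<in>#mu. u x) ~= 0)"
  by (rule ex_generic_homogeneous_values[OF finM]) (simp add: U_def uncountable_series[OF e])
  then obtain u where u: "u sh.zmono = 1" "!!m. m \<in> M ==> m ~= sh.zmono ==> u m \<in> U m"
  "!!A e. finite A & A ~= {} & (\<forall>mu\<in>A. set_mset mu \<subseteq> M & size mu = e) ==> (\<Sum>mu\<in>A. \<Prod>x\<in>#mu. u x) ~= 0"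
  by auto
  have "\<forall>m\<in>M. \<exists>f. u m = e (fps_to_fls f) & fps_nth f 0 = sh.form_coeff m"
  proof
  fix m assume m: "m \<in> M"
  show "\<exists>f. u m = e (fps_to_fls f) & fps_nth f 0 = sh.form_coeff m"
  proof (cases "m = sh.zmono")
  case True
  thus ?thesis using u(1) by (intro exI[of _ 1]) (simp add: sh.form_coeff_zmono e_def)
  next
  case False
  thus ?thesis using u(2)[OF m] by (auto simp: U_def)
  qed
  qed
  from bchoice[OF this] obtain s where s: "!!m. m \<in> M ==> u m = e (fps_to_fls (s m)) & fps_nth (s m) 0 = sh.form_coeff m" by blast
  have two': "(2 :: bit alg_closure fls alg_closure) = 0"
  proof -
  have "(2 :: bit alg_closure fls) = fls_const 2" by simp
  hence "(2 :: bit alg_closure fls) = 0" by (simp only: two fls_const_0)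
  hence "to_ac (2 :: bit alg_closure fls) = 0" by (simp only: to_ac_0)
  thus ?thesis by (simp only: to_ac_numeral)
  qed
  have "\<exists>GG. inj_graph K GG & countable GG & (\<forall>m\<in>M. (pj (L.cls (mp_var k m) (mp_var k sh.zmono)), u m) \<in> GG)"
  unfolding Kd pj_def
  proof (rule k.initial_graph[where u = u, OF assms(3) two' finM zM x _ u(1)])
  show "f \<notin> x" if "f \<in> mhomog k M (%_. ()) c" "f \<in> k.polys01 M" "f ~= \<zero>\<^bsub>mpoly_ring k M\<^esub>" for f c by (rule gen[OF that])
  show "(\<Sum>mu\<in>A. \<Prod>v\<in>#mu. u v) ~= 0" if "finite A & A ~= {} & (\<forall>mu\<in>A. set_mset mu \<subseteq> M & size mu = c)" for A c by (rule u(3)[OF that])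
  qed
  then obtain GG where GG: "inj_graph K GG" "countable GG"
  "!!m. m \<in> M ==> (pj (L.cls (mp_var k m) (mp_var k sh.zmono)), u m) \<in> GG" by blast
  have alg: "\<exists>p. p ~= 0 & poly (map_poly e p) y = 0" for y
  unfolding e_def using alg_closure_algebraic[of y] by metis
  have "(F0 m, e (fps_to_fls (s m))) \<in> GG" if "m \<in> M" for m
  using GG(3)[OF that] s[OF that] that by (simp add: F0_def hyp)
  from K.embed_finitely_generated[OF e alg alg_closed_imp_poly_has_root GG(1,2) finM this S]
  show "\<exists>A (io :: _ => bit alg_closure fls). partial_hom K A io & S \<subseteq> A & (\<forall>x\<in>A. io x = 0 --> x = \<zero>\<^bsub>K\<^esub>) &
  (\<forall>m\<in>sh.mons. \<exists>F'. io (F0 m) = fps_to_fls F' & fps_nth F' 0 = sh.form_coeff m)"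
  using s by (simp add: M_def)
  qed
  moreover have "hyp_ideal k (N + 1) d x = Idl\<^bsub>mpoly_ring K {..Suc N}\<^esub> G"
  unfolding hyp_ideal_def G_def K_def HE_def by simp
  ultimately show ?thesis by (simp add: K_def)
 qed
 ultimately show ?thesis unfolding very_general_def top by (intro exI[of _ UU]) blast
qed

end
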